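(* Let $p$ be a prime and let $G=\prod_{k=1}^s G_k$, where $s\ge1$ and each $G_k$ is a cyclic group of order $p^{m_k}$ with $m_k\ge1$. If $M$ is a non-trivial irreducible $G$-lattice, then for all $n\in\mathbb{Z}$ $$\hat H^n(G,M)\simeq\hat H^{n-1}(G,DM)\simeq(\mathbb{Z}/p\mathbb{Z})^{\nu(|n|-1,s)},$$ where $\nu(m,s)=(-1)^m\sum_{i=0}^{m}\binom{-s}{i}$ for $m\ge -1$ (so $\nu(-1,s)=0$, the sum being empty).
   Context: A $G$-lattice is a $\mathbb{Z}G$-module whose underlying abelian group is free of finite rank. A $G$-lattice $M$ is irreducible if $\mathbb{Q}\otimes_{\mathbb{Z}}M$ is a simple $\mathbb{Q}G$-module. Non-trivial means that $G$ does not act trivially on $M$. $DM=\mathrm{Hom}_{\mathbb{Z}}(M,\mathbb{Q}/\mathbb{Z})$ with $G$ acting by $(gf)(u)=f(g^{-1}u)$. $\hat H^n(G,-)$ denotes Tate cohomology; isomorphisms are of abelian groups. $\binom{-s}{i}=(-s)(-s-1)\cdots(-s-i+1)/i!$ is the generalized binomial coefficient. *)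

theory Defs
  imports "HOL-Algebra.Free_Abelian_Groups" "HOL-Computational_Algebra.Primes"
begin

text \<open>
  Abelian groups are written multiplicatively, as records for the locale
  \<^locale>\<open>comm_group\<close>.  A \<open>\<int>G\<close>-module is given by such a group together with an
  action of \<open>G\<close> on it by endomorphisms.
\<close>

locale G_module =
  G: group G + A: comm_group A
  for G :: "('a, 'b) monoid_scheme" and A :: "('c, 'd) monoid_scheme"
    and act :: "'a \<Rightarrow> 'c \<Rightarrow> 'c" +
  assumes act_hom: "g \<in> carrier G \<Longrightarrow> act g \<in> hom A A"
    and act_one: "u \<in> carrier A \<Longrightarrow> act \<one>\<^bsub>G\<^esub> u = u"
    and act_mult: "\<lbrakk>g \<in> carrier G; h \<in> carrier G; u \<in> carrier A\<rbrakk>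
      \<Longrightarrow> act (g \<otimes>\<^bsub>G\<^esub> h) u = act g (act h u)"

locale G_lattice = G_module G M act
  for G :: "('a, 'b) monoid_scheme" and M :: "('c, 'd) monoid_scheme"
    and act :: "'a \<Rightarrow> 'c \<Rightarrow> 'c" +
  assumes free_finite_rank: "\<exists>B :: nat set. finite B \<and> M \<cong> free_Abelian_group B"

definition acts_trivially ::
  "('a, 'b) monoid_scheme \<Rightarrow> ('c, 'd) monoid_scheme \<Rightarrow> ('a \<Rightarrow> 'c \<Rightarrow> 'c) \<Rightarrow> bool"
  where "acts_trivially G A act \<longleftrightarrow> (\<forall>g\<in>carrier G. \<forall>u\<in>carrier A. act g u = u)"


section \<open>Tensor products and irreducible lattices\<close>

text \<open>The tensor product over \<open>\<int>\<close> of two abelian groups: the free abelian group on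
  the set of pairs modulo the subgroup generated by the bilinearity relations.\<close>

definition tensor_rels ::
  "('a, 'b) monoid_scheme \<Rightarrow> ('c, 'd) monoid_scheme \<Rightarrow> ('a \<times> 'c \<Rightarrow>\<^sub>0 int) set"
  where "tensor_rels A B = generate (free_Abelian_group (carrier A \<times> carrier B))
    ({frag_of (a \<otimes>\<^bsub>A\<^esub> a', b) - frag_of (a, b) - frag_of (a', b) | a a' b.
        a \<in> carrier A \<and> a' \<in> carrier A \<and> b \<in> carrier B} \<union>
     {frag_of (a, b \<otimes>\<^bsub>B\<^esub> b') - frag_of (a, b) - frag_of (a, b') | a b b'.
        a \<in> carrier A \<and> b \<in> carrier B \<and> b' \<in> carrier B})"

definition tensor ::
  "('a, 'b) monoid_scheme \<Rightarrow> ('c, 'd) monoid_scheme \<Rightarrow> ('a \<times> 'c \<Rightarrow>\<^sub>0 int) set monoid"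
  where "tensor A B = free_Abelian_group (carrier A \<times> carrier B) Mod tensor_rels A B"

text \<open>For endomorphisms \<open>f\<close> of \<open>A\<close> and \<open>h\<close> of \<open>B\<close>, the endomorphism \<open>f \<otimes> h\<close>.  Elements
  of the tensor product are cosets \<open>C\<close>; the image of \<open>C\<close> under the induced map on the
  free group lies in one coset of the relations, and multiplying it by the subgroup of
  relations gives all of that coset.\<close>

definition tensor_map ::
  "('a, 'b) monoid_scheme \<Rightarrow> ('c, 'd) monoid_scheme \<Rightarrow> ('a \<Rightarrow> 'a) \<Rightarrow> ('c \<Rightarrow> 'c)
    \<Rightarrow> ('a \<times> 'c \<Rightarrow>\<^sub>0 int) set \<Rightarrow> ('a \<times> 'c \<Rightarrow>\<^sub>0 int) set"
  where "tensor_map A B f h C =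
    tensor_rels A B <#>\<^bsub>free_Abelian_group (carrier A \<times> carrier B)\<^esub>
      (frag_extend (\<lambda>(a, b). frag_of (f a, h b)) ` C)"

definition rat_group :: "rat monoid"
  where "rat_group = \<lparr>carrier = UNIV, monoid.mult = (+), one = 0\<rparr>"

text \<open>A \<open>\<rat>G\<close>-module is given by its underlying abelian group \<open>V\<close>, the multiplication
  \<open>sc\<close> by rational scalars and the action \<open>act\<close> of \<open>G\<close>.\<close>

definition QG_submodule ::
  "('a, 'b) monoid_scheme \<Rightarrow> ('v, 'w) monoid_scheme \<Rightarrow> (rat \<Rightarrow> 'v \<Rightarrow> 'v) \<Rightarrow> ('a \<Rightarrow> 'v \<Rightarrow> 'v)
    \<Rightarrow> 'v set \<Rightarrow> bool"
  where "QG_submodule G V sc act N \<longleftrightarrow> subgroup N V \<and>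
    (\<forall>q. \<forall>v\<in>N. sc q v \<in> N) \<and> (\<forall>g\<in>carrier G. \<forall>v\<in>N. act g v \<in> N)"

definition simple_QG_module ::
  "('a, 'b) monoid_scheme \<Rightarrow> ('v, 'w) monoid_scheme \<Rightarrow> (rat \<Rightarrow> 'v \<Rightarrow> 'v) \<Rightarrow> ('a \<Rightarrow> 'v \<Rightarrow> 'v)
    \<Rightarrow> bool"
  where "simple_QG_module G V sc act \<longleftrightarrow> carrier V \<noteq> {\<one>\<^bsub>V\<^esub>} \<and>
    (\<forall>N. QG_submodule G V sc act N \<longrightarrow> N = {\<one>\<^bsub>V\<^esub>} \<or> N = carrier V)"

definition irreducible_lattice ::
  "('a, 'b) monoid_scheme \<Rightarrow> ('c, 'd) monoid_scheme \<Rightarrow> ('a \<Rightarrow> 'c \<Rightarrow> 'c) \<Rightarrow> bool"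
  where "irreducible_lattice G M act \<longleftrightarrow>
    simple_QG_module G (tensor rat_group M)
      (\<lambda>q. tensor_map rat_group M (\<lambda>r. q * r) (\<lambda>u. u))
      (\<lambda>g. tensor_map rat_group M (\<lambda>r. r) (act g))"


section \<open>The dual module\<close>

definition rat_mod_int :: "rat set monoid"
  where "rat_mod_int = rat_group Mod \<int>"

definition dual_module :: "('c, 'd) monoid_scheme \<Rightarrow> ('c \<Rightarrow> rat set) monoid"
  where "dual_module M =
    \<lparr>carrier = hom M rat_mod_int \<inter> extensional (carrier M),
     monoid.mult = (\<lambda>f f'. \<lambda>u\<in>carrier M. f u \<otimes>\<^bsub>rat_mod_int\<^esub> f' u),
     one = (\<lambda>u\<in>carrier M. \<one>\<^bsub>rat_mod_int\<^esub>)\<rparr>"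

definition dual_act ::
  "('a, 'b) monoid_scheme \<Rightarrow> ('c, 'd) monoid_scheme \<Rightarrow> ('a \<Rightarrow> 'c \<Rightarrow> 'c)
    \<Rightarrow> 'a \<Rightarrow> ('c \<Rightarrow> rat set) \<Rightarrow> ('c \<Rightarrow> rat set)"
  where "dual_act G M act g f = (\<lambda>u\<in>carrier M. f (act (inv\<^bsub>G\<^esub> g) u))"


section \<open>Tate cohomology of a finite group\<close>

text \<open>
  Tate cohomology is the cohomology of \<open>Hom\<^sub>G(X, A)\<close> for the standard complete resolution
  \<open>X\<close> of a finite group \<open>G\<close>: for \<open>n \<ge> 0\<close>, \<open>X\<^sub>n\<close> is free abelian on \<open>G\<^sup>n\<^sup>+\<^sup>1\<close> with the diagonal
  action, and the module in degree \<open>-n-1\<close> is the dual \<open>Hom(X\<^sub>n, \<int>)\<close>, which has the dual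
  basis, again indexed by \<open>G\<^sup>n\<^sup>+\<^sup>1\<close>.  A cochain of degree \<open>n\<close> is therefore a
  \<open>G\<close>-equivariant function on tuples of length \<open>n + 1\<close> if \<open>n \<ge> 0\<close>, and of length \<open>-n\<close> if
  \<open>n < 0\<close>.
\<close>

definition tate_len :: "int \<Rightarrow> nat"
  where "tate_len n = (if n \<ge> 0 then nat n + 1 else nat (- n))"

definition tuples :: "('a, 'b) monoid_scheme \<Rightarrow> nat \<Rightarrow> 'a list set"
  where "tuples G k = {gs. length gs = k \<and> set gs \<subseteq> carrier G}"

definition tate_cochains ::
  "('a, 'b) monoid_scheme \<Rightarrow> ('c, 'd) monoid_scheme \<Rightarrow> ('a \<Rightarrow> 'c \<Rightarrow> 'c) \<Rightarrow> int
    \<Rightarrow> ('a list \<Rightarrow> 'c) monoid"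
  where "tate_cochains G A act n =
    \<lparr>carrier = {x \<in> tuples G (tate_len n) \<rightarrow>\<^sub>E carrier A.
       \<forall>g\<in>carrier G. \<forall>gs\<in>tuples G (tate_len n).
         x (map (\<lambda>h. g \<otimes>\<^bsub>G\<^esub> h) gs) = act g (x gs)},
     monoid.mult = (\<lambda>x y. \<lambda>gs\<in>tuples G (tate_len n). x gs \<otimes>\<^bsub>A\<^esub> y gs),
     one = (\<lambda>gs\<in>tuples G (tate_len n). \<one>\<^bsub>A\<^esub>)\<rparr>"

text \<open>
  The coboundary from degree \<open>n\<close> to degree \<open>n + 1\<close>.  Additively, with \<open>k\<close> the length of
  the argument:
  \<^item> for \<open>n \<ge> 0\<close>, \<open>\<Sum>\<^sub>i (-1)\<^sup>i x(g\<^sub>0,\<dots>,g\<^sub>i\<^sub>-\<^sub>1,g\<^sub>i\<^sub>+\<^sub>1,\<dots>,g\<^sub>k\<^sub>-\<^sub>1)\<close>;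
  \<^item> for \<open>n = -1\<close>, the map \<open>\<Sum>\<^sub>g x(g)\<close>, induced by the composite \<open>X\<^sub>0 \<rightarrow> \<int> \<rightarrow> Hom(X\<^sub>0, \<int>)\<close>
    of the augmentation and its dual (the norm);
  \<^item> for \<open>n \<le> -2\<close>, \<open>\<Sum>\<^sub>g \<Sum>\<^sub>i (-1)\<^sup>i x(g\<^sub>0,\<dots>,g\<^sub>i\<^sub>-\<^sub>1,g,g\<^sub>i,\<dots>,g\<^sub>k\<^sub>-\<^sub>1)\<close>, induced by the transpose
    of the boundary of \<open>X\<close> in nonnegative degrees.
\<close>

definition tate_coboundary ::
  "('a, 'b) monoid_scheme \<Rightarrow> ('c, 'd) monoid_scheme \<Rightarrow> int \<Rightarrow> ('a list \<Rightarrow> 'c) \<Rightarrow> 'a list \<Rightarrow> 'c"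
  where "tate_coboundary G A n x = (\<lambda>gs\<in>tuples G (tate_len (n + 1)).
    if n \<ge> 0 then
      (\<Otimes>\<^bsub>A\<^esub>i\<in>{..<length gs}. x (take i gs @ drop (Suc i) gs) [^]\<^bsub>A\<^esub> ((- 1) ^ i :: int))
    else if n = - 1 then
      (\<Otimes>\<^bsub>A\<^esub>g\<in>carrier G. x [g])
    else
      (\<Otimes>\<^bsub>A\<^esub>g\<in>carrier G. \<Otimes>\<^bsub>A\<^esub>i\<in>{..length gs}.
        x (take i gs @ g # drop i gs) [^]\<^bsub>A\<^esub> ((- 1) ^ i :: int)))"

definition tate_cocycles ::
  "('a, 'b) monoid_scheme \<Rightarrow> ('c, 'd) monoid_scheme \<Rightarrow> ('a \<Rightarrow> 'c \<Rightarrow> 'c) \<Rightarrow> int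
    \<Rightarrow> ('a list \<Rightarrow> 'c) set"
  where "tate_cocycles G A act n =
    kernel (tate_cochains G A act n) (tate_cochains G A act (n + 1)) (tate_coboundary G A n)"

definition tate_coboundaries ::
  "('a, 'b) monoid_scheme \<Rightarrow> ('c, 'd) monoid_scheme \<Rightarrow> ('a \<Rightarrow> 'c \<Rightarrow> 'c) \<Rightarrow> int
    \<Rightarrow> ('a list \<Rightarrow> 'c) set"
  where "tate_coboundaries G A act n =
    tate_coboundary G A (n - 1) ` carrier (tate_cochains G A act (n - 1))"

definition tate_cohomology ::
  "('a, 'b) monoid_scheme \<Rightarrow> ('c, 'd) monoid_scheme \<Rightarrow> ('a \<Rightarrow> 'c \<Rightarrow> 'c) \<Rightarrow> int
    \<Rightarrow> ('a list \<Rightarrow> 'c) set monoid"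
  where "tate_cohomology G A act n =
    (tate_cochains G A act n) \<lparr>carrier := tate_cocycles G A act n\<rparr>
      Mod tate_coboundaries G A act n"


section \<open>The exponents\<close>

text \<open>The truncations in \<open>nat m\<close> and \<open>nat (m + 1)\<close> only matter for \<open>m < 0\<close>; for
  \<open>m = -1\<close> the sum is empty and \<open>nu\<close> is \<open>0\<close>.\<close>

definition nu :: "int \<Rightarrow> nat \<Rightarrow> rat"
  where "nu m s = (- 1) ^ nat m * (\<Sum>i<nat (m + 1). (- of_nat s) gchoose i)"

lemma minus_one_power_gchoose:
  assumes "s \<ge> 1"
  shows "(- 1) ^ i * ((- of_nat s :: rat) gchoose i) = of_nat ((s + i - 1) choose i)"
  using assms
  by (simp add: gbinomial_minus binomial_gbinomial of_nat_diff flip: mult.assoc power_mult_distrib)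

text \<open>For these arguments \<open>nu\<close> is a natural number, so that \<open>nat \<lfloor>nu m s\<rfloor>\<close> loses nothing.\<close>

lemma of_nat_nu:
  assumes "s \<ge> 1" and "m \<ge> - 1"
  shows "of_nat (nat \<lfloor>nu m s\<rfloor>) = nu m s"
proof -
  define c :: "nat \<Rightarrow> nat" where "c i = (s + i - 1) choose i" for i
  have c_mono: "c i \<le> c (Suc i)" for i
    unfolding c_def using assms(1) by (cases s) simp_all
  have step: "nu (int k + 1) s = of_nat (c (Suc k)) - nu (int k) s" for k
    using minus_one_power_gchoose[OF assms(1), of "Suc k"]
    by (simp add: nu_def c_def nat_add_distrib algebra_simps)
  have "\<exists>e\<le>c k. nu (int k) s = of_nat e" for k
  proof (induction k)
    case 0
    show ?case by (simp add: nu_def c_def)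
  next
    case (Suc k)
    then obtain e where e: "e \<le> c k" "nu (int k) s = of_nat e" by blast
    hence "nu (int (Suc k)) s = of_nat (c (Suc k) - e)"
      using step[of k] c_mono[of k] by (simp add: add.commute of_nat_diff)
    thus ?case by (metis diff_le_self)
  qed
  moreover have "nu (- 1) s = 0"
    by (simp add: nu_def)
  moreover have "m = - 1 \<or> m = int (nat m)"
    using assms(2) by linarith
  ultimately have "\<exists>e. nu m s = of_nat e"
    by (metis of_nat_0)
  thus ?thesis by auto
qed

end

theory Submission
  imports "HOL-Computational_Algebra.Polynomial" Defs
begin

text \<open>
  Since \<open>M\<close> is irreducible, \<open>G\<close> acts on it through a cyclic \<open>p\<close>-group, generated by the image of some
  \<open>g\<close>.  Put \<open>\<theta> = g - 1\<close>.  It is injective on \<open>M\<close> with cokernel \<open>\<int>/p\<close>, and dually surjective on \<open>DM\<close>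
  with kernel \<open>\<int>/p\<close>.  As \<open>g\<close> is central, \<open>\<theta>\<close> induces \<open>0\<close> on Tate cohomology, so the long exact
  sequences split into short ones: \<open>H\<^sup>n(M)\<close> and \<open>H\<^sup>n\<^sup>-\<^sup>1(DM)\<close> embed into \<open>H\<^sup>n(\<int>/p)\<close>, hence have exponent \<open>p\<close>,
  and the orders of two consecutive groups multiply to the order of \<open>H\<^sup>n(\<int>/p)\<close>.  The latter is
  computed from the tensor product of the periodic resolutions of the factors \<open>G\<^sub>k\<close>.  As the norms
  of \<open>M\<close> and \<open>DM\<close> vanish, so do \<open>H\<^sup>0(M)\<close> and \<open>H\<^sup>-\<^sup>1(DM)\<close>, and the orders of both families follow by
  recursion away from \<open>n = 0\<close>.
\<close>

text \<open>Why \<open>\<theta>\<close> behaves as stated: \<open>M\<close> resembles an ideal in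
  the ring of integers of a p-power cyclotomic field, with \<open>g\<close> as a root of unity zeta,
  and zeta - 1 generates the only prime above p, with residue field of order p. That ring is never
  formed. Integer polynomials in \<open>g\<close> act on \<open>M\<close>; a cyclotomic polynomial
  with value p at 1 makes \<open>\<theta>\<close> a divisor of p, and (X - 1)^(p^n) = X^(p^n) - 1
  modulo p keeps \<open>\<theta>\<close> from being surjective. As such ideals need not be
  principal, a generator is found only up to index prime to p. The order of H^n(Z/p) is p to the
  number of monomials of degree k in s variables, where k = n for n >= 0 and k = -n - 1 for n < 0.
  This folding is the source of |n|, and \<open>nu\<close> solves nu(k-1) + nu(k) = binom(s+k-1, k).
  No map between the cohomology of \<open>M\<close> and of its dual is constructed: both are
  elementary abelian of the same order. Working with explicit cochains means giving each homotopy in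
  positive degrees, transposing it in negative ones, and checking the splice between them.\<close>

text \<open>The homomorphism extending \<open>x\<close> from a basis to formal sums, written so that
  only the values of \<open>x\<close> on the keys of \<open>c\<close> matter. Cochains are evaluated
  on chains this way, and identities between cochains are reduced to identities between formal
  sums.\<close>

definition ev :: "('b, 'd) monoid_scheme \<Rightarrow> ('t \<Rightarrow> 'b) \<Rightarrow> ('t \<Rightarrow>\<^sub>0 int) \<Rightarrow> 'b"
  where "ev A x c = (\<Otimes>\<^bsub>A\<^esub>t\<in>Poly_Mapping.keys c. x t [^]\<^bsub>A\<^esub> Poly_Mapping.lookup c t)"

lemma group_homI: "group G \<Longrightarrow> group H \<Longrightarrow> h \<in> hom G H \<Longrightarrow> group_hom G H h"
  by (simp add: group_hom_def group_hom_axioms_def)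

context comm_group
begin

lemma finprod_hom:
  assumes "comm_group H" "h \<in> hom G H" "f \<in> S \<rightarrow> carrier G"
  shows "h (finprod G f S) = finprod H (\<lambda>i. h (f i)) S"
proof -
  interpret H: comm_group H by fact
  interpret gh: group_hom G H h using assms by (intro group_homI is_group H.is_group)
  show ?thesis
    using assms(3) by (induction S rule: infinite_finite_induct) (auto simp: Pi_def)
qed

lemma ev_superset:
  assumes "finite S" "Poly_Mapping.keys c \<subseteq> S" "x \<in> S \<rightarrow> carrier G"
  shows "ev G x c = (\<Otimes>t\<in>S. x t [^] Poly_Mapping.lookup c t)"
  unfolding ev_def
  by (rule finprod_mono_neutral_cong_left) (use assms in \<open>auto simp: in_keys_iff\<close>)

lemma ev_closed [simp, intro]:
  assumes "x \<in> T \<rightarrow> carrier G" "Poly_Mapping.keys c \<subseteq> T"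
  shows "ev G x c \<in> carrier G"
  unfolding ev_def using assms by (intro finprod_closed) auto

lemma ev_0 [simp]: "ev G x 0 = \<one>"
  by (simp add: ev_def)

lemma ev_frag_of [simp]: "x t \<in> carrier G \<Longrightarrow> ev G x (frag_of t) = x t"
  by (simp add: ev_def keys_frag_of)

lemma ev_add:
  assumes x: "x \<in> T \<rightarrow> carrier G" and k: "Poly_Mapping.keys c \<subseteq> T" "Poly_Mapping.keys d \<subseteq> T"
  shows "ev G x (c + d) = ev G x c \<otimes> ev G x d"
proof -
  let ?S = "Poly_Mapping.keys c \<union> Poly_Mapping.keys d"
  have S: "finite ?S" "Poly_Mapping.keys (c + d) \<subseteq> ?S" "x \<in> ?S \<rightarrow> carrier G"
    using keys_add[of c d] x k by auto
  have "ev G x (c + d) = (\<Otimes>t\<in>?S. x t [^] Poly_Mapping.lookup c t \<otimes> x t [^] Poly_Mapping.lookup d t)"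
    unfolding ev_superset[OF S] using x k
    by (intro finprod_cong') (auto simp: Poly_Mapping.lookup_add int_pow_mult Pi_iff subset_iff)
  also have "\<dots> = ev G x c \<otimes> ev G x d"
  proof (subst finprod_multf)
    show "(\<Otimes>t\<in>?S. x t [^] Poly_Mapping.lookup c t) \<otimes> (\<Otimes>t\<in>?S. x t [^] Poly_Mapping.lookup d t)
        = ev G x c \<otimes> ev G x d"
      using ev_superset[OF S(1) _ S(3), of c] ev_superset[OF S(1) _ S(3), of d] by simp
  qed (use S(3) in \<open>auto simp: Pi_iff\<close>)
  finally show ?thesis .
qed

lemma ev_hom:
  assumes "x \<in> T \<rightarrow> carrier G"
  shows "ev G x \<in> hom (free_Abelian_group T) G"
  by (rule homI) (simp_all add: ev_closed[OF assms] ev_add[OF assms])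

lemma ev_minus:
  assumes x: "x \<in> T \<rightarrow> carrier G" and k: "Poly_Mapping.keys c \<subseteq> T"
  shows "ev G x (- c) = inv (ev G x c)"
proof -
  have "ev G x (- c) \<otimes> ev G x c = \<one>"
    using ev_add[OF x, of "- c" c] k by (simp add: keys_minus)
  thus ?thesis
    using x k by (metis ev_closed inv_equality keys_minus)
qed

lemma ev_diff:
  assumes x: "x \<in> T \<rightarrow> carrier G" and k: "Poly_Mapping.keys c \<subseteq> T" "Poly_Mapping.keys d \<subseteq> T"
  shows "ev G x (c - d) = ev G x c \<otimes> inv (ev G x d)"
  using ev_add[OF x k(1), of "- d"] ev_minus[OF x k(2)] k by (simp add: keys_minus)

lemma ev_cong:
  assumes "\<And>t. t \<in> Poly_Mapping.keys c \<Longrightarrow> x t = y t" "y \<in> Poly_Mapping.keys c \<rightarrow> carrier G"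
  shows "ev G x c = ev G y c"
  unfolding ev_def using assms by (intro finprod_cong') auto

lemma ev_sum:
  assumes x: "x \<in> T \<rightarrow> carrier G" and k: "\<And>i. i \<in> I \<Longrightarrow> Poly_Mapping.keys (c i) \<subseteq> T"
  shows "ev G x (\<Sum>i\<in>I. c i) = (\<Otimes>i\<in>I. ev G x (c i))"
  using k
proof (induction I rule: infinite_finite_induct)
  case (insert i I)
  have "Poly_Mapping.keys (\<Sum>i\<in>I. c i) \<subseteq> T"
    using sum_closed_free_Abelian_group[of I c T] insert.prems by auto
  with insert show ?case
    using x by (simp add: ev_add[OF x] ev_closed[OF x] Pi_def)
qed auto

lemma ev_cmul:
  assumes x: "x \<in> T \<rightarrow> carrier G" and k: "Poly_Mapping.keys c \<subseteq> T"
  shows "ev G x (frag_cmul n c) = ev G x c [^] n"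
  using hom_int_pow[OF ev_hom[OF x], of c n] k
  by (simp add: group_free_Abelian_group)

text \<open>Evaluation turns a map \<open>b\<close> of chains into precomposition with it. Every
  coboundary and homotopy computation passes through this rule.\<close>

lemma ev_frag_extend:
  assumes x: "x \<in> T \<rightarrow> carrier G" and k: "\<And>t. t \<in> Poly_Mapping.keys c \<Longrightarrow> Poly_Mapping.keys (b t) \<subseteq> T"
  shows "ev G x (frag_extend b c) = ev G (\<lambda>t. ev G x (b t)) c"
proof -
  have "ev G x (frag_extend b c) = (\<Otimes>t\<in>Poly_Mapping.keys c. ev G x (frag_cmul (Poly_Mapping.lookup c t) (b t)))"
    unfolding frag_extend_def using k keys_cmul by (intro ev_sum[OF x]) blast
  also have "\<dots> = ev G (\<lambda>t. ev G x (b t)) c"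
    unfolding ev_def[of G "\<lambda>t. ev G x (b t)" c] using k x
    by (intro finprod_cong') (auto simp: ev_cmul[OF x] intro!: int_pow_closed ev_closed[OF x])
  finally show ?thesis .
qed

lemma ev_mult:
  assumes "x \<in> T \<rightarrow> carrier G" "y \<in> T \<rightarrow> carrier G" "Poly_Mapping.keys c \<subseteq> T"
  shows "ev G (\<lambda>t. x t \<otimes> y t) c = ev G x c \<otimes> ev G y c"
proof -
  have "ev G (\<lambda>t. x t \<otimes> y t) c
      = (\<Otimes>t\<in>Poly_Mapping.keys c. x t [^] Poly_Mapping.lookup c t \<otimes> y t [^] Poly_Mapping.lookup c t)"
    unfolding ev_def using assms
    by (intro finprod_cong') (auto simp: Pi_def subset_iff int_pow_distrib)
  also have "\<dots> = ev G x c \<otimes> ev G y c"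
    unfolding ev_def using assms by (intro finprod_multf) auto
  finally show ?thesis .
qed

lemma ev_hom_comp:
  assumes "comm_group H" "h \<in> hom G H" "x \<in> Poly_Mapping.keys c \<rightarrow> carrier G"
  shows "ev H (\<lambda>t. h (x t)) c = h (ev G x c)"
proof -
  interpret H: comm_group H by fact
  show ?thesis
    unfolding ev_def using assms(3)
    by (subst finprod_hom[OF assms(1,2)]) (auto intro!: H.finprod_cong' simp: Pi_iff hom_int_pow[OF assms(2)] H.is_group hom_in_carrier[OF assms(2)] intro!: H.int_pow_closed)
qed

end

lemma (in comm_group) free_Abelian_hom_eq_ev:
  assumes h: "h \<in> hom (free_Abelian_group S) G" and "Poly_Mapping.keys c \<subseteq> S"
  shows "h c = ev G (\<lambda>b. h (frag_of b)) c"
proof -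
  interpret gh: group_hom "free_Abelian_group S" G h
    using h by (intro group_homI is_group group_free_Abelian_group)
  have f: "(\<lambda>b. h (frag_of b)) \<in> S \<rightarrow> carrier G"
    using gh.hom_closed by auto
  show ?thesis
    using assms(2)
  proof (rule free_Abelian_group_induct)
    fix x y :: "'c \<Rightarrow>\<^sub>0 int"
    assume 3: "Poly_Mapping.keys x \<subseteq> S" "Poly_Mapping.keys y \<subseteq> S"
      "h x = ev G (\<lambda>b. h (frag_of b)) x" "h y = ev G (\<lambda>b. h (frag_of b)) y"
    have "h (x - y) = h x \<otimes> inv h y"
      using gh.hom_mult[of x "- y"] gh.hom_inv[of y] 3(1,2) by (simp add: keys_minus)
    thus "h (x - y) = ev G (\<lambda>b. h (frag_of b)) (x - y)" using 3 ev_diff[OF f] by simp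
  qed (use gh.hom_one f in auto)
qed

section \<open>Quotients and cohomology of cochain complexes\<close>

context comm_group
begin

lemma subgroup_comm_group:
  assumes "subgroup H G" shows "comm_group (G\<lparr>carrier := H\<rparr>)"
  using group.group_comm_groupI[OF subgroup_imp_group[OF assms]] m_comm subgroup.mem_carrier[OF assms]
  by simp

lemma coset_eq_iff:
  assumes "subgroup N G" "x \<in> carrier G" "y \<in> carrier G"
  shows "N #> x = N #> y \<longleftrightarrow> x \<otimes> inv y \<in> N"
  by (metis assms coset_join2 coset_join1 coset_mult_inv1 coset_mult_inv2 inv_closed m_closed subgroup.subset)

lemma hom_from_quotient:
  assumes N: "subgroup N G" and K: "group K" and h: "h \<in> hom G K" and 1: "\<And>x. x \<in> N \<Longrightarrow> h x = \<one>\<^bsub>K\<^esub>"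
  shows "\<exists>\<phi>\<in>hom (G Mod N) K. \<forall>x\<in>carrier G. \<phi> (N #> x) = h x"
proof -
  interpret gh: group_hom G K h using h K by (intro group_homI is_group)
  have "N \<lhd> G" "N \<subseteq> kernel G K h"
    using N 1 subgroup_imp_normal subgroup.subset[OF N] by (auto simp: kernel_def)
  then obtain \<phi> where "\<phi> \<in> hom (G Mod N) K" "\<And>x. x \<in> carrier G \<Longrightarrow> \<phi> (N #> x) = h x"
    using gh.FactGroup_universal_kernel by blast
  thus ?thesis by blast
qed

end

lemma card_hom_image:
  assumes "group G" "group H" "f \<in> hom G H" "finite (carrier G)"
  shows "card (carrier G) = card (kernel G H f) * card (f ` carrier G)"
proof -
  interpret group_hom G H f using assms by (intro group_homI)
  have "card (rcosets\<^bsub>G\<^esub> kernel G H f) * card (kernel G H f) = card (carrier G)"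
    using G.lagrange[OF subgroup_kernel] by (simp add: order_def)
  moreover have "card (rcosets\<^bsub>G\<^esub> kernel G H f) = card (f ` carrier G)"
  proof -
    let ?I = "H\<lparr>carrier := f ` carrier G\<rparr>"
    have "group_hom G ?I f"
      using img_is_subgroup H.subgroup_imp_group homh
      by (auto simp: group_hom_def group_hom_axioms_def hom_def)
    then interpret I: group_hom G ?I f .
    have "kernel G ?I f = kernel G H f" by (simp add: kernel_def)
    thus ?thesis
      using I.FactGroup_iso_set iso_same_card[OF I.FactGroup_iso] by (simp add: FactGroup_def)
  qed
  ultimately show ?thesis by (metis mult.commute)
qed

section \<open>Cohomology of an arbitrary cochain complex of abelian groups\<close>

definition cocycles :: "(int \<Rightarrow> ('a, 'b) monoid_scheme) \<Rightarrow> (int \<Rightarrow> 'a \<Rightarrow> 'a) \<Rightarrow> int \<Rightarrow> 'a set"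
  where "cocycles C d n = kernel (C n) (C (n + 1)) (d n)"

definition coboundaries :: "(int \<Rightarrow> ('a, 'b) monoid_scheme) \<Rightarrow> (int \<Rightarrow> 'a \<Rightarrow> 'a) \<Rightarrow> int \<Rightarrow> 'a set"
  where "coboundaries C d n = d (n - 1) ` carrier (C (n - 1))"

definition cohomology :: "(int \<Rightarrow> ('a, 'b) monoid_scheme) \<Rightarrow> (int \<Rightarrow> 'a \<Rightarrow> 'a) \<Rightarrow> int \<Rightarrow> 'a set monoid"
  where "cohomology C d n = (C n)\<lparr>carrier := cocycles C d n\<rparr> Mod coboundaries C d n"

locale cochain_complex =
  fixes C :: "int \<Rightarrow> ('a, 'b) monoid_scheme" and d :: "int \<Rightarrow> 'a \<Rightarrow> 'a"
  assumes comm_group_C: "comm_group (C n)"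
    and d_hom: "d n \<in> hom (C n) (C (n + 1))"
    and d_d: "x \<in> carrier (C n) \<Longrightarrow> d (n + 1) (d n x) = \<one>\<^bsub>C (n + 1 + 1)\<^esub>"
begin

abbreviation "Z \<equiv> cocycles C d"
abbreviation "B \<equiv> coboundaries C d"
abbreviation "H \<equiv> cohomology C d"

definition cls :: "int \<Rightarrow> 'a \<Rightarrow> 'a set"
  where "cls n x = B n #>\<^bsub>C n\<^esub> x"

lemma Z_iff: "x \<in> Z n \<longleftrightarrow> x \<in> carrier (C n) \<and> d n x = \<one>\<^bsub>C (n + 1)\<^esub>"
  by (simp add: cocycles_def kernel_def)

lemma d_closed: "x \<in> carrier (C n) \<Longrightarrow> d n x \<in> carrier (C (n + 1))"
  using d_hom by (auto simp: hom_def)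

lemma d_group_hom: "group_hom (C n) (C (n + 1)) (d n)"
  using comm_group_C d_hom by (auto simp: group_hom_def group_hom_axioms_def comm_group_def)

lemma subgroup_Z: "subgroup (Z n) (C n)"
  using group_hom.subgroup_kernel[OF d_group_hom] by (simp add: cocycles_def)

lemma comm_group_Z: "comm_group (C n\<lparr>carrier := Z n\<rparr>)"
  using comm_group.subgroup_comm_group[OF comm_group_C subgroup_Z] .

lemma B_iff: "x \<in> B (n + 1) \<longleftrightarrow> (\<exists>y\<in>carrier (C n). x = d n y)"
  by (auto simp: coboundaries_def)

lemma B_subset_Z: "B n \<subseteq> Z n"
  using d_d[of _ "n - 1"] d_closed[of _ "n - 1"] by (auto simp: coboundaries_def Z_iff)

lemma subgroup_B: "subgroup (B n) (C n)"
  using group_hom.img_is_subgroup[OF d_group_hom[of "n - 1"]] by (simp add: coboundaries_def)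

lemma subgroup_B_Z: "subgroup (B n) (C n\<lparr>carrier := Z n\<rparr>)"
  by (rule group.subgroup_incl[OF comm_group.axioms(2)[OF comm_group_C] subgroup_B subgroup_Z B_subset_Z])

lemma comm_group_H: "comm_group (H n)"
  unfolding cohomology_def using comm_group.abelian_FactGroup[OF comm_group_Z subgroup_B_Z] .

lemma cls_Z: "cls n x = B n #>\<^bsub>C n\<lparr>carrier := Z n\<rparr>\<^esub> x"
  by (simp add: cls_def r_coset_def)

lemma carrier_H: "carrier (H n) = cls n ` Z n"
  by (simp add: cohomology_def carrier_FactGroup cls_Z[abs_def])

lemma one_H: "\<one>\<^bsub>H n\<^esub> = B n"
  by (simp add: cohomology_def)

lemma cls_hom: "cls n \<in> hom (C n\<lparr>carrier := Z n\<rparr>) (H n)"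
  unfolding cls_Z[abs_def] cohomology_def
  using normal.r_coset_hom_Mod[OF comm_group.subgroup_imp_normal[OF comm_group_Z subgroup_B_Z]] .

lemma cls_mult: "x \<in> Z n \<Longrightarrow> y \<in> Z n \<Longrightarrow> cls n (x \<otimes>\<^bsub>C n\<^esub> y) = cls n x \<otimes>\<^bsub>H n\<^esub> cls n y"
  using cls_hom[of n] by (auto simp: hom_def)

lemma cls_eq_iff:
  assumes "x \<in> Z n" "y \<in> Z n"
  shows "cls n x = cls n y \<longleftrightarrow> x \<otimes>\<^bsub>C n\<^esub> inv\<^bsub>C n\<^esub> y \<in> B n"
  unfolding cls_def
  using assms subgroup.subset[OF subgroup_Z]
  by (intro comm_group.coset_eq_iff[OF comm_group_C subgroup_B]) auto

lemma cls_eq_one_iff: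
  assumes "x \<in> Z n" shows "cls n x = \<one>\<^bsub>H n\<^esub> \<longleftrightarrow> x \<in> B n"
proof -
  interpret Cn: comm_group "C n" by (rule comm_group_C)
  have 1: "\<one>\<^bsub>C n\<^esub> \<in> Z n" "x \<in> carrier (C n)"
    using subgroup.one_closed[OF subgroup_Z] assms subgroup.subset[OF subgroup_Z] by auto
  have "cls n \<one>\<^bsub>C n\<^esub> = B n"
    unfolding cls_def using subgroup.subset[OF subgroup_B] by (rule Cn.coset_mult_one)
  thus ?thesis
    using cls_eq_iff[OF assms 1(1)] 1(2) by (simp add: one_H)
qed

lemma hom_from_H:
  assumes "group K" "h \<in> hom (C n\<lparr>carrier := Z n\<rparr>) K" "\<And>x. x \<in> B n \<Longrightarrow> h x = \<one>\<^bsub>K\<^esub>"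
  shows "\<exists>\<phi>\<in>hom (H n) K. \<forall>x\<in>Z n. \<phi> (cls n x) = h x"
  using comm_group.hom_from_quotient[OF comm_group_Z subgroup_B_Z assms] 
  by (simp add: cohomology_def cls_Z)

end

section \<open>The long exact sequence of a short exact sequence of complexes\<close>

locale short_exact =
  A: cochain_complex CA dA + B: cochain_complex CB dB + C: cochain_complex CC dC
  for CA :: "int \<Rightarrow> ('a, 'aa) monoid_scheme" and dA
    and CB :: "int \<Rightarrow> ('b, 'bb) monoid_scheme" and dB
    and CC :: "int \<Rightarrow> ('c, 'cc) monoid_scheme" and dC +
  fixes f :: "int \<Rightarrow> 'a \<Rightarrow> 'b" and g :: "int \<Rightarrow> 'b \<Rightarrow> 'c"
  assumes f_hom: "f n \<in> hom (CA n) (CB n)" and g_hom: "g n \<in> hom (CB n) (CC n)"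
    and f_d: "a \<in> carrier (CA n) \<Longrightarrow> f (n + 1) (dA n a) = dB n (f n a)"
    and g_d: "b \<in> carrier (CB n) \<Longrightarrow> g (n + 1) (dB n b) = dC n (g n b)"
    and f_inj: "inj_on (f n) (carrier (CA n))"
    and exact: "b \<in> carrier (CB n) \<Longrightarrow> g n b = \<one>\<^bsub>CC n\<^esub> \<longleftrightarrow> b \<in> f n ` carrier (CA n)"
    and g_surj: "g n ` carrier (CB n) = carrier (CC n)"
begin

lemmas grp = comm_group.axioms(2)[OF A.comm_group_C] comm_group.axioms(2)[OF B.comm_group_C]
  comm_group.axioms(2)[OF C.comm_group_C]

lemma f_group_hom: "group_hom (CA n) (CB n) (f n)"
  by (intro group_homI grp f_hom)

lemma g_group_hom: "group_hom (CB n) (CC n) (g n)"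
  by (intro group_homI grp g_hom)

lemma f_closed: "a \<in> carrier (CA n) \<Longrightarrow> f n a \<in> carrier (CB n)"
  using f_hom by (auto simp: hom_def)

lemma g_closed: "b \<in> carrier (CB n) \<Longrightarrow> g n b \<in> carrier (CC n)"
  using g_hom by (auto simp: hom_def)

lemma g_surjE:
  assumes "c \<in> carrier (CC n)" obtains b where "b \<in> carrier (CB n)" "g n b = c"
  using assms unfolding g_surj[symmetric] by (auto intro: that)

lemma g_f: "a \<in> carrier (CA n) \<Longrightarrow> g n (f n a) = \<one>\<^bsub>CC n\<^esub>"
  using exact f_closed by blast

lemma f_eq_one: "a \<in> carrier (CA n) \<Longrightarrow> f n a = \<one>\<^bsub>CB n\<^esub> \<Longrightarrow> a = \<one>\<^bsub>CA n\<^esub>"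
  using group_hom.inj_on_one_iff[OF f_group_hom, of n] f_inj[of n] by simp

lemma f_Z_iff: "a \<in> carrier (CA n) \<Longrightarrow> f n a \<in> B.Z n \<longleftrightarrow> a \<in> A.Z n"
  using f_d f_closed f_eq_one[of "dA n a" "n + 1"] A.d_closed group_hom.hom_one[OF f_group_hom, of "n + 1"]
  by (auto simp: A.Z_iff B.Z_iff) metis+

lemma f_Z: "a \<in> A.Z n \<Longrightarrow> f n a \<in> B.Z n"
  using f_Z_iff A.Z_iff by blast

lemma g_Z: "b \<in> B.Z n \<Longrightarrow> g n b \<in> C.Z n"
  using g_d[of b n] g_closed group_hom.hom_one[OF g_group_hom, of "n + 1"]
  by (auto simp: C.Z_iff B.Z_iff)

lemma f_B: "a \<in> A.B (n + 1) \<Longrightarrow> f (n + 1) a \<in> B.B (n + 1)"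
  using f_d f_closed by (fastforce simp: A.B_iff B.B_iff)

lemma g_B: "b \<in> B.B (n + 1) \<Longrightarrow> g (n + 1) b \<in> C.B (n + 1)"
  using g_d g_closed by (fastforce simp: C.B_iff B.B_iff)

text \<open>\<open>g\<close> is onto one degree lower, so the coboundary \<open>g n b\<close> is
  also the image of some \<open>dB (n - 1) b'\<close>; the difference of \<open>b\<close> and that
  element lies in the kernel of \<open>g n\<close>, which is the image of
  \<open>f n\<close>.\<close>

lemma lift_coboundary:
  assumes b: "b \<in> carrier (CB n)" and gb: "g n b \<in> C.B n"
  obtains a b' where "a \<in> carrier (CA n)" "b' \<in> carrier (CB (n - 1))"
    "b = f n a \<otimes>\<^bsub>CB n\<^esub> dB (n - 1) b'"
proof -
  interpret Bn: comm_group "CB n" by (rule B.comm_group_C)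
  interpret gn: group_hom "CB n" "CC n" "g n" by (rule g_group_hom)
  obtain b' where b': "b' \<in> carrier (CB (n - 1))" "g n b = dC (n - 1) (g (n - 1) b')"
    using gb g_surjE[of _ "n - 1"] unfolding coboundaries_def by (metis imageE)
  have d: "dB (n - 1) b' \<in> carrier (CB n)"
    using B.d_closed[OF b'(1)] by simp
  have "g n b = g n (dB (n - 1) b')"
    using g_d[OF b'(1)] b'(2) by simp
  hence "g n (b \<otimes>\<^bsub>CB n\<^esub> inv\<^bsub>CB n\<^esub> dB (n - 1) b') = \<one>\<^bsub>CC n\<^esub>"
    using b d g_closed by (simp add: gn.H.r_inv)
  then obtain a where a: "a \<in> carrier (CA n)" "b \<otimes>\<^bsub>CB n\<^esub> inv\<^bsub>CB n\<^esub> dB (n - 1) b' = f n a"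
    using exact[of "b \<otimes>\<^bsub>CB n\<^esub> inv\<^bsub>CB n\<^esub> dB (n - 1) b'" n] b d by auto
  have "b = f n a \<otimes>\<^bsub>CB n\<^esub> dB (n - 1) b'"
    using a b d by (metis Bn.inv_closed Bn.inv_solve_right' Bn.m_closed)
  thus ?thesis using that a(1) b'(1) by blast
qed

text \<open>The one diagram chase behind the connecting map: by \<open>lift_coboundary\<close>,
  \<open>b\<close> is \<open>f n a'\<close> up to a coboundary, so \<open>dB n b\<close> is
  \<open>f (n + 1)\<close> of \<open>dA n a'\<close>, and injectivity of \<open>f\<close> gives the
  claim. It yields additivity, vanishing on coboundaries, and both exactness statements
  below.\<close>

lemma coboundary_if_lift:
  assumes "a \<in> carrier (CA (n + 1))" "b \<in> carrier (CB n)" "g n b \<in> C.B n" "f (n + 1) a = dB n b"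
  shows "a \<in> A.B (n + 1)"
proof -
  obtain a' b' where ab: "a' \<in> carrier (CA n)" "b' \<in> carrier (CB (n - 1))" "b = f n a' \<otimes>\<^bsub>CB n\<^esub> dB (n - 1) b'"
    using lift_coboundary assms(2,3) .
  interpret dn: group_hom "CB n" "CB (n + 1)" "dB n" by (rule B.d_group_hom)
  have "dB n b = dB n (f n a') \<otimes>\<^bsub>CB (n+1)\<^esub> dB n (dB (n - 1) b')"
    using ab f_closed B.d_closed[OF ab(2)] by simp
  also have "\<dots> = f (n + 1) (dA n a')"
    using B.d_d[OF ab(2)] f_d[OF ab(1)] ab(1) f_closed by simp
  finally have "a = dA n a'"
    using assms(1,4) A.d_closed[OF ab(1)] f_inj[of "n + 1"] by (auto dest: inj_onD)
  thus ?thesis using ab(1) by (auto simp: A.B_iff)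
qed

lemma lift_exists:
  assumes "c \<in> C.Z n"
  shows "\<exists>a. a \<in> A.Z (n + 1) \<and> (\<exists>b\<in>carrier (CB n). g n b = c \<and> f (n + 1) a = dB n b)"
proof -
  obtain b where b: "b \<in> carrier (CB n)" "g n b = c"
    using assms g_surjE[of c n] C.Z_iff by blast
  have "g (n + 1) (dB n b) = \<one>\<^bsub>CC (n + 1)\<^esub>"
    using assms b g_d by (simp add: C.Z_iff)
  then obtain a where a: "a \<in> carrier (CA (n + 1))" "f (n + 1) a = dB n b"
    using exact[OF B.d_closed[OF b(1)]] by auto
  moreover have "dB n b \<in> B.Z (n + 1)"
    using B.d_d B.d_closed b by (simp add: B.Z_iff)
  ultimately have "a \<in> A.Z (n + 1)"
    using f_Z_iff by metis
  thus ?thesis using a b by blast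
qed

text \<open>An arbitrary choice in the snake construction. Only its class modulo coboundaries is
  canonical, so additivity is established only after applying \<open>A.cls\<close>.\<close>

definition lift :: "int \<Rightarrow> 'c \<Rightarrow> 'a"
  where "lift n c = (SOME a. a \<in> A.Z (n + 1) \<and> (\<exists>b\<in>carrier (CB n). g n b = c \<and> f (n + 1) a = dB n b))"

lemma lift:
  assumes "c \<in> C.Z n"
  shows "lift n c \<in> A.Z (n + 1)" "\<exists>b\<in>carrier (CB n). g n b = c \<and> f (n + 1) (lift n c) = dB n b"
  using someI_ex[OF lift_exists[OF assms]] unfolding lift_def by blast+

lemma connecting_hom:
  obtains \<delta> where "\<delta> \<in> hom (C.H n) (A.H (n + 1))"
    and "\<And>c. c \<in> C.Z n \<Longrightarrow> \<delta> (C.cls n c) = A.cls (n + 1) (lift n c)"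
proof -
  interpret An: comm_group "CA (n + 1)" by (rule A.comm_group_C)
  interpret Bn: comm_group "CB n" by (rule B.comm_group_C)
  interpret Cn: comm_group "CC n" by (rule C.comm_group_C)
  interpret gn: group_hom "CB n" "CC n" "g n" by (rule g_group_hom)
  interpret fn: group_hom "CA (n + 1)" "CB (n + 1)" "f (n + 1)" by (rule f_group_hom)
  interpret dn: group_hom "CB n" "CB (n + 1)" "dB n" by (rule B.d_group_hom)
  have "(\<lambda>c. A.cls (n + 1) (lift n c)) \<in> hom (CC n\<lparr>carrier := C.Z n\<rparr>) (A.H (n + 1))"
  proof (rule homI)
    fix c c' assume "c \<in> carrier (CC n\<lparr>carrier := C.Z n\<rparr>)" "c' \<in> carrier (CC n\<lparr>carrier := C.Z n\<rparr>)"
    hence c: "c \<in> C.Z n" "c' \<in> C.Z n" by auto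
    hence cc: "c \<otimes>\<^bsub>CC n\<^esub> c' \<in> C.Z n"
      using subgroup.m_closed[OF C.subgroup_Z] by blast
    obtain b b' b'' where b: "b \<in> carrier (CB n)" "b' \<in> carrier (CB n)" "b'' \<in> carrier (CB n)"
      "g n b = c" "g n b' = c'" "g n b'' = c \<otimes>\<^bsub>CC n\<^esub> c'"
      "f (n + 1) (lift n c) = dB n b" "f (n + 1) (lift n c') = dB n b'"
      "f (n + 1) (lift n (c \<otimes>\<^bsub>CC n\<^esub> c')) = dB n b''"
      using lift(2)[OF c(1)] lift(2)[OF c(2)] lift(2)[OF cc] by blast
    have a: "lift n c \<in> A.Z (n + 1)" "lift n c' \<in> A.Z (n + 1)" "lift n (c \<otimes>\<^bsub>CC n\<^esub> c') \<in> A.Z (n + 1)"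
      using lift(1) c cc by auto
    hence a': "lift n c \<in> carrier (CA (n+1))" "lift n c' \<in> carrier (CA (n+1))"
      "lift n (c \<otimes>\<^bsub>CC n\<^esub> c') \<in> carrier (CA (n+1))"
      by (auto simp: A.Z_iff)
    let ?a = "lift n (c \<otimes>\<^bsub>CC n\<^esub> c') \<otimes>\<^bsub>CA (n+1)\<^esub> inv\<^bsub>CA (n+1)\<^esub> (lift n c \<otimes>\<^bsub>CA (n+1)\<^esub> lift n c')"
    have "?a \<in> A.B (n + 1)"
    proof (rule coboundary_if_lift)
      let ?b = "b'' \<otimes>\<^bsub>CB n\<^esub> inv\<^bsub>CB n\<^esub> (b \<otimes>\<^bsub>CB n\<^esub> b')"
      show "?a \<in> carrier (CA (n + 1))" using a' by simp
      show "?b \<in> carrier (CB n)" using b by simp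
      show "f (n + 1) ?a = dB n ?b" using a' b by simp
      have "c \<in> carrier (CC n)" "c' \<in> carrier (CC n)" using c by (auto simp: C.Z_iff)
      hence "g n ?b = \<one>\<^bsub>CC n\<^esub>" using b by (simp add: Cn.r_inv)
      thus "g n ?b \<in> C.B n" using subgroup.one_closed[OF C.subgroup_B] by simp
    qed
    moreover have "lift n c \<otimes>\<^bsub>CA (n+1)\<^esub> lift n c' \<in> A.Z (n + 1)"
      using subgroup.m_closed[OF A.subgroup_Z] a by blast
    ultimately have "A.cls (n + 1) (lift n (c \<otimes>\<^bsub>CC n\<^esub> c')) = A.cls (n + 1) (lift n c \<otimes>\<^bsub>CA (n+1)\<^esub> lift n c')"
      using A.cls_eq_iff a by blast
    thus "A.cls (n + 1) (lift n (c \<otimes>\<^bsub>CC n\<lparr>carrier := C.Z n\<rparr>\<^esub> c'))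
       = A.cls (n + 1) (lift n c) \<otimes>\<^bsub>A.H (n + 1)\<^esub> A.cls (n + 1) (lift n c')"
      using A.cls_mult a by simp
  qed (use lift(1) in \<open>auto simp: A.carrier_H\<close>)
  moreover have "A.cls (n + 1) (lift n c) = \<one>\<^bsub>A.H (n + 1)\<^esub>" if "c \<in> C.B n" for c
  proof -
    have c: "c \<in> C.Z n" using that C.B_subset_Z by blast
    hence "lift n c \<in> A.B (n + 1)"
      using lift[OF c] that coboundary_if_lift by (auto simp: A.Z_iff)
    thus ?thesis using A.cls_eq_one_iff lift(1)[OF c] by blast
  qed
  ultimately show ?thesis
    using C.hom_from_H[of "A.H (n + 1)" "\<lambda>c. A.cls (n + 1) (lift n c)" n]
      comm_group.axioms(2)[OF A.comm_group_H] that by blast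
qed

text \<open>Exactness at \<open>C.H n\<close>. If the lift is \<open>dA n a\<close>, subtracting
  \<open>f n a\<close> from the chosen preimage \<open>b\<close> of \<open>c\<close> turns it into a
  cocycle still mapping to \<open>c\<close>.\<close>

lemma cls_lift_one_iff:
  assumes c: "c \<in> C.Z n"
  shows "A.cls (n + 1) (lift n c) = \<one>\<^bsub>A.H (n + 1)\<^esub> \<longleftrightarrow> (\<exists>b\<in>B.Z n. C.cls n (g n b) = C.cls n c)"
proof
  interpret Bn: comm_group "CB n" by (rule B.comm_group_C)
  interpret Cn: comm_group "CC n" by (rule C.comm_group_C)
  interpret gn: group_hom "CB n" "CC n" "g n" by (rule g_group_hom)
  interpret dn: group_hom "CB n" "CB (n + 1)" "dB n" by (rule B.d_group_hom)
  obtain b where b: "b \<in> carrier (CB n)" "g n b = c" "f (n + 1) (lift n c) = dB n b"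
    using lift(2)[OF c] by blast
  have cc: "c \<in> carrier (CC n)" using c by (simp add: C.Z_iff)
  {
    assume "A.cls (n + 1) (lift n c) = \<one>\<^bsub>A.H (n + 1)\<^esub>"
    hence "lift n c \<in> A.B (n + 1)" using A.cls_eq_one_iff lift(1)[OF c] by blast
    then obtain a where a: "a \<in> carrier (CA n)" "lift n c = dA n a" by (auto simp: A.B_iff)
    let ?b = "b \<otimes>\<^bsub>CB n\<^esub> inv\<^bsub>CB n\<^esub> f n a"
    have "dB n ?b = \<one>\<^bsub>CB (n + 1)\<^esub>"
      using a b f_d f_closed by (simp add: dn.H.r_inv)
    hence "?b \<in> B.Z n" using a b f_closed by (simp add: B.Z_iff)
    moreover have "g n ?b = c" using a b f_closed g_f cc by simp
    ultimately show "\<exists>b\<in>B.Z n. C.cls n (g n b) = C.cls n c" by metis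
  next
    assume "\<exists>b\<in>B.Z n. C.cls n (g n b) = C.cls n c"
    then obtain b' where b': "b' \<in> B.Z n" "C.cls n c = C.cls n (g n b')" by metis
    hence gb: "c \<otimes>\<^bsub>CC n\<^esub> inv\<^bsub>CC n\<^esub> g n b' \<in> C.B n"
      using C.cls_eq_iff[OF c g_Z[OF b'(1)]] by simp
    have b'': "b' \<in> carrier (CB n)" "dB n b' = \<one>\<^bsub>CB (n + 1)\<^esub>" using b' by (auto simp: B.Z_iff)
    have "lift n c \<in> A.B (n + 1)"
    proof (rule coboundary_if_lift)
      show "lift n c \<in> carrier (CA (n + 1))" using lift(1)[OF c] by (simp add: A.Z_iff)
      show "b \<otimes>\<^bsub>CB n\<^esub> inv\<^bsub>CB n\<^esub> b' \<in> carrier (CB n)" using b b'' by simp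
      show "g n (b \<otimes>\<^bsub>CB n\<^esub> inv\<^bsub>CB n\<^esub> b') \<in> C.B n" using b b'' gb by simp
      show "f (n + 1) (lift n c) = dB n (b \<otimes>\<^bsub>CB n\<^esub> inv\<^bsub>CB n\<^esub> b')" using b b'' by simp
    qed
    thus "A.cls (n + 1) (lift n c) = \<one>\<^bsub>A.H (n + 1)\<^esub>"
      using A.cls_eq_one_iff lift(1)[OF c] by blast
  }
qed

text \<open>Exactness at \<open>A.H (n + 1)\<close>: when \<open>f (n + 1) a\<close> is
  \<open>dB n b\<close>, the element \<open>g n b\<close> is a cocycle whose connecting class is
  that of \<open>a\<close>.\<close>

lemma lift_surj:
  assumes a: "a \<in> A.Z (n + 1)" and fa: "f (n + 1) a \<in> B.B (n + 1)"
  obtains c where "c \<in> C.Z n" "A.cls (n + 1) (lift n c) = A.cls (n + 1) a"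
proof -
  interpret Bn: comm_group "CB n" by (rule B.comm_group_C)
  interpret An: comm_group "CA (n + 1)" by (rule A.comm_group_C)
  interpret gn: group_hom "CB n" "CC n" "g n" by (rule g_group_hom)
  interpret fn: group_hom "CA (n + 1)" "CB (n + 1)" "f (n + 1)" by (rule f_group_hom)
  interpret dn: group_hom "CB n" "CB (n + 1)" "dB n" by (rule B.d_group_hom)
  have ac: "a \<in> carrier (CA (n + 1))" using a by (simp add: A.Z_iff)
  obtain b where b: "b \<in> carrier (CB n)" "f (n + 1) a = dB n b"
    using fa by (auto simp: B.B_iff)
  have c: "g n b \<in> C.Z n"
    using b g_d[OF b(1)] g_closed g_f[OF ac] by (simp add: C.Z_iff)
  obtain b' where b': "b' \<in> carrier (CB n)" "g n b' = g n b" "f (n + 1) (lift n (g n b)) = dB n b'"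
    using lift(2)[OF c] by blast
  have lc: "lift n (g n b) \<in> carrier (CA (n + 1))" using lift(1)[OF c] by (simp add: A.Z_iff)
  have "lift n (g n b) \<otimes>\<^bsub>CA (n+1)\<^esub> inv\<^bsub>CA (n+1)\<^esub> a \<in> A.B (n + 1)"
  proof (rule coboundary_if_lift)
    let ?b = "b' \<otimes>\<^bsub>CB n\<^esub> inv\<^bsub>CB n\<^esub> b"
    have "g n ?b = \<one>\<^bsub>CC n\<^esub>" using b b' g_closed by (simp add: gn.H.r_inv)
    thus "g n ?b \<in> C.B n" using subgroup.one_closed[OF C.subgroup_B] by simp
  qed (use ac lc b b' in auto)
  hence "A.cls (n + 1) (lift n (g n b)) = A.cls (n + 1) a"
    using A.cls_eq_iff a lift(1)[OF c] by blast
  thus ?thesis using that c by blast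
qed

text \<open>Dimension shifting: acyclicity of the middle complex in degree n gives injectivity, in
  degree n + 1 surjectivity.\<close>

theorem connecting_iso:
  assumes "B.Z n \<subseteq> B.B n" "B.Z (n + 1) \<subseteq> B.B (n + 1)"
  shows "C.H n \<cong> A.H (n + 1)"
proof -
  obtain \<delta> where \<delta>: "\<delta> \<in> hom (C.H n) (A.H (n + 1))" "\<And>c. c \<in> C.Z n \<Longrightarrow> \<delta> (C.cls n c) = A.cls (n + 1) (lift n c)"
    using connecting_hom by blast
  interpret gh: group_hom "C.H n" "A.H (n + 1)" \<delta>
    using \<delta>(1) A.comm_group_H C.comm_group_H by (intro group_homI) (auto simp: comm_group_def)
  have "C.cls n c = \<one>\<^bsub>C.H n\<^esub>" if c: "c \<in> C.Z n" and c1: "A.cls (n + 1) (lift n c) = \<one>\<^bsub>A.H (n + 1)\<^esub>" for c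
  proof -
    obtain b where b: "b \<in> B.Z n" "C.cls n (g n b) = C.cls n c"
      using cls_lift_one_iff[OF c] c1 by metis
    have "g n b \<in> C.B n" using b assms(1) g_B[of b "n - 1"] by auto
    thus ?thesis using b C.cls_eq_one_iff[OF g_Z[OF b(1)]] by simp
  qed
  hence "inj_on \<delta> (carrier (C.H n))"
    unfolding gh.inj_on_one_iff using \<delta>(2) by (auto simp: C.carrier_H)
  moreover have "\<delta> ` carrier (C.H n) = carrier (A.H (n + 1))"
  proof
    show "carrier (A.H (n + 1)) \<subseteq> \<delta> ` carrier (C.H n)"
    proof
      fix y assume "y \<in> carrier (A.H (n + 1))"
      then obtain a where a: "a \<in> A.Z (n + 1)" "y = A.cls (n + 1) a" by (auto simp: A.carrier_H)
      then obtain c where "c \<in> C.Z n" "A.cls (n + 1) (lift n c) = y"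
        using lift_surj[OF a(1)] assms(2) f_Z by blast
      thus "y \<in> \<delta> ` carrier (C.H n)" using \<delta>(2) by (force simp: C.carrier_H)
    qed
  qed auto
  ultimately have "\<delta> \<in> iso (C.H n) (A.H (n + 1))"
    using \<delta>(1) by (simp add: iso_def bij_betw_def)
  thus ?thesis by (rule is_isoI)
qed

text \<open>When \<open>f\<close> induces zero, the long exact sequence breaks into 0 -> H^n(B) ->
  H^n(C) -> H^(n+1)(A) -> 0. Vanishing in degree n gives the injection, in degree n + 1 the
  surjection. Applied to multiplication by \<open>\<theta>\<close> on the lattice, with C =
  Z/p.\<close>

theorem null_inclusion:
  assumes "f n ` A.Z n \<subseteq> B.B n" "f (n + 1) ` A.Z (n + 1) \<subseteq> B.B (n + 1)"
  shows "\<exists>\<phi>\<in>hom (B.H n) (C.H n). inj_on \<phi> (carrier (B.H n))"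
    and "finite (carrier (C.H n)) \<Longrightarrow> card (carrier (C.H n)) = card (carrier (B.H n)) * card (carrier (A.H (n + 1)))"
proof -
  obtain \<delta> where \<delta>: "\<delta> \<in> hom (C.H n) (A.H (n + 1))" "\<And>c. c \<in> C.Z n \<Longrightarrow> \<delta> (C.cls n c) = A.cls (n + 1) (lift n c)"
    using connecting_hom by blast
  have "(\<lambda>b. C.cls n (g n b)) \<in> hom (CB n\<lparr>carrier := B.Z n\<rparr>) (C.H n)"
    using g_Z hom_mult[OF g_hom[of n]] by (auto intro!: homI simp: C.carrier_H C.cls_mult B.Z_iff)
  moreover have "C.cls n (g n b) = \<one>\<^bsub>C.H n\<^esub>" if "b \<in> B.B n" for b
    using that g_B[of b "n - 1"] C.cls_eq_one_iff[OF g_Z] B.B_subset_Z[of n] by (simp add: subset_iff)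
  ultimately obtain \<phi> where \<phi>: "\<phi> \<in> hom (B.H n) (C.H n)" "\<And>b. b \<in> B.Z n \<Longrightarrow> \<phi> (B.cls n b) = C.cls n (g n b)"
    using B.hom_from_H[of "C.H n" "\<lambda>b. C.cls n (g n b)" n] C.comm_group_H by (auto simp: comm_group_def)
  interpret gh: group_hom "B.H n" "C.H n" \<phi>
    using \<phi>(1) B.comm_group_H C.comm_group_H by (intro group_homI) (auto simp: comm_group_def)
  have "b \<in> B.B n" if bZ: "b \<in> B.Z n" and gb: "g n b \<in> C.B n" for b
  proof -
    have "b \<in> carrier (CB n)" using that by (simp add: B.Z_iff)
    then obtain a b' where ab: "a \<in> carrier (CA n)" "b' \<in> carrier (CB (n - 1))" "b = f n a \<otimes>\<^bsub>CB n\<^esub> dB (n - 1) b'"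
      using lift_coboundary gb by blast
    interpret Bn: comm_group "CB n" by (rule B.comm_group_C)
    have d: "dB (n - 1) b' \<in> B.B n" using ab(2) by (auto simp: coboundaries_def)
    hence "f n a \<in> B.Z n"
      using bZ ab f_closed B.B_subset_Z
      by (metis Bn.inv_solve_right' subgroup.m_closed[OF B.subgroup_Z] subgroup.m_inv_closed[OF B.subgroup_Z]
          subgroup.mem_carrier[OF B.subgroup_Z] subset_iff)
    hence "f n a \<in> B.B n" using f_Z_iff ab(1) assms(1) by blast
    thus ?thesis using ab(3) d subgroup.m_closed[OF B.subgroup_B] by blast
  qed
  hence "B.cls n b = \<one>\<^bsub>B.H n\<^esub>" if "b \<in> B.Z n" "\<phi> (B.cls n b) = \<one>\<^bsub>C.H n\<^esub>" for b
    using that \<phi>(2)[OF that(1)] C.cls_eq_one_iff[OF g_Z[OF that(1)]] B.cls_eq_one_iff[OF that(1)] by simp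
  hence inj: "inj_on \<phi> (carrier (B.H n))"
    unfolding gh.inj_on_one_iff by (metis B.carrier_H imageE)
  thus "\<exists>\<phi>\<in>hom (B.H n) (C.H n). inj_on \<phi> (carrier (B.H n))" using \<phi>(1) by blast
  assume fin: "finite (carrier (C.H n))"
  have "card (carrier (C.H n)) = card (kernel (C.H n) (A.H (n + 1)) \<delta>) * card (\<delta> ` carrier (C.H n))"
    by (intro card_hom_image comm_group.axioms(2) A.comm_group_H C.comm_group_H \<delta>(1) fin)
  moreover have "\<delta> ` carrier (C.H n) = carrier (A.H (n + 1))"
  proof
    show "carrier (A.H (n + 1)) \<subseteq> \<delta> ` carrier (C.H n)"
    proof
      fix y assume "y \<in> carrier (A.H (n + 1))"
      then obtain a where a: "a \<in> A.Z (n + 1)" "y = A.cls (n + 1) a" by (auto simp: A.carrier_H)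
      then obtain c where "c \<in> C.Z n" "A.cls (n + 1) (lift n c) = y"
        using lift_surj[OF a(1)] assms(2) by blast
      thus "y \<in> \<delta> ` carrier (C.H n)" using \<delta>(2) by (force simp: C.carrier_H)
    qed
  qed (use hom_in_carrier[OF \<delta>(1)] in auto)
  moreover have "kernel (C.H n) (A.H (n + 1)) \<delta> = \<phi> ` carrier (B.H n)"
  proof -
    have "x \<in> kernel (C.H n) (A.H (n + 1)) \<delta> \<longleftrightarrow> x \<in> \<phi> ` carrier (B.H n)" for x
    proof (cases "x \<in> carrier (C.H n)")
      case True
      then obtain c where c: "c \<in> C.Z n" "x = C.cls n c" by (auto simp: C.carrier_H)
      have "x \<in> kernel (C.H n) (A.H (n + 1)) \<delta> \<longleftrightarrow> (\<exists>b\<in>B.Z n. C.cls n (g n b) = x)"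
        using True c \<delta>(2) cls_lift_one_iff by (simp add: kernel_def)
      also have "\<dots> \<longleftrightarrow> x \<in> \<phi> ` carrier (B.H n)"
        using \<phi>(2) by (force simp: B.carrier_H)
      finally show ?thesis .
    qed (use hom_in_carrier[OF \<phi>(1)] in \<open>auto simp: kernel_def\<close>)
    thus ?thesis by blast
  qed
  ultimately show "card (carrier (C.H n)) = card (carrier (B.H n)) * card (carrier (A.H (n + 1)))"
    using card_image[OF inj] by simp
qed

text \<open>The counterpart when \<open>g\<close> induces zero: 0 -> H^n(C) -> H^(n+1)(A) ->
  H^(n+1)(B) -> 0. Applied to the dual, where Z/p is the kernel A rather than the cokernel.\<close>

theorem null_projection:
  assumes "g n ` B.Z n \<subseteq> C.B n" "g (n + 1) ` B.Z (n + 1) \<subseteq> C.B (n + 1)"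
  shows "\<exists>\<delta>\<in>hom (C.H n) (A.H (n + 1)). inj_on \<delta> (carrier (C.H n))"
    and "finite (carrier (A.H (n + 1))) \<Longrightarrow>
      card (carrier (A.H (n + 1))) = card (carrier (C.H n)) * card (carrier (B.H (n + 1)))"
proof -
  obtain \<delta> where \<delta>: "\<delta> \<in> hom (C.H n) (A.H (n + 1))" "\<And>c. c \<in> C.Z n \<Longrightarrow> \<delta> (C.cls n c) = A.cls (n + 1) (lift n c)"
    using connecting_hom by blast
  interpret dh: group_hom "C.H n" "A.H (n + 1)" \<delta>
    using \<delta>(1) A.comm_group_H C.comm_group_H by (intro group_homI) (auto simp: comm_group_def)
  have "C.cls n c = \<one>\<^bsub>C.H n\<^esub>" if c: "c \<in> C.Z n" and c1: "A.cls (n + 1) (lift n c) = \<one>\<^bsub>A.H (n + 1)\<^esub>" for c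
  proof -
    obtain b where b: "b \<in> B.Z n" "C.cls n (g n b) = C.cls n c"
      using cls_lift_one_iff[OF c] c1 by metis
    have "g n b \<in> C.B n" using b assms(1) by auto
    thus ?thesis using b C.cls_eq_one_iff[OF g_Z[OF b(1)]] by simp
  qed
  hence inj: "inj_on \<delta> (carrier (C.H n))"
    unfolding dh.inj_on_one_iff using \<delta>(2) by (auto simp: C.carrier_H)
  thus "\<exists>\<delta>\<in>hom (C.H n) (A.H (n + 1)). inj_on \<delta> (carrier (C.H n))" using \<delta>(1) by blast
  let ?m = "n + 1"
  have "(\<lambda>a. B.cls ?m (f ?m a)) \<in> hom (CA ?m\<lparr>carrier := A.Z ?m\<rparr>) (B.H ?m)"
    using f_Z hom_mult[OF f_hom[of ?m]] by (auto intro!: homI simp: B.carrier_H B.cls_mult A.Z_iff)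
  moreover have "B.cls ?m (f ?m a) = \<one>\<^bsub>B.H ?m\<^esub>" if "a \<in> A.B ?m" for a
    using that f_B B.cls_eq_one_iff f_Z A.B_subset_Z by blast
  ultimately obtain \<phi> where \<phi>: "\<phi> \<in> hom (A.H ?m) (B.H ?m)" "\<And>a. a \<in> A.Z ?m \<Longrightarrow> \<phi> (A.cls ?m a) = B.cls ?m (f ?m a)"
    using A.hom_from_H[of "B.H ?m" "\<lambda>a. B.cls ?m (f ?m a)" ?m] B.comm_group_H by (auto simp: comm_group_def)
  assume fin: "finite (carrier (A.H ?m))"
  have "card (carrier (A.H ?m)) = card (kernel (A.H ?m) (B.H ?m) \<phi>) * card (\<phi> ` carrier (A.H ?m))"
    by (intro card_hom_image comm_group.axioms(2) A.comm_group_H B.comm_group_H \<phi>(1) fin)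
  moreover have "\<phi> ` carrier (A.H ?m) = carrier (B.H ?m)"
  proof
    show "carrier (B.H ?m) \<subseteq> \<phi> ` carrier (A.H ?m)"
    proof
      fix y assume "y \<in> carrier (B.H ?m)"
      then obtain b where b: "b \<in> B.Z ?m" "y = B.cls ?m b" by (auto simp: B.carrier_H)
      have bc: "b \<in> carrier (CB ?m)" using b by (simp add: B.Z_iff)
      then obtain a b' where ab: "a \<in> carrier (CA ?m)" "b' \<in> carrier (CB (?m - 1))"
        "b = f ?m a \<otimes>\<^bsub>CB ?m\<^esub> dB (?m - 1) b'"
        using lift_coboundary b(1) assms(2) by blast
      interpret Bn: comm_group "CB ?m" by (rule B.comm_group_C)
      have d: "dB (?m - 1) b' \<in> B.B ?m" using ab(2) by (auto simp: coboundaries_def)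
      have dc: "dB (?m - 1) b' \<in> B.Z ?m" using d B.B_subset_Z by blast
      hence dc: "dB (?m - 1) b' \<in> B.Z ?m" "dB (?m - 1) b' \<in> carrier (CB ?m)"
        using subgroup.mem_carrier[OF B.subgroup_Z] by blast+
      have eq: "f ?m a = b \<otimes>\<^bsub>CB ?m\<^esub> inv\<^bsub>CB ?m\<^esub> dB (?m - 1) b'"
        using ab(3) dc f_closed[OF ab(1)] bc by (simp add: Bn.inv_solve_right)
      hence fa: "f ?m a \<in> B.Z ?m"
        using b(1) dc subgroup.m_closed[OF B.subgroup_Z] subgroup.m_inv_closed[OF B.subgroup_Z] by metis
      have "b \<otimes>\<^bsub>CB ?m\<^esub> inv\<^bsub>CB ?m\<^esub> f ?m a = dB (?m - 1) b'"
        using ab(3) dc f_closed[OF ab(1)] bc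
        by (metis Bn.inv_solve_right' Bn.m_comm)
      hence "B.cls ?m b = B.cls ?m (f ?m a)" using B.cls_eq_iff[OF b(1) fa] d by simp
      moreover have "a \<in> A.Z ?m" using f_Z_iff fa ab(1) by blast
      ultimately show "y \<in> \<phi> ` carrier (A.H ?m)" using \<phi>(2) b(2) by (force simp: A.carrier_H)
    qed
  qed (use hom_in_carrier[OF \<phi>(1)] in auto)
  moreover have "kernel (A.H ?m) (B.H ?m) \<phi> = \<delta> ` carrier (C.H n)"
  proof
    show "kernel (A.H ?m) (B.H ?m) \<phi> \<subseteq> \<delta> ` carrier (C.H n)"
    proof
      fix y assume y: "y \<in> kernel (A.H ?m) (B.H ?m) \<phi>"
      then obtain a where a: "a \<in> A.Z ?m" "y = A.cls ?m a" by (auto simp: A.carrier_H kernel_def)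
      hence "f ?m a \<in> B.B ?m"
        using y \<phi>(2) B.cls_eq_one_iff f_Z by (auto simp: kernel_def)
      then obtain c where "c \<in> C.Z n" "A.cls ?m (lift n c) = y"
        using lift_surj[OF a(1)] a(2) by blast
      thus "y \<in> \<delta> ` carrier (C.H n)" using \<delta>(2) by (force simp: C.carrier_H)
    qed
    show "\<delta> ` carrier (C.H n) \<subseteq> kernel (A.H ?m) (B.H ?m) \<phi>"
    proof
      fix y assume "y \<in> \<delta> ` carrier (C.H n)"
      then obtain c where c: "c \<in> C.Z n" "y = A.cls ?m (lift n c)" using \<delta>(2) by (auto simp: C.carrier_H)
      have "f ?m (lift n c) \<in> B.B ?m" using lift(2)[OF c(1)] by (auto simp: B.B_iff)
      thus "y \<in> kernel (A.H ?m) (B.H ?m) \<phi>"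
        using c \<phi>(2) lift(1) f_Z B.cls_eq_one_iff by (auto simp: kernel_def A.carrier_H)
    qed
  qed
  ultimately show "card (carrier (A.H ?m)) = card (carrier (C.H n)) * card (carrier (B.H ?m))"
    using card_image[OF inj] by simp
qed

end

section \<open>The standard complete resolution in terms of formal sums of tuples\<close>

definition con :: "'a \<Rightarrow> ('a list \<Rightarrow>\<^sub>0 int) \<Rightarrow> 'a list \<Rightarrow>\<^sub>0 int"
  where "con g = frag_extend (\<lambda>t. frag_of (g # t))"

definition map_frag :: "('a \<Rightarrow> 'b) \<Rightarrow> ('a list \<Rightarrow>\<^sub>0 int) \<Rightarrow> 'b list \<Rightarrow>\<^sub>0 int"
  where "map_frag \<phi> = frag_extend (\<lambda>t. frag_of (map \<phi> t))"

text \<open>The alternating sum of faces, in a recursive form that allows induction on lists; the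
  minus sign in front of \<open>con\<close> accounts for the alternation. A singleton has the empty
  tuple as its face, so this is the augmented complex.\<close>

primrec face :: "'a list \<Rightarrow> 'a list \<Rightarrow>\<^sub>0 int" where
  "face [] = 0"
| "face (g # t) = frag_of t - con g (face t)"

text \<open>The alternating sum of insertions of \<open>g\<close> at all places. Summed over
  \<open>g\<close> it is the transpose of \<open>face\<close> with respect to the basis of
  tuples.\<close>

primrec ins :: "'a \<Rightarrow> 'a list \<Rightarrow> 'a list \<Rightarrow>\<^sub>0 int" where
  "ins g [] = frag_of [g]"
| "ins g (h # t) = frag_of (g # h # t) - con h (ins g t)"

lemma con_simps [simp]:
  "con g 0 = 0" "con g (frag_of t) = frag_of (g # t)" "con g (c - c') = con g c - con g c'"
  "con g (c + c') = con g c + con g c'" "con g (- c) = - con g c"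
  "con g (frag_cmul k c) = frag_cmul k (con g c)"
  by (simp_all add: con_def frag_extend_diff frag_extend_add frag_extend_minus frag_extend_cmul)

lemma con_sum [simp]: "con g (\<Sum>i\<in>I. c i) = (\<Sum>i\<in>I. con g (c i))"
  by (induction I rule: infinite_finite_induct) auto

lemma map_frag_simps [simp]:
  "map_frag \<phi> 0 = 0" "map_frag \<phi> (frag_of t) = frag_of (map \<phi> t)" "map_frag \<phi> (c - c') = map_frag \<phi> c - map_frag \<phi> c'"
  by (simp_all add: map_frag_def frag_extend_diff)

lemma frag_extend_sum': "frag_extend f (\<Sum>i\<in>I. c i) = (\<Sum>i\<in>I. frag_extend f (c i))"
  by (induction I rule: infinite_finite_induct) (auto simp: frag_extend_add)

lemma map_frag_sum [simp]: "map_frag \<phi> (\<Sum>i\<in>I. c i) = (\<Sum>i\<in>I. map_frag \<phi> (c i))"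
  by (simp add: map_frag_def frag_extend_sum')

lemma frag_linear_eqI:
  fixes F F' :: "('a \<Rightarrow>\<^sub>0 int) \<Rightarrow> 'b :: ab_group_add"
  assumes "F 0 = F' 0" "\<And>c c'. F (c - c') = F c - F c'" "\<And>c c'. F' (c - c') = F' c - F' c'"
    "\<And>t. F (frag_of t) = F' (frag_of t)"
  shows "F c = F' c"
  using subset_UNIV by (induction c rule: frag_induction) (auto simp: assms)

lemma map_frag_con: "map_frag \<phi> (con g c) = con (\<phi> g) (map_frag \<phi> c)"
  by (rule frag_linear_eqI) auto

lemma face_map: "face (map \<phi> t) = map_frag \<phi> (face t)"
  by (induction t) (auto simp: map_frag_con)

lemma ins_map: "ins (\<phi> g) (map \<phi> t) = map_frag \<phi> (ins g t)"
  by (induction t) (auto simp: map_frag_con)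

text \<open>The cone identity: prefixing a fixed entry contracts the augmented complex. It proves
  that faces of faces cancel, and its transpose reappears as \<open>strip_nab\<close>.\<close>

lemma face_con: "frag_extend face (con g c) = c - con g (frag_extend face c)"
  by (rule frag_linear_eqI) (auto simp: frag_extend_diff)

lemma face_face: "frag_extend face (face t) = 0"
  by (induction t) (auto simp: frag_extend_diff face_con)

lemma face_eq_sum:
  "face t = (\<Sum>i<length t. frag_cmul ((- 1) ^ i) (frag_of (take i t @ drop (Suc i) t)))"
  by (induction t) (auto simp: sum.lessThan_Suc_shift simp del: sum.lessThan_Suc simp flip: sum_negf)

lemma ins_eq_sum:
  "ins g t = (\<Sum>i\<le>length t. frag_cmul ((- 1) ^ i) (frag_of (take i t @ g # drop i t)))"
  by (induction t) (auto simp: sum.atMost_Suc_shift simp del: sum.atMost_Suc simp flip: sum_negf)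

lemma keys_con: "Poly_Mapping.keys (con g c) \<subseteq> (#) g ` Poly_Mapping.keys c"
  unfolding con_def using keys_frag_extend[of "\<lambda>t. frag_of (g # t)" c] by (auto simp: keys_frag_of)

lemma tuples_Cons [simp]: "g # t \<in> tuples G (Suc k) \<longleftrightarrow> g \<in> carrier G \<and> t \<in> tuples G k"
  by (auto simp: tuples_def)

lemma tuples_0 [simp]: "tuples G 0 = {[]}"
  by (auto simp: tuples_def)

lemma tuples_SucE:
  assumes "t \<in> tuples G (Suc k)"
  obtains g t' where "t = g # t'" "g \<in> carrier G" "t' \<in> tuples G k"
  using assms by (cases t) (auto simp: tuples_def)

lemma keys_con_tuples:
  assumes "g \<in> carrier G" "Poly_Mapping.keys c \<subseteq> tuples G k"
  shows "Poly_Mapping.keys (con g c) \<subseteq> tuples G (Suc k)"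
proof (rule order_trans[OF keys_con])
  show "(#) g ` Poly_Mapping.keys c \<subseteq> tuples G (Suc k)" using assms by auto
qed

lemma keys_face: "t \<in> tuples G (Suc k) \<Longrightarrow> Poly_Mapping.keys (face t) \<subseteq> tuples G k"
proof (induction k arbitrary: t)
  case 0
  thus ?case by (auto elim!: tuples_SucE simp: keys_frag_of)
next
  case (Suc k)
  then obtain g t' where t: "t = g # t'" "g \<in> carrier G" "t' \<in> tuples G (Suc k)" by (auto elim: tuples_SucE)
  show ?case
    using keys_con_tuples[OF t(2) Suc.IH[OF t(3)]] t(3) unfolding t(1) face.simps
    by (intro order_trans[OF keys_diff]) (simp add: keys_frag_of)
qed

lemma keys_ins: "g \<in> carrier G \<Longrightarrow> t \<in> tuples G k \<Longrightarrow> Poly_Mapping.keys (ins g t) \<subseteq> tuples G (Suc k)"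
proof (induction k arbitrary: t)
  case (Suc k)
  then obtain h t' where t: "t = h # t'" "h \<in> carrier G" "t' \<in> tuples G k" by (auto elim: tuples_SucE)
  show ?case
    using keys_con_tuples[OF t(2) Suc.IH[OF Suc.prems(1) t(3)]] t(2,3) Suc.prems(1) unfolding t(1) ins.simps
    by (intro order_trans[OF keys_diff]) (simp add: keys_frag_of)
qed (auto simp: keys_frag_of)

lemma keys_sum_subset:
  fixes c :: "'i \<Rightarrow> 'a \<Rightarrow>\<^sub>0 int"
  shows "(\<And>i. i \<in> I \<Longrightarrow> Poly_Mapping.keys (c i) \<subseteq> T) \<Longrightarrow> Poly_Mapping.keys (\<Sum>i\<in>I. c i) \<subseteq> T"
  using sum_closed_free_Abelian_group[of I c T] by simp

definition nab :: "('a, 'b) monoid_scheme \<Rightarrow> 'a list \<Rightarrow> 'a list \<Rightarrow>\<^sub>0 int"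
  where "nab G t = (\<Sum>g\<in>carrier G. ins g t)"

text \<open>The boundary from degree n + 1 to degree n of the complete resolution, with dual basis
  elements in negative degrees again written as tuples. For \<open>n = - 1\<close> the value is the
  same for all \<open>t\<close>: the augmentation followed by its dual.\<close>

definition bd :: "('a, 'b) monoid_scheme \<Rightarrow> int \<Rightarrow> 'a list \<Rightarrow> 'a list \<Rightarrow>\<^sub>0 int"
  where "bd G n t = (if n \<ge> 0 then face t else if n = - 1 then nab G [] else nab G t)"

lemma nab_con:
  "frag_extend (nab G) (con h c) = (\<Sum>g\<in>carrier G. con g (con h c)) - con h (frag_extend (nab G) c)"
  by (rule frag_linear_eqI)
    (auto simp: frag_extend_diff nab_def sum_subtractf)

text \<open>Two entries inserted in front of the leading \<open>h\<close> cancel, since exchanging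
  them reverses the sign; the remaining terms reduce to the induction hypothesis behind
  \<open>h\<close>.\<close>

lemma nab_nab: "frag_extend (nab G) (nab G t) = 0"
proof (induction t)
  case Nil
  show ?case
    by (simp add: nab_def frag_extend_sum' nab_con flip: con_simps(2))
      (simp add: nab_def sum_subtractf, rule sum.swap)
next
  case (Cons h t)
  have eq: "nab G (h # t) = (\<Sum>g\<in>carrier G. con g (con h (frag_of t))) - con h (nab G t)"
    by (simp add: nab_def sum_subtractf)
  have "frag_extend (nab G) (\<Sum>g\<in>carrier G. con g (con h (frag_of t)))
     = (\<Sum>g\<in>carrier G. (\<Sum>k\<in>carrier G. con k (con g (con h (frag_of t)))) - con g (nab G (h # t)))"
    by (simp add: frag_extend_sum' nab_con flip: con_simps(2)) (simp add: nab_def sum_subtractf)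
  also have "\<dots> = (\<Sum>g\<in>carrier G. \<Sum>k\<in>carrier G. con k (con g (con h (frag_of t))))
      - (\<Sum>g\<in>carrier G. \<Sum>k\<in>carrier G. con g (con k (con h (frag_of t)))) + (\<Sum>g\<in>carrier G. con g (con h (nab G t)))"
    unfolding eq by (simp add: sum_subtractf)
  also have "\<dots> = (\<Sum>g\<in>carrier G. con g (con h (nab G t)))"
    by (subst sum.swap) simp
  finally show ?case
    using Cons by (simp add: eq frag_extend_diff nab_con)
qed

lemma tate_len_simps:
  "n \<ge> 0 \<Longrightarrow> tate_len (n + 1) = Suc (tate_len n)" "tate_len 0 = 1" "tate_len (- 1) = 1"
  "n \<le> - 2 \<Longrightarrow> tate_len n = Suc (tate_len (n + 1))" "tate_len n > 0"
  by (auto simp: tate_len_def)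

lemma keys_bd:
  assumes "t \<in> tuples G (tate_len (n + 1))"
  shows "Poly_Mapping.keys (bd G n t) \<subseteq> tuples G (tate_len n)"
proof -
  consider "n \<ge> 0" | "n = - 1" | "n \<le> - 2" by linarith
  thus ?thesis
  proof cases
    case 1
    thus ?thesis using assms keys_face[of t G] by (simp add: bd_def tate_len_simps)
  next
    case 2
    thus ?thesis
      unfolding bd_def nab_def by (auto simp: tate_len_simps keys_frag_of intro!: keys_sum_subset)
  next
    case 3
    thus ?thesis using assms
      unfolding bd_def nab_def
      by (auto simp: tate_len_simps(4) intro!: keys_sum_subset dest!: keys_ins[THEN subsetD, rotated 2])
  qed
qed

text \<open>Two facts hold the splice together: the faces of a pair have coefficient sum zero, so
  the constant map \<open>bd G (- 1)\<close> kills them, and the value of \<open>bd G (- 1)\<close>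
  is \<open>nab G []\<close>, which \<open>nab\<close> kills.\<close>

lemma bd_bd:
  assumes "t \<in> tuples G (tate_len (n + 1 + 1))"
  shows "frag_extend (bd G n) (bd G (n + 1) t) = 0"
proof -
  consider "n \<ge> 0" | "n = - 1" | "n = - 2" | "n \<le> - 3" by linarith
  thus ?thesis
  proof cases
    case 1
    hence "bd G n = face" "bd G (n + 1) = face"
      by (auto simp: bd_def fun_eq_iff)
    thus ?thesis by (simp add: face_face)
  next
    case 2
    hence "t \<in> tuples G (Suc (Suc 0))" using assms by (simp add: tate_len_def numeral_eq_Suc)
    thus ?thesis using 2 by (auto elim!: tuples_SucE simp: bd_def frag_extend_diff)
  next
    case 3
    have "bd G n = nab G" "bd G (n + 1) t = nab G []"
      using 3 by (auto simp: bd_def fun_eq_iff)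
    thus ?thesis by (simp add: nab_nab)
  next
    case 4
    hence "bd G n = nab G" "bd G (n + 1) = nab G"
      by (auto simp: bd_def fun_eq_iff)
    thus ?thesis by (simp add: nab_nab)
  qed
qed

section \<open>Tate cochains of a module as a cochain complex\<close>

locale finite_module = G_module G A act
  for G :: "('a, 'b) monoid_scheme" and A :: "('c, 'd) monoid_scheme" and act +
  assumes finite_G: "finite (carrier G)"
begin

lemma act_closed [simp]: "g \<in> carrier G \<Longrightarrow> u \<in> carrier A \<Longrightarrow> act g u \<in> carrier A"
  using act_hom by (auto simp: hom_def)

abbreviation "T n \<equiv> tuples G (tate_len n)"
abbreviation "Ch n \<equiv> tate_cochains G A act n"
abbreviation "db n \<equiv> tate_coboundary G A n"

lemma tuples_translate: "g \<in> carrier G \<Longrightarrow> t \<in> tuples G k \<Longrightarrow> map ((\<otimes>\<^bsub>G\<^esub>) g) t \<in> tuples G k"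
  by (auto simp: tuples_def)

lemma Ch_iff:
  "x \<in> carrier (Ch n) \<longleftrightarrow> x \<in> T n \<rightarrow> carrier A \<and> x \<in> extensional (T n) \<and>
     (\<forall>g\<in>carrier G. \<forall>t\<in>T n. x (map ((\<otimes>\<^bsub>G\<^esub>) g) t) = act g (x t))"
  by (auto simp: tate_cochains_def PiE_def)

lemma mult_Ch: "x \<otimes>\<^bsub>Ch n\<^esub> y = (\<lambda>t\<in>T n. x t \<otimes>\<^bsub>A\<^esub> y t)"
  by (simp add: tate_cochains_def)

lemma one_Ch: "\<one>\<^bsub>Ch n\<^esub> = (\<lambda>t\<in>T n. \<one>\<^bsub>A\<^esub>)"
  by (simp add: tate_cochains_def)

lemma act_group_hom: "g \<in> carrier G \<Longrightarrow> group_hom A A (act g)"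
  by (intro group_homI A.is_group act_hom)

lemma Ch_closed: "x \<in> carrier (Ch n) \<Longrightarrow> t \<in> T n \<Longrightarrow> x t \<in> carrier A"
  by (auto simp: Ch_iff)

lemma comm_group_Ch: "comm_group (Ch n)"
proof (rule comm_groupI)
  fix x y assume "x \<in> carrier (Ch n)" "y \<in> carrier (Ch n)"
  thus "x \<otimes>\<^bsub>Ch n\<^esub> y \<in> carrier (Ch n)"
    using tuples_translate by (auto simp: Ch_iff mult_Ch group_hom.hom_mult[OF act_group_hom] Pi_iff)
next
  show "\<one>\<^bsub>Ch n\<^esub> \<in> carrier (Ch n)"
    using tuples_translate by (auto simp: Ch_iff one_Ch group_hom.hom_one[OF act_group_hom])
next
  fix x assume "x \<in> carrier (Ch n)"
  thus "\<exists>y\<in>carrier (Ch n). y \<otimes>\<^bsub>Ch n\<^esub> x = \<one>\<^bsub>Ch n\<^esub>"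
    using tuples_translate
    by (intro bexI[of _ "\<lambda>t\<in>T n. inv\<^bsub>A\<^esub> x t"])
      (auto simp: Ch_iff mult_Ch one_Ch group_hom.hom_inv[OF act_group_hom] Pi_iff A.l_inv intro!: restrict_ext)
qed (auto simp: mult_Ch one_Ch Ch_iff Pi_iff A.m_ac fun_eq_iff extensional_def)

text \<open>The bridge from the given product formulas to formal sums; from here on the coboundary
  is handled only as evaluation on \<open>bd\<close>.\<close>

lemma db_eq_ev:
  assumes x: "x \<in> carrier (Ch n)" and t: "t \<in> T (n + 1)"
  shows "db n x t = ev A x (bd G n t)"
proof -
  have x': "x \<in> T n \<rightarrow> carrier A" using x by (simp add: Ch_iff)
  consider "n \<ge> 0" | "n = - 1" | "n \<le> - 2" by linarith
  thus ?thesis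
  proof cases
    case 1
    hence t': "t \<in> tuples G (Suc (tate_len n))" using t by (simp add: tate_len_simps)
    have k: "take i t @ drop (Suc i) t \<in> T n" if "i < length t" for i
      using t' that set_take_subset[of i t] set_drop_subset[of "Suc i" t] by (auto simp: tuples_def)
    have "ev A x (bd G n t) = (\<Otimes>\<^bsub>A\<^esub>i\<in>{..<length t}. ev A x (frag_cmul ((- 1) ^ i) (frag_of (take i t @ drop (Suc i) t))))"
      using 1 k by (simp add: bd_def face_eq_sum, subst A.ev_sum[OF x']) (auto simp: keys_frag_of)
    also have "\<dots> = (\<Otimes>\<^bsub>A\<^esub>i\<in>{..<length t}. x (take i t @ drop (Suc i) t) [^]\<^bsub>A\<^esub> ((- 1) ^ i :: int))"
      using k x' by (intro A.finprod_cong') (auto simp: A.ev_cmul[OF x'] keys_frag_of Pi_iff)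
    finally show ?thesis using 1 t by (simp add: tate_coboundary_def)
  next
    case 2
    have "ev A x (bd G n t) = (\<Otimes>\<^bsub>A\<^esub>g\<in>carrier G. ev A x (frag_of [g]))"
      using 2 unfolding bd_def nab_def by (simp, subst A.ev_sum[OF x']) (auto simp: keys_frag_of tate_len_simps)
    also have "\<dots> = (\<Otimes>\<^bsub>A\<^esub>g\<in>carrier G. x [g])"
      using x' 2 by (intro A.finprod_cong') (auto simp: tate_len_simps Pi_iff)
    finally show ?thesis using 2 t by (simp add: tate_coboundary_def)
  next
    case 3
    have len: "tate_len n = Suc (tate_len (n + 1))" using 3 by (rule tate_len_simps)
    have k: "take i t @ g # drop i t \<in> T n" if "i \<le> length t" "g \<in> carrier G" for i g
      using t that set_take_subset[of i t] set_drop_subset[of i t] len by (auto simp: tuples_def)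
    have ki: "Poly_Mapping.keys (ins g t) \<subseteq> T n" if "g \<in> carrier G" for g
      using keys_ins that t len by metis
    have "ev A x (bd G n t) = (\<Otimes>\<^bsub>A\<^esub>g\<in>carrier G. ev A x (ins g t))"
      using 3 ki unfolding bd_def nab_def by (simp, subst A.ev_sum[OF x']) auto
    also have "\<dots> = (\<Otimes>\<^bsub>A\<^esub>g\<in>carrier G. \<Otimes>\<^bsub>A\<^esub>i\<in>{..length t}. x (take i t @ g # drop i t) [^]\<^bsub>A\<^esub> ((- 1) ^ i :: int))"
    proof (rule A.finprod_cong')
      fix g assume g: "g \<in> carrier G"
      have "ev A x (ins g t) = (\<Otimes>\<^bsub>A\<^esub>i\<in>{..length t}. ev A x (frag_cmul ((- 1) ^ i) (frag_of (take i t @ g # drop i t))))"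
        using k g unfolding ins_eq_sum by (subst A.ev_sum[OF x']) (auto simp: keys_frag_of)
      also have "\<dots> = (\<Otimes>\<^bsub>A\<^esub>i\<in>{..length t}. x (take i t @ g # drop i t) [^]\<^bsub>A\<^esub> ((- 1) ^ i :: int))"
        using k g x' by (intro A.finprod_cong') (auto simp: A.ev_cmul[OF x'] keys_frag_of Pi_iff)
      finally show "ev A x (ins g t) = (\<Otimes>\<^bsub>A\<^esub>i\<in>{..length t}. x (take i t @ g # drop i t) [^]\<^bsub>A\<^esub> ((- 1) ^ i :: int))" .
    qed (use k x' in \<open>auto simp: Pi_iff\<close>)
    finally show ?thesis using 3 t by (simp add: tate_coboundary_def)
  qed
qed

lemma nab_translate:
  assumes "g \<in> carrier G"
  shows "nab G (map ((\<otimes>\<^bsub>G\<^esub>) g) t) = map_frag ((\<otimes>\<^bsub>G\<^esub>) g) (nab G t)"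
proof -
  have "(\<Sum>h\<in>carrier G. ins h (map ((\<otimes>\<^bsub>G\<^esub>) g) t)) = (\<Sum>h\<in>carrier G. ins (g \<otimes>\<^bsub>G\<^esub> h) (map ((\<otimes>\<^bsub>G\<^esub>) g) t))"
    by (rule sum.reindex_bij_witness[of _ "\<lambda>h. g \<otimes>\<^bsub>G\<^esub> h" "\<lambda>h. inv\<^bsub>G\<^esub> g \<otimes>\<^bsub>G\<^esub> h"])
      (use assms in \<open>auto simp: G.m_assoc[symmetric]\<close>)
  thus ?thesis by (simp add: nab_def ins_map)
qed

lemma bd_translate:
  assumes "g \<in> carrier G"
  shows "bd G n (map ((\<otimes>\<^bsub>G\<^esub>) g) t) = map_frag ((\<otimes>\<^bsub>G\<^esub>) g) (bd G n t)"
  using nab_translate[OF assms, of t] nab_translate[OF assms, of "[]"] by (simp add: bd_def face_map)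

lemma ev_translate:
  assumes x: "x \<in> carrier (Ch n)" and g: "g \<in> carrier G" and c: "Poly_Mapping.keys c \<subseteq> T n"
  shows "ev A x (map_frag ((\<otimes>\<^bsub>G\<^esub>) g) c) = act g (ev A x c)"
proof -
  have x': "x \<in> T n \<rightarrow> carrier A" using x by (simp add: Ch_iff)
  have "ev A x (map_frag ((\<otimes>\<^bsub>G\<^esub>) g) c) = ev A (\<lambda>t. ev A x (frag_of (map ((\<otimes>\<^bsub>G\<^esub>) g) t))) c"
    unfolding map_frag_def
    using c tuples_translate[OF g] by (intro A.ev_frag_extend[OF x']) (auto simp: keys_frag_of)
  also have "\<dots> = ev A (\<lambda>t. act g (x t)) c"
    using c tuples_translate[OF g] g x x' by (intro A.ev_cong) (auto simp: Ch_iff Pi_iff subset_iff)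
  also have "\<dots> = act g (ev A x c)"
    using c x' g by (intro A.ev_hom_comp A.comm_group_axioms act_hom) auto
  finally show ?thesis .
qed

lemma db_closed:
  assumes x: "x \<in> carrier (Ch n)" shows "db n x \<in> carrier (Ch (n + 1))"
proof -
  have x': "x \<in> T n \<rightarrow> carrier A" using x by (simp add: Ch_iff)
  show ?thesis
    unfolding Ch_iff
    using A.ev_closed[OF x' keys_bd] tuples_translate ev_translate[OF x _ keys_bd]
    by (auto simp: db_eq_ev[OF x] bd_translate) (simp add: tate_coboundary_def)
qed

lemma db_hom: "db n \<in> hom (Ch n) (Ch (n + 1))"
proof (rule homI)
  fix x y assume x: "x \<in> carrier (Ch n)" and y: "y \<in> carrier (Ch n)"
  interpret Ch: comm_group "Ch n" by (rule comm_group_Ch)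
  have xy: "x \<otimes>\<^bsub>Ch n\<^esub> y \<in> carrier (Ch n)" using x y by simp
  have x': "x \<in> T n \<rightarrow> carrier A" "y \<in> T n \<rightarrow> carrier A" using x y by (auto simp: Ch_iff)
  show "db n (x \<otimes>\<^bsub>Ch n\<^esub> y) = db n x \<otimes>\<^bsub>Ch (n + 1)\<^esub> db n y"
  proof
    fix t show "db n (x \<otimes>\<^bsub>Ch n\<^esub> y) t = (db n x \<otimes>\<^bsub>Ch (n + 1)\<^esub> db n y) t"
    proof (cases "t \<in> T (n + 1)")
      case True
      have "ev A (x \<otimes>\<^bsub>Ch n\<^esub> y) (bd G n t) = ev A (\<lambda>t. x t \<otimes>\<^bsub>A\<^esub> y t) (bd G n t)"
        using x' keys_bd[OF True] by (intro A.ev_cong) (auto simp: mult_Ch Pi_iff subset_iff)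
      thus ?thesis
        using True x y xy A.ev_mult[OF x' keys_bd[OF True]] by (simp add: db_eq_ev mult_Ch)
    qed (use db_closed[OF xy] in \<open>auto simp: mult_Ch Ch_iff extensional_def\<close>)
  qed
qed (rule db_closed)

lemma db_db:
  assumes x: "x \<in> carrier (Ch n)"
  shows "db (n + 1) (db n x) = \<one>\<^bsub>Ch (n + 1 + 1)\<^esub>"
proof
  have x': "x \<in> T n \<rightarrow> carrier A" using x by (simp add: Ch_iff)
  fix t show "db (n + 1) (db n x) t = \<one>\<^bsub>Ch (n + 1 + 1)\<^esub> t"
  proof (cases "t \<in> T (n + 1 + 1)")
    case True
    note k = keys_bd[OF True]
    have "ev A (db n x) (bd G (n + 1) t) = ev A (\<lambda>s. ev A x (bd G n s)) (bd G (n + 1) t)"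
      using k A.ev_closed[OF x' keys_bd] by (intro A.ev_cong) (auto simp: db_eq_ev[OF x] subset_iff)
    also have "\<dots> = ev A x (frag_extend (bd G n) (bd G (n + 1) t))"
      using k keys_bd by (intro A.ev_frag_extend[OF x', symmetric]) blast
    finally show ?thesis
      using True bd_bd[OF True] by (simp add: db_eq_ev[OF db_closed[OF x]] one_Ch)
  qed (use db_closed[OF db_closed[OF x]] in \<open>auto simp: one_Ch Ch_iff extensional_def\<close>)
qed

sublocale cochain_complex Ch db
  by (intro cochain_complex.intro comm_group_Ch db_hom db_db)

lemma tate_cohomology_eq: "tate_cohomology G A act n = H n"
  by (simp add: tate_cohomology_def cohomology_def tate_cocycles_def tate_coboundaries_def
      cocycles_def coboundaries_def)

end

section \<open>Functoriality\<close>

definition push :: "('a, 'b) monoid_scheme \<Rightarrow> ('c \<Rightarrow> 'e) \<Rightarrow> int \<Rightarrow> ('a list \<Rightarrow> 'c) \<Rightarrow> 'a list \<Rightarrow> 'e"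
  where "push G \<phi> n x = (\<lambda>t\<in>tuples G (tate_len n). \<phi> (x t))"

locale module_hom = A: finite_module G A actA + B: finite_module G B actB
  for G :: "('a, 'b) monoid_scheme" and A :: "('c, 'd) monoid_scheme" and actA
    and B :: "('e, 'f) monoid_scheme" and actB +
  fixes \<phi>
  assumes \<phi>_hom: "\<phi> \<in> hom A B"
    and \<phi>_act: "\<lbrakk>g \<in> carrier G; u \<in> carrier A\<rbrakk> \<Longrightarrow> \<phi> (actA g u) = actB g (\<phi> u)"
begin

lemma \<phi>_closed: "u \<in> carrier A \<Longrightarrow> \<phi> u \<in> carrier B"
  using \<phi>_hom by (auto simp: hom_def)

lemma push_closed: "x \<in> carrier (A.Ch n) \<Longrightarrow> push G \<phi> n x \<in> carrier (B.Ch n)"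
  using A.tuples_translate
  by (auto simp: A.Ch_iff B.Ch_iff push_def \<phi>_closed \<phi>_act Pi_iff)

lemma push_hom: "push G \<phi> n \<in> hom (A.Ch n) (B.Ch n)"
proof (rule homI)
  fix x y assume "x \<in> carrier (A.Ch n)" "y \<in> carrier (A.Ch n)"
  thus "push G \<phi> n (x \<otimes>\<^bsub>A.Ch n\<^esub> y) = push G \<phi> n x \<otimes>\<^bsub>B.Ch n\<^esub> push G \<phi> n y"
    by (auto simp: push_def A.mult_Ch B.mult_Ch A.Ch_closed hom_mult[OF \<phi>_hom] intro!: restrict_ext)
qed (rule push_closed)

lemma push_db:
  assumes x: "x \<in> carrier (A.Ch n)"
  shows "push G \<phi> (n + 1) (A.db n x) = B.db n (push G \<phi> n x)"
proof
  fix t show "push G \<phi> (n + 1) (A.db n x) t = B.db n (push G \<phi> n x) t"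
  proof (cases "t \<in> tuples G (tate_len (n + 1))")
    case True
    have x': "x \<in> Poly_Mapping.keys (bd G n t) \<rightarrow> carrier A"
      using keys_bd[OF True] A.Ch_closed[OF x] by auto
    have "ev B (push G \<phi> n x) (bd G n t) = ev B (\<lambda>t. \<phi> (x t)) (bd G n t)"
      using keys_bd[OF True] x' \<phi>_closed by (intro B.A.ev_cong) (auto simp: push_def subset_iff)
    also have "\<dots> = \<phi> (ev A x (bd G n t))"
      by (intro A.A.ev_hom_comp B.A.comm_group_axioms \<phi>_hom x')
    finally show ?thesis
      using True B.db_eq_ev[OF push_closed[OF x] True] A.db_eq_ev[OF x True]
      by (simp add: push_def[of G \<phi> "n + 1"])
  qed (simp add: push_def tate_coboundary_def)
qed

end

locale module_exact =
  i: module_hom G A actA B actB i + \<pi>: module_hom G B actB C actC \<pi>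
  for G :: "('a, 'b) monoid_scheme" and A :: "('c, 'd) monoid_scheme" and actA
    and B :: "('e, 'f) monoid_scheme" and actB and C :: "('g, 'h) monoid_scheme" and actC
    and i and \<pi> +
  assumes i_inj: "inj_on i (carrier A)"
    and ker_eq_im: "b \<in> carrier B \<Longrightarrow> \<pi> b = \<one>\<^bsub>C\<^esub> \<longleftrightarrow> b \<in> i ` carrier A"
    and \<pi>_surj: "\<pi> ` carrier B = carrier C"

text \<open>Here the freeness of the resolution over the group ring enters: equivariant functions on
  a free orbit are determined by one arbitrary value, so preimages may be chosen there and spread
  out by the action.\<close>

lemma (in module_hom) push_surj:
  assumes surj: "\<phi> ` carrier A = carrier B"
  shows "push G \<phi> n ` carrier (A.Ch n) = carrier (B.Ch n)"
proof
  show "carrier (B.Ch n) \<subseteq> push G \<phi> n ` carrier (A.Ch n)"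
  proof
    fix x assume x: "x \<in> carrier (B.Ch n)"
    define s where "s c = (SOME b. b \<in> carrier A \<and> \<phi> b = c)" for c
    have s: "s c \<in> carrier A" "\<phi> (s c) = c" if "c \<in> carrier B" for c
    proof -
      have "c \<in> \<phi> ` carrier A" using surj that by simp
      hence "\<exists>b. b \<in> carrier A \<and> \<phi> b = c" by auto
      from someI_ex[OF this] show "s c \<in> carrier A" "\<phi> (s c) = c" by (simp_all add: s_def)
    qed
    let ?T = "tuples G (tate_len n)"
    \<comment> \<open>\<open>G\<close> acts freely on tuples, and the tuples with first entry \<open>1\<close> represent the orbits.\<close>
    define y where "y = (\<lambda>t\<in>?T. actA (hd t) (s (x (map ((\<otimes>\<^bsub>G\<^esub>) (inv\<^bsub>G\<^esub> hd t)) t))))"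
    have hd: "hd t \<in> carrier G" "t \<noteq> []" if "t \<in> ?T" for t
      using that tate_len_simps(5)[of n] by (cases t; auto simp: tuples_def)+
    have tt: "map ((\<otimes>\<^bsub>G\<^esub>) (inv\<^bsub>G\<^esub> hd t)) t \<in> ?T" if "t \<in> ?T" for t
      using A.tuples_translate that hd by simp
    have xc: "x (map ((\<otimes>\<^bsub>G\<^esub>) (inv\<^bsub>G\<^esub> hd t)) t) \<in> carrier B" if "t \<in> ?T" for t
      using B.Ch_closed[OF x tt[OF that]] .
    have "y (map ((\<otimes>\<^bsub>G\<^esub>) g) t) = actA g (y t)" if g: "g \<in> carrier G" and t: "t \<in> ?T" for g t
    proof -
      have eq: "map ((\<otimes>\<^bsub>G\<^esub>) (inv\<^bsub>G\<^esub> (g \<otimes>\<^bsub>G\<^esub> hd t))) (map ((\<otimes>\<^bsub>G\<^esub>) g) t) = map ((\<otimes>\<^bsub>G\<^esub>) (inv\<^bsub>G\<^esub> hd t)) t"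
      proof (subst map_map, rule map_cong)
        fix h assume "h \<in> set t"
        hence "h \<in> carrier G" using t by (auto simp: tuples_def)
        thus "((\<otimes>\<^bsub>G\<^esub>) (inv\<^bsub>G\<^esub> (g \<otimes>\<^bsub>G\<^esub> hd t)) \<circ> (\<otimes>\<^bsub>G\<^esub>) g) h = inv\<^bsub>G\<^esub> hd t \<otimes>\<^bsub>G\<^esub> h"
          using g hd[OF t] by (simp add: A.G.inv_mult_group A.G.m_assoc A.G.inv_solve_left')
      qed simp
      show ?thesis
        using g t hd[OF t] A.tuples_translate s(1)[OF xc[OF t]]
        by (simp add: y_def hd_map A.act_mult eq del: map_map)
    qed
    hence y: "y \<in> carrier (A.Ch n)"
      using s(1)[OF xc] hd by (auto simp: A.Ch_iff y_def)
    moreover have "push G \<phi> n y = x"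
    proof
      fix t show "push G \<phi> n y t = x t"
      proof (cases "t \<in> ?T")
        case True
        have "push G \<phi> n y t = actB (hd t) (x (map ((\<otimes>\<^bsub>G\<^esub>) (inv\<^bsub>G\<^esub> hd t)) t))"
          using True s xc hd by (simp add: push_def y_def \<phi>_act)
        also have "\<dots> = actB (hd t) (actB (inv\<^bsub>G\<^esub> hd t) (x t))"
          using x True hd by (simp add: B.Ch_iff)
        also have "\<dots> = x t"
          using hd[OF True] B.Ch_closed[OF x True] B.act_mult[of "hd t" "inv\<^bsub>G\<^esub> hd t" "x t"]
          by (simp add: B.act_one A.G.r_inv)
        finally show ?thesis .
      qed (use x in \<open>auto simp: push_def B.Ch_iff extensional_def\<close>)
    qed
    ultimately show "x \<in> push G \<phi> n ` carrier (A.Ch n)" by blast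
  qed
qed (use push_closed in blast)

sublocale module_exact \<subseteq> short_exact i.A.Ch i.A.db i.B.Ch i.B.db \<pi>.B.Ch \<pi>.B.db "push G i" "push G \<pi>"
proof (intro short_exact.intro short_exact_axioms.intro i.A.cochain_complex_axioms
    i.B.cochain_complex_axioms \<pi>.B.cochain_complex_axioms i.push_hom \<pi>.push_hom i.push_db \<pi>.push_db)
  fix n
  let ?T = "tuples G (tate_len n)"
  show "inj_on (push G i n) (carrier (i.A.Ch n))"
  proof (rule inj_onI, rule ext)
    fix x y t assume xy: "x \<in> carrier (i.A.Ch n)" "y \<in> carrier (i.A.Ch n)" "push G i n x = push G i n y"
    show "x t = y t"
    proof (cases "t \<in> ?T")
      case True
      thus ?thesis using fun_cong[OF xy(3), of t] i_inj i.A.Ch_closed xy by (auto simp: push_def dest: inj_onD)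
    qed (use xy in \<open>auto simp: i.A.Ch_iff extensional_def\<close>)
  qed
  show "push G \<pi> n ` carrier (i.B.Ch n) = carrier (\<pi>.B.Ch n)"
    by (rule \<pi>.push_surj[OF \<pi>_surj])
  fix b assume b: "b \<in> carrier (i.B.Ch n)"
  show "push G \<pi> n b = \<one>\<^bsub>\<pi>.B.Ch n\<^esub> \<longleftrightarrow> b \<in> push G i n ` carrier (i.A.Ch n)"
  proof
    assume "push G \<pi> n b = \<one>\<^bsub>\<pi>.B.Ch n\<^esub>"
    hence "push G \<pi> n b t = \<one>\<^bsub>\<pi>.B.Ch n\<^esub> t" for t by simp
    hence "\<pi> (b t) = \<one>\<^bsub>C\<^esub>" if "t \<in> ?T" for t
      using that by (simp add: push_def \<pi>.B.one_Ch) (metis (full_types))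
    hence im: "b t \<in> i ` carrier A" if "t \<in> ?T" for t
      using ker_eq_im i.B.Ch_closed[OF b] that by blast
    define a where "a = (\<lambda>t\<in>?T. inv_into (carrier A) i (b t))"
    have a: "a t \<in> carrier A" "i (a t) = b t" if "t \<in> ?T" for t
      using im[OF that] that by (auto simp: a_def inv_into_into f_inv_into_f)
    have "a (map ((\<otimes>\<^bsub>G\<^esub>) g) t) = actA g (a t)" if g: "g \<in> carrier G" and t: "t \<in> ?T" for g t
    proof (rule inj_onD[OF i_inj])
      show "i (a (map ((\<otimes>\<^bsub>G\<^esub>) g) t)) = i (actA g (a t))"
        using a g t b i.A.tuples_translate by (simp add: i.\<phi>_act i.B.Ch_iff)
    qed (use a g t i.A.tuples_translate in auto)
    hence "a \<in> carrier (i.A.Ch n)"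
      using a by (auto simp: i.A.Ch_iff) (simp add: a_def)
    moreover have "b = push G i n a"
      using a b by (auto simp: push_def i.B.Ch_iff extensional_def fun_eq_iff)
    ultimately show "b \<in> push G i n ` carrier (i.A.Ch n)" by blast
  next
    assume "b \<in> push G i n ` carrier (i.A.Ch n)"
    then obtain a where a: "a \<in> carrier (i.A.Ch n)" "b = push G i n a" by blast
    have "\<pi> (b t) = \<one>\<^bsub>C\<^esub>" if "t \<in> ?T" for t
      using that ker_eq_im[OF i.B.Ch_closed[OF b that]] i.A.Ch_closed[OF a(1) that]
      by (simp add: a(2) push_def)
    thus "push G \<pi> n b = \<one>\<^bsub>\<pi>.B.Ch n\<^esub>"
      by (auto simp: push_def \<pi>.B.one_Ch intro!: restrict_ext)
  qed
qed

section \<open>Homotopies of the standard complex\<close>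

text \<open>The transpose of \<open>con k\<close> in the basis of tuples: as \<open>con k\<close>
  contracts the augmented standard complex, \<open>strip k\<close> contracts its dual.\<close>

primrec strip :: "'a \<Rightarrow> 'a list \<Rightarrow> 'a list \<Rightarrow>\<^sub>0 int" where
  "strip k [] = 0"
| "strip k (h # t) = (if h = k then frag_of t else 0)"

abbreviation "strip_ext k \<equiv> frag_extend (strip k)"

lemma strip_con: "strip_ext k (con h c) = (if h = k then c else 0)"
  by (rule frag_linear_eqI) (auto simp: frag_extend_diff)

text \<open>The transposed cone identity. Among all insertions in front of \<open>t\<close>,
  stripping \<open>k\<close> keeps exactly the one of \<open>k\<close>; the other insertions match
  those made after stripping, with opposite sign.\<close>

lemma strip_nab:
  assumes "finite (carrier G)" "k \<in> carrier G"
  shows "strip_ext k (nab G t) + frag_extend (nab G) (strip k t) = frag_of t"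
proof -
  have S: "strip_ext k (\<Sum>g\<in>carrier G. con g c) = c" for c
    using assms by (simp add: frag_extend_sum' strip_con)
  show ?thesis
  proof (cases t)
    case Nil
    thus ?thesis using S[of "frag_of []"] by (simp add: nab_def)
  next
    case (Cons h s)
    have "nab G t = (\<Sum>g\<in>carrier G. con g (frag_of t)) - con h (nab G s)"
      by (simp add: nab_def Cons sum_subtractf)
    thus ?thesis by (simp only: frag_extend_diff S strip_con) (simp add: Cons)
  qed
qed

lemma keys_strip: "t \<in> tuples G (Suc k) \<Longrightarrow> Poly_Mapping.keys (strip g t) \<subseteq> tuples G k"
  by (auto elim!: tuples_SucE simp: keys_frag_of split: if_splits)

lemma strip_map:
  assumes "inj_on \<phi> (insert g (set t))"
  shows "strip (\<phi> g) (map \<phi> t) = map_frag \<phi> (strip g t)"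
  using assms by (cases t) (auto simp: inj_on_def)

text \<open>The prism operator, the alternating sum over i of the tuples (g_0, ..., g_i,
  \<open>\<gamma>\<close> g_i, ..., \<open>\<gamma>\<close> g_k); by \<open>prism_homotopy\<close>
  it joins the identity to the chain map induced by \<open>\<gamma>\<close>.\<close>

primrec prism :: "('a \<Rightarrow> 'a) \<Rightarrow> 'a list \<Rightarrow> 'a list \<Rightarrow>\<^sub>0 int" where
  "prism \<gamma> [] = 0"
| "prism \<gamma> (g # t) = frag_of (g # \<gamma> g # map \<gamma> t) - con g (prism \<gamma> t)"

lemma prism_con:
  "frag_extend (prism \<gamma>) (con g c) = con g (con (\<gamma> g) (map_frag \<gamma> c)) - con g (frag_extend (prism \<gamma>) c)"
  by (rule frag_linear_eqI) (auto simp: frag_extend_diff)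

lemma prism_homotopy:
  "frag_extend face (prism \<gamma> t) + frag_extend (prism \<gamma>) (face t) = frag_of (map \<gamma> t) - frag_of t"
proof (induction t)
  case (Cons g t)
  have "frag_extend face (prism \<gamma> (g # t)) + frag_extend (prism \<gamma>) (face (g # t))
      = frag_of (\<gamma> g # map \<gamma> t) - frag_of (g # t)
        + con g (frag_extend face (prism \<gamma> t) + frag_extend (prism \<gamma>) (face t)
            - (frag_of (map \<gamma> t) - frag_of t)) "
    by (simp add: frag_extend_diff face_con prism_con face_map)
  thus ?case using Cons.IH by simp
qed simp

lemma keys_prism:
  assumes "\<gamma> ` carrier G \<subseteq> carrier G"
  shows "t \<in> tuples G k \<Longrightarrow> Poly_Mapping.keys (prism \<gamma> t) \<subseteq> tuples G (Suc k)"
proof (induction k arbitrary: t)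
  case (Suc k)
  then obtain g t' where t: "t = g # t'" "g \<in> carrier G" "t' \<in> tuples G k" by (auto elim: tuples_SucE)
  have "map \<gamma> t' \<in> tuples G k" using t(3) assms by (auto simp: tuples_def)
  thus ?case
    using keys_con_tuples[OF t(2) Suc.IH[OF t(3)]] t(2,3) assms unfolding t(1) prism.simps
    by (intro order_trans[OF keys_diff]) (auto simp: keys_frag_of)
qed auto

lemma prism_map:
  assumes "\<And>g. g \<in> set t \<Longrightarrow> \<gamma> (\<phi> g) = \<phi> (\<gamma> g)"
  shows "prism \<gamma> (map \<phi> t) = map_frag \<phi> (prism \<gamma> t)"
  using assms by (induction t) (auto simp: map_frag_con cong: map_cong)

text \<open>The transpose of the prism, for the part of the complete resolution in negative degrees;
  \<open>\<gamma>'\<close> is the inverse of \<open>\<gamma>\<close>.\<close>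

primrec coprism :: "('a \<Rightarrow> 'a) \<Rightarrow> ('a \<Rightarrow> 'a) \<Rightarrow> 'a list \<Rightarrow> 'a list \<Rightarrow>\<^sub>0 int" where
  "coprism \<gamma> \<gamma>' [] = 0"
| "coprism \<gamma> \<gamma>' (g # t) = con g (map_frag \<gamma>' (strip (\<gamma> g) t)) - con g (coprism \<gamma> \<gamma>' t)"

lemma coprism_con:
  "frag_extend (coprism \<gamma> \<gamma>') (con g c)
    = con g (map_frag \<gamma>' (strip_ext (\<gamma> g) c)) - con g (frag_extend (coprism \<gamma> \<gamma>') c)"
  by (rule frag_linear_eqI) (auto simp: frag_extend_diff)

lemma map_frag_nab:
  assumes "bij_betw \<phi> (carrier G) (carrier G)"
  shows "map_frag \<phi> (nab G t) = nab G (map \<phi> t)"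
  unfolding nab_def map_frag_sum ins_map[symmetric]
  by (rule sum.reindex_bij_betw[OF assms])

lemma map_frag_nab_ext:
  assumes "bij_betw \<phi> (carrier G) (carrier G)"
  shows "map_frag \<phi> (frag_extend (nab G) c) = frag_extend (nab G) (map_frag \<phi> c)"
  by (rule frag_linear_eqI) (auto simp: frag_extend_diff map_frag_nab[OF assms])

text \<open>The transpose of a permutation of the basis is its inverse, which is why
  \<open>\<gamma>'\<close> and not \<open>\<gamma>\<close> appears on the right. The induction
  combines the transposed cone identity \<open>strip_nab\<close> with the recursion of
  \<open>nab\<close>.\<close>

lemma coprism_homotopy:
  assumes fin: "finite (carrier G)" and \<gamma>: "bij_betw \<gamma> (carrier G) (carrier G)"
    and inv: "\<And>g. g \<in> carrier G \<Longrightarrow> \<gamma>' (\<gamma> g) = g" "\<And>g. g \<in> carrier G \<Longrightarrow> \<gamma> (\<gamma>' g) = g"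
  shows "t \<in> tuples G k \<Longrightarrow> frag_extend (nab G) (coprism \<gamma> \<gamma>' t) + frag_extend (coprism \<gamma> \<gamma>') (nab G t)
    = frag_of (map \<gamma>' t) - frag_of t"
proof (induction k arbitrary: t)
  let ?Q = "frag_extend (coprism \<gamma> \<gamma>')"
  let ?N = "frag_extend (nab G)"
  let ?S = "\<lambda>c. \<Sum>g\<in>carrier G. con g c"
  {
    case 0
    have "?Q (nab G []) = 0"
      by (auto simp: nab_def frag_extend_sum' intro!: sum.neutral)
    thus ?case using 0 by simp
  next
    case (Suc k)
    then obtain g s where t: "t = g # s" "g \<in> carrier G" "s \<in> tuples G k" by (auto elim: tuples_SucE)
    have \<gamma>': "bij_betw \<gamma>' (carrier G) (carrier G)"
    proof (rule bij_betw_byWitness[where f' = \<gamma>])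
      show "\<gamma>' ` carrier G \<subseteq> carrier G"
      proof
        fix x assume "x \<in> \<gamma>' ` carrier G"
        then obtain g where g: "g \<in> carrier G" "x = \<gamma>' g" by blast
        then obtain h where "h \<in> carrier G" "g = \<gamma> h" using \<gamma> by (auto simp: bij_betw_def)
        thus "x \<in> carrier G" using g inv(1) by simp
      qed
    qed (use inv bij_betw_imp_surj_on[OF \<gamma>] in auto)
    have \<gamma>g: "\<gamma> g \<in> carrier G" "\<gamma>' g \<in> carrier G" using t(2) bij_betwE[OF \<gamma>] bij_betwE[OF \<gamma>'] by auto
    define v where "v = map_frag \<gamma>' (strip (\<gamma> g) s)"
    have Nv: "?N v = map_frag \<gamma>' (?N (strip (\<gamma> g) s))"
      by (simp add: v_def map_frag_nab_ext[OF \<gamma>'])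
    have N: "nab G t = ?S (frag_of t) - con g (nab G s)"
      by (simp add: nab_def t(1) sum_subtractf)
    have "?Q (?S (frag_of t)) = (\<Sum>k\<in>carrier G. con k (map_frag \<gamma>' (strip_ext (\<gamma> k) (con g (frag_of s)))))
        - ?S (coprism \<gamma> \<gamma>' t)"
      by (simp add: frag_extend_sum' coprism_con t(1) sum_subtractf del: coprism.simps con_simps(2))
        (simp add: t(1) sum_subtractf)
    \<comment> \<open>\<open>strip_ext (\<gamma> k)\<close> keeps the summand only if
      \<open>\<gamma> k\<close> equals the leading entry \<open>g\<close>, that is for
      \<open>k = \<gamma>' g\<close>.\<close>
    also have "(\<Sum>k\<in>carrier G. con k (map_frag \<gamma>' (strip_ext (\<gamma> k) (con g (frag_of s)))))
        = (\<Sum>k\<in>carrier G. if k = \<gamma>' g then frag_of (map \<gamma>' t) else 0)"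
      using inv \<gamma>g t(2) by (intro sum.cong refl) (auto simp: strip_con t(1) simp del: con_simps(2), auto)
    also have "\<dots> = frag_of (map \<gamma>' t)" using fin \<gamma>g by simp
    finally have 1: "?Q (?S (frag_of t)) = frag_of (map \<gamma>' t) - ?S (coprism \<gamma> \<gamma>' t)" .
    have 2: "coprism \<gamma> \<gamma>' t = con g (v - coprism \<gamma> \<gamma>' s)"
      by (simp add: t(1) v_def)
    have "?N (coprism \<gamma> \<gamma>' t) + ?Q (nab G t) =
       frag_of (map \<gamma>' t) - con g (?N v) + con g (?N (coprism \<gamma> \<gamma>' s))
         - con g (map_frag \<gamma>' (strip_ext (\<gamma> g) (nab G s))) + con g (?Q (nab G s))"
      unfolding N frag_extend_diff 1 coprism_con by (simp add: 2 nab_con frag_extend_diff sum_subtractf)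
    also have "\<dots> = frag_of (map \<gamma>' t)
        + con g ((?N (coprism \<gamma> \<gamma>' s) + ?Q (nab G s)) - map_frag \<gamma>' (strip_ext (\<gamma> g) (nab G s) + ?N (strip (\<gamma> g) s)))"
      unfolding Nv by (simp add: map_frag_def frag_extend_add)
    also have "\<dots> = frag_of (map \<gamma>' t) - frag_of t"
      unfolding strip_nab[OF fin \<gamma>g(1)] Suc.IH[OF t(3)] by (simp add: t(1))
    finally show ?case .
  }
qed

lemma keys_map_frag:
  assumes "\<phi> ` carrier G \<subseteq> carrier G" "Poly_Mapping.keys c \<subseteq> tuples G k"
  shows "Poly_Mapping.keys (map_frag \<phi> c) \<subseteq> tuples G k"
  unfolding map_frag_def
  by (rule order_trans[OF keys_frag_extend]) (use assms in \<open>auto simp: keys_frag_of tuples_def subset_iff image_subset_iff\<close>)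

lemma keys_coprism:
  assumes "\<gamma>' ` carrier G \<subseteq> carrier G"
  shows "t \<in> tuples G (Suc k) \<Longrightarrow> Poly_Mapping.keys (coprism \<gamma> \<gamma>' t) \<subseteq> tuples G k"
proof (induction k arbitrary: t)
  case (Suc k)
  then obtain g s where t: "t = g # s" "g \<in> carrier G" "s \<in> tuples G (Suc k)" by (auto elim: tuples_SucE)
  show ?case unfolding t(1) coprism.simps
    using keys_con_tuples[OF t(2) Suc.IH[OF t(3)]]
      keys_con_tuples[OF t(2) keys_map_frag[OF assms keys_strip[OF t(3)]]]
    by (intro order_trans[OF keys_diff]) simp
qed (auto elim!: tuples_SucE)

lemma coprism_map:
  assumes "inj_on \<phi> (carrier G)" "\<gamma> ` carrier G \<subseteq> carrier G" "\<gamma>' ` carrier G \<subseteq> carrier G"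
    and "\<And>g. g \<in> carrier G \<Longrightarrow> \<gamma> (\<phi> g) = \<phi> (\<gamma> g)" "\<And>g. g \<in> carrier G \<Longrightarrow> \<gamma>' (\<phi> g) = \<phi> (\<gamma>' g)"
  shows "set t \<subseteq> carrier G \<Longrightarrow> coprism \<gamma> \<gamma>' (map \<phi> t) = map_frag \<phi> (coprism \<gamma> \<gamma>' t)"
proof (induction t)
  case (Cons g t)
  have "inj_on \<phi> (insert (\<gamma> g) (set t))"
    using assms(2) Cons.prems by (intro inj_on_subset[OF assms(1)]) auto
  from strip_map[OF this] have "strip (\<gamma> (\<phi> g)) (map \<phi> t) = map_frag \<phi> (strip (\<gamma> g) t)"
    using Cons.prems assms(4) by simp
  moreover have "map_frag \<gamma>' (map_frag \<phi> (strip (\<gamma> g) t)) = map_frag \<phi> (map_frag \<gamma>' (strip (\<gamma> g) t))"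
    using Cons.prems assms(5) by (cases t) (auto simp: frag_of_eq subset_iff)
  ultimately show ?case using Cons by (simp add: map_frag_con)
qed simp

lemma tuples_Suc_0: "t \<in> tuples G (Suc 0) \<longleftrightarrow> (\<exists>h\<in>carrier G. t = [h])"
  by (cases t) (auto simp: tuples_def)

section \<open>Null-homotopies, acyclicity, and cohomology in degree 0\<close>

context finite_module
begin

text \<open>Pulling a cochain back along an equivariant map \<open>V\<close> of chains gives a
  cochain, and its coboundary evaluates on \<open>V\<close> composed with the boundary. All
  primitives of cocycles below arise in this way.\<close>

lemma ev_cochain:
  assumes x: "x \<in> carrier (Ch n)"
    and V: "\<And>t. t \<in> T m \<Longrightarrow> Poly_Mapping.keys (V t) \<subseteq> T n"
    and eq: "\<And>g t. g \<in> carrier G \<Longrightarrow> t \<in> T m \<Longrightarrow> V (map ((\<otimes>\<^bsub>G\<^esub>) g) t) = map_frag ((\<otimes>\<^bsub>G\<^esub>) g) (V t)"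
  shows "(\<lambda>t\<in>T m. ev A x (V t)) \<in> carrier (Ch m)"
    and "t \<in> T (m + 1) \<Longrightarrow> db m (\<lambda>t\<in>T m. ev A x (V t)) t = ev A x (frag_extend V (bd G m t))"
proof -
  have x': "x \<in> T n \<rightarrow> carrier A" using x by (simp add: Ch_iff)
  show y: "(\<lambda>t\<in>T m. ev A x (V t)) \<in> carrier (Ch m)"
    unfolding Ch_iff using A.ev_closed[OF x' V] ev_translate[OF x _ V] tuples_translate by (auto simp: eq)
  assume t: "t \<in> T (m + 1)"
  note k = keys_bd[OF t]
  have "db m (\<lambda>t\<in>T m. ev A x (V t)) t = ev A (\<lambda>t. ev A x (V t)) (bd G m t)"
    unfolding db_eq_ev[OF y t] using k A.ev_closed[OF x' V] by (intro A.ev_cong) (auto simp: subset_iff)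
  also have "\<dots> = ev A x (frag_extend V (bd G m t))"
    using k V by (intro A.ev_frag_extend[OF x', symmetric]) blast
  finally show "db m (\<lambda>t\<in>T m. ev A x (V t)) t = ev A x (frag_extend V (bd G m t))" .
qed

lemma ev_db:
  assumes x: "x \<in> carrier (Ch n)" and c: "Poly_Mapping.keys c \<subseteq> T (n + 1)"
  shows "ev A x (frag_extend (bd G n) c) = ev A (db n x) c"
proof -
  have x': "x \<in> T n \<rightarrow> carrier A" using x by (simp add: Ch_iff)
  have "ev A x (frag_extend (bd G n) c) = ev A (\<lambda>t. ev A x (bd G n t)) c"
    using c keys_bd by (intro A.ev_frag_extend[OF x']) blast
  also have "\<dots> = ev A (db n x) c"
    using c Ch_closed[OF db_closed[OF x]] by (intro A.ev_cong) (auto simp: db_eq_ev[OF x] subset_iff)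
  finally show ?thesis .
qed

lemma ev_db_cocycle:
  assumes x: "x \<in> Z n" and c: "Poly_Mapping.keys c \<subseteq> T (n + 1)"
  shows "ev A x (frag_extend (bd G n) c) = \<one>\<^bsub>A\<^esub>"
proof -
  have "ev A x (frag_extend (bd G n) c) = ev A (\<one>\<^bsub>Ch (n + 1)\<^esub>) c"
    using x ev_db[OF _ c] by (simp add: Z_iff)
  also have "\<dots> = ev A (\<lambda>_. \<one>\<^bsub>A\<^esub>) c"
    using c by (intro A.ev_cong) (auto simp: one_Ch)
  finally show ?thesis by (simp add: ev_def)
qed

lemma cocycle_0_const:
  assumes "x \<in> Z 0" "g \<in> carrier G" "h \<in> carrier G"
  shows "x [g] = x [h]"
proof -
  have x: "x \<in> carrier (Ch 0)" using assms(1) by (simp add: Z_iff)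
  have x': "x \<in> T 0 \<rightarrow> carrier A" using x by (simp add: Ch_iff)
  have T: "[k] \<in> T 0" if "k \<in> carrier G" for k using that by (simp add: tate_len_simps)
  have "ev A x (frag_extend (bd G 0) (frag_of [h, g])) = \<one>\<^bsub>A\<^esub>"
    using assms by (intro ev_db_cocycle) (auto simp: keys_frag_of tate_len_def numeral_eq_Suc)
  hence "ev A x (frag_of [g] - frag_of [h]) = \<one>\<^bsub>A\<^esub>"
    by (simp add: bd_def)
  hence "x [g] \<otimes>\<^bsub>A\<^esub> inv\<^bsub>A\<^esub> x [h] = \<one>\<^bsub>A\<^esub>"
    using A.ev_diff[OF x', of "frag_of [g]" "frag_of [h]"] T[OF assms(2)] T[OF assms(3)] Ch_closed[OF x]
    by (simp add: keys_frag_of)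
  thus ?thesis
    using Ch_closed[OF x T] assms by (metis A.inv_closed A.inv_equality A.inv_inv)
qed

text \<open>Translating tuples by a central \<open>c\<close> is an equivariant chain map homotopic
  to the identity. On an equivariant cochain that translation is the same as applying
  \<open>act c\<close> to the values, so the homotopy exhibits the difference as a
  coboundary.\<close>

lemma act_minus_one_null:
  assumes c: "c \<in> carrier G" and comm: "\<And>g. g \<in> carrier G \<Longrightarrow> c \<otimes>\<^bsub>G\<^esub> g = g \<otimes>\<^bsub>G\<^esub> c"
    and x: "x \<in> Z n"
  shows "push G (\<lambda>u. act c u \<otimes>\<^bsub>A\<^esub> inv\<^bsub>A\<^esub> u) n x \<in> B n"
proof -
  have xc: "x \<in> carrier (Ch n)" using x by (simp add: Z_iff)
  have x': "x \<in> T n \<rightarrow> carrier A" using xc by (simp add: Ch_iff)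
  have comm': "c \<otimes>\<^bsub>G\<^esub> (g \<otimes>\<^bsub>G\<^esub> h) = g \<otimes>\<^bsub>G\<^esub> (c \<otimes>\<^bsub>G\<^esub> h)" if "g \<in> carrier G" "h \<in> carrier G" for g h
    using that c comm by (metis G.m_assoc)
  have push_x: "push G (\<lambda>u. act c u \<otimes>\<^bsub>A\<^esub> inv\<^bsub>A\<^esub> u) n x t = x (map ((\<otimes>\<^bsub>G\<^esub>) c) t) \<otimes>\<^bsub>A\<^esub> inv\<^bsub>A\<^esub> x t"
    if "t \<in> T n" for t
    using that xc c by (simp add: push_def Ch_iff)
  consider "n \<ge> 1" | "n = 0" | "n \<le> - 1" by linarith
  thus ?thesis
  proof cases
    case 1
    have len: "tate_len n = Suc (tate_len (n - 1))" using tate_len_simps(1)[of "n - 1"] 1 by simp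
    let ?P = "prism ((\<otimes>\<^bsub>G\<^esub>) c)"
    have kP: "Poly_Mapping.keys (?P t) \<subseteq> T n" if "t \<in> T (n - 1)" for t
      using keys_prism[of "(\<otimes>\<^bsub>G\<^esub>) c" G t "tate_len (n - 1)"] that c len by auto
    have kP1: "Poly_Mapping.keys (?P t) \<subseteq> T (n + 1)" if "t \<in> T n" for t
      using keys_prism[of "(\<otimes>\<^bsub>G\<^esub>) c" G t "tate_len n"] that c tate_len_simps(1)[of n] 1 by auto
    let ?y = "\<lambda>t\<in>T (n - 1). ev A x (?P t)"
    have P_map: "?P (map ((\<otimes>\<^bsub>G\<^esub>) g) t) = map_frag ((\<otimes>\<^bsub>G\<^esub>) g) (?P t)" if "g \<in> carrier G" "t \<in> T (n - 1)" for g t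
      using that comm' by (intro prism_map) (auto simp: tuples_def)
    have y: "?y \<in> carrier (Ch (n - 1))"
      using ev_cochain(1)[of x n "n - 1" ?P, OF xc kP P_map] by blast
    have dy: "db (n - 1) ?y t = ev A x (frag_extend ?P (bd G (n - 1) t))" if "t \<in> T n" for t
      using ev_cochain(2)[of x n "n - 1" ?P, OF xc kP P_map] that by simp
    have "push G (\<lambda>u. act c u \<otimes>\<^bsub>A\<^esub> inv\<^bsub>A\<^esub> u) n x = db (n - 1) ?y"
    proof
      fix t show "push G (\<lambda>u. act c u \<otimes>\<^bsub>A\<^esub> inv\<^bsub>A\<^esub> u) n x t = db (n - 1) ?y t"
      proof (cases "t \<in> T n")
        case True
        have ct: "map ((\<otimes>\<^bsub>G\<^esub>) c) t \<in> T n" using True c tuples_translate by blast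
        have bd: "bd G (n - 1) = face" "bd G n = face" using 1 by (auto simp: bd_def fun_eq_iff)
        have "frag_extend ?P (face t) = frag_of (map ((\<otimes>\<^bsub>G\<^esub>) c) t) - frag_of t - frag_extend face (?P t)"
          using prism_homotopy[of "(\<otimes>\<^bsub>G\<^esub>) c" t] by (simp add: algebra_simps)
        moreover have "Poly_Mapping.keys (frag_extend face (?P t)) \<subseteq> T n"
          using keys_bd[of _ G n] kP1[OF True] unfolding bd(2)
          by (intro order_trans[OF keys_frag_extend]) blast
        moreover have "ev A x (frag_extend face (?P t)) = \<one>\<^bsub>A\<^esub>"
          using ev_db_cocycle[OF x kP1[OF True]] by (simp add: bd)
        moreover have "Poly_Mapping.keys (frag_of (map ((\<otimes>\<^bsub>G\<^esub>) c) t) - frag_of t) \<subseteq> T n"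
          using ct True by (intro order_trans[OF keys_diff]) (auto simp: keys_frag_of)
        ultimately have "ev A x (frag_extend ?P (face t)) = x (map ((\<otimes>\<^bsub>G\<^esub>) c) t) \<otimes>\<^bsub>A\<^esub> inv\<^bsub>A\<^esub> x t"
          using ct True Ch_closed[OF xc] by (simp add: A.ev_diff[OF x'] keys_frag_of)
        thus ?thesis using dy[OF True] True push_x by (simp add: bd)
      qed (simp add: push_def tate_coboundary_def)
    qed
    thus ?thesis using y unfolding coboundaries_def by blast
  next
    case 2
    \<comment> \<open>A cocycle of degree 0 is constant on singletons, hence unchanged by
      translation, and the difference is the zero cochain itself.\<close>
    have "push G (\<lambda>u. act c u \<otimes>\<^bsub>A\<^esub> inv\<^bsub>A\<^esub> u) n x = \<one>\<^bsub>Ch n\<^esub>"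
    proof
      fix t show "push G (\<lambda>u. act c u \<otimes>\<^bsub>A\<^esub> inv\<^bsub>A\<^esub> u) n x t = \<one>\<^bsub>Ch n\<^esub> t"
      proof (cases "t \<in> T n")
        case True
        then obtain h where h: "t = [h]" "h \<in> carrier G" using 2 by (auto simp: tate_len_simps tuples_Suc_0)
        have "x [c \<otimes>\<^bsub>G\<^esub> h] = x [h]" using cocycle_0_const[of x "c \<otimes>\<^bsub>G\<^esub> h" h] x 2 c h by simp
        thus ?thesis using push_x[OF True] Ch_closed[OF xc True] True h by (simp add: one_Ch A.r_inv)
      qed (simp add: push_def one_Ch)
    qed
    thus ?thesis using subgroup.one_closed[OF subgroup_B] by simp
  next
    case 3
    have len: "tate_len (n - 1) = Suc (tate_len n)" using tate_len_simps(4)[of "n - 1"] 3 by simp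
    let ?c' = "inv\<^bsub>G\<^esub> c"
    \<comment> \<open>\<open>coprism_homotopy\<close> yields the map of its second argument; to get
      translation by \<open>c\<close> the first argument must be translation by the inverse.\<close>
    let ?Q = "coprism ((\<otimes>\<^bsub>G\<^esub>) ?c') ((\<otimes>\<^bsub>G\<^esub>) c)"
    have im: "(\<otimes>\<^bsub>G\<^esub>) c ` carrier G \<subseteq> carrier G" "(\<otimes>\<^bsub>G\<^esub>) ?c' ` carrier G \<subseteq> carrier G" using c by auto
    have kQ: "Poly_Mapping.keys (?Q t) \<subseteq> T n" if "t \<in> T (n - 1)" for t
      using keys_coprism[OF im(1)] that len by metis
    have kQ1: "Poly_Mapping.keys (frag_extend (nab G) (?Q t)) \<subseteq> T n \<and> ev A x (frag_extend (nab G) (?Q t)) = \<one>\<^bsub>A\<^esub>"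
      if t: "t \<in> T n" for t
    proof (cases "n = - 1")
      case True
      \<comment> \<open>At the splice the tuple has length one, and the coprism of a singleton is
        zero.\<close>
      then obtain h where "t = [h]" using t by (auto simp: tate_len_simps tuples_Suc_0)
      thus ?thesis by simp
    next
      case False
      hence n: "n \<le> - 2" using 3 by simp
      have k: "Poly_Mapping.keys (?Q t) \<subseteq> T (n + 1)"
        using keys_coprism[OF im(1), of t "tate_len (n + 1)"] t tate_len_simps(4)[OF n] by simp
      have bd: "bd G n = nab G" using n by (auto simp: bd_def fun_eq_iff)
      have "Poly_Mapping.keys (frag_extend (nab G) (?Q t)) \<subseteq> T n"
        using keys_bd[of _ G n] k unfolding bd by (intro order_trans[OF keys_frag_extend]) blast
      thus ?thesis using ev_db_cocycle[OF x k] by (simp add: bd)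
    qed
    have inj: "inj_on ((\<otimes>\<^bsub>G\<^esub>) g) (carrier G)" if "g \<in> carrier G" for g
      using that by (auto simp: inj_on_def)
    have comm'': "?c' \<otimes>\<^bsub>G\<^esub> (g \<otimes>\<^bsub>G\<^esub> h) = g \<otimes>\<^bsub>G\<^esub> (?c' \<otimes>\<^bsub>G\<^esub> h)" if "g \<in> carrier G" "h \<in> carrier G" for g h
      using that c comm'[of g "?c' \<otimes>\<^bsub>G\<^esub> h"] by (simp add: G.inv_solve_left' flip: G.m_assoc)
    have Q_map: "?Q (map ((\<otimes>\<^bsub>G\<^esub>) g) t) = map_frag ((\<otimes>\<^bsub>G\<^esub>) g) (?Q t)" if "g \<in> carrier G" "t \<in> T (n - 1)" for g t
      using that comm' comm'' im by (intro coprism_map[of _ G] inj) (auto simp: tuples_def)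
    let ?y = "\<lambda>t\<in>T (n - 1). ev A x (?Q t)"
    have y: "?y \<in> carrier (Ch (n - 1))"
      using ev_cochain(1)[of x n "n - 1" ?Q, OF xc kQ Q_map] by blast
    have dy: "db (n - 1) ?y t = ev A x (frag_extend ?Q (bd G (n - 1) t))" if "t \<in> T n" for t
      using ev_cochain(2)[of x n "n - 1" ?Q, OF xc kQ Q_map] that by simp
    have "push G (\<lambda>u. act c u \<otimes>\<^bsub>A\<^esub> inv\<^bsub>A\<^esub> u) n x = db (n - 1) ?y"
    proof
      fix t show "push G (\<lambda>u. act c u \<otimes>\<^bsub>A\<^esub> inv\<^bsub>A\<^esub> u) n x t = db (n - 1) ?y t"
      proof (cases "t \<in> T n")
        case True
        have ct: "map ((\<otimes>\<^bsub>G\<^esub>) c) t \<in> T n" using True c tuples_translate by blast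
        have bd: "bd G (n - 1) = nab G" using 3 by (auto simp: bd_def fun_eq_iff)
        have "bij_betw ((\<otimes>\<^bsub>G\<^esub>) ?c') (carrier G) (carrier G)"
          using c by (intro bij_betw_byWitness[where f' = "(\<otimes>\<^bsub>G\<^esub>) c"]) (auto simp flip: G.m_assoc)
        hence "frag_extend (nab G) (?Q t) + frag_extend ?Q (nab G t) = frag_of (map ((\<otimes>\<^bsub>G\<^esub>) c) t) - frag_of t"
          using True c by (intro coprism_homotopy finite_G) (auto simp flip: G.m_assoc)
        hence "frag_extend ?Q (nab G t) = frag_of (map ((\<otimes>\<^bsub>G\<^esub>) c) t) - frag_of t - frag_extend (nab G) (?Q t)"
          by (simp add: algebra_simps)
        moreover have "Poly_Mapping.keys (frag_of (map ((\<otimes>\<^bsub>G\<^esub>) c) t) - frag_of t) \<subseteq> T n"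
          using ct True by (intro order_trans[OF keys_diff]) (auto simp: keys_frag_of)
        ultimately have "ev A x (frag_extend ?Q (nab G t)) = x (map ((\<otimes>\<^bsub>G\<^esub>) c) t) \<otimes>\<^bsub>A\<^esub> inv\<^bsub>A\<^esub> x t"
          using ct True Ch_closed[OF xc] kQ1[OF True] by (simp add: A.ev_diff[OF x'] keys_frag_of)
        thus ?thesis using dy[OF True] True push_x by (simp add: bd)
      qed (simp add: push_def tate_coboundary_def)
    qed
    thus ?thesis using y unfolding coboundaries_def by blast
  qed
qed

lemma finprod_translate:
  assumes "k \<in> carrier G" "f \<in> carrier G \<rightarrow> carrier A"
  shows "(\<Otimes>\<^bsub>A\<^esub>g\<in>carrier G. f (k \<otimes>\<^bsub>G\<^esub> g)) = (\<Otimes>\<^bsub>A\<^esub>g\<in>carrier G. f g)"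
proof -
  have im: "(\<otimes>\<^bsub>G\<^esub>) k ` carrier G = carrier G"
    using assms(1) G.surj_const_mult by auto
  have "(\<Otimes>\<^bsub>A\<^esub>g\<in>(\<otimes>\<^bsub>G\<^esub>) k ` carrier G. f g) = (\<Otimes>\<^bsub>A\<^esub>g\<in>carrier G. f (k \<otimes>\<^bsub>G\<^esub> g))"
    using assms im by (intro A.finprod_reindex) (auto simp: inj_on_def)
  thus ?thesis by (simp add: im)
qed

text \<open>If the identity of \<open>A\<close> is the norm of an endomorphism \<open>\<rho>\<close>, averaging \<open>\<rho>\<close> composed with a
  contraction of the complete resolution over \<open>G\<close> gives an equivariant contraction.\<close>

lemma acyclic:
  assumes \<rho>: "\<rho> \<in> hom A A"
    and avg: "\<And>u. u \<in> carrier A \<Longrightarrow> (\<Otimes>\<^bsub>A\<^esub>g\<in>carrier G. act g (\<rho> (act (inv\<^bsub>G\<^esub> g) u))) = u"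
  shows "Z n \<subseteq> B n"
proof
  fix x assume x: "x \<in> Z n"
  have xc: "x \<in> carrier (Ch n)" using x by (simp add: Z_iff)
  have x': "x \<in> T n \<rightarrow> carrier A" using xc by (simp add: Ch_iff)
  define R where "R g u = act g (\<rho> (act (inv\<^bsub>G\<^esub> g) u))" for g u
  have R_hom: "R g \<in> hom A A" if "g \<in> carrier G" for g
    unfolding R_def using hom_compose[OF act_hom[of "inv\<^bsub>G\<^esub> g"] hom_compose[OF \<rho> act_hom[of g]]] that
    by (simp add: o_def)
  have R_closed: "R g u \<in> carrier A" if "g \<in> carrier G" "u \<in> carrier A" for g u
    using R_hom that by (auto simp: hom_def)
  have R_mult: "R (k \<otimes>\<^bsub>G\<^esub> g) (act k u) = act k (R g u)"
    if "k \<in> carrier G" "g \<in> carrier G" "u \<in> carrier A" for k g u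
  proof -
    have "act (inv\<^bsub>G\<^esub> (k \<otimes>\<^bsub>G\<^esub> g)) (act k u) = act (inv\<^bsub>G\<^esub> g) u"
      using that act_mult[of "inv\<^bsub>G\<^esub> (k \<otimes>\<^bsub>G\<^esub> g)" k u, symmetric] by (simp add: G.inv_mult_group G.m_assoc)
    thus ?thesis using that \<rho> by (simp add: R_def act_mult hom_in_carrier)
  qed
  \<comment> \<open>\<open>W g\<close> stands for a contraction with base point \<open>g\<close>. By
    \<open>W_map\<close> a translation moves the base point along, and \<open>R\<close> transforms
    in the same way; the product over \<open>g\<close> is therefore equivariant although no single
    \<open>W g\<close> is.\<close>
  have main: "x \<in> B n"
    if kW: "\<And>t g. t \<in> T (n - 1) \<Longrightarrow> g \<in> carrier G \<Longrightarrow> Poly_Mapping.keys (W g t) \<subseteq> T n"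
      and W_map: "\<And>t g k. t \<in> T (n - 1) \<Longrightarrow> g \<in> carrier G \<Longrightarrow> k \<in> carrier G \<Longrightarrow>
        W (k \<otimes>\<^bsub>G\<^esub> g) (map ((\<otimes>\<^bsub>G\<^esub>) k) t) = map_frag ((\<otimes>\<^bsub>G\<^esub>) k) (W g t)"
      and W: "\<And>t g. t \<in> T n \<Longrightarrow> g \<in> carrier G \<Longrightarrow> ev A x (frag_extend (W g) (bd G (n - 1) t)) = x t" for W
  proof -
    define y' where "y' t = (\<Otimes>\<^bsub>A\<^esub>g\<in>carrier G. R g (ev A x (W g t)))" for t
    have evW: "ev A x (W g t) \<in> carrier A" if "t \<in> T (n - 1)" "g \<in> carrier G" for g t
      using A.ev_closed[OF x' kW] that by blast
    have y'_closed: "y' t \<in> carrier A" if "t \<in> T (n - 1)" for t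
      unfolding y'_def using that R_closed evW by (intro A.finprod_closed) auto
    have "y' (map ((\<otimes>\<^bsub>G\<^esub>) k) t) = act k (y' t)" if k: "k \<in> carrier G" and t: "t \<in> T (n - 1)" for k t
    proof -
      have "y' (map ((\<otimes>\<^bsub>G\<^esub>) k) t) = (\<Otimes>\<^bsub>A\<^esub>g\<in>carrier G. R (k \<otimes>\<^bsub>G\<^esub> g) (ev A x (W (k \<otimes>\<^bsub>G\<^esub> g) (map ((\<otimes>\<^bsub>G\<^esub>) k) t))))"
        unfolding y'_def using k t R_closed evW tuples_translate by (intro finprod_translate[symmetric]) auto
      also have "\<dots> = (\<Otimes>\<^bsub>A\<^esub>g\<in>carrier G. act k (R g (ev A x (W g t))))"
        using k t R_closed evW by (intro A.finprod_cong') (auto simp: W_map ev_translate[OF xc k kW] R_mult)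
      also have "\<dots> = act k (y' t)"
        unfolding y'_def using k t R_closed evW
        by (intro A.finprod_hom[symmetric] A.comm_group_axioms act_hom) auto
      finally show ?thesis .
    qed
    hence y: "(\<lambda>t\<in>T (n - 1). y' t) \<in> carrier (Ch (n - 1))"
      using y'_closed tuples_translate by (auto simp: Ch_iff)
    have "db (n - 1) (\<lambda>t\<in>T (n - 1). y' t) = x"
    proof
      fix t show "db (n - 1) (\<lambda>t\<in>T (n - 1). y' t) t = x t"
      proof (cases "t \<in> T n")
        case True
        hence t: "t \<in> T (n - 1 + 1)" by simp
        note k = keys_bd[OF t]
        have fin_ev: "ev A y' c = (\<Otimes>\<^bsub>A\<^esub>g\<in>carrier G. R g (ev A x (frag_extend (W g) c)))"
          if "Poly_Mapping.keys c \<subseteq> T (n - 1)" for c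
        proof -
          let ?F = "\<lambda>c. \<Otimes>\<^bsub>A\<^esub>g\<in>carrier G. R g (ev A x (frag_extend (W g) c))"
          have kc: "Poly_Mapping.keys (frag_extend (W g) c) \<subseteq> T n"
            if "Poly_Mapping.keys c \<subseteq> T (n - 1)" "g \<in> carrier G" for c g
            using kW that by (intro order_trans[OF keys_frag_extend]) blast
          have evc: "R g (ev A x (frag_extend (W g) c)) \<in> carrier A"
            if "Poly_Mapping.keys c \<subseteq> T (n - 1)" "g \<in> carrier G" for c g
            using R_closed A.ev_closed[OF x' kc] that by blast
          have "?F \<in> hom (free_Abelian_group (T (n - 1))) A"
          proof (rule homI)
            fix c d assume cd: "c \<in> carrier (free_Abelian_group (T (n - 1)))" "d \<in> carrier (free_Abelian_group (T (n - 1)))"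
            have "R g (ev A x (frag_extend (W g) (c + d)))
               = R g (ev A x (frag_extend (W g) c)) \<otimes>\<^bsub>A\<^esub> R g (ev A x (frag_extend (W g) d))" if "g \<in> carrier G" for g
              using cd kc that A.ev_closed[OF x'] by (simp add: frag_extend_add A.ev_add[OF x'] hom_mult[OF R_hom])
            hence "?F (c + d) = (\<Otimes>\<^bsub>A\<^esub>g\<in>carrier G. R g (ev A x (frag_extend (W g) c)) \<otimes>\<^bsub>A\<^esub> R g (ev A x (frag_extend (W g) d)))"
              using evc cd by (intro A.finprod_cong') auto
            thus "?F (c \<otimes>\<^bsub>free_Abelian_group (T (n - 1))\<^esub> d) = ?F c \<otimes>\<^bsub>A\<^esub> ?F d"
              using evc cd by simp
          qed (use evc in \<open>auto intro!: A.finprod_closed\<close>)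
          from A.free_Abelian_hom_eq_ev[OF this that] show ?thesis
            by (simp add: y'_def[abs_def])
        qed
        have "db (n - 1) (\<lambda>t\<in>T (n - 1). y' t) t = ev A y' (bd G (n - 1) t)"
          unfolding db_eq_ev[OF y t] using k y'_closed by (intro A.ev_cong) (auto simp: subset_iff)
        also have "\<dots> = (\<Otimes>\<^bsub>A\<^esub>g\<in>carrier G. R g (ev A x (frag_extend (W g) (bd G (n - 1) t))))"
          by (rule fin_ev[OF k])
        also have "\<dots> = (\<Otimes>\<^bsub>A\<^esub>g\<in>carrier G. R g (x t))"
          using True W R_closed Ch_closed[OF xc] by (intro A.finprod_cong') auto
        also have "\<dots> = x t"
          using avg[OF Ch_closed[OF xc True]] by (simp add: R_def)
        finally show ?thesis .
      next
        case False
        thus ?thesis using xc by (simp add: tate_coboundary_def Ch_iff extensional_def)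
      qed
    qed
    thus ?thesis using y unfolding coboundaries_def by blast
  qed
  consider "n \<ge> 1" | "n = 0" | "n \<le> - 1" by linarith
  thus "x \<in> B n"
  proof cases
    case 1
    have len: "tate_len n = Suc (tate_len (n - 1))" using tate_len_simps(1)[of "n - 1"] 1 by simp
    have bd: "bd G (n - 1) = face" "bd G n = face" using 1 by (auto simp: bd_def fun_eq_iff)
    show ?thesis
    proof (rule main[of "\<lambda>g t. con g (frag_of t)"])
      fix t g assume t: "t \<in> T n" and g: "g \<in> carrier G"
      have k: "Poly_Mapping.keys (con g (frag_of t)) \<subseteq> T (n + 1)"
        using t g 1 by (simp add: keys_frag_of tate_len_simps)
      have "frag_extend (\<lambda>t. con g (frag_of t)) (face t) = frag_of t - frag_extend face (con g (frag_of t))"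
        by (simp add: con_def)
      moreover have "Poly_Mapping.keys (frag_extend face (con g (frag_of t))) \<subseteq> T n"
        using keys_bd[of _ G n] k unfolding bd(2) by (intro order_trans[OF keys_frag_extend]) blast
      ultimately show "ev A x (frag_extend (\<lambda>t. con g (frag_of t)) (bd G (n - 1) t)) = x t"
        using ev_db_cocycle[OF x k] t Ch_closed[OF xc] by (simp add: bd A.ev_diff[OF x'] keys_frag_of del: face.simps con_simps)
    qed (auto simp: len keys_frag_of)
  next
    case 2
    show ?thesis
    \<comment> \<open>At the splice the contraction sends \<open>[g]\<close> to itself and all other
      singletons to zero. The norm element, the sum of all singletons, goes to \<open>[g]\<close>,
      and a 0-cocycle takes the same value on every singleton.\<close>
    proof (rule main[of "\<lambda>g. con g \<circ> strip g"])
      fix t g assume t: "t \<in> T (n - 1)" and g: "g \<in> carrier G"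
      then obtain h where h: "t = [h]" "h \<in> carrier G" using 2 by (auto simp: tate_len_simps tuples_Suc_0)
      thus "Poly_Mapping.keys ((con g \<circ> strip g) t) \<subseteq> T n"
        using g 2 by (auto simp: keys_frag_of tate_len_simps)
      fix k assume "k \<in> carrier G"
      thus "(con (k \<otimes>\<^bsub>G\<^esub> g) \<circ> strip (k \<otimes>\<^bsub>G\<^esub> g)) (map ((\<otimes>\<^bsub>G\<^esub>) k) t) = map_frag ((\<otimes>\<^bsub>G\<^esub>) k) ((con g \<circ> strip g) t)"
        using g h by auto
    next
      fix t g assume t: "t \<in> T n" and g: "g \<in> carrier G"
      then obtain h where h: "t = [h]" "h \<in> carrier G" using 2 by (auto simp: tate_len_simps tuples_Suc_0)
      have "frag_extend (con g \<circ> strip g) (bd G (n - 1) t) = (\<Sum>k\<in>carrier G. if k = g then frag_of [k] else 0)"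
        unfolding bd_def nab_def using 2 by (simp add: frag_extend_sum') (intro sum.cong refl, auto)
      also have "\<dots> = frag_of [g]" using g finite_G by simp
      finally show "ev A x (frag_extend (con g \<circ> strip g) (bd G (n - 1) t)) = x t"
        using cocycle_0_const[of x g h] x 2 g h Ch_closed[OF xc, of "[g]"] by (simp add: tate_len_simps)
    qed
  next
    case 3
    have len: "tate_len (n - 1) = Suc (tate_len n)" using tate_len_simps(4)[of "n - 1"] 3 by simp
    have bd: "bd G (n - 1) = nab G" using 3 by (auto simp: bd_def fun_eq_iff)
    show ?thesis
    proof (rule main[of strip])
      fix t g assume t: "t \<in> T n" and g: "g \<in> carrier G"
      have nab1: "Poly_Mapping.keys (frag_extend (nab G) (strip g t)) \<subseteq> T n \<and> ev A x (frag_extend (nab G) (strip g t)) = \<one>\<^bsub>A\<^esub>"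
      proof (cases "n = - 1")
        case True
        then obtain h where h: "t = [h]" using t by (auto simp: tate_len_simps tuples_Suc_0)
        have g': "Poly_Mapping.keys (frag_of [g]) \<subseteq> T (n + 1)" using g True by (simp add: keys_frag_of tate_len_simps)
        have "ev A x (frag_extend (bd G n) (frag_of [g])) = \<one>\<^bsub>A\<^esub>"
          by (rule ev_db_cocycle[OF x g'])
        moreover have "Poly_Mapping.keys (bd G n [g]) \<subseteq> T n" using g' by (intro keys_bd) (simp add: keys_frag_of)
        ultimately show ?thesis using True h by (simp add: bd_def)
      next
        case False
        hence n: "n \<le> - 2" using 3 by simp
        have k: "Poly_Mapping.keys (strip g t) \<subseteq> T (n + 1)"
          using keys_strip[of t G "tate_len (n + 1)"] t tate_len_simps(4)[OF n] by simp
        have bd: "bd G n = nab G" using n by (auto simp: bd_def fun_eq_iff)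
        have "Poly_Mapping.keys (frag_extend (nab G) (strip g t)) \<subseteq> T n"
          using keys_bd[of _ G n] k unfolding bd by (intro order_trans[OF keys_frag_extend]) blast
        thus ?thesis using ev_db_cocycle[OF x k] by (simp add: bd)
      qed
      have "strip_ext g (nab G t) = frag_of t - frag_extend (nab G) (strip g t)"
        using strip_nab[OF finite_G g, of t] by (simp add: algebra_simps)
      thus "ev A x (strip_ext g (bd G (n - 1) t)) = x t"
        using nab1 t Ch_closed[OF xc] by (simp add: bd A.ev_diff[OF x'] keys_frag_of)
    next
      fix t g k assume t: "t \<in> T (n - 1)" and g: "g \<in> carrier G" and k: "k \<in> carrier G"
      have "inj_on ((\<otimes>\<^bsub>G\<^esub>) k) (insert g (set t))"
        using t g k by (auto simp: inj_on_def tuples_def subset_iff)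
      from strip_map[OF this] show "strip (k \<otimes>\<^bsub>G\<^esub> g) (map ((\<otimes>\<^bsub>G\<^esub>) k) t) = map_frag ((\<otimes>\<^bsub>G\<^esub>) k) (strip g t)" .
    qed (use keys_strip len in metis)
  qed
qed

lemma norm_coboundary:
  assumes norm: "\<And>u. u \<in> carrier A \<Longrightarrow> (\<Otimes>\<^bsub>A\<^esub>g\<in>carrier G. act g u) = \<one>\<^bsub>A\<^esub>"
    and y: "y \<in> carrier (Ch (- 1))"
  shows "db (- 1) y = \<one>\<^bsub>Ch 0\<^esub>"
proof -
  have 1: "[\<one>\<^bsub>G\<^esub>] \<in> T (- 1)" by (simp add: tate_len_simps)
  have eq: "y [g] = act g (y [\<one>\<^bsub>G\<^esub>])" if "g \<in> carrier G" for g
  proof -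
    have "y (map ((\<otimes>\<^bsub>G\<^esub>) g) [\<one>\<^bsub>G\<^esub>]) = act g (y [\<one>\<^bsub>G\<^esub>])" using y that 1 unfolding Ch_iff by blast
    thus ?thesis using that by simp
  qed
  have "(\<lambda>g. act g (y [\<one>\<^bsub>G\<^esub>])) \<in> carrier G \<rightarrow> carrier A"
    using Ch_closed[OF y 1] by simp
  hence "(\<Otimes>\<^bsub>A\<^esub>g\<in>carrier G. y [g]) = (\<Otimes>\<^bsub>A\<^esub>g\<in>carrier G. act g (y [\<one>\<^bsub>G\<^esub>]))"
    by (rule A.finprod_cong'[OF refl _ eq])
  hence "(\<Otimes>\<^bsub>A\<^esub>g\<in>carrier G. y [g]) = \<one>\<^bsub>A\<^esub>" using norm Ch_closed[OF y 1] by simp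
  thus ?thesis by (simp add: tate_coboundary_def one_Ch)
qed

lemma exponent_H:
  assumes k: "\<And>u. u \<in> carrier A \<Longrightarrow> u [^]\<^bsub>A\<^esub> (k :: nat) = \<one>\<^bsub>A\<^esub>" and x: "x \<in> carrier (H n)"
  shows "x [^]\<^bsub>H n\<^esub> k = \<one>\<^bsub>H n\<^esub>"
proof -
  obtain z where z: "z \<in> Z n" "x = cls n z" using x by (auto simp: carrier_H)
  have "z [^]\<^bsub>Ch n\<^esub> j = (\<lambda>t\<in>T n. z t [^]\<^bsub>A\<^esub> j)" for j :: nat
  proof (induction j)
    case (Suc j)
    thus ?case by (simp add: nat_pow_def mult_Ch) (auto intro!: restrict_ext)
  qed (simp add: nat_pow_def one_Ch)
  hence "z [^]\<^bsub>Ch n\<^esub> k = \<one>\<^bsub>Ch n\<^esub>"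
    using z(1) k by (auto simp: one_Ch Z_iff Ch_closed intro!: restrict_ext)
  moreover have "z [^]\<^bsub>Ch n\<lparr>carrier := Z n\<rparr>\<^esub> k = z [^]\<^bsub>Ch n\<^esub> k" by (simp add: nat_pow_def)
  ultimately have "z [^]\<^bsub>Ch n\<lparr>carrier := Z n\<rparr>\<^esub> k = \<one>\<^bsub>Ch n\<lparr>carrier := Z n\<rparr>\<^esub>" by simp
  moreover interpret c: group_hom "Ch n\<lparr>carrier := Z n\<rparr>" "H n" "cls n"
    using comm_group_Z comm_group_H by (intro group_homI cls_hom) (auto simp: comm_group_def)
  have "cls n (z [^]\<^bsub>Ch n\<lparr>carrier := Z n\<rparr>\<^esub> k) = cls n z [^]\<^bsub>H n\<^esub> k"
    by (rule c.hom_nat_pow) (simp add: z(1))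
  ultimately show ?thesis using c.hom_one z(2) by metis
qed

text \<open>Degree 0 is invariants modulo norms. With all norms trivial there are no coboundaries,
  and a cocycle is the constant function at an invariant element.\<close>

lemma card_H_0:
  assumes norm: "\<And>u. u \<in> carrier A \<Longrightarrow> (\<Otimes>\<^bsub>A\<^esub>g\<in>carrier G. act g u) = \<one>\<^bsub>A\<^esub>"
  shows "card (carrier (H 0)) = card {u \<in> carrier A. \<forall>g\<in>carrier G. act g u = u}"
proof -
  have B0: "x = \<one>\<^bsub>Ch 0\<^esub>" if x: "x \<in> B 0" for x
  proof -
    obtain y where y: "y \<in> carrier (Ch (- 1))" "x = db (- 1) y" using x by (auto simp: coboundaries_def)
    show ?thesis using norm_coboundary[OF norm y(1)] y(2) by simp
  qed
  interpret Ch: comm_group "Ch 0" by (rule comm_group_Ch)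
  have "inj_on (cls 0) (Z 0)"
  proof (rule inj_onI)
    fix x y assume xy: "x \<in> Z 0" "y \<in> Z 0" "cls 0 x = cls 0 y"
    hence "x \<otimes>\<^bsub>Ch 0\<^esub> inv\<^bsub>Ch 0\<^esub> y = \<one>\<^bsub>Ch 0\<^esub>" using B0 cls_eq_iff by blast
    thus "x = y" using xy(1,2) by (metis Ch.inv_closed Ch.inv_equality Ch.inv_inv Z_iff)
  qed
  hence "card (carrier (H 0)) = card (Z 0)" by (simp add: carrier_H card_image)
  also have "\<dots> = card {u \<in> carrier A. \<forall>g\<in>carrier G. act g u = u}"
  proof (rule bij_betw_same_card[of "\<lambda>x. x [\<one>\<^bsub>G\<^esub>]"], rule bij_betw_byWitness[where f' = "\<lambda>u. \<lambda>t\<in>T 0. u"])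
    have T0: "t \<in> T 0 \<longleftrightarrow> (\<exists>h\<in>carrier G. t = [h])" for t
      by (auto simp: tate_len_simps tuples_Suc_0)
    show "\<forall>x\<in>Z 0. (\<lambda>t\<in>T 0. x [\<one>\<^bsub>G\<^esub>]) = x"
      using cocycle_0_const by (auto simp: fun_eq_iff T0 Z_iff Ch_iff extensional_def)
    show "(\<lambda>x. x [\<one>\<^bsub>G\<^esub>]) ` Z 0 \<subseteq> {u \<in> carrier A. \<forall>g\<in>carrier G. act g u = u}"
    proof clarsimp
      fix x assume x: "x \<in> Z 0"
      hence xc: "x \<in> carrier (Ch 0)" by (simp add: Z_iff)
      have 1: "[\<one>\<^bsub>G\<^esub>] \<in> T 0" using T0 by blast
      have "act g (x [\<one>\<^bsub>G\<^esub>]) = x [\<one>\<^bsub>G\<^esub>]" if g: "g \<in> carrier G" for g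
      proof -
        have "x (map ((\<otimes>\<^bsub>G\<^esub>) g) [\<one>\<^bsub>G\<^esub>]) = act g (x [\<one>\<^bsub>G\<^esub>])"
          using xc g 1 unfolding Ch_iff by blast
        thus ?thesis using g cocycle_0_const[OF x g G.one_closed] by simp
      qed
      thus "x [\<one>\<^bsub>G\<^esub>] \<in> carrier A \<and> (\<forall>g\<in>carrier G. act g (x [\<one>\<^bsub>G\<^esub>]) = x [\<one>\<^bsub>G\<^esub>])"
        using Ch_closed[OF xc 1] by blast
    qed
    show "(\<lambda>u. \<lambda>t\<in>T 0. u) ` {u \<in> carrier A. \<forall>g\<in>carrier G. act g u = u} \<subseteq> Z 0"
    proof clarsimp
      fix u assume u: "u \<in> carrier A" "\<forall>g\<in>carrier G. act g u = u"
      let ?x = "\<lambda>t\<in>T 0. u"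
      have x: "?x \<in> carrier (Ch 0)" using u tuples_translate by (auto simp: Ch_iff)
      have x': "?x \<in> T 0 \<rightarrow> carrier A" using x by (simp add: Ch_iff)
      have "db 0 ?x = \<one>\<^bsub>Ch (0 + 1)\<^esub>"
      proof
        fix t show "db 0 ?x t = \<one>\<^bsub>Ch (0 + 1)\<^esub> t"
        proof (cases "t \<in> T (0 + 1)")
          case True
          then obtain g h where "t = [g, h]" "g \<in> carrier G" "h \<in> carrier G"
            by (auto simp: tate_len_def numeral_eq_Suc elim!: tuples_SucE)
          thus ?thesis
            using True u(1) unfolding db_eq_ev[OF x True]
            by (simp add: bd_def A.ev_diff[OF x'] keys_frag_of one_Ch A.r_inv T0)
        qed (simp add: tate_coboundary_def one_Ch)
      qed
      thus "?x \<in> Z 0" using x by (simp add: Z_iff)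
    qed
  qed (auto simp: tate_len_simps)
  finally show ?thesis .
qed

end

section \<open>The tensor product of periodic resolutions\<close>

text \<open>\<open>\<gamma> k\<close> generates the \<open>k\<close>-th cyclic factor of \<open>G\<close>, of order \<open>q k\<close>, and \<open>lg k h\<close> is the
  exponent of \<open>\<gamma> k\<close> in \<open>h\<close>.\<close>

locale coords = comm_group G for G :: "('a, 'b) monoid_scheme" (structure) +
  fixes K :: "nat set" and \<gamma> :: "nat \<Rightarrow> 'a" and q :: "nat \<Rightarrow> nat" and lg :: "nat \<Rightarrow> 'a \<Rightarrow> nat" and p :: nat
  assumes fin_G: "finite (carrier G)" and fin_K: "finite K" and p: "prime p"
    and \<gamma>_closed: "k \<in> K \<Longrightarrow> \<gamma> k \<in> carrier G"
    and lg_less: "\<lbrakk>k \<in> K; h \<in> carrier G\<rbrakk> \<Longrightarrow> lg k h < q k"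
    and \<gamma>_pow: "k \<in> K \<Longrightarrow> \<gamma> k [^] q k = \<one>"
    and lg_same: "\<lbrakk>k \<in> K; h \<in> carrier G\<rbrakk> \<Longrightarrow> lg k (h \<otimes> \<gamma> k) = Suc (lg k h) mod q k"
    and lg_other: "\<lbrakk>j \<in> K; k \<in> K; j \<noteq> k; h \<in> carrier G\<rbrakk> \<Longrightarrow> lg j (h \<otimes> \<gamma> k) = lg j h"
    and lg_inj: "\<lbrakk>h \<in> carrier G; h' \<in> carrier G; \<And>k. k \<in> K \<Longrightarrow> lg k h = lg k h'\<rbrakk> \<Longrightarrow> h = h'"
    and p_dvd_q: "k \<in> K \<Longrightarrow> p dvd q k" and p_dvd_order: "p dvd order G"
begin

abbreviation gp :: "nat \<Rightarrow> nat \<Rightarrow> 'a" where "gp k i \<equiv> \<gamma> k [^] i"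
abbreviation gm :: "nat \<Rightarrow> nat \<Rightarrow> 'a" where "gm k i \<equiv> inv (\<gamma> k [^] i)"

text \<open>The differentials \<open>\<gamma> k - 1\<close> and norm of the periodic resolution for the \<open>k\<close>-th factor,
  alternating with the parity of the position \<open>j\<close>, and a contracting homotopy \<open>Rop\<close>, which is not
  equivariant.\<close>

definition Dop :: "nat \<Rightarrow> nat \<Rightarrow> ('a \<Rightarrow> int) \<Rightarrow> 'a \<Rightarrow> int"
  where "Dop k j \<phi> h = (if odd j then \<phi> (h \<otimes> \<gamma> k) - \<phi> h else \<Sum>i<q k. \<phi> (h \<otimes> gp k i))"

definition Rop :: "nat \<Rightarrow> nat \<Rightarrow> ('a \<Rightarrow> int) \<Rightarrow> 'a \<Rightarrow> int"
  where "Rop k j \<phi> h = (if odd j then \<Sum>i<lg k h. \<phi> (h \<otimes> gm k (Suc i))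
     else if Suc (lg k h) = q k then \<phi> (h \<otimes> \<gamma> k) else 0)"

lemma gp_closed [simp]: "k \<in> K \<Longrightarrow> gp k i \<in> carrier G"
  by (simp add: \<gamma>_closed)

lemma lg_pow: "k \<in> K \<Longrightarrow> h \<in> carrier G \<Longrightarrow> lg k (h \<otimes> gp k i) = (lg k h + i) mod q k"
proof (induction i)
  case (Suc i)
  have "lg k (h \<otimes> gp k (Suc i)) = lg k ((h \<otimes> gp k i) \<otimes> \<gamma> k)"
    using Suc.prems by (simp add: m_assoc \<gamma>_closed)
  also have "\<dots> = (lg k h + Suc i) mod q k"
    using Suc by (subst lg_same) (simp_all add: mod_Suc_eq)
  finally show ?case .
qed (simp add: lg_less)

lemma lg_other_pow: "j \<in> K \<Longrightarrow> k \<in> K \<Longrightarrow> j \<noteq> k \<Longrightarrow> h \<in> carrier G \<Longrightarrow> lg j (h \<otimes> gp k i) = lg j h"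
proof (induction i)
  case (Suc i)
  have "lg j (h \<otimes> gp k (Suc i)) = lg j ((h \<otimes> gp k i) \<otimes> \<gamma> k)"
    using Suc.prems by (simp add: m_assoc \<gamma>_closed)
  thus ?case using Suc by (subst (asm) lg_other) simp_all
qed simp

lemma q_pos: "k \<in> K \<Longrightarrow> q k > 0"
  using lg_less[of k \<one>] by simp

lemma gp_eq_gm: "k \<in> K \<Longrightarrow> i \<le> q k \<Longrightarrow> gp k i = gm k (q k - i)"
  using nat_pow_mult[of "\<gamma> k" i "q k - i"] \<gamma>_pow[of k] \<gamma>_closed[of k]
  by (intro inv_equality[symmetric]) simp_all

lemma gp_gm: "k \<in> K \<Longrightarrow> h \<in> carrier G \<Longrightarrow> h \<otimes> \<gamma> k \<otimes> gm k (Suc i) = h \<otimes> gm k i"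
  using \<gamma>_closed[of k] by (simp add: inv_mult_group m_assoc) (simp add: m_assoc[symmetric])

text \<open>For odd \<open>j\<close>, \<open>Rop\<close> sums over the exponents below that of
  \<open>h\<close>, a discrete antiderivative for the difference \<open>Dop\<close>. It fails only
  where the exponent wraps around, at \<open>q k - 1\<close>; the defect there is the full norm,
  which the even \<open>Rop\<close> supplies at exactly that exponent.\<close>

lemma DS_EN:
  assumes k: "k \<in> K" and h: "h \<in> carrier G" and j: "odd j"
  shows "Dop k j (Rop k j \<phi>) h + Rop k (Suc j) (Dop k (Suc j) \<phi>) h = \<phi> h"
proof (cases "Suc (lg k h) = q k")
  case True
  hence l: "lg k (h \<otimes> \<gamma> k) = 0" using k h by (simp add: lg_same)
  have "(\<Sum>i<q k. \<phi> (h \<otimes> \<gamma> k \<otimes> gp k i)) = (\<Sum>i<q k. \<phi> (h \<otimes> gp k (Suc i)))"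
    using k h \<gamma>_closed[of k] by (intro sum.cong refl arg_cong[where f = \<phi>]) (simp add: m_ac)
  also have "\<dots> = (\<Sum>i<Suc (lg k h). \<phi> (h \<otimes> gp k (Suc i)))" by (simp only: True)
  also have "\<dots> = (\<Sum>i<lg k h. \<phi> (h \<otimes> gp k (Suc i))) + \<phi> (h \<otimes> gp k (Suc (lg k h)))"
    by (rule sum.lessThan_Suc)
  also have "h \<otimes> gp k (Suc (lg k h)) = h" using \<gamma>_pow[OF k] h by (simp only: True r_one)
  also have "(\<Sum>i<lg k h. \<phi> (h \<otimes> gp k (Suc i))) = (\<Sum>i<lg k h. \<phi> (h \<otimes> gm k (Suc i)))"
  proof (rule sum.reindex_bij_witness[of _ "\<lambda>i. lg k h - Suc i" "\<lambda>i. lg k h - Suc i"])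
    fix i assume "i \<in> {..<lg k h}"
    thus "\<phi> (h \<otimes> gm k (Suc (lg k h - Suc i))) = \<phi> (h \<otimes> gp k (Suc i))"
      using gp_eq_gm[OF k, of "Suc i"] True[symmetric] by (simp add: Suc_diff_Suc del: nat_pow_Suc)
  qed auto
  finally show ?thesis using j l True by (simp add: Dop_def Rop_def)
next
  case False
  hence "Suc (lg k h) < q k" using lg_less[OF k h] by simp
  hence l: "lg k (h \<otimes> \<gamma> k) = Suc (lg k h)" using k h by (simp add: lg_same)
  have "(\<Sum>i<Suc (lg k h). \<phi> (h \<otimes> \<gamma> k \<otimes> gm k (Suc i))) = \<phi> h + (\<Sum>i<lg k h. \<phi> (h \<otimes> gm k (Suc i)))"
    unfolding gp_gm[OF k h] sum.lessThan_Suc_shift using h by simp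
  thus ?thesis using j l False by (simp add: Dop_def Rop_def)
qed

text \<open>Both formulas involve the value at exponent zero, at the point
  \<open>h \<otimes> gm k (lg k h)\<close>: one as the norm of a function concentrated at the top
  exponent, the other from a telescoping sum. They are kept apart because only the second term is
  present in position 0.\<close>

lemma NE_SD':
  assumes k: "k \<in> K" and h: "h \<in> carrier G" and j: "even j"
  shows "Dop k j (Rop k j \<phi>) h = \<phi> (h \<otimes> gm k (lg k h))"
    and "Rop k (Suc j) (Dop k (Suc j) \<phi>) h = \<phi> h - \<phi> (h \<otimes> gm k (lg k h))"
proof -
  let ?i = "q k - Suc (lg k h)"
  have l: "lg k h < q k" by (rule lg_less[OF k h])
  have iff: "Suc (lg k (h \<otimes> gp k i)) = q k \<longleftrightarrow> i = ?i" if i: "i < q k" for i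
  proof (cases "lg k h + i < q k")
    case True
    thus ?thesis using l i k h by (auto simp: lg_pow)
  next
    case False
    hence "(lg k h + i) mod q k = lg k h + i - q k"
      using l i by (subst le_mod_geq) auto
    thus ?thesis using False l i k h by (auto simp: lg_pow)
  qed
  have "Dop k j (Rop k j \<phi>) h = (\<Sum>i<q k. if i = ?i then \<phi> (h \<otimes> gp k ?i \<otimes> \<gamma> k) else 0)"
    using j iff by (auto simp: Dop_def Rop_def intro!: sum.cong)
  also have "\<dots> = \<phi> (h \<otimes> gp k (Suc ?i))"
    using l k h \<gamma>_closed[OF k] by (simp add: m_assoc)
  also have "Suc ?i = q k - lg k h" using l by simp
  also have "gp k (q k - lg k h) = gm k (lg k h)"
    using gp_eq_gm[OF k, of "q k - lg k h"] l by simp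
  finally show "Dop k j (Rop k j \<phi>) h = \<phi> (h \<otimes> gm k (lg k h))" .
  have "Rop k (Suc j) (Dop k (Suc j) \<phi>) h = (\<Sum>i<lg k h. \<phi> (h \<otimes> gm k i) - \<phi> (h \<otimes> gm k (Suc i)))"
  proof -
    have "h \<otimes> gm k (Suc i) \<otimes> \<gamma> k = h \<otimes> gm k i" for i
    proof -
      have "h \<otimes> gm k (Suc i) \<otimes> \<gamma> k = h \<otimes> \<gamma> k \<otimes> gm k (Suc i)"
        using h k \<gamma>_closed[OF k] by (simp add: m_ac del: nat_pow_Suc)
      thus ?thesis using gp_gm[OF k h] by (simp only:)
    qed
    thus ?thesis using j by (simp add: Dop_def Rop_def)
  qed
  also have "\<dots> = \<phi> h - \<phi> (h \<otimes> gm k (lg k h))"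
    using sum_lessThan_telescope'[of "\<lambda>i. \<phi> (h \<otimes> gm k i)" "lg k h"] h by simp
  finally show "Rop k (Suc j) (Dop k (Suc j) \<phi>) h = \<phi> h - \<phi> (h \<otimes> gm k (lg k h))" .
qed

lemma Dop_Rop:
  assumes "k \<in> K" "h \<in> carrier G"
  shows "Dop k j (Rop k j \<phi>) h + Rop k (Suc j) (Dop k (Suc j) \<phi>) h = \<phi> h"
  using DS_EN[OF assms] NE_SD'[OF assms] by (cases "odd j") auto

lemma parity: "Dop k (Suc (Suc j)) = Dop k j" "Rop k (Suc (Suc j)) = Rop k j"
  by (auto simp: Dop_def Rop_def fun_eq_iff)

lemma Dop_Dop:
  assumes "k \<in> K" "h \<in> carrier G"
  shows "Dop k j (Dop k (Suc j) \<phi>) h = 0" "Dop k (Suc j) (Dop k j \<phi>) h = 0"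
proof -
  have s: "(\<Sum>i<q k. \<phi> (h \<otimes> gp k (Suc i))) = (\<Sum>i<q k. \<phi> (h \<otimes> gp k i))"
  proof -
    obtain r where r: "q k = Suc r" using q_pos[OF assms(1)] by (cases "q k") auto
    have "(\<Sum>i<Suc r. \<phi> (h \<otimes> gp k (Suc i))) = (\<Sum>i<r. \<phi> (h \<otimes> gp k (Suc i))) + \<phi> (h \<otimes> gp k 0)"
      using \<gamma>_pow[OF assms(1)] assms(2) r by simp
    also have "\<dots> = (\<Sum>i<Suc r. \<phi> (h \<otimes> gp k i))"
      unfolding sum.lessThan_Suc_shift by simp
    finally show ?thesis by (simp add: r)
  qed
  have a: "h \<otimes> \<gamma> k \<otimes> gp k i = h \<otimes> gp k (Suc i)" "h \<otimes> gp k i \<otimes> \<gamma> k = h \<otimes> gp k (Suc i)" for i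
    using assms \<gamma>_closed[of k] by (simp_all add: m_ac)
  show "Dop k j (Dop k (Suc j) \<phi>) h = 0" "Dop k (Suc j) (Dop k j \<phi>) h = 0"
    using s a by (auto simp: Dop_def sum_subtractf simp del: nat_pow_Suc)
qed

lemma Dop_Dop_comm:
  assumes "j \<in> K" "k \<in> K" "h \<in> carrier G"
  shows "Dop k a (Dop j b \<phi>) h = Dop j b (Dop k a \<phi>) h"
proof -
  have c: "h \<otimes> x \<otimes> y = h \<otimes> y \<otimes> x" if "x \<in> carrier G" "y \<in> carrier G" for x y
    using that assms by (simp add: m_ac)
  have "(\<Sum>i<q k. \<Sum>i'<q j. \<phi> (h \<otimes> gp k i \<otimes> gp j i')) = (\<Sum>i<q j. \<Sum>i'<q k. \<phi> (h \<otimes> gp j i \<otimes> gp k i'))"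
    using assms by (subst sum.swap) (simp add: c)
  moreover have "h \<otimes> \<gamma> k \<otimes> gp j i = h \<otimes> gp j i \<otimes> \<gamma> k" "h \<otimes> gp k i \<otimes> \<gamma> j = h \<otimes> \<gamma> j \<otimes> gp k i"
    "h \<otimes> \<gamma> k \<otimes> \<gamma> j = h \<otimes> \<gamma> j \<otimes> \<gamma> k" for i
    using assms \<gamma>_closed by (auto intro!: c)
  ultimately show ?thesis by (auto simp: Dop_def sum_subtractf)
qed

lemma Dop_Rop_comm:
  assumes "j \<in> K" "k \<in> K" "j \<noteq> k" "h \<in> carrier G"
  shows "Dop k a (Rop j b \<phi>) h = Rop j b (Dop k a \<phi>) h"
proof -
  have c: "h \<otimes> x \<otimes> y = h \<otimes> y \<otimes> x" if "x \<in> carrier G" "y \<in> carrier G" for x y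
    using that assms by (simp add: m_ac)
  have "(\<Sum>i<q k. \<Sum>i'<lg j h. \<phi> (h \<otimes> gp k i \<otimes> gm j (Suc i'))) = (\<Sum>i<lg j h. \<Sum>i'<q k. \<phi> (h \<otimes> gm j (Suc i) \<otimes> gp k i'))"
    using assms by (subst sum.swap) (simp add: c \<gamma>_closed)
  moreover have "h \<otimes> \<gamma> k \<otimes> gm j (Suc i) = h \<otimes> gm j (Suc i) \<otimes> \<gamma> k" "h \<otimes> gp k i \<otimes> \<gamma> j = h \<otimes> \<gamma> j \<otimes> gp k i"
    "h \<otimes> \<gamma> k \<otimes> \<gamma> j = h \<otimes> \<gamma> j \<otimes> \<gamma> k" for i
    using assms \<gamma>_closed by (auto intro!: c simp del: nat_pow_Suc)
  ultimately show ?thesis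
    using assms by (auto simp: Dop_def Rop_def sum_subtractf lg_other lg_other_pow simp del: nat_pow_Suc)
qed

text \<open>Each value is a finite integral combination of values of \<open>\<phi>\<close> on
  \<open>G\<close>; the natural number in the index separates summands with equal coefficient and
  group element. Additivity, dependence on \<open>carrier G\<close> only, and preservation of
  divisibility follow at once for \<open>Dop\<close> and \<open>Rop\<close>.\<close>

definition linear_op :: "(nat \<Rightarrow> nat \<Rightarrow> ('a \<Rightarrow> int) \<Rightarrow> 'a \<Rightarrow> int) \<Rightarrow> bool"
  where "linear_op X \<longleftrightarrow> (\<forall>k\<in>K. \<forall>j. \<forall>h\<in>carrier G. \<exists>L :: ((int \<times> nat) \<times> 'a) set. finite L \<and> snd ` L \<subseteq> carrier G \<and>
     (\<forall>\<phi>. X k j \<phi> h = (\<Sum>l\<in>L. fst (fst l) * \<phi> (snd l))))"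

lemma linear_opD:
  assumes "linear_op X" "k \<in> K" "h \<in> carrier G"
  obtains L :: "((int \<times> nat) \<times> 'a) set" where "finite L" "snd ` L \<subseteq> carrier G"
    "\<And>\<phi>. X k j \<phi> h = (\<Sum>l\<in>L. fst (fst l) * \<phi> (snd l))"
  using assms unfolding linear_op_def by metis

lemma linear_Dop: "linear_op Dop"
  unfolding linear_op_def
proof (intro ballI allI)
  fix k j h assume kh: "k \<in> K" "h \<in> carrier G"
  have inj: "inj_on (\<lambda>i. ((1 :: int, i), h \<otimes> gp k i)) {..<q k}" by (auto simp: inj_on_def)
  show "\<exists>L :: ((int \<times> nat) \<times> 'a) set. finite L \<and> snd ` L \<subseteq> carrier G \<and> (\<forall>\<phi>. Dop k j \<phi> h = (\<Sum>l\<in>L. fst (fst l) * \<phi> (snd l)))"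
    using kh \<gamma>_closed[of k]
    by (cases "odd j")
      (intro exI[of _ "{((1, 0), h \<otimes> \<gamma> k), ((- 1, 0), h)}"], simp add: Dop_def,
       intro exI[of _ "(\<lambda>i. ((1, i), h \<otimes> gp k i)) ` {..<q k}"], auto simp: Dop_def sum.reindex[OF inj])
qed

lemma linear_Rop: "linear_op Rop"
  unfolding linear_op_def
proof (intro ballI allI)
  fix k j h assume kh: "k \<in> K" "h \<in> carrier G"
  define f where "f i = ((1 :: int, i), h \<otimes> gm k (Suc i))" for i
  have inj: "inj_on f {..<lg k h}" by (auto simp: inj_on_def f_def)
  have im: "snd ` f ` {..<lg k h} \<subseteq> carrier G" using kh by (auto simp: f_def \<gamma>_closed)
  show "\<exists>L :: ((int \<times> nat) \<times> 'a) set. finite L \<and> snd ` L \<subseteq> carrier G \<and> (\<forall>\<phi>. Rop k j \<phi> h = (\<Sum>l\<in>L. fst (fst l) * \<phi> (snd l)))"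
  proof (cases "odd j")
    case True
    have "(\<Sum>l\<in>f ` {..<lg k h}. fst (fst l) * \<phi> (snd l)) = Rop k j \<phi> h" for \<phi>
      using True by (subst sum.reindex[OF inj]) (simp add: f_def Rop_def)
    thus ?thesis using im by (intro exI[of _ "f ` {..<lg k h}"]) auto
  next
    case False
    thus ?thesis using kh \<gamma>_closed[of k]
      by (intro exI[of _ "{((if Suc (lg k h) = q k then 1 else 0, 0), h \<otimes> \<gamma> k)}"]) (auto simp: Rop_def)
  qed
qed

lemma linear_op_sum:
  assumes "linear_op X" "k \<in> K" "h \<in> carrier G"
  shows "X k j (\<lambda>h. \<Sum>i\<in>I. c i * \<phi> i h) h = (\<Sum>i\<in>I. c i * X k j (\<phi> i) h)"
proof -
  obtain L :: "((int \<times> nat) \<times> 'a) set" where L: "\<And>\<phi>. X k j \<phi> h = (\<Sum>l\<in>L. fst (fst l) * \<phi> (snd l))"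
    using linear_opD[OF assms] by metis
  show ?thesis
    unfolding L sum_distrib_left by (subst sum.swap) (simp add: algebra_simps)
qed

lemma linear_op_cmul:
  assumes "linear_op X" "k \<in> K" "h \<in> carrier G"
  shows "X k j (\<lambda>h. c * \<phi> h) h = c * X k j \<phi> h"
  using linear_op_sum[OF assms, where I = "{()}" and c = "\<lambda>_. c" and \<phi> = "\<lambda>_. \<phi>"] by simp

lemma linear_op_cong:
  assumes "linear_op X" "k \<in> K" "h \<in> carrier G" "\<And>x. x \<in> carrier G \<Longrightarrow> \<phi> x = \<psi> x"
  shows "X k j \<phi> h = X k j \<psi> h"
proof -
  obtain L :: "((int \<times> nat) \<times> 'a) set" where L: "snd ` L \<subseteq> carrier G" "\<And>\<phi>. X k j \<phi> h = (\<Sum>l\<in>L. fst (fst l) * \<phi> (snd l))"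
    using linear_opD[OF assms(1-3)] by metis
  show ?thesis unfolding L(2) using L(1) assms(4) by (intro sum.cong) auto
qed

lemma linear_op_dvd:
  assumes "linear_op X" "k \<in> K" "h \<in> carrier G" "\<And>x. x \<in> carrier G \<Longrightarrow> (r :: int) dvd \<phi> x"
  shows "r dvd X k j \<phi> h"
proof -
  obtain L :: "((int \<times> nat) \<times> 'a) set" where L: "snd ` L \<subseteq> carrier G" "\<And>\<phi>. X k j \<phi> h = (\<Sum>l\<in>L. fst (fst l) * \<phi> (snd l))"
    using linear_opD[OF assms(1-3)] by metis
  show ?thesis unfolding L(2) using L(1) assms(4) by (intro dvd_sum dvd_mult) auto
qed

lemma linear_op_zero: "linear_op X \<Longrightarrow> k \<in> K \<Longrightarrow> h \<in> carrier G \<Longrightarrow> X k j (\<lambda>_. 0) h = 0"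
  using linear_op_cmul[of X k h j 0 "\<lambda>_. 0"] by simp

definition sg :: "nat \<Rightarrow> (nat \<Rightarrow> nat) \<Rightarrow> int"
  where "sg k a = (- 1) ^ (\<Sum>j\<in>{j\<in>K. j < k}. a j)"

lemma sg_upd:
  assumes "j \<in> K"
  shows "sg k (a(j := Suc (a j))) = (if j < k then - sg k a else sg k a)"
    and "a j > 0 \<Longrightarrow> sg k (a(j := a j - Suc 0)) = (if j < k then - sg k a else sg k a)"
proof -
  have *: "sg k (b(j := Suc (b j))) = (if j < k then - sg k b else sg k b)" for b
  proof (cases "j < k")
    case True
    have "(\<Sum>i\<in>{i\<in>K. i < k}. (b(j := Suc (b j))) i) = (\<Sum>i\<in>{i\<in>K. i < k}. b i + (if i = j then 1 else 0))"
      by (intro sum.cong) auto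
    also have "\<dots> = (\<Sum>i\<in>{i\<in>K. i < k}. b i) + 1"
      using True assms fin_K by (simp add: sum.distrib)
    finally show ?thesis using True by (simp add: sg_def)
  next
    case False
    have "(\<Sum>i\<in>{i\<in>K. i < k}. (b(j := Suc (b j))) i) = (\<Sum>i\<in>{i\<in>K. i < k}. b i)"
      using False by (intro sum.cong) auto
    thus ?thesis using False by (simp add: sg_def)
  qed
  show "sg k (a(j := Suc (a j))) = (if j < k then - sg k a else sg k a)" by (rule *)
  assume "a j > 0"
  thus "sg k (a(j := a j - Suc 0)) = (if j < k then - sg k a else sg k a)"
    using *[of "a(j := a j - Suc 0)"] by (simp split: if_splits)
qed

lemma sg_sq [simp]: "sg k a * (sg k a * x) = x" "sg k a * sg k a = 1"
  by (simp_all add: sg_def flip: mult.assoc power_mult_distrib)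

text \<open>\<open>sg\<close> is the Koszul sign of the tensor product over \<open>K\<close>; \<open>a\<close> is the multi-index of positions in
  the factors.  In negative degrees the transposed complex is used, hence the two variants
  \<open>lower\<close> and \<open>raise\<close>.\<close>

definition lower :: "(nat \<Rightarrow> nat \<Rightarrow> ('a \<Rightarrow> int) \<Rightarrow> 'a \<Rightarrow> int) \<Rightarrow> nat \<Rightarrow> ((nat \<Rightarrow> nat) \<Rightarrow> 'a \<Rightarrow> int) \<Rightarrow> (nat \<Rightarrow> nat) \<Rightarrow> 'a \<Rightarrow> int"
  where "lower X k f a h = (if a k = 0 then 0 else sg k a * X k (a k) (f (a(k := a k - 1))) h)"

definition raise :: "(nat \<Rightarrow> nat \<Rightarrow> ('a \<Rightarrow> int) \<Rightarrow> 'a \<Rightarrow> int) \<Rightarrow> nat \<Rightarrow> ((nat \<Rightarrow> nat) \<Rightarrow> 'a \<Rightarrow> int) \<Rightarrow> (nat \<Rightarrow> nat) \<Rightarrow> 'a \<Rightarrow> int"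
  where "raise X k f a h = sg k a * X k (Suc (a k)) (f (a(k := Suc (a k)))) h"

text \<open>Of two distinct factors exactly one precedes the other, so exactly one of the two signs
  changes when the index is moved. Commuting operators of different factors thereby become
  anticommuting ones.\<close>

lemma lower_lower:
  assumes "linear_op X" "linear_op Y" "j \<in> K" "k \<in> K" "j \<noteq> k" "h \<in> carrier G"
    and "\<And>b c \<phi>. X j b (Y k c \<phi>) h = Y k c (X j b \<phi>) h"
  shows "lower X j (lower Y k f) a h = - lower Y k (lower X j f) a h"
proof (cases "a j = 0 \<or> a k = 0")
  case True
  thus ?thesis using assms by (auto simp: lower_def[abs_def] linear_op_zero)
next
  case False
  have e: "a(j := a j - 1, k := a k - 1) = a(k := a k - 1, j := a j - 1)"
    using assms(5) by (simp add: fun_upd_twist)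
  show ?thesis
    using False assms e
    by (simp add: lower_def[abs_def] sg_upd linear_op_cmul)
qed

lemma raise_raise:
  assumes "linear_op X" "linear_op Y" "j \<in> K" "k \<in> K" "j \<noteq> k" "h \<in> carrier G"
    and "\<And>b c \<phi>. X j b (Y k c \<phi>) h = Y k c (X j b \<phi>) h"
  shows "raise X j (raise Y k f) a h = - raise Y k (raise X j f) a h"
proof -
  have e: "a(j := Suc (a j), k := Suc (a k)) = a(k := Suc (a k), j := Suc (a j))"
    using assms(5) by (simp add: fun_upd_twist)
  show ?thesis
    using assms e
    by (simp add: raise_def[abs_def] sg_upd linear_op_cmul)
qed

lemma lower_raise:
  assumes "linear_op X" "linear_op Y" "j \<in> K" "k \<in> K" "j \<noteq> k" "h \<in> carrier G"
    and "\<And>b c \<phi>. X j b (Y k c \<phi>) h = Y k c (X j b \<phi>) h"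
  shows "lower X j (raise Y k f) a h = - raise Y k (lower X j f) a h"
proof (cases "a j = 0")
  case True
  thus ?thesis using assms by (simp add: lower_def[abs_def] raise_def[abs_def] linear_op_zero)
next
  case False
  have e: "a(j := a j - 1, k := Suc (a k)) = a(k := Suc (a k), j := a j - 1)"
    using assms(5) by (simp add: fun_upd_twist)
  show ?thesis
    using False assms e
    by (simp add: lower_def[abs_def] raise_def[abs_def] sg_upd linear_op_cmul)
qed

text \<open>In position 0 the complex of one factor ends and one of the two terms of
  \<open>Dop_Rop\<close> is missing. The correction is the value at exponent zero in the first
  formula, and in the second the norm concentrated at the top exponent.\<close>

lemma lower_raise_same:
  assumes "k \<in> K" "h \<in> carrier G"
  shows "lower Dop k (raise Rop k f) a h + raise Rop k (lower Dop k f) a h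
      = f a h - (if a k = 0 then f a (h \<otimes> gm k (lg k h)) else 0)"
    and "raise Dop k (lower Rop k f) a h + lower Rop k (raise Dop k f) a h
      = f a h - (if a k = 0 then Rop k 2 (Dop k 2 (f a)) h else 0)"
proof -
  have lin: "X k j (\<lambda>h. c * \<phi> h) h = c * X k j \<phi> h" if "X = Dop \<or> X = Rop" for X j c \<phi>
    using that linear_op_cmul linear_Dop linear_Rop assms by blast
  have ne: "sg k (a(k := x)) = sg k a" for x
  proof -
    have "(\<Sum>i\<in>{i\<in>K. i < k}. (a(k := x)) i) = (\<Sum>i\<in>{i\<in>K. i < k}. a i)" by (intro sum.cong) auto
    thus ?thesis by (simp add: sg_def)
  qed
  show "lower Dop k (raise Rop k f) a h + raise Rop k (lower Dop k f) a h
      = f a h - (if a k = 0 then f a (h \<otimes> gm k (lg k h)) else 0)"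
    using Dop_Rop[OF assms, of "a k" "f a"] NE_SD'(2)[OF assms, of 0 "f a"]
    by (auto simp: lower_def[abs_def] raise_def[abs_def] lin ne fun_upd_idem)
  show "raise Dop k (lower Rop k f) a h + lower Rop k (raise Dop k f) a h
      = f a h - (if a k = 0 then Rop k 2 (Dop k 2 (f a)) h else 0)"
    using Dop_Rop[OF assms, of "Suc (a k)" "f a"] Dop_Rop[OF assms, of 1 "f a"]
    by (auto simp: lower_def[abs_def] raise_def[abs_def] lin ne fun_upd_idem parity numeral_2_eq_2)
qed

lemma same_zero:
  assumes "k \<in> K" "h \<in> carrier G"
  shows "lower Dop k (lower Dop k f) a h = 0" "raise Dop k (raise Dop k f) a h = 0"
proof -
  have ne: "sg k (a(k := x)) = sg k a" for x
  proof -
    have "(\<Sum>i\<in>{i\<in>K. i < k}. (a(k := x)) i) = (\<Sum>i\<in>{i\<in>K. i < k}. a i)" by (intro sum.cong) auto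
    thus ?thesis by (simp add: sg_def)
  qed
  note lin = linear_op_cmul[OF linear_Dop assms] linear_op_zero[OF linear_Dop assms]
  show "lower Dop k (lower Dop k f) a h = 0"
    using Dop_Dop(2)[OF assms, of "a k - 1"]
    by (cases "a k"; cases "a k - 1") (auto simp: lower_def[abs_def] lin ne)
  show "raise Dop k (raise Dop k f) a h = 0"
    using Dop_Dop(1)[OF assms, of "Suc (a k)"]
    by (auto simp: raise_def[abs_def] lin ne)
qed

section \<open>Total differentials of the tensor product and their homotopies\<close>

definition dU :: "((nat \<Rightarrow> nat) \<Rightarrow> 'a \<Rightarrow> int) \<Rightarrow> (nat \<Rightarrow> nat) \<Rightarrow> 'a \<Rightarrow> int"
  where "dU f a h = (\<Sum>k\<in>K. lower Dop k f a h)"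

definition dD :: "((nat \<Rightarrow> nat) \<Rightarrow> 'a \<Rightarrow> int) \<Rightarrow> (nat \<Rightarrow> nat) \<Rightarrow> 'a \<Rightarrow> int"
  where "dD f a h = (\<Sum>k\<in>K. raise Dop k f a h)"

lemma lower_sum:
  assumes "linear_op X" "k \<in> K" "h \<in> carrier G"
  shows "lower X k (\<lambda>a h. \<Sum>i\<in>I. F i a h) a h = (\<Sum>i\<in>I. lower X k (F i) a h)"
  using linear_op_sum[OF assms, where j = "a k" and I = I and c = "\<lambda>_. 1" and \<phi> = "\<lambda>i. F i (a(k := a k - 1))"]
  by (simp add: lower_def sum_distrib_left)

lemma raise_sum:
  assumes "linear_op X" "k \<in> K" "h \<in> carrier G"
  shows "raise X k (\<lambda>a h. \<Sum>i\<in>I. F i a h) a h = (\<Sum>i\<in>I. raise X k (F i) a h)"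
  using linear_op_sum[OF assms, where j = "Suc (a k)" and I = I and c = "\<lambda>_. 1" and \<phi> = "\<lambda>i. F i (a(k := Suc (a k)))"]
  by (simp add: raise_def sum_distrib_left)

lemma antisym_sum_zero:
  fixes F :: "nat \<Rightarrow> nat \<Rightarrow> int"
  assumes "\<And>j k. j \<in> K \<Longrightarrow> k \<in> K \<Longrightarrow> F j k = - F k j"
  shows "(\<Sum>j\<in>K. \<Sum>k\<in>K. F j k) = 0"
proof -
  have "(\<Sum>j\<in>K. \<Sum>k\<in>K. F j k) = (\<Sum>j\<in>K. \<Sum>k\<in>K. - F k j)"
    by (intro sum.cong refl assms)
  also have "\<dots> = - (\<Sum>j\<in>K. \<Sum>k\<in>K. F j k)"
    by (subst sum.swap) (simp add: sum_negf)
  finally show ?thesis by simp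
qed

lemma dU_dU: "h \<in> carrier G \<Longrightarrow> dU (dU f) a h = 0"
proof -
  assume h: "h \<in> carrier G"
  have "dU (dU f) a h = (\<Sum>j\<in>K. \<Sum>k\<in>K. lower Dop j (lower Dop k f) a h)"
    unfolding dU_def[abs_def] using h by (intro sum.cong refl lower_sum linear_Dop) auto
  also have "\<dots> = 0"
  proof (rule antisym_sum_zero)
    fix j k assume "j \<in> K" "k \<in> K"
    thus "lower Dop j (lower Dop k f) a h = - lower Dop k (lower Dop j f) a h"
      using same_zero(1)[of k h f a] h lower_lower[OF linear_Dop linear_Dop, of j k h f a] Dop_Dop_comm
      by (cases "j = k") auto
  qed
  finally show ?thesis .
qed

lemma dD_dD: "h \<in> carrier G \<Longrightarrow> dD (dD f) a h = 0"
proof -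
  assume h: "h \<in> carrier G"
  have "dD (dD f) a h = (\<Sum>j\<in>K. \<Sum>k\<in>K. raise Dop j (raise Dop k f) a h)"
    unfolding dD_def[abs_def] using h by (intro sum.cong refl raise_sum linear_Dop) auto
  also have "\<dots> = 0"
  proof (rule antisym_sum_zero)
    fix j k assume "j \<in> K" "k \<in> K"
    thus "raise Dop j (raise Dop k f) a h = - raise Dop k (raise Dop j f) a h"
      using same_zero(2)[of k h f a] h raise_raise[OF linear_Dop linear_Dop, of j k h f a] Dop_Dop_comm
      by (cases "j = k") auto
  qed
  finally show ?thesis .
qed

text \<open>The homotopy of factor \<open>k\<close> anticommutes with the differentials of the other
  factors, so only the formula for the single factor \<open>k\<close> survives.\<close>

lemma dU_homotopy:
  assumes k: "k \<in> K" and h: "h \<in> carrier G"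
  shows "dU (raise Rop k f) a h + raise Rop k (dU f) a h
    = f a h - (if a k = 0 then f a (h \<otimes> gm k (lg k h)) else 0)"
proof -
  have "raise Rop k (dU f) a h = (\<Sum>j\<in>K. raise Rop k (lower Dop j f) a h)"
    unfolding dU_def[abs_def] by (rule raise_sum[OF linear_Rop k h])
  hence "dU (raise Rop k f) a h + raise Rop k (dU f) a h
     = (\<Sum>j\<in>K. lower Dop j (raise Rop k f) a h + raise Rop k (lower Dop j f) a h)"
    by (simp add: dU_def sum.distrib)
  also have "\<dots> = (\<Sum>j\<in>K. if j = k then lower Dop k (raise Rop k f) a h + raise Rop k (lower Dop k f) a h else 0)"
    using lower_raise[OF linear_Dop linear_Rop _ k _ h, of _ f a] Dop_Rop_comm[OF k _ _ h] by (intro sum.cong refl) auto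
  also have "\<dots> = lower Dop k (raise Rop k f) a h + raise Rop k (lower Dop k f) a h"
    using k fin_K by simp
  finally show ?thesis using lower_raise_same(1)[OF k h] by simp
qed

lemma dD_homotopy:
  assumes k: "k \<in> K" and h: "h \<in> carrier G"
  shows "dD (lower Rop k f) a h + lower Rop k (dD f) a h
    = f a h - (if a k = 0 then Rop k 2 (Dop k 2 (f a)) h else 0)"
proof -
  have "lower Rop k (dD f) a h = (\<Sum>j\<in>K. lower Rop k (raise Dop j f) a h)"
    unfolding dD_def[abs_def] by (rule lower_sum[OF linear_Rop k h])
  hence "dD (lower Rop k f) a h + lower Rop k (dD f) a h
     = (\<Sum>j\<in>K. raise Dop j (lower Rop k f) a h + lower Rop k (raise Dop j f) a h)"
    by (simp add: dD_def sum.distrib)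
  also have "\<dots> = (\<Sum>j\<in>K. if j = k then raise Dop k (lower Rop k f) a h + lower Rop k (raise Dop k f) a h else 0)"
    using lower_raise[OF linear_Rop linear_Dop k _ _ h, of _ f a] Dop_Rop_comm[OF k _ _ h] by (intro sum.cong refl) auto
  also have "\<dots> = raise Dop k (lower Rop k f) a h + lower Rop k (raise Dop k f) a h"
    using k fin_K by simp
  finally show ?thesis using lower_raise_same(2)[OF k h] by simp
qed

end

section \<open>The spliced complex and its exactness modulo p\<close>

context coords
begin

definition idx :: "nat \<Rightarrow> (nat \<Rightarrow> nat) set"
  where "idx M = {a. (\<forall>k. k \<notin> K \<longrightarrow> a k = 0) \<and> (\<Sum>k\<in>K. a k) = M}"

text \<open>The splice: the augmentation, summing over \<open>G\<close> in position zero, followed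
  by its dual, which makes the result constant in \<open>h\<close>.\<close>

definition tot :: "((nat \<Rightarrow> nat) \<Rightarrow> 'a \<Rightarrow> int) \<Rightarrow> (nat \<Rightarrow> nat) \<Rightarrow> 'a \<Rightarrow> int"
  where "tot f a h = (if a = (\<lambda>_. 0) then \<Sum>x\<in>carrier G. f a x else 0)"

text \<open>Degree -k-1 is the transpose of degree k and has the same positions. This fold about
  -1/2 is what makes orders in positive and negative degrees agree.\<close>

definition wt :: "int \<Rightarrow> nat" where "wt m = nat (if m \<ge> 0 then m else - m - 1)"

definition dP :: "int \<Rightarrow> ((nat \<Rightarrow> nat) \<Rightarrow> 'a \<Rightarrow> int) \<Rightarrow> (nat \<Rightarrow> nat) \<Rightarrow> 'a \<Rightarrow> int"
  where "dP m = (if m \<ge> 0 then dU else if m = - 1 then tot else dD)"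

definition supp :: "nat \<Rightarrow> ((nat \<Rightarrow> nat) \<Rightarrow> 'a \<Rightarrow> int) \<Rightarrow> bool"
  where "supp M f \<longleftrightarrow> (\<forall>a. \<forall>h\<in>carrier G. a \<notin> idx M \<longrightarrow> f a h = 0)"

lemma wt_simps:
  "m \<ge> 0 \<Longrightarrow> wt (m + 1) = Suc (wt m)" "wt 0 = 0" "wt (- 1) = 0" "m \<le> - 2 \<Longrightarrow> wt m = Suc (wt (m + 1))"
  by (auto simp: wt_def)

lemma idx_0: "idx 0 = {\<lambda>_. 0}"
  using fin_K by (auto simp: idx_def)

lemma idx_upd:
  assumes "k \<in> K"
  shows "a(k := Suc (a k)) \<in> idx (Suc M) \<longleftrightarrow> a \<in> idx M" "a(k := Suc (a k)) \<notin> idx 0"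
    and "a k > 0 \<Longrightarrow> a(k := a k - 1) \<in> idx M \<longleftrightarrow> a \<in> idx (Suc M)"
proof -
  have s: "(\<Sum>i\<in>K. (b(k := Suc (b k))) i) = Suc (\<Sum>i\<in>K. b i)" for b
    using assms fin_K by (simp add: sum.remove[of K k])
  show *: "a(k := Suc (a k)) \<in> idx (Suc M) \<longleftrightarrow> a \<in> idx M" for a
    using s[of a] assms by (auto simp: idx_def)
  show "a(k := Suc (a k)) \<notin> idx 0"
    using s[of a] by (auto simp: idx_def)
  assume "a k > 0"
  thus "a(k := a k - 1) \<in> idx M \<longleftrightarrow> a \<in> idx (Suc M)"
    using *[of "a(k := a k - 1)"] by simp
qed

lemma linear_op_add:
  assumes "linear_op X" "k \<in> K" "h \<in> carrier G"
  shows "X k j (\<lambda>h. \<phi> h + \<psi> h) h = X k j \<phi> h + X k j \<psi> h"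
proof -
  obtain L :: "((int \<times> nat) \<times> 'a) set" where L: "\<And>\<phi>. X k j \<phi> h = (\<Sum>l\<in>L. fst (fst l) * \<phi> (snd l))"
    using linear_opD[OF assms] by metis
  show ?thesis unfolding L by (simp add: algebra_simps sum.distrib)
qed

lemma linear_op_zero': "linear_op X \<Longrightarrow> k \<in> K \<Longrightarrow> h \<in> carrier G \<Longrightarrow> (\<And>x. x \<in> carrier G \<Longrightarrow> \<phi> x = 0) \<Longrightarrow> X k j \<phi> h = 0"
  using linear_op_cong[of X k h \<phi> "\<lambda>_. 0"] linear_op_zero[of X k h] by metis

lemma supp_lower:
  assumes X: "linear_op X" and k: "k \<in> K" and f: "supp M f"
  shows "supp (Suc M) (lower X k f)"
  unfolding supp_def
proof (intro allI ballI impI)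
  fix a h assume h: "h \<in> carrier G" and a: "a \<notin> idx (Suc M)"
  show "lower X k f a h = 0"
  proof (cases "a k = 0")
    case False
    hence "f (a(k := a k - 1)) x = 0" if "x \<in> carrier G" for x
      using f a idx_upd(3)[OF k, of a M] that by (simp add: supp_def)
    from linear_op_zero'[OF X k h this] show ?thesis by (simp add: lower_def)
  qed (simp add: lower_def)
qed

lemma supp_raise:
  assumes X: "linear_op X" and k: "k \<in> K" and f: "supp (Suc M) f"
  shows "supp M (raise X k f)"
  unfolding supp_def
proof (intro allI ballI impI)
  fix a h assume h: "h \<in> carrier G" and a: "a \<notin> idx M"
  have "f (a(k := Suc (a k))) x = 0" if "x \<in> carrier G" for x
    using f a idx_upd(1)[OF k, of a M] that by (simp add: supp_def)
  from linear_op_zero'[OF X k h this] show "raise X k f a h = 0" by (simp add: raise_def)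
qed

lemma supp_dU: "supp M f \<Longrightarrow> supp (Suc M) (dU f)"
  using supp_lower[OF linear_Dop, of _ M f] unfolding supp_def dU_def by (metis (no_types, lifting) sum.neutral)

lemma supp_dD: "supp (Suc M) f \<Longrightarrow> supp M (dD f)"
  using supp_raise[OF linear_Dop, of _ M f] unfolding supp_def dD_def by (metis (no_types, lifting) sum.neutral)

lemma dD_supp_0:
  assumes f: "supp 0 f" and h: "h \<in> carrier G"
  shows "dD f a h = 0"
  unfolding dD_def
proof (intro sum.neutral ballI)
  fix k assume k: "k \<in> K"
  have "f (a(k := Suc (a k))) x = 0" if "x \<in> carrier G" for x
    using f idx_upd(2)[OF k, of a] that by (simp add: supp_def)
  from linear_op_zero'[OF linear_Dop k h this] show "raise Dop k f a h = 0" by (simp add: raise_def)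
qed

lemma supp_dP: "supp (wt m) f \<Longrightarrow> supp (wt (m + 1)) (dP m f)"
proof -
  assume f: "supp (wt m) f"
  consider "m \<ge> 0" | "m = - 1" | "m \<le> - 2" by linarith
  thus ?thesis
    using f supp_dU supp_dD wt_simps
    by cases (auto simp: dP_def supp_def[of 0] tot_def idx_0)
qed

lemma supp_add: "supp M f \<Longrightarrow> supp M g \<Longrightarrow> supp M (\<lambda>a h. f a h + g a h)"
  by (simp add: supp_def)

lemma dP_add: "h \<in> carrier G \<Longrightarrow> dP m (\<lambda>a h. f a h + g a h) a h = dP m f a h + dP m g a h"
  by (auto simp: dP_def dU_def dD_def tot_def lower_def raise_def linear_op_add[OF linear_Dop]
      sum.distrib[symmetric] algebra_simps intro!: sum.cong)

lemma dP_cmul: "h \<in> carrier G \<Longrightarrow> dP m (\<lambda>a h. c * f a h) a h = c * dP m f a h"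
  by (auto simp: dP_def dU_def dD_def tot_def lower_def raise_def linear_op_cmul[OF linear_Dop]
      sum_distrib_left algebra_simps intro!: sum.cong)

lemma dP_diff: "h \<in> carrier G \<Longrightarrow> dP m (\<lambda>a h. f a h - g a h) a h = dP m f a h - dP m g a h"
  using dP_add[of h m f "\<lambda>a h. (- 1) * g a h" a] dP_cmul[of h m "- 1" g a] by simp

lemma dP_dvd: "h \<in> carrier G \<Longrightarrow> (\<And>a x. x \<in> carrier G \<Longrightarrow> r dvd f a x) \<Longrightarrow> r dvd dP m f a h"
  by (auto simp: dP_def dU_def dD_def tot_def lower_def raise_def intro!: dvd_sum dvd_mult linear_op_dvd[OF linear_Dop])

lemma dP_cong_mod:
  assumes "h \<in> carrier G" "\<And>a x. x \<in> carrier G \<Longrightarrow> r dvd f a x - g a x"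
  shows "r dvd dP m f a h - dP m g a h"
  using dP_dvd[of h r "\<lambda>a h. f a h - g a h" m a] dP_diff[of h m f g a] assms by simp

lemma sum_translate: "g \<in> carrier G \<Longrightarrow> (\<Sum>x\<in>carrier G. \<phi> (x \<otimes> g)) = (\<Sum>x\<in>carrier G. \<phi> x :: int)"
  by (rule sum.reindex_bij_witness[of _ "\<lambda>x. x \<otimes> inv g" "\<lambda>x. x \<otimes> g"]) (auto simp: m_assoc)

lemma dP_dP:
  assumes h: "h \<in> carrier G"
  shows "dP (m + 1) (dP m f) a h = 0"
proof -
  consider "m \<ge> 0" | "m = - 1" | "m = - 2" | "m \<le> - 3" by linarith
  thus ?thesis
  proof cases
    case 2
    have "lower Dop k (tot f) a h = 0" if k: "k \<in> K" for k
    proof (cases "a(k := a k - 1) = (\<lambda>_. 0) \<and> a k \<noteq> 0")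
      case True
      \<comment> \<open>The position \<open>1\<close> is odd, so \<open>Dop\<close> is a difference
        there, and it is applied to a function constant in \<open>h\<close>.\<close>
      hence "a k = 1" by (metis diff_is_0_eq fun_upd_same le_antisym not_less_eq_eq One_nat_def le_0_eq)
      thus ?thesis by (simp add: lower_def tot_def Dop_def)
    next
      case False
      thus ?thesis using k h by (auto simp: lower_def tot_def[abs_def] linear_op_zero[OF linear_Dop])
    qed
    thus ?thesis using 2 by (simp add: dP_def dU_def)
  next
    case 3
    \<comment> \<open>Into position zero the operator of factor \<open>k\<close> is a difference,
      and differences of translates have sum zero over \<open>G\<close>.\<close>
    have "(\<Sum>x\<in>carrier G. raise Dop k f (\<lambda>_. 0) x) = 0" if k: "k \<in> K" for k
      using sum_translate[OF \<gamma>_closed[OF k], of "f ((\<lambda>_. 0)(k := Suc 0))"]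
      by (simp add: raise_def Dop_def sum_subtractf flip: sum_distrib_left)
    hence "(\<Sum>x\<in>carrier G. dD f (\<lambda>_. 0) x) = 0"
      unfolding dD_def by (subst sum.swap) (simp add: sum.neutral)
    thus ?thesis using 3 by (simp add: dP_def tot_def)
  qed (use h dU_dU dD_dD in \<open>auto simp: dP_def\<close>)
qed

lemma Dop_translate:
  assumes "k \<in> K" "h \<in> carrier G" "g \<in> carrier G"
  shows "Dop k j (\<lambda>h. \<phi> (h \<otimes> g)) h = Dop k j \<phi> (h \<otimes> g)"
proof -
  have "h \<otimes> \<gamma> k \<otimes> g = h \<otimes> g \<otimes> \<gamma> k" "h \<otimes> gp k i \<otimes> g = h \<otimes> g \<otimes> gp k i" for i
    using assms \<gamma>_closed[of k] gp_closed[of k i] by (simp_all add: m_ac)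
  thus ?thesis by (simp add: Dop_def)
qed

lemma dP_translate:
  assumes "h \<in> carrier G" "g \<in> carrier G"
  shows "dP m (\<lambda>a h. f a (h \<otimes> g)) a h = dP m f a (h \<otimes> g)"
  using assms sum_translate[OF assms(2), of "f a"]
  by (auto simp: dP_def dU_def dD_def tot_def lower_def raise_def Dop_translate intro!: sum.cong)

lemma dP_cong:
  assumes "h \<in> carrier G" "\<And>a x. x \<in> carrier G \<Longrightarrow> f a x = g a x"
  shows "dP m f a h = dP m g a h"
  using dP_diff[OF assms(1), of m f g a] dP_dvd[of h 0 "\<lambda>a h. f a h - g a h" m a] assms by simp

text \<open>On constants the differences vanish, while the norms and the sum over \<open>G\<close>
  multiply by \<open>q k\<close> and the order of \<open>G\<close>, both divisible by p. So the
  differential is zero modulo p on invariants, and invariants need only be counted.\<close>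

lemma dP_invariant:
  assumes h: "h \<in> carrier G" and f: "\<And>a x. x \<in> carrier G \<Longrightarrow> f a x = f a \<one>"
  shows "int p dvd dP m f a h"
proof -
  have "int p dvd Dop k j (f b) h" if "k \<in> K" for k j b
  proof (cases "odd j")
    case True
    thus ?thesis using f[of "h \<otimes> \<gamma> k" b] f[OF h, of b] h \<gamma>_closed[OF that] by (simp add: Dop_def)
  next
    case False
    have "(\<Sum>i<q k. f b (h \<otimes> gp k i)) = (\<Sum>i<q k. f b \<one>)"
      by (intro sum.cong refl f) (use h that in simp)
    thus ?thesis using False p_dvd_q[OF that] by (simp add: Dop_def)
  qed
  moreover have tot: "int p dvd (\<Sum>x\<in>carrier G. f a x)"
  proof -
    have "(\<Sum>x\<in>carrier G. f a x) = (\<Sum>x\<in>carrier G. f a \<one>)" by (intro sum.cong refl f)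
    thus ?thesis using p_dvd_order by (simp add: order_def)
  qed
  ultimately have "int p dvd lower Dop k f a h" "int p dvd raise Dop k f a h"
    if "k \<in> K" for k
    using that by (simp_all add: lower_def raise_def dvd_mult)
  moreover have "int p dvd tot f a h"
    using tot by (cases "a = (\<lambda>_. 0)") (simp_all add: tot_def)
  ultimately show ?thesis
    by (simp add: dP_def dU_def dD_def dvd_sum)
qed

text \<open>Applying the homotopies of the factors one after the other moves a cocycle into smaller and
  smaller sets of positions.\<close>

lemma dU_iterate:
  assumes f: "supp (Suc M) f" "\<And>a h. h \<in> carrier G \<Longrightarrow> int p dvd dU f a h"
    and J: "J \<subseteq> K"
  shows "\<exists>f'. supp M f' \<and>
    (\<forall>a. \<forall>h\<in>carrier G. (\<exists>k\<in>J. a k \<noteq> 0) \<longrightarrow> int p dvd f a h - dU f' a h)"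
proof -
  have "finite J" using J fin_K finite_subset by blast
  thus ?thesis using J
  proof (induction J rule: finite_induct)
    case empty
    show ?case by (intro exI[of _ "\<lambda>_ _. 0"]) (simp add: supp_def)
  next
    case (insert k J)
    then obtain f' where f': "supp M f'" and
      *: "\<forall>a. \<forall>h\<in>carrier G. (\<exists>k\<in>J. a k \<noteq> 0) \<longrightarrow> int p dvd f a h - dU f' a h"
      by blast
    have dvd: "int p dvd f a h - dU f' a h" if "h \<in> carrier G" "j \<in> J" "a j \<noteq> 0" for a h j
      using * that by blast
    have k: "k \<in> K" using insert.prems by simp
    define f2 where "f2 a h = f a h - dU f' a h" for a h
    have f2: "supp (Suc M) f2"
      using supp_dU[OF f'] f(1) by (simp add: supp_def f2_def)
    have d2: "int p dvd dU f2 a h" if "h \<in> carrier G" for a h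
      using dP_diff[of h 0 f "dU f'" a] that f(2) dU_dU[OF that] by (simp add: dP_def f2_def[abs_def])
    let ?g = "\<lambda>a h. f' a h + raise Rop k f2 a h"
    have "int p dvd f a h - dU ?g a h" if h: "h \<in> carrier G" and j: "j \<in> insert k J" "a j \<noteq> 0" for a h j
    proof -
      have "dU ?g a h = dU f' a h + dU (raise Rop k f2) a h"
        using dP_add[OF h, of 0 f' "raise Rop k f2" a] by (simp add: dP_def)
      hence "f a h - dU ?g a h = (if a k = 0 then f2 a (h \<otimes> gm k (lg k h)) else 0) + raise Rop k (dU f2) a h"
        using dU_homotopy[OF k h, of f2 a] by (simp add: f2_def)
      moreover have "int p dvd raise Rop k (dU f2) a h"
        unfolding raise_def using d2 by (intro dvd_mult linear_op_dvd[OF linear_Rop k h])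
      \<comment> \<open>If \<open>a k = 0\<close>, the nonzero position \<open>j\<close> belongs to
        \<open>J\<close>, where \<open>f2\<close> is already divisible by p at every group
        element.\<close>
      moreover have "int p dvd (if a k = 0 then f2 a (h \<otimes> gm k (lg k h)) else 0)"
        using dvd[of "h \<otimes> gm k (lg k h)" j a] j h k by (auto simp: f2_def)
      ultimately show ?thesis by simp
    qed
    moreover have "supp M ?g" by (intro supp_add f' supp_raise linear_Rop k f2)
    ultimately show ?case by blast
  qed
qed

lemma dD_iterate:
  assumes f: "supp M f" "\<And>a h. h \<in> carrier G \<Longrightarrow> int p dvd dD f a h"
    and J: "J \<subseteq> K"
  shows "\<exists>f'. supp (Suc M) f' \<and>
    (\<forall>a. \<forall>h\<in>carrier G. (\<exists>k\<in>J. a k \<noteq> 0 \<or> Suc (lg k h) \<noteq> q k) \<longrightarrow> int p dvd f a h - dD f' a h)"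
proof -
  have "finite J" using J fin_K finite_subset by blast
  thus ?thesis using J
  proof (induction J rule: finite_induct)
    case empty
    show ?case by (intro exI[of _ "\<lambda>_ _. 0"]) (simp add: supp_def)
  next
    case (insert k J)
    then obtain f' where f': "supp (Suc M) f'" and
      *: "\<forall>a. \<forall>h\<in>carrier G. (\<exists>k\<in>J. a k \<noteq> 0 \<or> Suc (lg k h) \<noteq> q k) \<longrightarrow> int p dvd f a h - dD f' a h"
      by blast
    have dvd: "int p dvd f a h - dD f' a h" if "h \<in> carrier G" "j \<in> J" "a j \<noteq> 0 \<or> Suc (lg j h) \<noteq> q j" for a h j
      using * that by blast
    have k: "k \<in> K" using insert.prems by simp
    define f2 where "f2 a h = f a h - dD f' a h" for a h
    have f2: "supp M f2"
      using supp_dD[OF f'] f(1) by (simp add: supp_def f2_def)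
    have d2: "int p dvd dD f2 a h" if "h \<in> carrier G" for a h
      using dP_diff[of h "- 2" f "dD f'" a] that f(2) dD_dD[OF that] by (simp add: dP_def f2_def[abs_def])
    let ?g = "\<lambda>a h. f' a h + lower Rop k f2 a h"
    have "int p dvd f a h - dD ?g a h"
      if h: "h \<in> carrier G" and j: "j \<in> insert k J" "a j \<noteq> 0 \<or> Suc (lg j h) \<noteq> q j" for a h j
    proof -
      have "dD ?g a h = dD f' a h + dD (lower Rop k f2) a h"
        using dP_add[OF h, of "- 2" f' "lower Rop k f2" a] by (simp add: dP_def)
      hence "f a h - dD ?g a h = (if a k = 0 then Rop k 2 (Dop k 2 (f2 a)) h else 0) + lower Rop k (dD f2) a h"
        using dD_homotopy[OF k h, of f2 a] by (simp add: f2_def)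
      moreover have "int p dvd lower Rop k (dD f2) a h"
        unfolding lower_def using d2 by (auto intro!: dvd_mult linear_op_dvd[OF linear_Rop k h])
      \<comment> \<open>For \<open>j = k\<close> the exponent of \<open>h\<close> is not the top
        one, where alone the even \<open>Rop\<close> is nonzero. For \<open>j\<close> in
        \<open>J\<close> the operators move only the exponent of \<open>\<gamma> k\<close>, so
        \<open>j\<close> still witnesses divisibility at each point involved.\<close>
      moreover have "int p dvd (if a k = 0 then Rop k 2 (Dop k 2 (f2 a)) h else 0)"
      proof (cases "j = k")
        case True
        thus ?thesis using j by (auto simp: Rop_def)
      next
        case False
        hence jJ: "j \<in> J" "j \<in> K" using j(1) insert.prems by auto
        have "lg j (h \<otimes> \<gamma> k \<otimes> gp k i) = lg j h" for i
          using lg_other_pow[OF jJ(2) k False, of "h \<otimes> \<gamma> k" i] lg_other[OF jJ(2) k False h] h \<gamma>_closed[OF k] by simp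
        hence "int p dvd f2 a (h \<otimes> \<gamma> k \<otimes> gp k i)" for i
          using dvd[of "h \<otimes> \<gamma> k \<otimes> gp k i" j a] jJ j(2) h k \<gamma>_closed[OF k] by (simp add: f2_def)
        thus ?thesis by (auto simp: Rop_def Dop_def intro!: dvd_sum)
      qed
      ultimately show ?thesis by simp
    qed
    moreover have "supp (Suc M) ?g" by (intro supp_add f' supp_lower linear_Rop k f2)
    ultimately show ?case by blast
  qed
qed

text \<open>Multiplying by suitable powers of the \<open>\<gamma> k\<close> brings all exponents of
  an element to zero without changing \<open>\<phi>\<close>; by \<open>lg_inj\<close> the end point
  is the same for every start.\<close>

lemma const_if_generators:
  assumes "\<And>k h. k \<in> K \<Longrightarrow> h \<in> carrier G \<Longrightarrow> \<phi> (h \<otimes> \<gamma> k) = (\<phi> h :: int)" "h \<in> carrier G" "h' \<in> carrier G"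
  shows "\<phi> h = \<phi> h'"
proof -
  have pow: "\<phi> (h \<otimes> gp k i) = \<phi> h" if "k \<in> K" "h \<in> carrier G" for k h i
  proof (induction i)
    case (Suc i)
    have "h \<otimes> gp k (Suc i) = (h \<otimes> gp k i) \<otimes> \<gamma> k" using that by (simp add: m_assoc \<gamma>_closed)
    thus ?case using Suc assms(1)[OF that(1), of "h \<otimes> gp k i"] that by simp
  qed (use that in simp)
  have "\<exists>g\<in>carrier G. \<phi> g = \<phi> h \<and> (\<forall>k\<in>J. lg k g = 0)" if "J \<subseteq> K" "h \<in> carrier G" for J h
  proof -
    have "finite J" using that(1) fin_K finite_subset by blast
    thus ?thesis using that(1)
    proof (induction J rule: finite_induct)
      case (insert k J)
      then obtain g where g: "g \<in> carrier G" "\<phi> g = \<phi> h" "\<forall>k\<in>J. lg k g = 0" by auto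
      have k: "k \<in> K" using insert.prems by simp
      let ?g = "g \<otimes> gp k (q k - lg k g)"
      have "lg k ?g = 0" using lg_pow[OF k g(1), of "q k - lg k g"] lg_less[OF k g(1)] by simp
      moreover have "lg j ?g = 0" if "j \<in> J" for j
      proof -
        have "j \<noteq> k" "j \<in> K" using that insert.hyps insert.prems by auto
        thus ?thesis using g that by (simp add: lg_other_pow[OF _ k _ g(1)])
      qed
      ultimately show ?case using g k pow by (intro bexI[of _ ?g]) auto
    qed (use that in auto)
  qed
  from this[OF order_refl assms(2)] this[OF order_refl assms(3)]
  obtain g g' where "g \<in> carrier G" "\<phi> g = \<phi> h" "\<forall>k\<in>K. lg k g = 0"
    "g' \<in> carrier G" "\<phi> g' = \<phi> h'" "\<forall>k\<in>K. lg k g' = 0" by blast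
  thus ?thesis using lg_inj[of g g'] by auto
qed

text \<open>Above the splice some position is nonzero, so \<open>dU_iterate\<close> reaches
  everything. At the splice a cocycle is constant modulo p. Below it, \<open>dD_iterate\<close>
  leaves only one group element in position zero, which the sum over \<open>G\<close>
  controls.\<close>

lemma dP_exact:
  assumes f: "supp (wt (m + 1)) f" "\<And>a h. h \<in> carrier G \<Longrightarrow> int p dvd dP (m + 1) f a h"
  shows "\<exists>f'. supp (wt m) f' \<and> (\<forall>a. \<forall>h\<in>carrier G. int p dvd f a h - dP m f' a h)"
proof -
  consider "m \<ge> 0" | "m = - 1" | "m \<le> - 2" by linarith
  thus ?thesis
  proof cases
    case 1
    hence w: "wt (m + 1) = Suc (wt m)" and d: "dP (m + 1) = dU" "dP m = dU" by (auto simp: dP_def wt_simps)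
    obtain f' where f': "supp (wt m) f'"
      "\<forall>a. \<forall>h\<in>carrier G. (\<exists>k\<in>K. a k \<noteq> 0) \<longrightarrow> int p dvd f a h - dU f' a h"
      using dU_iterate[OF f[unfolded w d] order_refl] by blast
    have "int p dvd f a h - dU f' a h" if h: "h \<in> carrier G" for a h
    proof (cases "a \<in> idx (Suc (wt m))")
      case True
      hence "(\<Sum>k\<in>K. a k) \<noteq> 0" by (simp add: idx_def)
      then obtain k where "k \<in> K" "a k \<noteq> 0" by (meson sum.neutral)
      thus ?thesis using f'(2) h by blast
    next
      case False
      thus ?thesis using f(1) supp_dU[OF f'(1)] h by (simp add: supp_def w)
    qed
    thus ?thesis using f'(1) d by auto
  next
    case 2
    define v where "v = (\<lambda>_ :: nat. 0 :: nat)"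
    \<comment> \<open>The differential at the unit multi-index of \<open>k\<close> is the difference
      of \<open>f v\<close> along \<open>\<gamma> k\<close>; being a cocycle thus means invariance
      modulo p under each generator.\<close>
    have step: "f v (h \<otimes> \<gamma> k) mod int p = f v h mod int p" if k: "k \<in> K" and h: "h \<in> carrier G" for k h
    proof -
      have "dU f (v(k := 1)) h = (\<Sum>j\<in>K. if j = k then sg k (v(k := 1)) * (f v (h \<otimes> \<gamma> k) - f v h) else 0)"
        unfolding dU_def
        by (intro sum.cong) (auto simp: lower_def Dop_def v_def fun_upd_idem)
      also have "\<dots> = sg k (v(k := 1)) * (f v (h \<otimes> \<gamma> k) - f v h)" using k fin_K by simp
      also have "sg k (v(k := 1)) = 1" by (simp add: sg_def v_def)
      finally have eq: "dU f (v(k := 1)) h = f v (h \<otimes> \<gamma> k) - f v h" by (simp only: mult_1)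
      have "int p dvd dU f (v(k := 1)) h"
        using f(2)[OF h, of "v(k := 1)"] 2 by (simp add: dP_def)
      thus ?thesis unfolding eq by (simp only: mod_eq_dvd_iff)
    qed
    \<comment> \<open>All of the constant value is concentrated at the identity, so that its sum
      over \<open>G\<close> is this constant.\<close>
    define f' where "f' a h = (if a = v \<and> h = \<one> then f v \<one> else 0)" for a h
    have "supp (wt m) f'" using 2 by (auto simp: supp_def wt_simps idx_0 f'_def v_def)
    moreover have "int p dvd f a h - dP m f' a h" if h: "h \<in> carrier G" for a h
    proof (cases "a = v")
      case True
      have "dP m f' a h = f v \<one>"
        using 2 True fin_G by (simp add: dP_def tot_def f'_def v_def)
      moreover have "f v h mod int p = f v \<one> mod int p"
        using const_if_generators[of "\<lambda>h. f v h mod int p" h \<one>] step h by simp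
      ultimately show ?thesis using True by (simp add: mod_eq_dvd_iff)
    next
      case False
      thus ?thesis using 2 f(1) h by (auto simp: dP_def tot_def supp_def wt_simps idx_0 v_def)
    qed
    ultimately show ?thesis by blast
  next
    case 3
    hence w: "wt m = Suc (wt (m + 1))" and d: "dP m = dD" by (auto simp: dP_def wt_simps)
    \<comment> \<open>In degree -1 the hypothesis is about \<open>tot\<close>, but there
      \<open>dD\<close> vanishes because raising an index leaves the support.\<close>
    have dDf: "int p dvd dD f a h" if "h \<in> carrier G" for a h
    proof (cases "m = - 2")
      case True
      thus ?thesis using dD_supp_0[of f h a] f(1) that by (simp add: wt_simps)
    next
      case False
      thus ?thesis using f(2)[OF that] 3 by (simp add: dP_def)
    qed
    obtain f' where f': "supp (wt m) f'"
      "\<forall>a. \<forall>h\<in>carrier G. (\<exists>k\<in>K. a k \<noteq> 0 \<or> Suc (lg k h) \<noteq> q k) \<longrightarrow> int p dvd f a h - dD f' a h"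
      using dD_iterate[OF f(1) dDf order_refl] unfolding w by blast
    have "int p dvd f a h - dD f' a h" if h: "h \<in> carrier G" for a h
    proof (cases "\<exists>k\<in>K. a k \<noteq> 0 \<or> Suc (lg k h) \<noteq> q k")
      case True
      thus ?thesis using f'(2) h by blast
    next
      \<comment> \<open>All positions are zero on \<open>K\<close> and \<open>h\<close> is the one
        element with all exponents maximal. For \<open>m = - 2\<close> its value is recovered from
        the sum over \<open>G\<close>: that sum is divisible by p, and so are all other values.
        Otherwise \<open>a\<close> lies outside the support.\<close>
      case top: False
      show ?thesis
      proof (cases "a \<in> idx (wt (m + 1)) \<and> m = - 2")
        case True
        hence a: "a = (\<lambda>_. 0)" by (auto simp: wt_simps idx_0)
        have "int p dvd f a x - dD f' a x" if x: "x \<in> carrier G" "x \<noteq> h" for x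
        proof -
          obtain k where "k \<in> K" "lg k x \<noteq> lg k h" using lg_inj[OF x(1) h] x(2) by blast
          thus ?thesis using f'(2) x(1) top by (metis Suc_inject)
        qed
        moreover have "int p dvd (\<Sum>x\<in>carrier G. f a x - dD f' a x)"
        proof -
          have "(\<Sum>x\<in>carrier G. dD f' a x) = 0"
            using dP_dP[of \<one> "- 2" f' a] a by (simp add: dP_def tot_def)
          moreover have "int p dvd (\<Sum>x\<in>carrier G. f a x)"
            using f(2)[OF h, of a] True a by (simp add: dP_def tot_def)
          ultimately show ?thesis by (simp add: sum_subtractf)
        qed
        moreover have "(\<Sum>x\<in>carrier G. f a x - dD f' a x)
           = (f a h - dD f' a h) + (\<Sum>x\<in>carrier G - {h}. f a x - dD f' a x)"
          by (rule sum.remove[OF fin_G h])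
        ultimately show ?thesis
          by (metis (no_types, lifting) DiffE dvd_add_left_iff dvd_sum insertCI)
      next
        case False
        have "a \<notin> idx (wt (m + 1))"
        proof
          assume a: "a \<in> idx (wt (m + 1))"
          hence "(\<Sum>k\<in>K. a k) = wt (m + 1)" by (simp add: idx_def)
          moreover have "(\<Sum>k\<in>K. a k) = 0" using top by (intro sum.neutral) auto
          ultimately have "wt (m + 1) = 0" by simp
          thus False using False a 3 by (auto simp: wt_def)
        qed
        thus ?thesis using f(1) supp_dD[of "wt (m + 1)" f'] f'(1) h by (simp add: supp_def w)
      qed
    qed
    thus ?thesis using f'(1) d by auto
  qed
qed

end

section \<open>Tate cohomology with coefficients in \<open>\<int>/p\<close>\<close>

context coords
begin

text \<open>\<open>Pm\<close> is an exact sequence of induced modules extending over all integer degrees, obtained by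
  splicing the tensor product of the periodic resolutions modulo \<open>p\<close> with its transpose through
  the sum over \<open>G\<close>.  Its cocycles satisfy \<open>Zm 0 = \<int>/p\<close>, and dimension shifting moves degree \<open>m\<close>
  cohomology of \<open>Zm 0\<close> to degree \<open>0\<close> cohomology of \<open>Zm m\<close>, where the differential vanishes on
  invariants.\<close>

definition Pm :: "int \<Rightarrow> ((nat \<Rightarrow> nat) \<Rightarrow> 'a \<Rightarrow> int) monoid"
  where "Pm m = \<lparr>carrier = {f. (\<forall>a h. 0 \<le> f a h \<and> f a h < int p) \<and>
       (\<forall>a h. a \<in> idx (wt m) \<and> h \<in> carrier G \<or> f a h = 0)},
     monoid.mult = (\<lambda>f g a h. (f a h + g a h) mod int p), one = (\<lambda>_ _. 0)\<rparr>"

definition actP :: "'a \<Rightarrow> ((nat \<Rightarrow> nat) \<Rightarrow> 'a \<Rightarrow> int) \<Rightarrow> (nat \<Rightarrow> nat) \<Rightarrow> 'a \<Rightarrow> int"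
  where "actP g f a h = (if h \<in> carrier G then f a (h \<otimes> g) else 0)"

text \<open>Residues are stored as integers from 0 to p - 1, so the integral operators apply without
  change; \<open>red\<close> normalises their results.\<close>

definition red :: "((nat \<Rightarrow> nat) \<Rightarrow> 'a \<Rightarrow> int) \<Rightarrow> (nat \<Rightarrow> nat) \<Rightarrow> 'a \<Rightarrow> int"
  where "red f a h = (if h \<in> carrier G then f a h mod int p else 0)"

definition Zm :: "int \<Rightarrow> ((nat \<Rightarrow> nat) \<Rightarrow> 'a \<Rightarrow> int) monoid"
  where "Zm m = Pm m\<lparr>carrier := {f \<in> carrier (Pm m). \<forall>a. \<forall>h\<in>carrier G. int p dvd dP m f a h}\<rparr>"

definition Dm :: "int \<Rightarrow> ((nat \<Rightarrow> nat) \<Rightarrow> 'a \<Rightarrow> int) \<Rightarrow> (nat \<Rightarrow> nat) \<Rightarrow> 'a \<Rightarrow> int"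
  where "Dm m f = red (dP m f)"

lemma p_pos: "int p > 0" using p prime_gt_0_nat by simp

lemma Pm_iff: "f \<in> carrier (Pm m) \<longleftrightarrow> (\<forall>a h. 0 \<le> f a h \<and> f a h < int p) \<and>
    (\<forall>a h. a \<in> idx (wt m) \<and> h \<in> carrier G \<or> f a h = 0)"
  by (simp add: Pm_def)

lemma mult_Pm: "f \<otimes>\<^bsub>Pm m\<^esub> g = (\<lambda>a h. (f a h + g a h) mod int p)"
  by (simp add: Pm_def)

lemma one_Pm: "\<one>\<^bsub>Pm m\<^esub> = (\<lambda>_ _. 0)"
  by (simp add: Pm_def)

lemma Pm_mod: "f \<in> carrier (Pm m) \<Longrightarrow> f a h mod int p = f a h"
  by (simp add: Pm_iff)

lemma comm_group_Pm: "comm_group (Pm m)"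
proof (rule comm_groupI)
  fix f g assume f: "f \<in> carrier (Pm m)" and g: "g \<in> carrier (Pm m)"
  have "(f a h + g a h) mod int p = 0" if "\<not> (a \<in> idx (wt m) \<and> h \<in> carrier G)" for a h
  proof -
    have "f a h = 0" "g a h = 0" using f g that unfolding Pm_iff by blast+
    thus ?thesis by simp
  qed
  thus "f \<otimes>\<^bsub>Pm m\<^esub> g \<in> carrier (Pm m)"
    using p_pos unfolding Pm_iff mult_Pm by (auto simp: )
  show "\<exists>g\<in>carrier (Pm m). g \<otimes>\<^bsub>Pm m\<^esub> f = \<one>\<^bsub>Pm m\<^esub>"
  proof (intro bexI[of _ "\<lambda>a h. (- f a h) mod int p"])
    have "(- f a h) mod int p = 0" if "\<not> (a \<in> idx (wt m) \<and> h \<in> carrier G)" for a h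
    proof -
      have "f a h = 0" using f that unfolding Pm_iff by blast
      thus ?thesis by simp
    qed
    thus "(\<lambda>a h. (- f a h) mod int p) \<in> carrier (Pm m)"
      using p_pos unfolding Pm_iff by auto
  qed (simp add: mult_Pm one_Pm mod_simps)
qed (use p_pos in \<open>auto simp: mult_Pm one_Pm Pm_iff mod_simps algebra_simps\<close>)

lemma supp_Pm: "f \<in> carrier (Pm m) \<Longrightarrow> supp (wt m) f"
  by (auto simp: Pm_iff supp_def)

lemma red_closed: "supp (wt m) f \<Longrightarrow> red f \<in> carrier (Pm m)"
  using p_pos by (auto simp: Pm_iff supp_def red_def)

lemma Pm_red: "f \<in> carrier (Pm m) \<Longrightarrow> red f = f"
  by (auto simp: Pm_iff red_def fun_eq_iff)

lemma red_eq_iff: "red f = red g \<longleftrightarrow> (\<forall>a. \<forall>h\<in>carrier G. int p dvd f a h - g a h)"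
  by (auto simp: red_def fun_eq_iff mod_eq_dvd_iff)

lemma red_zero_iff: "red f = (\<lambda>_ _. 0) \<longleftrightarrow> (\<forall>a. \<forall>h\<in>carrier G. int p dvd f a h)"
proof -
  have "red (\<lambda>_ _. 0) = (\<lambda>_ _. 0)" by (simp add: red_def fun_eq_iff)
  thus ?thesis using red_eq_iff[of f "\<lambda>_ _. 0"] by simp
qed

lemma actP_closed: "g \<in> carrier G \<Longrightarrow> f \<in> carrier (Pm m) \<Longrightarrow> actP g f \<in> carrier (Pm m)"
  unfolding Pm_iff actP_def using p_pos by auto

lemma finite_module_Pm: "finite_module G (Pm m) actP"
proof (intro finite_module.intro finite_module_axioms.intro G_module.intro G_module_axioms.intro
    is_group comm_group_Pm fin_G)
  fix g h u assume g: "g \<in> carrier G"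
  show "actP g \<in> hom (Pm m) (Pm m)"
    using actP_closed[OF g] by (intro homI) (auto simp: mult_Pm actP_def fun_eq_iff)
  assume h: "h \<in> carrier G"
  show "actP (g \<otimes> h) u = actP g (actP h u)"
    using g h by (auto simp: actP_def fun_eq_iff m_assoc)
next
  fix u assume "u \<in> carrier (Pm m)"
  thus "actP \<one> u = u" by (auto simp: actP_def fun_eq_iff Pm_iff)
qed

lemma dP_actP:
  assumes "h \<in> carrier G" "g \<in> carrier G"
  shows "dP m (actP g f) a h = dP m f a (h \<otimes> g)"
  using dP_translate[OF assms, of m f a] dP_cong[OF assms(1), of "actP g f" "\<lambda>a h. f a (h \<otimes> g)" m a]
  by (simp add: actP_def)

lemma dP_mult:
  assumes h: "h \<in> carrier G"
  shows "int p dvd dP m (f \<otimes>\<^bsub>Pm k\<^esub> g) a h - (dP m f a h + dP m g a h)"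
  unfolding dP_add[OF h, symmetric] mult_Pm
  by (rule dP_cong_mod[OF h]) (metis mod_eq_dvd_iff mod_mod_trivial)

lemma Zm_iff: "f \<in> carrier (Zm m) \<longleftrightarrow> f \<in> carrier (Pm m) \<and> (\<forall>a. \<forall>h\<in>carrier G. int p dvd dP m f a h)"
  by (simp add: Zm_def)

lemma Zm_mult [simp]: "(\<otimes>\<^bsub>Zm m\<^esub>) = (\<otimes>\<^bsub>Pm m\<^esub>)" and Zm_one [simp]: "\<one>\<^bsub>Zm m\<^esub> = \<one>\<^bsub>Pm m\<^esub>"
  by (simp_all add: Zm_def)

lemma Dm_closed:
  assumes "f \<in> carrier (Pm m)" shows "Dm m f \<in> carrier (Zm (m + 1))"
proof -
  have s: "supp (wt (m + 1)) (dP m f)" using supp_dP supp_Pm assms by blast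
  have "int p dvd dP (m + 1) (red (dP m f)) a h" if h: "h \<in> carrier G" for a h
  proof -
    have "int p dvd dP (m + 1) (red (dP m f)) a h - dP (m + 1) (dP m f) a h"
      by (rule dP_cong_mod[OF h]) (simp add: red_def flip: mod_eq_dvd_iff)
    thus ?thesis using dP_dP[OF h] by simp
  qed
  thus ?thesis using red_closed[OF s] by (simp add: Zm_iff Dm_def)
qed

lemma Dm_hom: "Dm m \<in> hom (Pm m) (Pm (m + 1))"
proof (rule homI)
  fix f g assume "f \<in> carrier (Pm m)" "g \<in> carrier (Pm m)"
  show "Dm m (f \<otimes>\<^bsub>Pm m\<^esub> g) = Dm m f \<otimes>\<^bsub>Pm (m + 1)\<^esub> Dm m g"
  proof -
    have "Dm m (f \<otimes>\<^bsub>Pm m\<^esub> g) = red (\<lambda>a h. dP m f a h + dP m g a h)"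
      unfolding Dm_def red_eq_iff using dP_mult by blast
    also have "\<dots> = Dm m f \<otimes>\<^bsub>Pm (m + 1)\<^esub> Dm m g"
      by (auto simp: Dm_def red_def mult_Pm fun_eq_iff mod_simps)
    finally show ?thesis .
  qed
qed (use Dm_closed in \<open>simp add: Zm_iff\<close>)

lemma Dm_actP:
  assumes "g \<in> carrier G" shows "Dm m (actP g f) = actP g (Dm m f)"
  using assms by (auto simp: Dm_def red_def actP_def[of g "red (dP m f)"] fun_eq_iff dP_actP)

lemma Dm_eq_one_iff: "f \<in> carrier (Pm m) \<Longrightarrow> Dm m f = \<one>\<^bsub>Pm (m + 1)\<^esub> \<longleftrightarrow> f \<in> carrier (Zm m)"
  by (simp add: Dm_def one_Pm red_zero_iff Zm_iff)

lemma subgroup_Zm: "subgroup (carrier (Zm m)) (Pm m)"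
proof -
  have "carrier (Zm m) = kernel (Pm m) (Pm (m + 1)) (Dm m)"
    using Dm_eq_one_iff by (auto simp: kernel_def Zm_iff)
  thus ?thesis
    using group_hom.subgroup_kernel[OF group_homI[OF _ _ Dm_hom]] comm_group_Pm
    by (simp add: comm_group_def)
qed

lemma comm_group_Zm: "comm_group (Zm m)"
  using comm_group.subgroup_comm_group[OF comm_group_Pm subgroup_Zm] by (simp add: Zm_def)

lemma finite_module_Zm: "finite_module G (Zm m) actP"
proof (intro finite_module.intro finite_module_axioms.intro G_module.intro G_module_axioms.intro
    is_group comm_group_Zm fin_G)
  interpret P: finite_module G "Pm m" actP by (rule finite_module_Pm)
  fix g h u assume g: "g \<in> carrier G"
  show "actP g \<in> hom (Zm m) (Zm m)"
    using hom_mult[OF P.act_hom[OF g]] P.act_closed[OF g] g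
    by (intro homI) (auto simp: Zm_iff dP_actP)
  assume "h \<in> carrier G" "u \<in> carrier (Zm m)"
  thus "actP (g \<otimes> h) u = actP g (actP h u)" using g P.act_mult by (simp add: Zm_iff)
next
  interpret P: finite_module G "Pm m" actP by (rule finite_module_Pm)
  fix u assume "u \<in> carrier (Zm m)"
  thus "actP \<one> u = u" using P.act_one by (simp add: Zm_iff)
qed

text \<open>One short exact piece of the spliced sequence. Surjectivity onto the next cocycles is
  \<open>dP_exact\<close>, after reducing the primitive modulo p.\<close>

lemma module_exact_PZ: "module_exact G (Zm m) actP (Pm m) actP (Zm (m + 1)) actP id (Dm m)"
proof (intro module_exact.intro module_exact_axioms.intro module_hom.intro module_hom_axioms.intro
    finite_module_Pm finite_module_Zm)
  show "id \<in> hom (Zm m) (Pm m)" by (rule homI) (auto simp: Zm_iff)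
  show "Dm m \<in> hom (Pm m) (Zm (m + 1))"
    using hom_mult[OF Dm_hom] Dm_closed by (intro homI) auto
  show "Dm m ` carrier (Pm m) = carrier (Zm (m + 1))"
  proof
    show "carrier (Zm (m + 1)) \<subseteq> Dm m ` carrier (Pm m)"
    proof
      fix f assume f: "f \<in> carrier (Zm (m + 1))"
      hence "supp (wt (m + 1)) f" using supp_Pm by (simp add: Zm_iff)
      then obtain f' where f': "supp (wt m) f'" "\<forall>a. \<forall>h\<in>carrier G. int p dvd f a h - dP m f' a h"
        using dP_exact[of m f] f by (auto simp: Zm_iff)
      have "int p dvd dP m f' a h - dP m (red f') a h" if h: "h \<in> carrier G" for a h
        by (rule dP_cong_mod[OF h]) (metis (no_types) mod_eq_dvd_iff mod_mod_trivial red_def)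
      hence "int p dvd f a h - dP m (red f') a h" if "h \<in> carrier G" for a h
        using f'(2) that by (smt (verit) dvd_add)
      hence "red f = Dm m (red f')" unfolding Dm_def red_eq_iff by blast
      hence "f = Dm m (red f')" using Pm_red[of f "m + 1"] f by (simp add: Zm_iff)
      thus "f \<in> Dm m ` carrier (Pm m)" using red_closed[OF f'(1)] by blast
    qed
  qed (use Dm_closed in auto)
  show "Dm m (actP g u) = actP g (Dm m u)" if "g \<in> carrier G" for g u
    using Dm_actP[OF that] .
  show "Dm m b = \<one>\<^bsub>Zm (m + 1)\<^esub> \<longleftrightarrow> b \<in> id ` carrier (Zm m)" if "b \<in> carrier (Pm m)" for b
    using Dm_eq_one_iff[OF that] by simp
qed auto

lemma finprod_Pm:
  assumes "F \<in> I \<rightarrow> carrier (Pm m)"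
  shows "(\<Otimes>\<^bsub>Pm m\<^esub>i\<in>I. F i) = (\<lambda>a h. (\<Sum>i\<in>I. F i a h) mod int p)"
proof -
  interpret P: comm_group "Pm m" by (rule comm_group_Pm)
  show ?thesis using assms
  proof (induction I rule: infinite_finite_induct)
    case (insert i I)
    thus ?case by (simp add: P.finprod_insert Pi_iff) (simp add: mult_Pm mod_simps)
  qed (simp_all add: P.finprod_empty P.finprod_infinite one_Pm)
qed

text \<open>\<open>Pm m\<close> is an induced module: cutting a function down to its values at the
  identity is an endomorphism whose average over \<open>G\<close> is the identity, as
  \<open>acyclic\<close> requires.\<close>

lemma acyclic_Pm: "cocycles (\<lambda>n. tate_cochains G (Pm m) actP n) (tate_coboundary G (Pm m)) n
     \<subseteq> coboundaries (\<lambda>n. tate_cochains G (Pm m) actP n) (tate_coboundary G (Pm m)) n"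
proof -
  interpret P: finite_module G "Pm m" actP by (rule finite_module_Pm)
  define \<rho> :: "((nat \<Rightarrow> nat) \<Rightarrow> 'a \<Rightarrow> int) \<Rightarrow> (nat \<Rightarrow> nat) \<Rightarrow> 'a \<Rightarrow> int"
    where "\<rho> f a h = (if h = \<one> then f a h else 0)" for f a h
  show ?thesis
  proof (rule P.acyclic[of \<rho>])
    have \<rho>: "\<rho> f \<in> carrier (Pm m)" if "f \<in> carrier (Pm m)" for f
      using that p_pos by (auto simp: Pm_iff \<rho>_def)
    show "\<rho> \<in> hom (Pm m) (Pm m)"
      using \<rho> by (intro homI) (auto simp: mult_Pm \<rho>_def fun_eq_iff)
    fix u assume u: "u \<in> carrier (Pm m)"
    have "(\<Otimes>\<^bsub>Pm m\<^esub>g\<in>carrier G. actP g (\<rho> (actP (inv g) u))) = (\<lambda>a h. (\<Sum>g\<in>carrier G. actP g (\<rho> (actP (inv g) u)) a h) mod int p)"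
      using u \<rho> by (intro finprod_Pm) auto
    also have "\<dots> = u"
    proof (intro ext)
      fix a h
      show "(\<Sum>g\<in>carrier G. actP g (\<rho> (actP (inv g) u)) a h) mod int p = u a h"
      proof (cases "h \<in> carrier G")
        case True
        have "actP g (\<rho> (actP (inv g) u)) a h = (if g = inv h then u a h else 0)" if g: "g \<in> carrier G" for g
        proof -
          have "h \<otimes> g = \<one> \<longleftrightarrow> g = inv h" using True g by (metis inv_comm inv_equality r_inv inv_inv)
          thus ?thesis using True g by (auto simp: actP_def \<rho>_def)
        qed
        hence "(\<Sum>g\<in>carrier G. actP g (\<rho> (actP (inv g) u)) a h) = (\<Sum>g\<in>carrier G. if g = inv h then u a h else 0)"
          by (rule sum.cong[OF refl])
        thus ?thesis using True fin_G Pm_mod[OF u] by simp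
      next
        case False
        thus ?thesis using u by (auto simp: actP_def Pm_iff)
      qed
    qed
    finally show "(\<Otimes>\<^bsub>Pm m\<^esub>g\<in>carrier G. actP g (\<rho> (actP (inv g) u))) = u" .
  qed
qed

lemma card_shift:
  "card (carrier (tate_cohomology G (Zm (m + 1)) actP n)) = card (carrier (tate_cohomology G (Zm m) actP (n + 1)))"
proof -
  interpret E: module_exact G "Zm m" actP "Pm m" actP "Zm (m + 1)" actP id "Dm m"
    by (rule module_exact_PZ)
  have "E.\<pi>.B.H n \<cong> E.i.A.H (n + 1)"
    using acyclic_Pm by (intro E.connecting_iso) auto
  thus ?thesis
    unfolding E.\<pi>.B.tate_cohomology_eq E.i.A.tate_cohomology_eq by (rule iso_same_card)
qed

lemma card_shift_0: "card (carrier (tate_cohomology G (Zm 0) actP n)) = card (carrier (tate_cohomology G (Zm n) actP 0))"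
proof -
  have "card (carrier (tate_cohomology G (Zm m) actP (n - m))) = card (carrier (tate_cohomology G (Zm 0) actP n))" for m
  proof (induction m rule: int_induct[where k = 0])
    case (step1 i)
    thus ?case using card_shift[of i "n - (i + 1)"] by simp
  next
    case (step2 i)
    thus ?case using card_shift[of "i - 1" "n - i"] by (simp add: algebra_simps)
  qed simp
  from this[of n] show ?thesis by simp
qed

lemma finite_idx: "finite (idx M)"
proof (rule finite_subset)
  show "idx M \<subseteq> {a. \<forall>k. (k \<in> K \<longrightarrow> a k \<in> {..M}) \<and> (k \<notin> K \<longrightarrow> a k = 0)}"
    using fin_K member_le_sum[of _ K] by (force simp: idx_def)
qed (use fin_K in \<open>intro finite_set_of_finite_funs finite_atMost\<close>)

lemma invariant_iff:
  assumes f: "f \<in> carrier (Pm m)"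
  shows "(\<forall>g\<in>carrier G. actP g f = f) \<longleftrightarrow> (\<forall>a. \<forall>h\<in>carrier G. f a h = f a \<one>)"
proof
  assume L: "\<forall>g\<in>carrier G. actP g f = f"
  show "\<forall>a. \<forall>h\<in>carrier G. f a h = f a \<one>"
  proof (intro allI ballI)
    fix a h assume h: "h \<in> carrier G"
    hence "actP h f a \<one> = f a \<one>" using L by simp
    thus "f a h = f a \<one>" using h by (simp add: actP_def)
  qed
next
  assume L: "\<forall>a. \<forall>h\<in>carrier G. f a h = f a \<one>"
  show "\<forall>g\<in>carrier G. actP g f = f"
  proof (intro ballI ext)
    fix g a h assume g: "g \<in> carrier G"
    show "actP g f a h = f a h"
    proof (cases "h \<in> carrier G")
      case True
      hence "f a (h \<otimes> g) = f a \<one>" "f a h = f a \<one>" using L g by blast+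
      thus ?thesis using True by (simp add: actP_def)
    qed (use f in \<open>auto simp: actP_def Pm_iff\<close>)
  qed
qed

lemma Dm_invariant:
  assumes f: "f \<in> carrier (Pm m)" and inv: "\<forall>g\<in>carrier G. actP g f = f"
  shows "f \<in> carrier (Zm m)"
proof -
  have "int p dvd dP m f a h" if "h \<in> carrier G" for a h
    using dP_invariant[OF that, of f m a] inv f invariant_iff by blast
  thus ?thesis using f by (simp add: Zm_iff)
qed

text \<open>Write \<open>u\<close> as \<open>Dm (m - 1) v\<close>. The norm of \<open>u\<close> is
  then \<open>Dm\<close> of the norm of \<open>v\<close>, which is invariant and so killed. Hence
  degree 0 cohomology consists of the invariants, one residue modulo p for each position.\<close>

lemma card_H_0_Zm: "card (carrier (tate_cohomology G (Zm m) actP 0)) = p ^ card (idx (wt m))"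
proof -
  interpret Z: finite_module G "Zm m" actP by (rule finite_module_Zm)
  interpret E: module_exact G "Zm (m - 1)" actP "Pm (m - 1)" actP "Zm (m - 1 + 1)" actP id "Dm (m - 1)"
    by (rule module_exact_PZ)
  interpret P: finite_module G "Pm m" actP by (rule finite_module_Pm)
  have "(\<Otimes>\<^bsub>Zm m\<^esub>g\<in>carrier G. actP g u) = \<one>\<^bsub>Zm m\<^esub>" if "u \<in> carrier (Zm m)" for u
  proof -
    let ?Q = "Pm (m - 1)"
    obtain v where v: "v \<in> carrier ?Q" "u = Dm (m - 1) v"
      using E.\<pi>_surj \<open>u \<in> carrier (Zm m)\<close> by auto
    define N where "N = (\<Otimes>\<^bsub>?Q\<^esub>g\<in>carrier G. actP g v)"
    have Nc: "N \<in> carrier ?Q" unfolding N_def using v(1) by (intro E.i.B.A.finprod_closed) auto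
    have "actP k N = N" if k: "k \<in> carrier G" for k
    proof -
      have "actP k N = (\<Otimes>\<^bsub>?Q\<^esub>g\<in>carrier G. actP k (actP g v))"
        unfolding N_def using v(1) k
        by (intro E.i.B.A.finprod_hom E.i.B.A.comm_group_axioms E.i.B.act_hom) auto
      also have "\<dots> = (\<Otimes>\<^bsub>?Q\<^esub>g\<in>carrier G. actP (k \<otimes> g) v)"
        using v(1) k by (intro E.i.B.A.finprod_cong') (auto simp: E.i.B.act_mult)
      also have "\<dots> = N"
        unfolding N_def using v(1) k by (intro E.i.B.finprod_translate) auto
      finally show ?thesis .
    qed
    hence "Dm (m - 1) N = \<one>\<^bsub>Zm (m - 1 + 1)\<^esub>"
      using Dm_invariant[OF Nc] Dm_eq_one_iff[OF Nc] by simp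
    moreover have "Dm (m - 1) N = (\<Otimes>\<^bsub>Zm (m - 1 + 1)\<^esub>g\<in>carrier G. Dm (m - 1) (actP g v))"
      unfolding N_def using v(1)
      by (intro E.i.B.A.finprod_hom E.\<pi>.B.A.comm_group_axioms E.\<pi>.\<phi>_hom) auto
    moreover have "\<dots> = (\<Otimes>\<^bsub>Zm m\<^esub>g\<in>carrier G. actP g u)"
      using that by (simp, intro Z.A.finprod_cong') (auto simp: v(2) Dm_actP)
    ultimately show ?thesis by simp
  qed
  hence "card (carrier (Z.H 0)) = card {u \<in> carrier (Zm m). \<forall>g\<in>carrier G. actP g u = u}"
    by (rule Z.card_H_0)
  also have "{u \<in> carrier (Zm m). \<forall>g\<in>carrier G. actP g u = u} = {u \<in> carrier (Pm m). \<forall>a. \<forall>h\<in>carrier G. u a h = u a \<one>}"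
  proof (rule Collect_cong)
    fix u
    show "u \<in> carrier (Zm m) \<and> (\<forall>g\<in>carrier G. actP g u = u)
      \<longleftrightarrow> u \<in> carrier (Pm m) \<and> (\<forall>a. \<forall>h\<in>carrier G. u a h = u a \<one>)"
      using Dm_invariant[of u m] invariant_iff[of u m] Zm_iff[of u m] by blast
  qed
  also have "card \<dots> = card (idx (wt m) \<rightarrow>\<^sub>E {0..<int p})"
  proof (rule bij_betw_same_card[of "\<lambda>u. \<lambda>a\<in>idx (wt m). u a \<one>"],
      rule bij_betw_byWitness[where f' = "\<lambda>c a h. if a \<in> idx (wt m) \<and> h \<in> carrier G then c a else 0"])
    show "\<forall>u\<in>{u \<in> carrier (Pm m). \<forall>a. \<forall>h\<in>carrier G. u a h = u a \<one>}.
       (\<lambda>a h. if a \<in> idx (wt m) \<and> h \<in> carrier G then (\<lambda>a\<in>idx (wt m). u a \<one>) a else 0) = u"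
    proof (intro ballI ext)
      fix u a h assume u: "u \<in> {u \<in> carrier (Pm m). \<forall>a. \<forall>h\<in>carrier G. u a h = u a \<one>}"
      show "(if a \<in> idx (wt m) \<and> h \<in> carrier G then (\<lambda>a\<in>idx (wt m). u a \<one>) a else 0) = u a h"
      proof (cases "a \<in> idx (wt m) \<and> h \<in> carrier G")
        case True
        hence "u a h = u a \<one>" using u by blast
        thus ?thesis using True by simp
      next
        case False
        have "u \<in> carrier (Pm m)" using u by blast
        hence "u a h = 0" using False unfolding Pm_iff by blast
        thus ?thesis using False by auto
      qed
    qed
    show "\<forall>c\<in>idx (wt m) \<rightarrow>\<^sub>E {0..<int p}.
       (\<lambda>a\<in>idx (wt m). if a \<in> idx (wt m) \<and> \<one> \<in> carrier G then c a else 0) = c"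
    proof (intro ballI ext)
      fix c :: "(nat \<Rightarrow> nat) \<Rightarrow> int" and a assume c: "c \<in> idx (wt m) \<rightarrow>\<^sub>E {0..<int p}"
      show "(\<lambda>a\<in>idx (wt m). if a \<in> idx (wt m) \<and> \<one> \<in> carrier G then c a else 0) a = c a"
        using PiE_arb[OF c, of a] by (cases "a \<in> idx (wt m)") simp_all
    qed
    show "(\<lambda>u. \<lambda>a\<in>idx (wt m). u a \<one>) ` {u \<in> carrier (Pm m). \<forall>a. \<forall>h\<in>carrier G. u a h = u a \<one>}
       \<subseteq> idx (wt m) \<rightarrow>\<^sub>E {0..<int p}"
    proof (rule image_subsetI)
      fix u assume "u \<in> {u \<in> carrier (Pm m). \<forall>a. \<forall>h\<in>carrier G. u a h = u a \<one>}"
      hence "u \<in> carrier (Pm m)" by blast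
      thus "(\<lambda>a\<in>idx (wt m). u a \<one>) \<in> idx (wt m) \<rightarrow>\<^sub>E {0..<int p}" by (simp add: Pm_iff)
    qed
    show "(\<lambda>c a h. if a \<in> idx (wt m) \<and> h \<in> carrier G then c a else 0) ` (idx (wt m) \<rightarrow>\<^sub>E {0..<int p})
       \<subseteq> {u \<in> carrier (Pm m). \<forall>a. \<forall>h\<in>carrier G. u a h = u a \<one>}"
      using p_pos by (simp add: image_subset_iff Pm_iff PiE_iff)
  qed
  also have "\<dots> = p ^ card (idx (wt m))"
    by (simp add: card_PiE finite_idx)
  finally show ?thesis by (simp add: Z.tate_cohomology_eq)
qed

text \<open>Stars and bars, by listing the values of a multi-index along the sorted elements of
  \<open>K\<close>.\<close>

lemma card_idx:
  assumes "card K = s" "s \<ge> 1"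
  shows "card (idx M) = (s + M - 1) choose M"
proof -
  define ks where "ks = sorted_list_of_set K"
  have ks: "set ks = K" "distinct ks" "length ks = s"
    using fin_K assms by (auto simp: ks_def)
  have "card (idx M) = card {l :: nat list. length l = s \<and> sum_list l = M}"
  proof (rule bij_betw_same_card[of "\<lambda>a. map a ks"], rule bij_betw_imageI)
    show "inj_on (\<lambda>a. map a ks) (idx M)"
    proof (rule inj_onI, rule ext)
      fix a b k assume ab: "a \<in> idx M" "b \<in> idx M" "map a ks = map b ks"
      show "a k = b k"
        using ab ks(1) by (cases "k \<in> K") (simp_all add: idx_def)
    qed
    have sum: "sum_list (map a ks) = (\<Sum>k\<in>K. a k)" for a :: "nat \<Rightarrow> nat"
      using ks by (simp add: sum_list_distinct_conv_sum_set)
    show "(\<lambda>a. map a ks) ` idx M = {l. length l = s \<and> sum_list l = M}"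
    proof
      show "{l. length l = s \<and> sum_list l = M} \<subseteq> (\<lambda>a. map a ks) ` idx M"
      proof
        fix l :: "nat list" assume l: "l \<in> {l. length l = s \<and> sum_list l = M}"
        define a where "a k = (case map_of (zip ks l) k of Some x \<Rightarrow> x | None \<Rightarrow> 0)" for k
        have "map a ks = l"
          using l ks by (intro nth_equalityI) (auto simp: a_def map_of_zip_nth)
        moreover have "a \<in> idx M"
          using sum[of a] l ks \<open>map a ks = l\<close> by (auto simp: idx_def a_def split: option.split dest!: map_of_SomeD dest: set_zip_leftD)
        ultimately show "l \<in> (\<lambda>a. map a ks) ` idx M" by blast
      qed
    qed (use sum ks in \<open>auto simp: idx_def\<close>)
  qed
  also have "\<dots> = (M + s - 1) choose M"
    by (rule card_length_sum_list)
  finally show ?thesis by (simp add: add.commute)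
qed

theorem card_cohomology_Zm_0:
  assumes "card K = s" "s \<ge> 1"
  shows "card (carrier (tate_cohomology G (Zm 0) actP n)) = p ^ ((s + wt n - 1) choose (wt n))"
  using card_shift_0[of n] card_H_0_Zm[of n] card_idx[OF assms] by simp

section \<open>Identification of \<open>Zm 0\<close> with Z/p and trivial action\<close>

definition cst :: "int \<Rightarrow> (nat \<Rightarrow> nat) \<Rightarrow> 'a \<Rightarrow> int"
  where "cst c a h = (if a = (\<lambda>_. 0) \<and> h \<in> carrier G then c mod int p else 0)"

lemma cst_mod: "cst (c mod int p) = cst c"
  by (intro ext) (simp add: cst_def)

text \<open>By exactness at the splice every element is a value of \<open>Dm (- 1)\<close>, a sum
  over \<open>G\<close>, hence constant in \<open>h\<close> and concentrated in position
  zero.\<close>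

lemma carrier_Zm_0: "carrier (Zm 0) = cst ` {0..<int p}"
proof -
  have "f \<in> cst ` {0..<int p}" if f: "f \<in> carrier (Zm 0)" for f
  proof -
    interpret E: module_exact G "Zm (- 1)" actP "Pm (- 1)" actP "Zm (- 1 + 1)" actP id "Dm (- 1)"
      by (rule module_exact_PZ)
    obtain v where "v \<in> carrier (Pm (- 1))" "f = Dm (- 1) v"
      using E.\<pi>_surj f by auto
    hence "f = cst (\<Sum>x\<in>carrier G. v (\<lambda>_. 0) x)"
      by (intro ext) (simp add: Dm_def red_def dP_def tot_def cst_def)
    also have "\<dots> = cst ((\<Sum>x\<in>carrier G. v (\<lambda>_. 0) x) mod int p)" by (simp add: cst_mod)
    finally show ?thesis using p_pos by auto
  qed
  moreover have "cst c \<in> carrier (Zm 0)" for c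
  proof (rule Dm_invariant)
    show c: "cst c \<in> carrier (Pm 0)" using p_pos by (auto simp: Pm_iff cst_def wt_simps idx_0)
    show "\<forall>g\<in>carrier G. actP g (cst c) = cst c"
      unfolding invariant_iff[OF c] by (simp add: cst_def)
  qed
  ultimately show ?thesis by blast
qed

lemma cst_closed: "cst c \<in> carrier (Zm 0)"
proof -
  have "cst (c mod int p) \<in> carrier (Zm 0)" using p_pos unfolding carrier_Zm_0 by simp
  thus ?thesis by (simp add: cst_mod)
qed

lemma cst_mult: "cst c \<otimes>\<^bsub>Zm 0\<^esub> cst d = cst (c + d)"
  by (auto simp: mult_Pm cst_def fun_eq_iff mod_simps)

lemma cst_eq_iff: "cst c = cst d \<longleftrightarrow> c mod int p = d mod int p"
proof
  assume "cst c = cst d"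
  hence "cst c (\<lambda>_. 0) \<one> = cst d (\<lambda>_. 0) \<one>" by simp
  thus "c mod int p = d mod int p" by (simp add: cst_def)
qed (metis cst_mod)

lemma cst_one: "cst c = \<one>\<^bsub>Zm 0\<^esub> \<longleftrightarrow> int p dvd c"
proof -
  have "cst 0 = \<one>\<^bsub>Zm 0\<^esub>" by (intro ext) (simp add: cst_def one_Pm)
  thus ?thesis using cst_eq_iff[of c 0] by (simp add: dvd_eq_mod_eq_0)
qed

lemma actP_cst: "g \<in> carrier G \<Longrightarrow> actP g (cst c) = cst c"
  by (auto simp: actP_def cst_def fun_eq_iff)

lemma pow_Pm:
  assumes "f \<in> carrier (Pm m)"
  shows "f [^]\<^bsub>Pm m\<^esub> (n :: nat) = (\<lambda>a h. (int n * f a h) mod int p)"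
proof (induction n)
  case (Suc n)
  have "f [^]\<^bsub>Pm m\<^esub> Suc n = f [^]\<^bsub>Pm m\<^esub> n \<otimes>\<^bsub>Pm m\<^esub> f" by (simp add: nat_pow_def)
  thus ?case unfolding Suc mult_Pm by (simp add: mod_simps algebra_simps)
qed (simp add: one_Pm)

end

section \<open>Irreducible lattices\<close>

lemma comm_group_rat_group: "comm_group rat_group"
  by (rule comm_groupI) (auto simp: rat_group_def intro: exI[of _ "- x" for x] )

lemma rat_group_simps [simp]:
  "carrier rat_group = UNIV" "x \<otimes>\<^bsub>rat_group\<^esub> y = x + y" "\<one>\<^bsub>rat_group\<^esub> = 0"
  by (simp_all add: rat_group_def)

lemma inv_rat_group [simp]: "inv\<^bsub>rat_group\<^esub> x = - x"
  using comm_group_rat_group by (intro group.inv_equality) (auto simp: comm_group_def)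

lemma nat_pow_rat_group [simp]: "x [^]\<^bsub>rat_group\<^esub> (n :: nat) = of_nat n * x"
proof (induction n)
  case (Suc n)
  have "x [^]\<^bsub>rat_group\<^esub> Suc n = x [^]\<^bsub>rat_group\<^esub> n \<otimes>\<^bsub>rat_group\<^esub> x" by (simp add: nat_pow_def)
  thus ?case by (simp add: Suc algebra_simps)
qed (simp add: nat_pow_def)

lemma int_pow_rat_group [simp]: "x [^]\<^bsub>rat_group\<^esub> (n :: int) = of_int n * x"
  by (simp add: int_pow_def2 of_nat_nat)

context G_lattice
begin

lemma basis_iso:
  obtains \<phi> and S :: "nat set" where "\<phi> \<in> hom M (free_Abelian_group S)" "inj_on \<phi> (carrier M)"
    "\<phi> ` carrier M = carrier (free_Abelian_group S)" "finite S"
  using free_finite_rank by (auto simp: is_iso_def iso_def bij_betw_def)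

lemma torsion_free:
  assumes u: "u \<in> carrier M" and k: "k \<noteq> (0 :: int)" and "u [^]\<^bsub>M\<^esub> k = \<one>\<^bsub>M\<^esub>"
  shows "u = \<one>\<^bsub>M\<^esub>"
proof -
  obtain \<phi> and S :: "nat set" where \<phi>: "\<phi> \<in> hom M (free_Abelian_group S)" "inj_on \<phi> (carrier M)"
    using basis_iso by metis
  interpret h: group_hom M "free_Abelian_group S" \<phi>
    using \<phi>(1) by (intro group_homI A.is_group) auto
  have "frag_cmul k (\<phi> u) = 0"
    using h.hom_int_pow[OF u, of k] assms(3) h.hom_closed[OF u] by simp
  hence "\<phi> u = \<phi> \<one>\<^bsub>M\<^esub>" using k by simp
  thus ?thesis using inj_onD[OF \<phi>(2)] u by blast
qed

lemma not_divisible: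
  assumes "\<And>u. u \<in> carrier M \<Longrightarrow> \<exists>w\<in>carrier M. u = w [^]\<^bsub>M\<^esub> (k :: nat)" and k: "k > 1"
  shows "carrier M = {\<one>\<^bsub>M\<^esub>}"
proof -
  obtain \<phi> and S :: "nat set" where \<phi>: "\<phi> \<in> hom M (free_Abelian_group S)" "inj_on \<phi> (carrier M)"
    "\<phi> ` carrier M = carrier (free_Abelian_group S)"
    using basis_iso by metis
  interpret h: group_hom M "free_Abelian_group S" \<phi>
    using \<phi>(1) by (intro group_homI A.is_group) auto
  have "S = {}"
  proof (rule ccontr)
    assume "S \<noteq> {}"
    then obtain b where "b \<in> S" by blast
    hence "frag_of b \<in> \<phi> ` carrier M" using \<phi>(3) by simp
    then obtain u where u: "u \<in> carrier M" "\<phi> u = frag_of b" by auto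
    obtain w where w: "w \<in> carrier M" "u = w [^]\<^bsub>M\<^esub> k" using assms(1)[OF u(1)] by blast
    have "frag_of b = frag_cmul (int k) (\<phi> w)"
      using h.hom_nat_pow[OF w(1), of k] u(2) w(2) by simp
    hence "1 = int k * Poly_Mapping.lookup (\<phi> w) b"
      by (metis lookup_frag_cmul lookup_frag_of)
    thus False using k by (metis abs_zmult_eq_1 abs_of_nat less_numeral_extra(4) of_nat_1_eq_iff)
  qed
  have "u = \<one>\<^bsub>M\<^esub>" if "u \<in> carrier M" for u
  proof -
    have "\<phi> u \<in> carrier (free_Abelian_group S)" using that by (rule h.hom_closed)
    hence "\<phi> u = \<phi> \<one>\<^bsub>M\<^esub>" using \<open>S = {}\<close> by simp
    thus ?thesis using inj_onD[OF \<phi>(2)] that by blast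
  qed
  thus ?thesis by auto
qed

section \<open>The rational tensor product of a lattice\<close>

abbreviation "F \<equiv> free_Abelian_group (carrier rat_group \<times> carrier M)"
abbreviation "Rl \<equiv> tensor_rels rat_group M"

definition tens :: "rat \<Rightarrow> 'c \<Rightarrow> (rat \<times> 'c \<Rightarrow>\<^sub>0 int) set"
  where "tens r u = Rl #>\<^bsub>F\<^esub> frag_of (r, u)"

lemma rels_in_F:
  "{frag_of (a \<otimes>\<^bsub>rat_group\<^esub> a', b) - frag_of (a, b) - frag_of (a', b) | a a' b.
        a \<in> carrier rat_group \<and> a' \<in> carrier rat_group \<and> b \<in> carrier M} \<union>
   {frag_of (a, b \<otimes>\<^bsub>M\<^esub> b') - frag_of (a, b) - frag_of (a, b') | a b b'.
        a \<in> carrier rat_group \<and> b \<in> carrier M \<and> b' \<in> carrier M} \<subseteq> carrier F"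
proof -
  have "Poly_Mapping.keys (frag_of x - frag_of y - frag_of z) \<subseteq> carrier rat_group \<times> carrier M"
    if "{x, y, z} \<subseteq> carrier rat_group \<times> carrier M" for x y z
    using that keys_diff[of "frag_of x" "frag_of y"] keys_diff[of "frag_of x - frag_of y" "frag_of z"]
    by (auto simp: keys_frag_of)
  thus ?thesis by auto
qed

lemma subgroup_Rl: "subgroup Rl F"
  unfolding tensor_rels_def by (rule group.generate_is_subgroup[OF group_free_Abelian_group rels_in_F])

text \<open>A homomorphism that sends the two families of bilinearity relations into a subgroup
  sends everything they generate there. It is used with the relations themselves as target, and with
  the zero subgroup.\<close>

lemma Rl_induct:
  assumes h: "h \<in> hom F K" and K: "group K" and "subgroup J K"
    and "\<And>r r' u. u \<in> carrier M \<Longrightarrow> h (frag_of (r + r', u) - frag_of (r, u) - frag_of (r', u)) \<in> J"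
    and "\<And>r u u'. u \<in> carrier M \<Longrightarrow> u' \<in> carrier M \<Longrightarrow>
      h (frag_of (r, u \<otimes>\<^bsub>M\<^esub> u') - frag_of (r, u) - frag_of (r, u')) \<in> J"
    and x: "x \<in> Rl"
  shows "h x \<in> J"
proof -
  interpret h: group_hom F K h by (intro group_homI group_free_Abelian_group K h)
  have "subgroup {x \<in> carrier F. h x \<in> J} F"
  proof (rule group.subgroupI[OF group_free_Abelian_group])
    show "{x \<in> carrier F. h x \<in> J} \<noteq> {}"
      using h.hom_one subgroup.one_closed[OF assms(3)] by (auto intro!: exI[of _ 0])
    fix a b assume a: "a \<in> {x \<in> carrier F. h x \<in> J}" and b: "b \<in> {x \<in> carrier F. h x \<in> J}"
    show "inv\<^bsub>F\<^esub> a \<in> {x \<in> carrier F. h x \<in> J}"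
      using a h.hom_inv[of a] subgroup.m_inv_closed[OF assms(3)] by (auto simp: keys_minus)
    show "a \<otimes>\<^bsub>F\<^esub> b \<in> {x \<in> carrier F. h x \<in> J}"
      using a b h.hom_mult[of a b] subgroup.m_closed[OF assms(3)] keys_add[of a b] by auto
  qed auto
  hence "generate F ({frag_of (a \<otimes>\<^bsub>rat_group\<^esub> a', b) - frag_of (a, b) - frag_of (a', b) | a a' b.
        a \<in> carrier rat_group \<and> a' \<in> carrier rat_group \<and> b \<in> carrier M} \<union>
   {frag_of (a, b \<otimes>\<^bsub>M\<^esub> b') - frag_of (a, b) - frag_of (a, b') | a b b'.
        a \<in> carrier rat_group \<and> b \<in> carrier M \<and> b' \<in> carrier M}) \<subseteq> {x \<in> carrier F. h x \<in> J}"
  proof (rule group.generate_subgroup_incl[OF group_free_Abelian_group, rotated], intro subsetI CollectI conjI)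
    fix y assume y: "y \<in> {frag_of (a \<otimes>\<^bsub>rat_group\<^esub> a', b) - frag_of (a, b) - frag_of (a', b) | a a' b.
        a \<in> carrier rat_group \<and> a' \<in> carrier rat_group \<and> b \<in> carrier M} \<union>
      {frag_of (a, b \<otimes>\<^bsub>M\<^esub> b') - frag_of (a, b) - frag_of (a, b') | a b b'.
        a \<in> carrier rat_group \<and> b \<in> carrier M \<and> b' \<in> carrier M}"
    show "y \<in> carrier F" by (rule subsetD[OF rels_in_F y])
    show "h y \<in> J" using y assms(4,5) by auto
  qed
  thus ?thesis using x unfolding tensor_rels_def by blast
qed

lemma tens_eq_iff:
  "u \<in> carrier M \<Longrightarrow> u' \<in> carrier M \<Longrightarrow> tens r u = tens r' u' \<longleftrightarrow> frag_of (r, u) - frag_of (r', u') \<in> Rl"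
  unfolding tens_def
  by (subst comm_group.coset_eq_iff[OF abelian_free_Abelian_group subgroup_Rl]) (auto simp: keys_frag_of)

lemma Rl_coset_eqI:
  assumes "a - b \<in> Rl" "Poly_Mapping.keys a \<subseteq> carrier rat_group \<times> carrier M"
    "Poly_Mapping.keys b \<subseteq> carrier rat_group \<times> carrier M"
  shows "Rl #>\<^bsub>F\<^esub> a = Rl #>\<^bsub>F\<^esub> b"
  using comm_group.coset_eq_iff[OF abelian_free_Abelian_group subgroup_Rl, of a b] assms by simp

lemma comm_group_tensor: "comm_group (tensor rat_group M)"
  unfolding tensor_def by (rule comm_group.abelian_FactGroup[OF abelian_free_Abelian_group subgroup_Rl])

lemma normal_Rl: "Rl \<lhd> F"
  by (rule comm_group.subgroup_imp_normal[OF abelian_free_Abelian_group subgroup_Rl])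

lemma tens_closed: "u \<in> carrier M \<Longrightarrow> tens r u \<in> carrier (tensor rat_group M)"
  by (auto simp: tensor_def tens_def carrier_FactGroup keys_frag_of intro!: image_eqI)

lemma tens_mult: "u \<in> carrier M \<Longrightarrow> u' \<in> carrier M \<Longrightarrow>
  tens r u \<otimes>\<^bsub>tensor rat_group M\<^esub> tens r' u' = Rl #>\<^bsub>F\<^esub> (frag_of (r, u) + frag_of (r', u'))"
  using normal.rcos_sum[OF normal_Rl, of "frag_of (r, u)" "frag_of (r', u')"]
  by (simp add: tensor_def tens_def keys_frag_of)

lemma tens_add:
  assumes u: "u \<in> carrier M"
  shows "tens (r + r') u = tens r u \<otimes>\<^bsub>tensor rat_group M\<^esub> tens r' u"
proof -
  have "frag_of (r + r', u) - frag_of (r, u) - frag_of (r', u) \<in> Rl"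
    unfolding tensor_rels_def using u by (intro generate.incl) auto
  hence "frag_of (r + r', u) - (frag_of (r, u) + frag_of (r', u)) \<in> Rl" by (simp add: algebra_simps)
  moreover have "Poly_Mapping.keys (frag_of (r, u) + frag_of (r', u)) \<subseteq> carrier rat_group \<times> carrier M"
    using u by (intro order_trans[OF keys_add]) (simp add: keys_frag_of)
  ultimately show ?thesis
    unfolding tens_mult[OF u u] unfolding tens_def using u
    by (intro Rl_coset_eqI) (auto simp: keys_frag_of)
qed

lemma tens_mult_right:
  assumes u: "u \<in> carrier M" "u' \<in> carrier M"
  shows "tens r (u \<otimes>\<^bsub>M\<^esub> u') = tens r u \<otimes>\<^bsub>tensor rat_group M\<^esub> tens r u'"
proof -
  have "frag_of (r, u \<otimes>\<^bsub>M\<^esub> u') - frag_of (r, u) - frag_of (r, u') \<in> Rl"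
    unfolding tensor_rels_def using u by (intro generate.incl) auto
  hence "frag_of (r, u \<otimes>\<^bsub>M\<^esub> u') - (frag_of (r, u) + frag_of (r, u')) \<in> Rl" by (simp add: algebra_simps)
  moreover have "Poly_Mapping.keys (frag_of (r, u) + frag_of (r, u')) \<subseteq> carrier rat_group \<times> carrier M"
    using u by (intro order_trans[OF keys_add]) (simp add: keys_frag_of)
  ultimately show ?thesis
    unfolding tens_mult[OF u] unfolding tens_def using u
    by (intro Rl_coset_eqI) (auto simp: keys_frag_of)
qed

lemma tens_scale:
  assumes u: "u \<in> carrier M"
  shows "tens (of_int n * r) u = tens r (u [^]\<^bsub>M\<^esub> (n :: int))"
proof -
  have "(\<lambda>r. tens r u) \<in> hom rat_group (tensor rat_group M)"
    using u tens_closed tens_add by (intro homI) auto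
  hence "tens (r [^]\<^bsub>rat_group\<^esub> n) u = tens r u [^]\<^bsub>tensor rat_group M\<^esub> n"
    using comm_group_rat_group comm_group_tensor by (intro hom_int_pow) (auto simp: comm_group_def)
  moreover have "tens r \<in> hom M (tensor rat_group M)"
    using tens_closed tens_mult_right by (intro homI) auto
  hence "tens r (u [^]\<^bsub>M\<^esub> n) = tens r u [^]\<^bsub>tensor rat_group M\<^esub> n"
    using comm_group_tensor u A.is_group by (intro hom_int_pow) (auto simp: comm_group_def)
  ultimately show ?thesis by simp
qed

text \<open>An equality of cosets as sets: the induced map preserves the relations, so the image
  lies in one coset, and the relations multiplied in fill up the whole of it.\<close>

lemma tensor_map_tens:
  assumes f: "f \<in> hom rat_group rat_group" and h: "h \<in> hom M M" and u: "u \<in> carrier M"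
  shows "tensor_map rat_group M f h (tens r u) = tens (f r) (h u)"
proof -
  let ?E = "frag_extend (\<lambda>(a, b). frag_of (f a, h b))"
  have hc: "h v \<in> carrier M" if "v \<in> carrier M" for v using h that by (auto simp: hom_def)
  have keys: "Poly_Mapping.keys (?E c) \<subseteq> carrier rat_group \<times> carrier M"
    if "Poly_Mapping.keys c \<subseteq> carrier rat_group \<times> carrier M" for c
    using that hc by (intro order_trans[OF keys_frag_extend]) (auto simp: keys_frag_of)
  have E: "?E \<in> hom F F"
    using keys by (intro homI) (auto simp: frag_extend_add)
  have fm: "f (a + b) = f a + f b" for a b using hom_mult[OF f, of a b] by simp
  have ER: "?E c \<in> Rl" if "c \<in> Rl" for c
  proof (rule Rl_induct[OF E group_free_Abelian_group subgroup_Rl _ _ that])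
    fix r r' v assume "v \<in> carrier M"
    hence "frag_of (f r \<otimes>\<^bsub>rat_group\<^esub> f r', h v) - frag_of (f r, h v) - frag_of (f r', h v) \<in> Rl"
      unfolding tensor_rels_def using hc by (intro generate.incl) auto
    thus "?E (frag_of (r + r', v) - frag_of (r, v) - frag_of (r', v)) \<in> Rl"
      by (simp add: frag_extend_diff fm)
  next
    fix r v v' assume v: "v \<in> carrier M" "v' \<in> carrier M"
    hence "frag_of (f r, h v \<otimes>\<^bsub>M\<^esub> h v') - frag_of (f r, h v) - frag_of (f r, h v') \<in> Rl"
      unfolding tensor_rels_def using hc by (intro generate.incl UnI2) auto
    thus "?E (frag_of (r, v \<otimes>\<^bsub>M\<^esub> v') - frag_of (r, v) - frag_of (r, v')) \<in> Rl"
      using v by (simp add: frag_extend_diff hom_mult[OF h])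
  qed
  have 0: "0 \<in> Rl" using subgroup.one_closed[OF subgroup_Rl] by simp
  have add: "a + b \<in> Rl" if "a \<in> Rl" "b \<in> Rl" for a b using subgroup.m_closed[OF subgroup_Rl that] by simp
  have "tensor_map rat_group M f h (tens r u) = {a + (?E b + frag_of (f r, h u)) | a b. a \<in> Rl \<and> b \<in> Rl}"
    by (auto simp: tensor_map_def tens_def r_coset_def set_mult_def frag_extend_add)
  also have "\<dots> = tens (f r) (h u)"
  proof (intro equalityI subsetI)
    fix x assume "x \<in> {a + (?E b + frag_of (f r, h u)) | a b. a \<in> Rl \<and> b \<in> Rl}"
    then obtain a b where "a \<in> Rl" "b \<in> Rl" "x = (a + ?E b) + frag_of (f r, h u)" by (auto simp: add.assoc)
    thus "x \<in> tens (f r) (h u)" using add ER unfolding tens_def r_coset_def by auto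
  next
    fix x assume "x \<in> tens (f r) (h u)"
    then obtain a where "a \<in> Rl" "x = a + (?E 0 + frag_of (f r, h u))" by (auto simp: tens_def r_coset_def)
    thus "x \<in> {a + (?E b + frag_of (f r, h u)) | a b. a \<in> Rl \<and> b \<in> Rl}" using 0 by blast
  qed
  finally show ?thesis .
qed

text \<open>The scalar times a coordinate of \<open>\<phi> u\<close> is bilinear, hence vanishes on
  the relations and is well defined on tensors. These functionals allow equations between tensors to
  be read back in the lattice.\<close>

lemma tens_coordinates:
  assumes \<phi>: "\<phi> \<in> hom M (free_Abelian_group S)" and u: "u \<in> carrier M" "u' \<in> carrier M"
    and eq: "tens r u = tens r' u'"
  shows "r * of_int (Poly_Mapping.lookup (\<phi> u) b) = r' * of_int (Poly_Mapping.lookup (\<phi> u') b)"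
proof -
  interpret Q: comm_group rat_group by (rule comm_group_rat_group)
  define x where "x = (\<lambda>(r, u). r * of_int (Poly_Mapping.lookup (\<phi> u) b) :: rat)"
  have \<phi>m: "\<phi> (v \<otimes>\<^bsub>M\<^esub> v') = \<phi> v + \<phi> v'" if "v \<in> carrier M" "v' \<in> carrier M" for v v'
    using hom_mult[OF \<phi> that] by simp
  have ev: "ev rat_group x (frag_of s - frag_of t) = x s - x t" "ev rat_group x (frag_of s - frag_of t - frag_of t') = x s - x t - x t'" for s t t'
    by (simp_all add: Q.ev_diff[of _ UNIV])
  have "ev rat_group x (frag_of (r, u) - frag_of (r', u')) \<in> {0}"
  proof (rule Rl_induct[where K = rat_group])
    show "ev rat_group x \<in> hom F rat_group" by (rule Q.ev_hom) simp
    show "subgroup {0} rat_group" using Q.triv_subgroup by simp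
    show "frag_of (r, u) - frag_of (r', u') \<in> Rl" using tens_eq_iff[OF u] eq by blast
  qed (simp_all add: ev Q.is_group, simp_all add: x_def \<phi>m Poly_Mapping.lookup_add algebra_simps)
  thus ?thesis by (simp add: ev) (simp add: x_def)
qed

text \<open>All uses of irreducibility go through this form. The tensors \<open>tens r u\<close>
  with \<open>u\<close> in \<open>N\<close> form a submodule. If it is zero, coordinates show that
  \<open>N\<close> is trivial; if it is everything, clearing the denominator of \<open>r\<close>
  puts a multiple of any \<open>u\<close> into \<open>N\<close>, and purity does the rest.\<close>

theorem irreducible_pure:
  assumes irr: "irreducible_lattice G M act" and N: "subgroup N M"
    and stable: "\<And>g u. g \<in> carrier G \<Longrightarrow> u \<in> N \<Longrightarrow> act g u \<in> N"
    and pure: "\<And>u k. u \<in> carrier M \<Longrightarrow> k \<noteq> (0 :: int) \<Longrightarrow> u [^]\<^bsub>M\<^esub> k \<in> N \<Longrightarrow> u \<in> N"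
  shows "N = {\<one>\<^bsub>M\<^esub>} \<or> N = carrier M"
proof -
  let ?T = "tensor rat_group M"
  obtain \<phi> and S :: "nat set" where \<phi>: "\<phi> \<in> hom M (free_Abelian_group S)" "inj_on \<phi> (carrier M)"
    using basis_iso by metis
  interpret h: group_hom M "free_Abelian_group S" \<phi>
    using \<phi>(1) by (intro group_homI A.is_group) auto
  have NM: "u \<in> carrier M" if "u \<in> N" for u using that subgroup.mem_carrier[OF N] by blast
  define N' where "N' = {tens r u | r u. u \<in> N}"
  have mult: "(\<lambda>r. q * r) \<in> hom rat_group rat_group" for q :: rat
    by (auto intro!: homI simp: algebra_simps)
  have id: "(\<lambda>u. u) \<in> hom M M" "(\<lambda>r. r) \<in> hom rat_group rat_group" by (auto intro!: homI)
  interpret T: comm_group ?T by (rule comm_group_tensor)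
  have sub: "subgroup N' ?T"
  proof (rule T.subgroupI)
    show "N' \<subseteq> carrier ?T" using tens_closed NM by (auto simp: N'_def)
    show "N' \<noteq> {}" using subgroup.one_closed[OF N] by (auto simp: N'_def)
    show "inv\<^bsub>?T\<^esub> a \<in> N'" if a: "a \<in> N'" for a
    proof -
      obtain r u where ru: "a = tens r u" "u \<in> N" using a by (auto simp: N'_def)
      have "tens r \<in> hom M ?T"
        using tens_closed tens_mult_right by (intro homI) auto
      from group_hom.hom_inv[OF group_homI[OF A.is_group T.is_group this] NM[OF ru(2)]]
      have "inv\<^bsub>?T\<^esub> a = tens r (inv\<^bsub>M\<^esub> u)" using ru by simp
      thus ?thesis using subgroup.m_inv_closed[OF N ru(2)] by (auto simp: N'_def)
    qed
    show "a \<otimes>\<^bsub>?T\<^esub> b \<in> N'" if ab: "a \<in> N'" "b \<in> N'" for a b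
    proof -
      obtain r u r' u' where ru: "a = tens r u" "u \<in> N" "b = tens r' u'" "u' \<in> N" using ab by (auto simp: N'_def)
      obtain x d where r: "r = of_int x / of_int d" "d > 0" by (metis quotient_of_div quotient_of_denom_pos surj_pair)
      obtain x' d' where r': "r' = of_int x' / of_int d'" "d' > 0" by (metis quotient_of_div quotient_of_denom_pos surj_pair)
      \<comment> \<open>A common denominator lets the two simple tensors be written over the same
        scalar, so their sum is again a simple tensor.\<close>
      let ?e = "1 / (of_int d * of_int d') :: rat"
      have "of_int (x * d') * ?e = r" "of_int (x' * d) * ?e = r'"
        using r(2) r'(2) unfolding r(1) r'(1) by simp_all
      hence "a = tens (of_int (x * d') * ?e) u" "b = tens (of_int (x' * d) * ?e) u'"
        by (simp_all only: ru)
      hence "a \<otimes>\<^bsub>?T\<^esub> b = tens ?e (u [^]\<^bsub>M\<^esub> (x * d') \<otimes>\<^bsub>M\<^esub> u' [^]\<^bsub>M\<^esub> (x' * d))"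
        using ru NM by (simp only: tens_scale tens_mult_right A.int_pow_closed)
      moreover have "u [^]\<^bsub>M\<^esub> (x * d') \<otimes>\<^bsub>M\<^esub> u' [^]\<^bsub>M\<^esub> (x' * d) \<in> N"
        using ru subgroup.m_closed[OF N] A.subgroup_int_pow_closed[OF N] by blast
      ultimately show ?thesis by (auto simp: N'_def)
    qed
  qed
  have "QG_submodule G ?T (\<lambda>q. tensor_map rat_group M (\<lambda>r. q * r) (\<lambda>u. u))
      (\<lambda>g. tensor_map rat_group M (\<lambda>r. r) (act g)) N'"
    unfolding QG_submodule_def
  proof (intro conjI sub allI ballI)
    fix q v assume "v \<in> N'"
    then obtain r u where "v = tens r u" "u \<in> N" by (auto simp: N'_def)
    thus "tensor_map rat_group M (\<lambda>r. q * r) (\<lambda>u. u) v \<in> N'"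
      using tensor_map_tens[OF mult id(1)] NM by (auto simp: N'_def)
  next
    fix g v assume g: "g \<in> carrier G" and "v \<in> N'"
    then obtain r u where u: "v = tens r u" "u \<in> N" by (auto simp: N'_def)
    hence "tensor_map rat_group M (\<lambda>r. r) (act g) v = tens r (act g u)"
      using tensor_map_tens[OF id(2) act_hom[OF g] NM[OF u(2)]] by simp
    thus "tensor_map rat_group M (\<lambda>r. r) (act g) v \<in> N'"
      using stable[OF g u(2)] unfolding N'_def by blast
  qed
  hence "N' = {\<one>\<^bsub>?T\<^esub>} \<or> N' = carrier ?T"
    using irr unfolding irreducible_lattice_def simple_QG_module_def by blast
  thus ?thesis
  proof
    assume "N' = {\<one>\<^bsub>?T\<^esub>}"
    have "u = \<one>\<^bsub>M\<^esub>" if "u \<in> N" for u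
    proof -
      have "tens 1 u \<in> N'" "tens 1 \<one>\<^bsub>M\<^esub> \<in> N'"
        using that subgroup.one_closed[OF N] unfolding N'_def by blast+
      hence "tens 1 u = tens 1 \<one>\<^bsub>M\<^esub>" using \<open>N' = {\<one>\<^bsub>?T\<^esub>}\<close> by blast
      hence "Poly_Mapping.lookup (\<phi> u) b = Poly_Mapping.lookup (\<phi> \<one>\<^bsub>M\<^esub>) b" for b
        using tens_coordinates[OF \<phi>(1) NM[OF that] A.one_closed, of 1 1 b] by simp
      hence "\<phi> u = \<phi> \<one>\<^bsub>M\<^esub>" by (intro poly_mapping_eqI) simp
      thus ?thesis using inj_onD[OF \<phi>(2)] NM[OF that] by blast
    qed
    thus ?thesis using subgroup.one_closed[OF N] by blast
  next
    assume full: "N' = carrier ?T"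
    have "u \<in> N" if u: "u \<in> carrier M" for u
    proof -
      obtain r w where w: "tens 1 u = tens r w" "w \<in> N"
        using full tens_closed[OF u, of 1] unfolding N'_def by blast
      obtain x d where r: "r = of_int x / of_int d" "d > 0" by (metis quotient_of_div quotient_of_denom_pos surj_pair)
      have "d * Poly_Mapping.lookup (\<phi> u) b = x * Poly_Mapping.lookup (\<phi> w) b" for b
      proof -
        have "of_int (d * Poly_Mapping.lookup (\<phi> u) b) = (of_int (x * Poly_Mapping.lookup (\<phi> w) b) :: rat)"
          using tens_coordinates[OF \<phi>(1) u NM[OF w(2)] w(1), of b] r by (simp add: field_simps)
        thus ?thesis unfolding of_int_eq_iff .
      qed
      hence "frag_cmul d (\<phi> u) = frag_cmul x (\<phi> w)" by (intro poly_mapping_eqI) simp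
      hence "\<phi> (u [^]\<^bsub>M\<^esub> d) = \<phi> (w [^]\<^bsub>M\<^esub> x)"
        using h.hom_int_pow[OF u, of d] h.hom_int_pow[OF NM[OF w(2)], of x]
          h.hom_closed[OF u] h.hom_closed[OF NM[OF w(2)]] by simp
      hence "u [^]\<^bsub>M\<^esub> d = w [^]\<^bsub>M\<^esub> x"
        using inj_onD[OF \<phi>(2)] u NM[OF w(2)] by blast
      hence "u [^]\<^bsub>M\<^esub> d \<in> N" using A.subgroup_int_pow_closed[OF N w(2)] by simp
      thus ?thesis using pure[OF u, of d] r(2) by simp
    qed
    thus ?thesis using NM by blast
  qed
qed

end

lemma (in comm_monoid) finprod_swap:
  assumes "finite I" "finite J" "\<And>i j. i \<in> I \<Longrightarrow> j \<in> J \<Longrightarrow> f i j \<in> carrier G"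
  shows "(\<Otimes>i\<in>I. \<Otimes>j\<in>J. f i j) = (\<Otimes>j\<in>J. \<Otimes>i\<in>I. f i j)"
  using assms(1,3)
proof (induction I rule: finite_induct)
  case (insert i I)
  have "(\<Otimes>j\<in>J. \<Otimes>i\<in>insert i I. f i j) = (\<Otimes>j\<in>J. f i j \<otimes> (\<Otimes>i\<in>I. f i j))"
    using insert by (intro finprod_cong') (auto intro!: finprod_closed)
  also have "\<dots> = (\<Otimes>j\<in>J. f i j) \<otimes> (\<Otimes>j\<in>J. \<Otimes>i\<in>I. f i j)"
    using insert.prems by (intro finprod_multf) (auto intro!: finprod_closed)
  finally show ?case
    using insert by (subst finprod_insert) (auto intro!: finprod_closed)
qed simp

lemma (in comm_group) finprod_shift:
  fixes f :: "nat \<Rightarrow> 'a"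
  assumes "\<And>j. f j \<in> carrier G" "f n = f 0"
  shows "(\<Otimes>j\<in>{..<n}. f (Suc j)) = (\<Otimes>j\<in>{..<n}. f j)"
proof -
  have *: "(\<Otimes>j\<in>{..<n}. f (Suc j)) \<otimes> f 0 = (\<Otimes>j\<in>{..<n}. f j) \<otimes> f n" for n
  proof (induction n)
    case (Suc n)
    have "(\<Otimes>j\<in>{..<Suc n}. f (Suc j)) \<otimes> f 0 = f (Suc n) \<otimes> ((\<Otimes>j\<in>{..<n}. f (Suc j)) \<otimes> f 0)"
      using assms(1) by (simp add: lessThan_Suc Pi_def m_assoc)
    also have "\<dots> = (\<Otimes>j\<in>{..<Suc n}. f j) \<otimes> f (Suc n)"
      using assms(1) Suc by (simp add: lessThan_Suc Pi_def m_ac)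
    finally show ?case .
  qed (use assms in simp)
  have "(\<Otimes>j\<in>{..<n}. f (Suc j)) \<in> carrier G" "(\<Otimes>j\<in>{..<n}. f j) \<in> carrier G"
    using assms(1) by auto
  thus ?thesis using *[of n] assms by (metis right_cancel one_closed)
qed

lemma smult_sum_right: "smult c (\<Sum>i\<in>S. f i) = (\<Sum>i\<in>S. smult c (f i))"
  by (induction S rule: infinite_finite_induct) (auto simp: smult_add_right)

text \<open>The Frobenius congruence for X - 1, with the multiple of p kept as an explicit
  polynomial so that it can act on the lattice.\<close>

lemma int_poly_power_prime:
  assumes "prime p"
  shows "\<exists>\<chi> :: int poly. [:- 1, 1:] ^ (p ^ n) = monom 1 (p ^ n) - 1 + smult (int p) \<chi>"
proof (induction n)
  case 0
  show ?case by (intro exI[of _ 0]) (simp add: monom_altdef one_pCons)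
next
  case (Suc n)
  then obtain \<chi> :: "int poly" where \<chi>: "[:- 1, 1:] ^ (p ^ n) = monom 1 (p ^ n) - 1 + smult (int p) \<chi>" by blast
  have dream: "\<exists>c. (a + b) ^ p = a ^ p + b ^ p + smult (int p) c" for a b :: "int poly"
  proof -
    have p1: "p \<ge> 1" using assms prime_ge_1_nat by blast
    have "(a + b) ^ p = (\<Sum>k\<le>p. of_nat (p choose k) * a ^ k * b ^ (p - k))"
      by (rule binomial_ring)
    also have "{..p} = insert 0 (insert p {1..<p})" using p1 by auto
    also have "(\<Sum>k\<in>\<dots>. of_nat (p choose k) * a ^ k * b ^ (p - k))
      = b ^ p + (a ^ p + (\<Sum>k\<in>{1..<p}. of_nat (p choose k) * a ^ k * b ^ (p - k)))"
      using p1 by (subst sum.insert; simp)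
    also have "(\<Sum>k\<in>{1..<p}. of_nat (p choose k) * a ^ k * b ^ (p - k))
       = (\<Sum>k\<in>{1..<p}. smult (int p) (of_nat ((p choose k) div p) * a ^ k * b ^ (p - k)))"
    proof (rule sum.cong[OF refl])
      fix k assume "k \<in> {1..<p}"
      hence "p dvd (p choose k)" using assms by (intro dvd_choose_prime) auto
      hence "p choose k = p * ((p choose k) div p)" by simp
      hence "of_nat (p choose k) = (of_nat p * of_nat ((p choose k) div p) :: int poly)"
        by (metis of_nat_mult)
      thus "of_nat (p choose k) * a ^ k * b ^ (p - k)
        = smult (int p) (of_nat ((p choose k) div p) * a ^ k * b ^ (p - k))"
        by (simp add: of_nat_poly mult.commute)
    qed
    finally show ?thesis
      by (intro exI[of _ "\<Sum>k\<in>{1..<p}. of_nat ((p choose k) div p) * a ^ k * b ^ (p - k)"])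
        (simp add: smult_sum_right algebra_simps)
  qed
  \<comment> \<open>The prime 2 needs the correction 1 = -1 + 2; for odd p the sign is
    preserved.\<close>
  have m1: "\<exists>c. (- 1 :: int poly) ^ p = - 1 + smult (int p) c"
  proof (cases "p = 2")
    case True
    thus ?thesis by (intro exI[of _ 1]) (simp add: one_pCons power2_eq_square)
  next
    case False
    hence "odd p" using assms prime_odd_nat prime_gt_1_nat[OF assms] by (metis nat_neq_iff not_less_eq numeral_2_eq_2 less_Suc_eq One_nat_def)
    thus ?thesis by (intro exI[of _ 0]) simp
  qed
  obtain c1 c2 c3 where c: "(monom 1 (p ^ n) - 1 + smult (int p) \<chi>) ^ p
      = (monom 1 (p ^ n) - 1) ^ p + (smult (int p) \<chi>) ^ p + smult (int p) c1"
    "(monom 1 (p ^ n) + - 1) ^ p = (monom 1 (p ^ n)) ^ p + (- 1) ^ p + smult (int p) c2"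
    "(- 1 :: int poly) ^ p = - 1 + smult (int p) c3"
    using dream m1 by metis
  have "(smult (int p) \<chi>) ^ p = smult (int p) (smult (int p ^ (p - 1)) (\<chi> ^ p))"
    using prime_gt_0_nat[OF assms] by (simp add: smult_power flip: power_Suc)
  moreover have "[:- 1, 1:] ^ (p ^ Suc n) = (([:- 1, 1:] :: int poly) ^ (p ^ n)) ^ p"
    by (simp add: power_mult[symmetric] mult.commute)
  moreover have "(monom 1 (p ^ n) :: int poly) ^ p = monom 1 (p ^ Suc n)"
    by (simp add: monom_power mult.commute)
  ultimately show ?case
    using c \<chi> by (intro exI[of _ "smult (int p ^ (p - 1)) (\<chi> ^ p) + c1 + c2 + c3"])
      (simp add: smult_add_right)
qed

section \<open>Cyclicity of the image of the group\<close>

locale irreducible_p_lattice = G_lattice G M act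
  for G :: "('a, 'b) monoid_scheme" and M :: "('c, 'd) monoid_scheme" and act +
  fixes p e :: nat
  assumes G_comm: "\<lbrakk>g \<in> carrier G; h \<in> carrier G\<rbrakk> \<Longrightarrow> g \<otimes>\<^bsub>G\<^esub> h = h \<otimes>\<^bsub>G\<^esub> g"
    and prime_p: "prime p"
    and exponent: "g \<in> carrier G \<Longrightarrow> g [^]\<^bsub>G\<^esub> (p ^ e) = \<one>\<^bsub>G\<^esub>"
    and irr: "irreducible_lattice G M act"
    and nontriv: "\<not> acts_trivially G M act"
begin

lemma act_closed [simp]: "g \<in> carrier G \<Longrightarrow> u \<in> carrier M \<Longrightarrow> act g u \<in> carrier M"
  using act_hom by (auto simp: hom_def)

lemma act_group_hom: "g \<in> carrier G \<Longrightarrow> group_hom M M (act g)"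
  by (intro group_homI A.is_group act_hom)

lemma act_mult_M: "g \<in> carrier G \<Longrightarrow> u \<in> carrier M \<Longrightarrow> v \<in> carrier M \<Longrightarrow> act g (u \<otimes>\<^bsub>M\<^esub> v) = act g u \<otimes>\<^bsub>M\<^esub> act g v"
  using hom_mult[OF act_hom] .

lemma act_pow_M: "g \<in> carrier G \<Longrightarrow> u \<in> carrier M \<Longrightarrow> act g (u [^]\<^bsub>M\<^esub> (k :: int)) = act g u [^]\<^bsub>M\<^esub> k"
  using group_hom.hom_int_pow[OF act_group_hom] .

lemma act_one_M [simp]: "g \<in> carrier G \<Longrightarrow> act g \<one>\<^bsub>M\<^esub> = \<one>\<^bsub>M\<^esub>"
  using group_hom.hom_one[OF act_group_hom] .

lemma act_comm: "g \<in> carrier G \<Longrightarrow> h \<in> carrier G \<Longrightarrow> u \<in> carrier M \<Longrightarrow> act g (act h u) = act h (act g u)"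
  using act_mult G_comm by metis

definition triv :: "'a \<Rightarrow> bool" where "triv a \<longleftrightarrow> (\<forall>u\<in>carrier M. act a u = u)"

lemma triv_mult: "a \<in> carrier G \<Longrightarrow> b \<in> carrier G \<Longrightarrow> triv b \<Longrightarrow> u \<in> carrier M \<Longrightarrow> act (a \<otimes>\<^bsub>G\<^esub> b) u = act a u"
  by (simp add: triv_def act_mult)

lemma triv_pow: "a \<in> carrier G \<Longrightarrow> triv a \<Longrightarrow> triv (a [^]\<^bsub>G\<^esub> (n :: nat))"
  by (induction n) (auto simp: triv_def act_mult act_one)

text \<open>The fixed points of \<open>a\<close> are stable because \<open>G\<close> is abelian, and
  pure because the lattice is torsion-free; irreducibility leaves only zero or everything.\<close>

lemma fixed_trivial:
  assumes a: "a \<in> carrier G" "\<not> triv a" and u: "u \<in> carrier M" "act a u = u"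
  shows "u = \<one>\<^bsub>M\<^esub>"
proof -
  let ?N = "{u \<in> carrier M. act a u = u}"
  interpret h: group_hom M M "act a" by (rule act_group_hom[OF a(1)])
  have "subgroup ?N M" by (rule A.subgroupI) (use a in auto)
  moreover have "w \<in> ?N" if w: "w \<in> carrier M" and k: "k \<noteq> 0" "w [^]\<^bsub>M\<^esub> k \<in> ?N" for w and k :: int
  proof -
    have "(act a w \<otimes>\<^bsub>M\<^esub> inv\<^bsub>M\<^esub> w) [^]\<^bsub>M\<^esub> k = act a (w [^]\<^bsub>M\<^esub> k) \<otimes>\<^bsub>M\<^esub> inv\<^bsub>M\<^esub> (w [^]\<^bsub>M\<^esub> k)"
      using w a by (simp add: A.int_pow_distrib act_pow_M A.int_pow_inv)
    also have "\<dots> = \<one>\<^bsub>M\<^esub>" using k w by (simp add: A.r_inv)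
    finally have "act a w \<otimes>\<^bsub>M\<^esub> inv\<^bsub>M\<^esub> w = \<one>\<^bsub>M\<^esub>" using torsion_free w a k by simp
    hence "act a w = w" using w a by (metis A.inv_closed A.inv_equality A.inv_inv act_closed)
    thus ?thesis using w by simp
  qed
  ultimately have "?N = {\<one>\<^bsub>M\<^esub>} \<or> ?N = carrier M"
    using a(1) act_comm by (intro irreducible_pure[OF irr]) auto
  moreover have "?N \<noteq> carrier M" using a(2) by (auto simp: triv_def)
  ultimately show ?thesis using u by blast
qed

lemma nontrivial_M: "carrier M \<noteq> {\<one>\<^bsub>M\<^esub>}"
  using nontriv by (auto simp: acts_trivially_def)

text \<open>Since \<open>a\<close> to the power p acts trivially, applying \<open>a\<close> permutes
  the factors cyclically; the product is fixed by \<open>a\<close> and therefore trivial.\<close>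

lemma orbit_product:
  assumes a: "a \<in> carrier G" "\<not> triv a" "triv (a [^]\<^bsub>G\<^esub> p)" and u: "u \<in> carrier M"
  shows "(\<Otimes>\<^bsub>M\<^esub>j\<in>{..<p}. act (a [^]\<^bsub>G\<^esub> j) u) = \<one>\<^bsub>M\<^esub>"
proof (rule fixed_trivial[OF a(1,2)])
  show c: "(\<Otimes>\<^bsub>M\<^esub>j\<in>{..<p}. act (a [^]\<^bsub>G\<^esub> j) u) \<in> carrier M"
    using a(1) u by (intro A.finprod_closed) auto
  have "act a (\<Otimes>\<^bsub>M\<^esub>j\<in>{..<p}. act (a [^]\<^bsub>G\<^esub> j) u) = (\<Otimes>\<^bsub>M\<^esub>j\<in>{..<p}. act a (act (a [^]\<^bsub>G\<^esub> j) u))"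
    using a(1) u by (intro A.finprod_hom A.comm_group_axioms act_hom) auto
  also have "\<dots> = (\<Otimes>\<^bsub>M\<^esub>j\<in>{..<p}. act (a [^]\<^bsub>G\<^esub> Suc j) u)"
    using a(1) u by (intro A.finprod_cong') (auto simp: act_mult act_comm)
  also have "\<dots> = (\<Otimes>\<^bsub>M\<^esub>j\<in>{..<p}. act (a [^]\<^bsub>G\<^esub> j) u)"
    using a u by (intro A.finprod_shift) (auto simp: triv_def act_one)
  finally show "act a (\<Otimes>\<^bsub>M\<^esub>j\<in>{..<p}. act (a [^]\<^bsub>G\<^esub> j) u) = (\<Otimes>\<^bsub>M\<^esub>j\<in>{..<p}. act (a [^]\<^bsub>G\<^esub> j) u)" .
qed

lemma triv_if_coprime:
  assumes z: "z \<in> carrier G" "triv (z [^]\<^bsub>G\<^esub> p)" "triv (z [^]\<^bsub>G\<^esub> c)" and c: "\<not> p dvd c"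
  shows "triv z"
proof -
  have "coprime c p" using prime_imp_coprime[OF prime_p c] by (simp add: coprime_commute)
  then obtain x y where xy: "c * x = p * y + 1" using coprime_bezout_strong[of c p] prime_p by (metis not_prime_1)
  have "act z u = u" if u: "u \<in> carrier M" for u
  proof -
    have "act (z [^]\<^bsub>G\<^esub> (c * x)) u = u"
      using triv_pow[OF _ z(3), of x] z(1) u by (simp add: G.nat_pow_pow triv_def)
    moreover have "z [^]\<^bsub>G\<^esub> (c * x) = z \<otimes>\<^bsub>G\<^esub> (z [^]\<^bsub>G\<^esub> p) [^]\<^bsub>G\<^esub> y"
      unfolding xy using z(1) G.nat_pow_mult[of z 1 "p * y"] by (simp add: G.nat_pow_pow add.commute)
    ultimately show ?thesis using triv_mult[OF z(1) _ triv_pow[OF _ z(2), of y] u] z(1) by simp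
  qed
  thus ?thesis by (simp add: triv_def)
qed

text \<open>The image of \<open>G\<close> in the automorphism group is cyclic: were it to contain two independent
  elements \<open>h\<close> and \<open>z\<close> of order \<open>p\<close>, summing the vanishing norms of the \<open>p\<close> subgroups generated by
  the \<open>h z\<^sup>k\<close> would make \<open>p\<close> act as \<open>0\<close>.\<close>

lemma cyclic_image:
  obtains g r where "g \<in> carrier G" "\<not> triv (g [^]\<^bsub>G\<^esub> (p ^ r))" "triv (g [^]\<^bsub>G\<^esub> (p ^ Suc r))"
    "\<And>h. h \<in> carrier G \<Longrightarrow> \<exists>k :: nat. \<forall>u\<in>carrier M. act h u = act (g [^]\<^bsub>G\<^esub> k) u"
proof -
  \<comment> \<open>The exponents t for which some p^t-th power acts nontrivially. Their maximum
    \<open>r\<close> gives p^(r+1) as exponent of the image, attained by \<open>g\<close>, and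
    \<open>z\<close> acts with order p.\<close>
  let ?R = "{t. \<exists>a\<in>carrier G. \<not> triv (a [^]\<^bsub>G\<^esub> (p ^ t))}"
  have sub: "?R \<subseteq> {..<e}"
  proof
    fix t assume "t \<in> ?R"
    then obtain a where a: "a \<in> carrier G" "\<not> triv (a [^]\<^bsub>G\<^esub> (p ^ t))" by blast
    show "t \<in> {..<e}"
    proof (rule ccontr)
      assume "t \<notin> {..<e}"
      hence "p ^ t = p ^ e * p ^ (t - e)" by (simp flip: power_add)
      hence "a [^]\<^bsub>G\<^esub> (p ^ t) = \<one>\<^bsub>G\<^esub>" using a(1) exponent[OF a(1)] by (simp flip: G.nat_pow_pow)
      thus False using a(2) by (simp add: triv_def act_one)
    qed
  qed
  hence fin: "finite ?R" by (rule finite_subset) simp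
  have "\<exists>a\<in>carrier G. \<not> triv a" using nontriv by (auto simp: acts_trivially_def triv_def)
  hence ne: "?R \<noteq> {}" by (auto intro!: exI[of _ 0])
  define r where "r = Max ?R"
  obtain g where g: "g \<in> carrier G" "\<not> triv (g [^]\<^bsub>G\<^esub> (p ^ r))"
    using Max_in[OF fin ne] unfolding r_def by blast
  have max: "triv (a [^]\<^bsub>G\<^esub> (p ^ Suc r))" if "a \<in> carrier G" for a
    using Max_ge[OF fin, of "Suc r"] that unfolding r_def[symmetric] by fastforce
  define z where "z = g [^]\<^bsub>G\<^esub> (p ^ r)"
  have z: "z \<in> carrier G" "\<not> triv z" "triv (z [^]\<^bsub>G\<^esub> p)"
    using g max[OF g(1)] by (auto simp: z_def G.nat_pow_pow mult.commute)
  have "\<exists>k :: nat. \<forall>u\<in>carrier M. act h u = act (g [^]\<^bsub>G\<^esub> k) u" if "h \<in> carrier G" "triv (h [^]\<^bsub>G\<^esub> (p ^ t))" for h t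
    using that
  proof (induction t arbitrary: h)
    case 0
    thus ?case by (intro exI[of _ 0]) (auto simp: triv_def act_one)
  next
    case (Suc t)
    have "triv ((h [^]\<^bsub>G\<^esub> p) [^]\<^bsub>G\<^esub> (p ^ t))" using Suc.prems by (simp add: G.nat_pow_pow)
    then obtain c :: nat where "\<forall>u\<in>carrier M. act (h [^]\<^bsub>G\<^esub> p) u = act (g [^]\<^bsub>G\<^esub> c) u"
      using Suc.IH[OF G.nat_pow_closed[OF Suc.prems(1)]] by blast
    hence c: "act (h [^]\<^bsub>G\<^esub> p) u = act (g [^]\<^bsub>G\<^esub> c) u" if "u \<in> carrier M" for u
      using that by blast
    have pow_eq: "act ((h [^]\<^bsub>G\<^esub> p) [^]\<^bsub>G\<^esub> n) u = act ((g [^]\<^bsub>G\<^esub> c) [^]\<^bsub>G\<^esub> n) u" if "u \<in> carrier M" for u and n :: nat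
      using that by (induction n arbitrary: u) (use Suc.prems(1) g(1) c in \<open>auto simp: act_mult\<close>)
    have "p dvd c"
    proof (rule ccontr)
      assume nd: "\<not> p dvd c"
      have "triv (h [^]\<^bsub>G\<^esub> (p * p ^ r))" using max[OF Suc.prems(1)] by simp
      hence "triv ((h [^]\<^bsub>G\<^esub> p) [^]\<^bsub>G\<^esub> (p ^ r))" using Suc.prems(1) by (simp add: G.nat_pow_pow)
      hence "triv ((g [^]\<^bsub>G\<^esub> c) [^]\<^bsub>G\<^esub> (p ^ r))" using pow_eq by (simp add: triv_def)
      hence "triv (z [^]\<^bsub>G\<^esub> c)" using g(1) by (simp add: z_def G.nat_pow_pow mult.commute)
      thus False using triv_if_coprime[OF z(1,3)] nd z(2) by blast
    qed
    then obtain c' where c': "c = p * c'" by blast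
    define gc where "gc = g [^]\<^bsub>G\<^esub> c'"
    \<comment> \<open>On the lattice \<open>w\<close> acts as the inverse of \<open>gc\<close>,
      whose p-th power acts like that of \<open>h\<close>. So \<open>h' = h \<otimes> w\<close> has
      a p-th power acting trivially.\<close>
    define w where "w = gc [^]\<^bsub>G\<^esub> (p ^ Suc r - 1)"
    have gw: "gc \<in> carrier G" "w \<in> carrier G" using g(1) by (auto simp: gc_def w_def)
    have "p ^ Suc r = Suc (p ^ Suc r - 1)" using prime_gt_0_nat[OF prime_p] by simp
    hence wgc: "w \<otimes>\<^bsub>G\<^esub> gc = gc [^]\<^bsub>G\<^esub> (p ^ Suc r)" unfolding w_def by (metis nat_pow_Suc)
    have tw: "triv (w \<otimes>\<^bsub>G\<^esub> gc)" unfolding wgc using max gw(1) by blast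
    define h' where "h' = h \<otimes>\<^bsub>G\<^esub> w"
    have h': "h' \<in> carrier G" using gw Suc.prems(1) by (simp add: h'_def)
    have hh': "act h u = act (h' \<otimes>\<^bsub>G\<^esub> gc) u" if "u \<in> carrier M" for u
      using triv_mult[OF Suc.prems(1) _ tw that] gw Suc.prems(1) by (simp add: h'_def G.m_assoc)
    have "triv (h' [^]\<^bsub>G\<^esub> p)"
      unfolding triv_def
    proof
      fix u assume u: "u \<in> carrier M"
      have "h' [^]\<^bsub>G\<^esub> p = h [^]\<^bsub>G\<^esub> p \<otimes>\<^bsub>G\<^esub> w [^]\<^bsub>G\<^esub> p"
        unfolding h'_def using gw Suc.prems(1) G_comm by (intro G.pow_mult_distrib) auto
      hence "act (h' [^]\<^bsub>G\<^esub> p) u = act (h [^]\<^bsub>G\<^esub> p) (act (w [^]\<^bsub>G\<^esub> p) u)"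
        using gw Suc.prems(1) u by (simp add: act_mult)
      also have "\<dots> = act (gc [^]\<^bsub>G\<^esub> p) (act (w [^]\<^bsub>G\<^esub> p) u)"
        using c[of "act (w [^]\<^bsub>G\<^esub> p) u"] gw u g(1) by (simp add: gc_def G.nat_pow_pow c' mult.commute)
      also have "\<dots> = act ((gc \<otimes>\<^bsub>G\<^esub> w) [^]\<^bsub>G\<^esub> p) u"
        using gw u G_comm by (subst G.pow_mult_distrib) (auto simp: act_mult)
      also have "\<dots> = u"
        using triv_pow[OF _ tw, of p] gw u G_comm[of gc w] by (simp add: triv_def)
      finally show "act (h' [^]\<^bsub>G\<^esub> p) u = u" .
    qed
    have "\<exists>k<p. triv (h' \<otimes>\<^bsub>G\<^esub> z [^]\<^bsub>G\<^esub> k)"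
    proof (rule ccontr)
      assume no: "\<not> (\<exists>k<p. triv (h' \<otimes>\<^bsub>G\<^esub> z [^]\<^bsub>G\<^esub> k))"
      have "u = \<one>\<^bsub>M\<^esub>" if u: "u \<in> carrier M" for u
      proof -
        have pw: "(h' \<otimes>\<^bsub>G\<^esub> z [^]\<^bsub>G\<^esub> k) [^]\<^bsub>G\<^esub> j = h' [^]\<^bsub>G\<^esub> j \<otimes>\<^bsub>G\<^esub> (z [^]\<^bsub>G\<^esub> j) [^]\<^bsub>G\<^esub> k" for j k :: nat
          using h' z(1) G_comm by (subst G.pow_mult_distrib) (auto simp: G.nat_pow_pow mult.commute)
        have "(\<Otimes>\<^bsub>M\<^esub>j\<in>{..<p}. act ((h' \<otimes>\<^bsub>G\<^esub> z [^]\<^bsub>G\<^esub> k) [^]\<^bsub>G\<^esub> j) u) = \<one>\<^bsub>M\<^esub>" if "k < p" for k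
        proof (rule orbit_product)
          show "triv ((h' \<otimes>\<^bsub>G\<^esub> z [^]\<^bsub>G\<^esub> k) [^]\<^bsub>G\<^esub> p)"
            unfolding pw using triv_pow[OF _ z(3), of k] \<open>triv (h' [^]\<^bsub>G\<^esub> p)\<close> h' z(1)
            by (simp add: triv_def act_mult)
        qed (use no that h' z(1) u in auto)
        hence "(\<Otimes>\<^bsub>M\<^esub>k\<in>{..<p}. \<Otimes>\<^bsub>M\<^esub>j\<in>{..<p}. act ((h' \<otimes>\<^bsub>G\<^esub> z [^]\<^bsub>G\<^esub> k) [^]\<^bsub>G\<^esub> j) u) = \<one>\<^bsub>M\<^esub>"
          by (rule A.finprod_one_eqI) simp
        hence "\<one>\<^bsub>M\<^esub> = (\<Otimes>\<^bsub>M\<^esub>j\<in>{..<p}. \<Otimes>\<^bsub>M\<^esub>k\<in>{..<p}. act ((h' \<otimes>\<^bsub>G\<^esub> z [^]\<^bsub>G\<^esub> k) [^]\<^bsub>G\<^esub> j) u)"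
          using h' z(1) u by (subst A.finprod_swap) auto
        also have "\<dots> = (\<Otimes>\<^bsub>M\<^esub>j\<in>{..<p}. if j = 0 then u [^]\<^bsub>M\<^esub> p else \<one>\<^bsub>M\<^esub>)"
        proof (rule A.finprod_cong')
          fix j assume j: "j \<in> {..<p}"
          have "(\<Otimes>\<^bsub>M\<^esub>k\<in>{..<p}. act ((h' \<otimes>\<^bsub>G\<^esub> z [^]\<^bsub>G\<^esub> k) [^]\<^bsub>G\<^esub> j) u)
             = (\<Otimes>\<^bsub>M\<^esub>k\<in>{..<p}. act (h' [^]\<^bsub>G\<^esub> j) (act ((z [^]\<^bsub>G\<^esub> j) [^]\<^bsub>G\<^esub> k) u))"
            unfolding pw using h' z(1) u by (intro A.finprod_cong') (auto simp: act_mult)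
          also have "\<dots> = act (h' [^]\<^bsub>G\<^esub> j) (\<Otimes>\<^bsub>M\<^esub>k\<in>{..<p}. act ((z [^]\<^bsub>G\<^esub> j) [^]\<^bsub>G\<^esub> k) u)"
            using h' z(1) u by (intro A.finprod_hom[symmetric] A.comm_group_axioms act_hom) auto
          also have "\<dots> = (if j = 0 then u [^]\<^bsub>M\<^esub> p else \<one>\<^bsub>M\<^esub>)"
          proof (cases "j = 0")
            case True
            thus ?thesis using u A.finprod_const[OF u, of "{..<p}"] by (simp add: act_one)
          next
            case False
            hence nd: "\<not> p dvd j" using j nat_dvd_not_less by auto
            have "\<not> triv (z [^]\<^bsub>G\<^esub> j)" using triv_if_coprime[OF z(1,3) _ nd] z(2) by blast
            moreover have "triv ((z [^]\<^bsub>G\<^esub> j) [^]\<^bsub>G\<^esub> p)"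
              using triv_pow[OF _ z(3), of j] z(1) by (simp add: G.nat_pow_pow mult.commute)
            ultimately show ?thesis using orbit_product[of "z [^]\<^bsub>G\<^esub> j" u] z(1) u False h' by simp
          qed
          finally show "(\<Otimes>\<^bsub>M\<^esub>k\<in>{..<p}. act ((h' \<otimes>\<^bsub>G\<^esub> z [^]\<^bsub>G\<^esub> k) [^]\<^bsub>G\<^esub> j) u) = (if j = 0 then u [^]\<^bsub>M\<^esub> p else \<one>\<^bsub>M\<^esub>)" .
        qed (use u in auto)
        also have "\<dots> = u [^]\<^bsub>M\<^esub> p"
          using prime_gt_0_nat[OF prime_p] u A.finprod_singleton_swap[of 0 "{..<p}" "\<lambda>_. u [^]\<^bsub>M\<^esub> p"] by simp
        finally have "u [^]\<^bsub>M\<^esub> int p = \<one>\<^bsub>M\<^esub>" by (simp add: int_pow_int)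
        thus ?thesis using torsion_free[OF u, of "int p"] prime_gt_0_nat[OF prime_p] by simp
      qed
      thus False using nontrivial_M by auto
    qed
    then obtain k where k: "k < p" "triv (h' \<otimes>\<^bsub>G\<^esub> z [^]\<^bsub>G\<^esub> k)" by blast
    let ?zi = "z [^]\<^bsub>G\<^esub> (k * (p - 1))"
    have "z [^]\<^bsub>G\<^esub> k \<otimes>\<^bsub>G\<^esub> ?zi = (z [^]\<^bsub>G\<^esub> p) [^]\<^bsub>G\<^esub> k"
      using z(1) prime_gt_0_nat[OF prime_p] by (simp add: G.nat_pow_mult G.nat_pow_pow) (metis Suc_pred add.commute mult.commute mult_Suc)
    hence tz: "triv (z [^]\<^bsub>G\<^esub> k \<otimes>\<^bsub>G\<^esub> ?zi)" using triv_pow[OF _ z(3), of k] z(1) by simp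
    have "act h' u = act ?zi u" if u: "u \<in> carrier M" for u
    proof -
      have "act h' u = act (h' \<otimes>\<^bsub>G\<^esub> (z [^]\<^bsub>G\<^esub> k \<otimes>\<^bsub>G\<^esub> ?zi)) u"
        using triv_mult[OF h' _ tz u] z(1) by simp
      also have "\<dots> = act (h' \<otimes>\<^bsub>G\<^esub> z [^]\<^bsub>G\<^esub> k) (act ?zi u)"
        using h' z(1) u by (simp add: act_mult flip: G.m_assoc)
      also have "\<dots> = act ?zi u" using k(2) z(1) u by (simp add: triv_def)
      finally show ?thesis .
    qed
    hence "act h u = act (?zi \<otimes>\<^bsub>G\<^esub> gc) u" if "u \<in> carrier M" for u
      using hh'[OF that] that h' z(1) gw by (simp add: act_mult)
    moreover have "?zi \<otimes>\<^bsub>G\<^esub> gc = g [^]\<^bsub>G\<^esub> (p ^ r * (k * (p - 1)) + c')"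
      using g(1) by (simp add: z_def gc_def G.nat_pow_pow G.nat_pow_mult)
    ultimately show ?case by metis
  qed
  thus ?thesis using that g max by metis
qed

end

section \<open>Polynomials in the generator and the cokernel of \<open>\<theta>\<close>\<close>

locale generated_p_lattice = irreducible_p_lattice G M act p e
  for G :: "('a, 'b) monoid_scheme" and M :: "('c, 'd) monoid_scheme" and act p e +
  fixes g r
  assumes g: "g \<in> carrier G" and g_nontriv: "\<not> triv (g [^]\<^bsub>G\<^esub> (p ^ r))"
    and g_order: "triv (g [^]\<^bsub>G\<^esub> (p ^ Suc r))"
    and g_gen: "h \<in> carrier G \<Longrightarrow> \<exists>k :: nat. \<forall>u\<in>carrier M. act h u = act (g [^]\<^bsub>G\<^esub> k) u"
begin

text \<open>The lattice as a module over integer polynomials, the variable acting as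
  \<open>g\<close>, evaluated by Horner's rule; \<open>\<theta>\<close> is the action of X -
  1.\<close>

definition pa :: "int poly \<Rightarrow> 'c \<Rightarrow> 'c"
  where "pa f = fold_coeffs (\<lambda>c F u. u [^]\<^bsub>M\<^esub> c \<otimes>\<^bsub>M\<^esub> act g (F u)) f (\<lambda>u. \<one>\<^bsub>M\<^esub>)"

lemma pa_0 [simp]: "pa 0 u = \<one>\<^bsub>M\<^esub>"
  by (simp add: pa_def)

lemma pa_pCons [simp]: "u \<in> carrier M \<Longrightarrow> pa (pCons c f) u = u [^]\<^bsub>M\<^esub> c \<otimes>\<^bsub>M\<^esub> act g (pa f u)"
  using g by (cases "c = 0 \<and> f = 0") (auto simp: pa_def fold_coeffs_pCons_eq)

lemma pa_closed [simp]: "u \<in> carrier M \<Longrightarrow> pa f u \<in> carrier M"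
  using g by (induction f) auto

lemma pa_mult_M: "u \<in> carrier M \<Longrightarrow> v \<in> carrier M \<Longrightarrow> pa f (u \<otimes>\<^bsub>M\<^esub> v) = pa f u \<otimes>\<^bsub>M\<^esub> pa f v"
  using g by (induction f) (auto simp: act_mult_M A.int_pow_distrib A.m_ac)

lemma pa_hom: "pa f \<in> hom M M"
  by (intro homI) (auto simp: pa_mult_M)

lemma pa_pow: "u \<in> carrier M \<Longrightarrow> pa f (u [^]\<^bsub>M\<^esub> (k :: int)) = pa f u [^]\<^bsub>M\<^esub> k"
  using hom_int_pow[OF pa_hom _ A.is_group A.is_group] .

lemma pa_add: "u \<in> carrier M \<Longrightarrow> pa (f + h) u = pa f u \<otimes>\<^bsub>M\<^esub> pa h u"
  using g by (induction f h rule: poly_induct2) (auto simp: act_mult_M A.m_ac A.int_pow_mult)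

lemma pa_smult: "u \<in> carrier M \<Longrightarrow> pa (smult c f) u = pa f u [^]\<^bsub>M\<^esub> c"
  using g by (induction f) (auto simp: A.int_pow_distrib A.int_pow_pow act_pow_M mult.commute)

lemma pa_diff: "u \<in> carrier M \<Longrightarrow> pa (f - h) u = pa f u \<otimes>\<^bsub>M\<^esub> inv\<^bsub>M\<^esub> pa h u"
  using pa_add[of u f "smult (- 1) h"] pa_smult[of u "- 1" h] by (simp add: A.int_pow_neg)

lemma pa_mult: "u \<in> carrier M \<Longrightarrow> pa (f * h) u = pa f (pa h u)"
proof (induction f)
  case (pCons a f)
  thus ?case using g by (simp add: pa_add pa_smult)
qed simp

lemma pa_1 [simp]: "u \<in> carrier M \<Longrightarrow> pa 1 u = u"
  using g by (simp add: one_pCons)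

lemma pa_monom: "u \<in> carrier M \<Longrightarrow> pa (monom 1 k) u = act (g [^]\<^bsub>G\<^esub> k) u"
proof (induction k)
  case 0
  thus ?case using g by (simp add: act_one monom_0)
next
  case (Suc k)
  have "act (g [^]\<^bsub>G\<^esub> Suc k) u = act g (act (g [^]\<^bsub>G\<^esub> k) u)"
    using Suc.prems g by (simp add: act_mult act_comm)
  thus ?case using Suc g by (simp add: monom_Suc)
qed

lemma pa_sum: "u \<in> carrier M \<Longrightarrow> pa (\<Sum>i\<in>I. f i) u = (\<Otimes>\<^bsub>M\<^esub>i\<in>I. pa (f i) u)"
  by (induction I rule: infinite_finite_induct) (auto simp: pa_add)

definition \<theta> :: "'c \<Rightarrow> 'c" where "\<theta> u = act g u \<otimes>\<^bsub>M\<^esub> inv\<^bsub>M\<^esub> u"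

lemma \<theta>_pa: "u \<in> carrier M \<Longrightarrow> \<theta> u = pa [:- 1, 1:] u"
  using g by (simp add: \<theta>_def A.int_pow_neg A.m_comm)

lemma \<theta>_closed [simp]: "u \<in> carrier M \<Longrightarrow> \<theta> u \<in> carrier M"
  using g by (simp add: \<theta>_def)

lemma \<theta>_mult: "u \<in> carrier M \<Longrightarrow> v \<in> carrier M \<Longrightarrow> \<theta> (u \<otimes>\<^bsub>M\<^esub> v) = \<theta> u \<otimes>\<^bsub>M\<^esub> \<theta> v"
  by (simp only: \<theta>_pa pa_mult_M A.m_closed)

lemma \<theta>_hom: "\<theta> \<in> hom M M"
  by (intro homI) (auto simp: \<theta>_mult)

lemma \<theta>_pow: "u \<in> carrier M \<Longrightarrow> \<theta> (u [^]\<^bsub>M\<^esub> (k :: int)) = \<theta> u [^]\<^bsub>M\<^esub> k"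
  using hom_int_pow[OF \<theta>_hom _ A.is_group A.is_group] .

lemma pa_\<theta>: "u \<in> carrier M \<Longrightarrow> pa f (\<theta> u) = \<theta> (pa f u)"
  using pa_mult[of u f "[:- 1, 1:]"] pa_mult[of u "[:- 1, 1:]" f] by (simp only: \<theta>_pa pa_closed mult.commute)

lemma act_\<theta>: "h \<in> carrier G \<Longrightarrow> u \<in> carrier M \<Longrightarrow> act h (\<theta> u) = \<theta> (act h u)"
  using g by (simp add: \<theta>_def act_mult_M act_comm group_hom.hom_inv[OF act_group_hom])

lemma g_not_triv: "\<not> triv g"
  using triv_pow[OF g, of "p ^ r"] g_nontriv by blast

lemma \<theta>_inj: "u \<in> carrier M \<Longrightarrow> \<theta> u = \<one>\<^bsub>M\<^esub> \<Longrightarrow> u = \<one>\<^bsub>M\<^esub>"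
  using fixed_trivial[OF g g_not_triv, of u] g
  by (metis A.inv_closed A.inv_equality A.inv_inv \<theta>_def act_closed)

lemma \<theta>_cancel: "u \<in> carrier M \<Longrightarrow> v \<in> carrier M \<Longrightarrow> \<theta> u = \<theta> v \<Longrightarrow> u = v"
proof -
  interpret h: group_hom M M \<theta> by (intro group_homI A.is_group \<theta>_hom)
  have "inj_on \<theta> (carrier M)" unfolding h.inj_on_one_iff using \<theta>_inj by blast
  thus "u \<in> carrier M \<Longrightarrow> v \<in> carrier M \<Longrightarrow> \<theta> u = \<theta> v \<Longrightarrow> u = v" by (rule inj_onD)
qed

text \<open>\<open>p\<close> is the value at \<open>1\<close> of the cyclotomic polynomial annihilating \<open>g\<close>.\<close>

lemma p_factors:
  obtains \<psi> where "\<And>u. u \<in> carrier M \<Longrightarrow> \<theta> (pa \<psi> u) = u [^]\<^bsub>M\<^esub> int p"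
proof -
  define \<Phi> :: "int poly" where "\<Phi> = (\<Sum>j\<in>{..<p}. monom 1 (p ^ r * j))"
  have "poly (\<Phi> - [:int p:]) 1 = 0" by (simp add: \<Phi>_def poly_sum poly_monom)
  then obtain h where h: "\<Phi> - [:int p:] = [:- 1, 1:] * h" unfolding poly_eq_0_iff_dvd by blast
  have "\<theta> (pa (- h) u) = u [^]\<^bsub>M\<^esub> int p" if u: "u \<in> carrier M" for u
  proof -
    let ?z = "g [^]\<^bsub>G\<^esub> (p ^ r)"
    have "pa \<Phi> u = (\<Otimes>\<^bsub>M\<^esub>j\<in>{..<p}. act (?z [^]\<^bsub>G\<^esub> j) u)"
      unfolding \<Phi>_def using u g
      by (simp add: pa_sum pa_monom G.nat_pow_pow)
    also have "\<dots> = \<one>\<^bsub>M\<^esub>"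
      using g g_nontriv g_order u by (intro orbit_product) (auto simp: G.nat_pow_pow mult.commute)
    finally have "pa ([:int p:] - \<Phi>) u = u [^]\<^bsub>M\<^esub> int p" using u g by (simp add: pa_diff)
    moreover have "[:int p:] - \<Phi> = [:- 1, 1:] * (- h)"
      by (simp only: mult_minus_right h[symmetric] minus_diff_eq)
    ultimately have "pa ([:- 1, 1:] * (- h)) u = u [^]\<^bsub>M\<^esub> int p" by (simp only:)
    thus ?thesis using u by (simp only: pa_mult \<theta>_pa pa_closed)
  qed
  thus ?thesis using that by blast
qed

text \<open>The Frobenius congruence with exponent p^(r+1): since this power of \<open>g\<close>
  acts trivially, a power of X - 1 acts as a multiple of p.\<close>

lemma \<theta>_power:
  obtains n \<chi> where "\<And>u. u \<in> carrier M \<Longrightarrow> (\<theta> ^^ n) u = pa \<chi> u [^]\<^bsub>M\<^esub> int p"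
proof -
  let ?n = "p ^ Suc r"
  obtain \<chi> :: "int poly" where \<chi>: "[:- 1, 1:] ^ ?n = monom 1 ?n - 1 + smult (int p) \<chi>"
    using int_poly_power_prime[OF prime_p] by blast
  have pw: "pa ([:- 1, 1:] ^ k) u = (\<theta> ^^ k) u" if "u \<in> carrier M" for k u
    using that
  proof (induction k)
    case (Suc k)
    have "(\<theta> ^^ k) u \<in> carrier M" using Suc pa_closed by metis
    thus ?case using Suc by (simp only: power_Suc pa_mult funpow.simps o_apply \<theta>_pa)
  qed simp
  have "(\<theta> ^^ ?n) u = pa \<chi> u [^]\<^bsub>M\<^esub> int p" if u: "u \<in> carrier M" for u
  proof -
    have "(\<theta> ^^ ?n) u = pa (monom 1 ?n - 1 + smult (int p) \<chi>) u"
      unfolding \<chi>[symmetric] pw[OF u] ..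
    also have "\<dots> = (act (g [^]\<^bsub>G\<^esub> ?n) u \<otimes>\<^bsub>M\<^esub> inv\<^bsub>M\<^esub> u) \<otimes>\<^bsub>M\<^esub> pa \<chi> u [^]\<^bsub>M\<^esub> int p"
      using u by (simp only: pa_add pa_diff pa_smult pa_monom pa_1)
    also have "\<dots> = pa \<chi> u [^]\<^bsub>M\<^esub> int p"
      using u g_order by (simp only: triv_def A.r_inv A.l_one A.int_pow_closed pa_closed)
    finally show ?thesis .
  qed
  thus ?thesis using that by blast
qed

text \<open>If \<open>\<theta>\<close> were onto, so would be its powers; by
  \<open>\<theta>_power\<close> every element would be divisible by p, which is impossible in a
  nonzero lattice.\<close>

lemma \<theta>_not_surj: obtains v where "v \<in> carrier M" "v \<notin> \<theta> ` carrier M"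
proof -
  have "\<not> carrier M \<subseteq> \<theta> ` carrier M"
  proof
    assume surj: "carrier M \<subseteq> \<theta> ` carrier M"
    obtain n \<chi> where n: "\<And>u. u \<in> carrier M \<Longrightarrow> (\<theta> ^^ n) u = pa \<chi> u [^]\<^bsub>M\<^esub> int p"
      using \<theta>_power by blast
    have it: "\<exists>w\<in>carrier M. u = (\<theta> ^^ k) w" if "u \<in> carrier M" for u k
      using that
    proof (induction k arbitrary: u)
      case (Suc k)
      then obtain w where w: "w \<in> carrier M" "u = \<theta> w" using surj by blast
      thus ?case using Suc.IH[OF w(1)] by auto
    qed auto
    have "\<exists>w\<in>carrier M. u = w [^]\<^bsub>M\<^esub> p" if "u \<in> carrier M" for u
      using it[OF that, of n] n pa_closed by (metis int_pow_int)
    hence "carrier M = {\<one>\<^bsub>M\<^esub>}"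
      using not_divisible[of p] prime_gt_1_nat[OF prime_p] by blast
    thus False using nontrivial_M by blast
  qed
  thus ?thesis using that by blast
qed

text \<open>The cokernel of \<open>\<theta>\<close> is cyclic of order p on any \<open>v\<close>
  outside the image. The lattice need not be generated by \<open>v\<close> over the polynomials, so
  the decomposition is proved first in the submodule \<open>N\<close> generated by \<open>v\<close>.
  \<open>N\<close> is closed under division by p, and irreducibility carries the result to the whole
  lattice.\<close>

theorem uniformizer:
  obtains v \<psi> where "v \<in> carrier M" "\<psi> \<in> hom M M"
    and "\<And>u. u \<in> carrier M \<Longrightarrow> \<psi> (\<theta> u) = u [^]\<^bsub>M\<^esub> int p"
    and "\<And>w. w \<in> carrier M \<Longrightarrow> \<exists>c :: int. \<exists>n\<in>carrier M. w = v [^]\<^bsub>M\<^esub> c \<otimes>\<^bsub>M\<^esub> \<theta> n"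
    and "\<And>c :: int. v [^]\<^bsub>M\<^esub> c \<in> \<theta> ` carrier M \<longleftrightarrow> int p dvd c"
proof -
  obtain v where v: "v \<in> carrier M" "v \<notin> \<theta> ` carrier M" by (rule \<theta>_not_surj)
  obtain \<psi> where \<psi>: "\<And>u. u \<in> carrier M \<Longrightarrow> \<theta> (pa \<psi> u) = u [^]\<^bsub>M\<^esub> int p" using p_factors by blast
  obtain m \<chi> where m: "\<And>u. u \<in> carrier M \<Longrightarrow> (\<theta> ^^ m) u = pa \<chi> u [^]\<^bsub>M\<^esub> int p" using \<theta>_power by blast
  let ?I = "\<theta> ` carrier M"
  interpret \<theta>: group_hom M M \<theta> by (intro group_homI A.is_group \<theta>_hom)
  have subI: "subgroup ?I M" by (rule \<theta>.img_is_subgroup)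
  have bez: "\<exists>x y. k * x + int p * y = 1" if "\<not> int p dvd k" for k
  proof -
    have "prime (int p)" using prime_p by simp
    hence "coprime (int p) k" using that by (rule prime_imp_coprime)
    hence "gcd k (int p) = 1" by (simp add: coprime_iff_gcd_eq_1 gcd.commute)
    moreover obtain x y where "x * k + y * int p = gcd k (int p)" using bezout_int by blast
    ultimately have "k * x + int p * y = 1" by (simp add: mult.commute)
    thus ?thesis by blast
  qed
  have pI: "u [^]\<^bsub>M\<^esub> (int p * y) \<in> ?I" if "u \<in> carrier M" for u y
  proof -
    have "u [^]\<^bsub>M\<^esub> (int p * y) = \<theta> (pa \<psi> u [^]\<^bsub>M\<^esub> y)"
      using that by (simp add: \<theta>_pow \<psi> A.int_pow_pow)
    moreover have "pa \<psi> u [^]\<^bsub>M\<^esub> y \<in> carrier M" using that by simp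
    ultimately show ?thesis by (rule image_eqI)
  qed
  have vI: "v [^]\<^bsub>M\<^esub> c \<in> ?I \<longleftrightarrow> int p dvd c" for c :: int
  proof
    assume "int p dvd c"
    then obtain y where "c = int p * y" by (rule dvdE)
    thus "v [^]\<^bsub>M\<^esub> c \<in> ?I" using pI[OF v(1), of y] by simp
  next
    assume L: "v [^]\<^bsub>M\<^esub> c \<in> ?I"
    show "int p dvd c"
    proof (rule ccontr)
      assume "\<not> int p dvd c"
      then obtain x y where "c * x + int p * y = 1" using bez by blast
      hence "v = v [^]\<^bsub>M\<^esub> (c * x + int p * y)" using v(1) by simp
      also have "\<dots> = (v [^]\<^bsub>M\<^esub> c) [^]\<^bsub>M\<^esub> x \<otimes>\<^bsub>M\<^esub> v [^]\<^bsub>M\<^esub> (int p * y)"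
        using v(1) by (simp add: A.int_pow_mult A.int_pow_pow)
      also have "\<dots> \<in> ?I"
        using subgroup.m_closed[OF subI] A.subgroup_int_pow_closed[OF subI L] pI[OF v(1)] by blast
      finally show False using v(2) by simp
    qed
  qed
  define N where "N = (\<lambda>f. pa f v) ` UNIV"
  have NM: "u \<in> carrier M" if "u \<in> N" for u using that v(1) by (auto simp: N_def)
  have subN: "subgroup N M"
  proof (rule A.subgroupI)
    show "inv\<^bsub>M\<^esub> a \<in> N" if a: "a \<in> N" for a
    proof -
      obtain f where "a = pa f v" using a unfolding N_def by blast
      hence "inv\<^bsub>M\<^esub> a = pa (smult (- 1) f) v" using pa_smult[OF v(1), of "- 1" f] v(1) by (simp add: A.int_pow_neg)
      thus ?thesis unfolding N_def by blast
    qed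
    show "a \<otimes>\<^bsub>M\<^esub> b \<in> N" if a: "a \<in> N" and b: "b \<in> N" for a b
    proof -
      obtain f h where "a = pa f v" "b = pa h v" using a b unfolding N_def by blast
      hence "a \<otimes>\<^bsub>M\<^esub> b = pa (f + h) v" using pa_add[OF v(1)] by simp
      thus ?thesis unfolding N_def by blast
    qed
  qed (use NM in \<open>auto simp: N_def\<close>)
  have paN: "pa f u \<in> N" if u: "u \<in> N" for f u
  proof -
    obtain h where "u = pa h v" using u unfolding N_def by blast
    hence "pa f u = pa (f * h) v" using pa_mult[OF v(1)] by simp
    thus ?thesis unfolding N_def by blast
  qed
  \<comment> \<open>Division of the polynomial by X - 1: the remainder is its value at 1.\<close>
  have N_decomp: "\<exists>c :: int. \<exists>n\<in>N. u = v [^]\<^bsub>M\<^esub> c \<otimes>\<^bsub>M\<^esub> \<theta> n" if u: "u \<in> N" for u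
  proof -
    obtain f where f: "u = pa f v" using u unfolding N_def by blast
    have "poly (f - [:poly f 1:]) 1 = 0" by simp
    then obtain h where "f - [:poly f 1:] = [:- 1, 1:] * h" unfolding poly_eq_0_iff_dvd by blast
    hence "f = [:poly f 1:] + [:- 1, 1:] * h" by (simp add: algebra_simps)
    hence "u = pa ([:poly f 1:] + [:- 1, 1:] * h) v" using f by simp
    also have "\<dots> = v [^]\<^bsub>M\<^esub> poly f 1 \<otimes>\<^bsub>M\<^esub> \<theta> (pa h v)"
      using v(1) g by (simp only: pa_add pa_mult \<theta>_pa pa_closed pa_pCons pa_0 act_one_M A.r_one A.int_pow_closed)
    finally show ?thesis unfolding N_def by blast
  qed
  \<comment> \<open>The power of \<open>v\<close> lies in the image of \<open>\<theta>\<close>, so p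
    divides \<open>c\<close>. As p is \<open>\<theta>\<close> after \<open>pa \<psi>\<close>, this
    power is \<open>\<theta>\<close> of an element of \<open>N\<close>, and injectivity of
    \<open>\<theta>\<close> finishes.\<close>
  have \<theta>_pure: "w \<in> N" if w: "w \<in> carrier M" "\<theta> w \<in> N" for w
  proof -
    obtain c n where cn: "n \<in> N" "\<theta> w = v [^]\<^bsub>M\<^esub> (c :: int) \<otimes>\<^bsub>M\<^esub> \<theta> n" using N_decomp[OF w(2)] by blast
    have "v [^]\<^bsub>M\<^esub> c = \<theta> w \<otimes>\<^bsub>M\<^esub> inv\<^bsub>M\<^esub> \<theta> n"
      using cn w(1) v(1) NM[OF cn(1)] by (simp add: A.inv_solve_right)
    also have "\<dots> = \<theta> (w \<otimes>\<^bsub>M\<^esub> inv\<^bsub>M\<^esub> n)" using w(1) NM[OF cn(1)] by simp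
    finally have "v [^]\<^bsub>M\<^esub> c \<in> ?I"
      by (rule image_eqI) (use w(1) NM[OF cn(1)] in simp)
    then obtain y where y: "c = int p * y" unfolding vI by (rule dvdE)
    have "v [^]\<^bsub>M\<^esub> c = \<theta> (pa \<psi> v [^]\<^bsub>M\<^esub> y)"
      using v(1) by (simp add: y \<theta>_pow \<psi> A.int_pow_pow)
    hence "\<theta> w = \<theta> (pa \<psi> v [^]\<^bsub>M\<^esub> y \<otimes>\<^bsub>M\<^esub> n)"
      using cn v(1) NM[OF cn(1)] by (simp add: \<theta>_mult)
    hence "w = pa \<psi> v [^]\<^bsub>M\<^esub> y \<otimes>\<^bsub>M\<^esub> n"
      by (rule \<theta>_cancel[rotated 2]) (use w(1) v(1) NM[OF cn(1)] in simp_all)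
    moreover have "pa \<psi> v \<in> N" unfolding N_def by blast
    ultimately show ?thesis
      using subgroup.m_closed[OF subN A.subgroup_int_pow_closed[OF subN] cn(1)] by simp
  qed
  \<comment> \<open>A power of \<open>\<theta>\<close> sends \<open>w\<close> to a polynomial in
    \<open>g\<close> applied to the p-th power of \<open>w\<close>, so into \<open>N\<close>;
    \<open>\<theta>_pure\<close> then descends one factor at a time.\<close>
  have p_pure: "w \<in> N" if w: "w \<in> carrier M" "w [^]\<^bsub>M\<^esub> int p \<in> N" for w
  proof -
    have "(\<theta> ^^ m) w = pa \<chi> (w [^]\<^bsub>M\<^esub> int p)" using m[OF w(1)] pa_pow[OF w(1)] by simp
    hence "(\<theta> ^^ m) w \<in> N" using paN[OF w(2), of \<chi>] by simp
    moreover have "(\<theta> ^^ k) w \<in> N \<Longrightarrow> w \<in> N" for k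
    proof (induction k)
      case (Suc k)
      have "(\<theta> ^^ k) w \<in> carrier M" using w(1) by (induction k) auto
      from \<theta>_pure[OF this] show ?case using Suc by simp
    qed simp
    ultimately show ?thesis by blast
  qed
  \<comment> \<open>The saturation of \<open>N\<close> is pure and stable under \<open>G\<close>,
    and contains \<open>v\<close>; by irreducibility it is the whole lattice, so every element has a
    nonzero multiple in \<open>N\<close>.\<close>
  define Sat where "Sat = {w \<in> carrier M. \<exists>k :: int. k \<noteq> 0 \<and> w [^]\<^bsub>M\<^esub> k \<in> N}"
  have "Sat = {\<one>\<^bsub>M\<^esub>} \<or> Sat = carrier M"
  proof (rule irreducible_pure[OF irr])
    show "subgroup Sat M"
    proof (rule A.subgroupI)
      have "\<one>\<^bsub>M\<^esub> \<in> Sat" using subgroup.one_closed[OF subN] by (auto simp: Sat_def intro: exI[of _ 1])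
      thus "Sat \<noteq> {}" by blast
      show "inv\<^bsub>M\<^esub> a \<in> Sat" if "a \<in> Sat" for a
        using that subgroup.m_inv_closed[OF subN] by (auto simp: Sat_def A.int_pow_inv)
      show "a \<otimes>\<^bsub>M\<^esub> b \<in> Sat" if ab: "a \<in> Sat" "b \<in> Sat" for a b
      proof -
        obtain k l where kl: "k \<noteq> 0" "a [^]\<^bsub>M\<^esub> (k :: int) \<in> N" "l \<noteq> 0" "b [^]\<^bsub>M\<^esub> (l :: int) \<in> N"
          "a \<in> carrier M" "b \<in> carrier M" using ab by (auto simp: Sat_def)
        have "(a \<otimes>\<^bsub>M\<^esub> b) [^]\<^bsub>M\<^esub> (k * l) = (a [^]\<^bsub>M\<^esub> k) [^]\<^bsub>M\<^esub> l \<otimes>\<^bsub>M\<^esub> (b [^]\<^bsub>M\<^esub> l) [^]\<^bsub>M\<^esub> k"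
          using kl by (simp add: A.int_pow_distrib A.int_pow_pow mult.commute)
        hence "(a \<otimes>\<^bsub>M\<^esub> b) [^]\<^bsub>M\<^esub> (k * l) \<in> N"
          using kl subgroup.m_closed[OF subN A.subgroup_int_pow_closed[OF subN] A.subgroup_int_pow_closed[OF subN]] by simp
        thus ?thesis using kl by (auto simp: Sat_def intro!: exI[of _ "k * l"])
      qed
    qed (auto simp: Sat_def)
    show "act h u \<in> Sat" if h: "h \<in> carrier G" and u: "u \<in> Sat" for h u
    proof -
      obtain k where k: "k \<noteq> 0" "u [^]\<^bsub>M\<^esub> (k :: int) \<in> N" "u \<in> carrier M" using u by (auto simp: Sat_def)
      obtain j :: nat where j: "\<forall>u\<in>carrier M. act h u = act (g [^]\<^bsub>G\<^esub> j) u" using g_gen[OF h] by blast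
      have "act h u [^]\<^bsub>M\<^esub> k = pa (monom 1 j) (u [^]\<^bsub>M\<^esub> k)"
        using k(3) act_pow_M[OF h k(3), of k] j by (simp add: pa_monom)
      thus ?thesis using paN[OF k(2)] k h by (auto simp: Sat_def)
    qed
    show "u \<in> Sat" if u: "u \<in> carrier M" and k: "k \<noteq> 0" "u [^]\<^bsub>M\<^esub> k \<in> Sat" for u and k :: int
    proof -
      obtain l :: int where l: "l \<noteq> 0" "(u [^]\<^bsub>M\<^esub> k) [^]\<^bsub>M\<^esub> l \<in> N" using k(2) by (auto simp: Sat_def)
      thus ?thesis using u k(1) by (auto simp: Sat_def A.int_pow_pow intro!: exI[of _ "k * l"])
    qed
  qed
  moreover have "v \<in> Sat" unfolding Sat_def N_def using v(1)
    by (auto intro!: exI[of _ 1] range_eqI[of _ _ 1])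
  moreover have "v \<noteq> \<one>\<^bsub>M\<^esub>" using v(2) subgroup.one_closed[OF subI] by blast
  ultimately have Sat: "Sat = carrier M" by blast
  have "\<exists>c :: int. \<exists>n\<in>carrier M. w = v [^]\<^bsub>M\<^esub> c \<otimes>\<^bsub>M\<^esub> \<theta> n" if w: "w \<in> carrier M" for w
  proof -
    have "\<exists>k. k \<noteq> 0 \<and> w [^]\<^bsub>M\<^esub> int k \<in> N"
    proof -
      obtain k :: int where k: "k \<noteq> 0" "w [^]\<^bsub>M\<^esub> k \<in> N" using w Sat by (auto simp: Sat_def)
      show ?thesis
      proof (cases "k > 0")
        case True
        thus ?thesis using k by (intro exI[of _ "nat k"]) simp
      next
        case False
        have "w [^]\<^bsub>M\<^esub> (- k) \<in> N" using subgroup.m_inv_closed[OF subN k(2)] w by (simp add: A.int_pow_neg)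
        thus ?thesis using False k(1) by (intro exI[of _ "nat (- k)"]) simp
      qed
    qed
    \<comment> \<open>By \<open>p_pure\<close> the least such multiple is prime to p. A Bezout
      relation then recovers \<open>w\<close> from its k-th power, which lies in \<open>N\<close>,
      and its p-th power, which lies in the image of \<open>\<theta>\<close>.\<close>
    define k where "k = (LEAST k. k \<noteq> 0 \<and> w [^]\<^bsub>M\<^esub> int k \<in> N)"
    have k: "k \<noteq> 0" "w [^]\<^bsub>M\<^esub> int k \<in> N" using LeastI_ex[OF \<open>\<exists>k. k \<noteq> 0 \<and> w [^]\<^bsub>M\<^esub> int k \<in> N\<close>] by (auto simp: k_def)
    have "\<not> int p dvd int k"
    proof
      assume "int p dvd int k"
      then obtain l where l: "k = l * p" by (metis dvdE int_dvd_int_iff mult.commute)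
      have "(w [^]\<^bsub>M\<^esub> int l) [^]\<^bsub>M\<^esub> int p \<in> N" using k(2) w by (simp add: A.int_pow_pow l)
      hence "w [^]\<^bsub>M\<^esub> int l \<in> N" using p_pure w by simp
      hence "k \<le> l" unfolding k_def using k(1) l by (intro Least_le) auto
      thus False using k(1) l prime_gt_1_nat[OF prime_p] by simp
    qed
    then obtain x y where xy: "int k * x + int p * y = 1" using bez by blast
    obtain c n where cn: "n \<in> N" "w [^]\<^bsub>M\<^esub> int k = v [^]\<^bsub>M\<^esub> (c :: int) \<otimes>\<^bsub>M\<^esub> \<theta> n" using N_decomp[OF k(2)] by blast
    have nM: "n \<in> carrier M" by (rule NM[OF cn(1)])
    have "w = w [^]\<^bsub>M\<^esub> (int k * x + int p * y)" using w by (simp add: xy)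
    also have "\<dots> = (w [^]\<^bsub>M\<^esub> int k) [^]\<^bsub>M\<^esub> x \<otimes>\<^bsub>M\<^esub> (w [^]\<^bsub>M\<^esub> int p) [^]\<^bsub>M\<^esub> y"
      using w by (simp add: A.int_pow_mult A.int_pow_pow)
    also have "\<dots> = (v [^]\<^bsub>M\<^esub> c \<otimes>\<^bsub>M\<^esub> \<theta> n) [^]\<^bsub>M\<^esub> x \<otimes>\<^bsub>M\<^esub> (\<theta> (pa \<psi> w)) [^]\<^bsub>M\<^esub> y"
      using w by (simp add: cn(2) \<psi>)
    also have "\<dots> = v [^]\<^bsub>M\<^esub> (c * x) \<otimes>\<^bsub>M\<^esub> \<theta> (n [^]\<^bsub>M\<^esub> x \<otimes>\<^bsub>M\<^esub> pa \<psi> w [^]\<^bsub>M\<^esub> y)"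
      using w v(1) nM by (simp add: A.int_pow_distrib A.int_pow_pow \<theta>_mult \<theta>_pow A.m_assoc)
    finally have "w = v [^]\<^bsub>M\<^esub> (c * x) \<otimes>\<^bsub>M\<^esub> \<theta> (n [^]\<^bsub>M\<^esub> x \<otimes>\<^bsub>M\<^esub> pa \<psi> w [^]\<^bsub>M\<^esub> y)" .
    moreover have "n [^]\<^bsub>M\<^esub> x \<otimes>\<^bsub>M\<^esub> pa \<psi> w [^]\<^bsub>M\<^esub> y \<in> carrier M" using w nM by simp
    ultimately show ?thesis by blast
  qed
  moreover have "pa \<psi> (\<theta> u) = u [^]\<^bsub>M\<^esub> int p" if "u \<in> carrier M" for u
    using pa_\<theta>[OF that] \<psi>[OF that] by simp
  ultimately show ?thesis using that[OF v(1) pa_hom[of \<psi>] _ _ vI] by blast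
qed

text \<open>Each \<open>h\<close> acts as a power of \<open>g\<close>, and X^k - 1 is divisible by X
  - 1; thus \<open>G\<close> acts trivially on the cokernel of \<open>\<theta>\<close>.\<close>

lemma act_cong_\<theta>:
  assumes h: "h \<in> carrier G" and u: "u \<in> carrier M"
  shows "act h u \<otimes>\<^bsub>M\<^esub> inv\<^bsub>M\<^esub> u \<in> \<theta> ` carrier M"
proof -
  obtain k :: nat where k: "act h u = act (g [^]\<^bsub>G\<^esub> k) u" using g_gen[OF h] u by blast
  have "poly (monom 1 k - 1 :: int poly) 1 = 0" by (simp add: poly_monom)
  then obtain f :: "int poly" where "monom 1 k - 1 = [:- 1, 1:] * f" unfolding poly_eq_0_iff_dvd by blast
  hence "pa (monom 1 k - 1) u = pa ([:- 1, 1:] * f) u" by simp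
  hence "act h u \<otimes>\<^bsub>M\<^esub> inv\<^bsub>M\<^esub> u = \<theta> (pa f u)"
    using u k by (simp only: pa_diff pa_monom pa_1 pa_mult \<theta>_pa pa_closed)
  thus ?thesis using u by (metis imageI pa_closed)
qed

end

section \<open>Elementary abelian groups and the exponents\<close>

text \<open>An embedding of a power of Z/p is enlarged by one coordinate at a time, using an element
  outside the current image, which exists as long as the order is too small. After k steps the
  orders agree.\<close>

theorem elementary_abelian_iso:
  assumes H: "comm_group H" and fin: "finite (carrier H)" and p: "prime p"
    and exp: "\<And>x. x \<in> carrier H \<Longrightarrow> x [^]\<^bsub>H\<^esub> p = \<one>\<^bsub>H\<^esub>" and card: "card (carrier H) = p ^ k"
  shows "H \<cong> product_group {..<k} (\<lambda>_. integer_mod_group p)"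
proof -
  interpret H: comm_group H by fact
  have p0: "p > 0" using p prime_gt_0_nat by blast
  have Zc: "carrier (integer_mod_group p) = {0..<int p}" using p0 by (simp add: carrier_integer_mod_group)
  let ?P = "\<lambda>j :: nat. product_group {..<j} (\<lambda>_. integer_mod_group p)"
  have grpP: "group (?P j)" for j by simp
  have cardP: "card (carrier (?P j)) = p ^ j" for j
    by (simp add: card_PiE Zc)
  have expi: "x [^]\<^bsub>H\<^esub> (int p * z) = \<one>\<^bsub>H\<^esub>" if "x \<in> carrier H" for x z
    using exp[OF that] that by (simp add: int_pow_int flip: H.int_pow_pow)
  have pow_mod: "x [^]\<^bsub>H\<^esub> (a mod int p) = x [^]\<^bsub>H\<^esub> a" if "x \<in> carrier H" for x and a :: int
  proof -
    have "x [^]\<^bsub>H\<^esub> a = x [^]\<^bsub>H\<^esub> (int p * (a div int p) + a mod int p)" by simp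
    also have "\<dots> = x [^]\<^bsub>H\<^esub> (a mod int p)"
      using that expi[OF that] by (simp only: H.int_pow_mult H.l_one H.int_pow_closed)
    finally show ?thesis ..
  qed
  have "\<exists>\<Phi>\<in>hom (?P j) H. inj_on \<Phi> (carrier (?P j))" if "j \<le> k" for j
    using that
  proof (induction j)
    case 0
    show ?case
      by (intro bexI[of _ "\<lambda>_. \<one>\<^bsub>H\<^esub>"]) (auto intro!: homI)
  next
    case (Suc j)
    then obtain \<Phi> where \<Phi>: "\<Phi> \<in> hom (?P j) H" "inj_on \<Phi> (carrier (?P j))" by auto
    interpret h: group_hom "?P j" H \<Phi> by (intro group_homI grpP H.is_group \<Phi>)
    let ?S = "\<Phi> ` carrier (?P j)"
    have subS: "subgroup ?S H" by (rule h.img_is_subgroup)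
    have "card ?S = p ^ j" using card_image[OF \<Phi>(2)] cardP by simp
    hence "card ?S < card (carrier H)"
      using card Suc.prems prime_gt_1_nat[OF p] by simp
    hence "?S \<noteq> carrier H" by auto
    then obtain y where y: "y \<in> carrier H" "y \<notin> ?S" using subgroup.subset[OF subS] by blast
    define \<Phi>' where "\<Phi>' f = \<Phi> (restrict f {..<j}) \<otimes>\<^bsub>H\<^esub> y [^]\<^bsub>H\<^esub> (f j)" for f :: "nat \<Rightarrow> int"
    have res: "restrict f {..<j} \<in> carrier (?P j)" if "f \<in> carrier (?P (Suc j))" for f
      using that by (simp add: PiE_iff)
    have hom: "\<Phi>' \<in> hom (?P (Suc j)) H"
    proof (rule homI)
      fix f f' assume f: "f \<in> carrier (?P (Suc j))" "f' \<in> carrier (?P (Suc j))"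
      have "restrict (f \<otimes>\<^bsub>?P (Suc j)\<^esub> f') {..<j} = restrict f {..<j} \<otimes>\<^bsub>?P j\<^esub> restrict f' {..<j}"
        by (auto simp: fun_eq_iff)
      moreover have "(f \<otimes>\<^bsub>?P (Suc j)\<^esub> f') j = (f j + f' j) mod int p"
        by (simp add: mult_integer_mod_group)
      moreover have "\<Phi> (restrict f {..<j}) \<in> carrier H" "\<Phi> (restrict f' {..<j}) \<in> carrier H"
        using res[OF f(1)] res[OF f(2)] h.hom_closed by blast+
      ultimately show "\<Phi>' (f \<otimes>\<^bsub>?P (Suc j)\<^esub> f') = \<Phi>' f \<otimes>\<^bsub>H\<^esub> \<Phi>' f'"
        using h.hom_mult[OF res[OF f(1)] res[OF f(2)]] y(1)
        by (simp add: \<Phi>'_def pow_mod H.int_pow_mult H.m_ac del: mult_product_group)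
    qed (use res y(1) h.hom_closed in \<open>auto simp: \<Phi>'_def simp del: carrier_product_group\<close>)
    interpret h': group_hom "?P (Suc j)" H \<Phi>' by (intro group_homI grpP H.is_group hom)
    have "f = \<one>\<^bsub>?P (Suc j)\<^esub>" if f: "f \<in> carrier (?P (Suc j))" "\<Phi>' f = \<one>\<^bsub>H\<^esub>" for f
    proof -
      have \<Phi>c: "\<Phi> (restrict f {..<j}) \<in> ?S" "\<Phi> (restrict f {..<j}) \<in> carrier H"
        using res[OF f(1)] h.hom_closed by blast+
      have "y [^]\<^bsub>H\<^esub> (f j) = inv\<^bsub>H\<^esub> \<Phi> (restrict f {..<j})"
        using f(2) y(1) \<Phi>c(2) unfolding \<Phi>'_def
        by (metis H.int_pow_closed H.inv_equality H.inv_inv)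
      hence yS: "y [^]\<^bsub>H\<^esub> (f j) \<in> ?S" using subgroup.m_inv_closed[OF subS \<Phi>c(1)] by simp
      have fj: "0 \<le> f j" "f j < int p" using f(1) by (auto simp: Zc PiE_iff)
      \<comment> \<open>If \<open>f j\<close> were prime to p, a Bezout relation would express
        \<open>y\<close> itself through its power in the image, against the choice of
        \<open>y\<close>.\<close>
      have fj0: "f j = 0"
      proof (rule ccontr)
        assume "f j \<noteq> 0"
        hence "\<not> int p dvd f j" using fj zdvd_not_zless[of "f j" "int p"] by simp
        moreover have "prime (int p)" using p by simp
        ultimately have "coprime (int p) (f j)" by (intro prime_imp_coprime)
        hence "gcd (f j) (int p) = 1" by (simp add: coprime_iff_gcd_eq_1 gcd.commute)
        moreover obtain x z where "x * f j + z * int p = gcd (f j) (int p)" using bezout_int by blast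
        ultimately have xz: "f j * x + int p * z = 1" by (simp add: mult.commute)
        have "y = y [^]\<^bsub>H\<^esub> (f j * x + int p * z)" using y(1) by (simp add: xz)
        also have "\<dots> = (y [^]\<^bsub>H\<^esub> f j) [^]\<^bsub>H\<^esub> x"
          using y(1) expi[OF y(1)] by (simp add: H.int_pow_mult H.int_pow_pow)
        also have "\<dots> \<in> ?S" by (rule H.subgroup_int_pow_closed[OF subS yS])
        finally show False using y(2) by simp
      qed
      hence "\<Phi> (restrict f {..<j}) = \<one>\<^bsub>H\<^esub>" using f(2) \<Phi>c(2) by (simp add: \<Phi>'_def)
      hence "restrict f {..<j} = \<one>\<^bsub>?P j\<^esub>"
        using inj_onD[OF \<Phi>(2), of "restrict f {..<j}" "\<one>\<^bsub>?P j\<^esub>"] res[OF f(1)] h.hom_one h.G.one_closed by simp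
      hence r: "restrict f {..<j} i = \<one>\<^bsub>?P j\<^esub> i" for i by simp
      have "f i = 0" if "i < j" for i using r[of i] that by simp
      hence fi: "f i = 0" if "i < Suc j" for i using fj0 that by (auto simp: less_Suc_eq)
      show ?thesis
      proof
        fix i show "f i = \<one>\<^bsub>?P (Suc j)\<^esub> i"
          using f(1) fi[of i] by (cases "i < Suc j") (auto simp: PiE_iff extensional_def)
      qed
    qed
    hence "inj_on \<Phi>' (carrier (?P (Suc j)))" unfolding h'.inj_on_one_iff by blast
    thus ?case using hom by blast
  qed
  then obtain \<Phi> where \<Phi>: "\<Phi> \<in> hom (?P k) H" "inj_on \<Phi> (carrier (?P k))" by blast
  have "\<Phi> ` carrier (?P k) = carrier H"
  proof (rule card_subset_eq[OF fin])
    show "\<Phi> ` carrier (?P k) \<subseteq> carrier H" using \<Phi>(1) by (auto simp: hom_def simp del: carrier_product_group)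
    show "card (\<Phi> ` carrier (?P k)) = card (carrier H)" using card_image[OF \<Phi>(2)] cardP card by simp
  qed
  hence "\<Phi> \<in> iso (?P k) H" using \<Phi> by (simp add: iso_def bij_betw_def)
  hence "?P k \<cong> H" by (rule is_isoI)
  thus ?thesis using group.iso_sym[OF grpP] by blast
qed

text \<open>The sign in front of the partial sum alternates, so the common part of two consecutive
  values cancels and only the last summand stays, up to sign a binomial coefficient. The case
  \<open>k = 0\<close> uses the empty sum at -1.\<close>

lemma nu_recursion:
  assumes "s \<ge> 1"
  shows "nat \<lfloor>nu (int k - 1) s\<rfloor> + nat \<lfloor>nu (int k) s\<rfloor> = (s + k - 1) choose k"
proof -
  have "nu (int k - 1) s + nu (int k) s = of_nat ((s + k - 1) choose k)"
  proof (cases k)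
    case 0
    thus ?thesis by (simp add: nu_def)
  next
    case (Suc j)
    have "nu (int k - 1) s = - ((- 1) ^ k * (\<Sum>i<k. (- of_nat s) gchoose i))"
    proof -
      have "int k - 1 = int j" "nat (int j + 1) = k" using Suc by simp_all
      thus ?thesis by (simp only: nu_def nat_int Suc power_Suc)
    qed
    moreover have "nu (int k) s = (- 1) ^ k * (\<Sum>i<k. (- of_nat s) gchoose i) + (- 1) ^ k * ((- of_nat s) gchoose k)"
    proof -
      have "nat (int k + 1) = Suc k" by simp
      thus ?thesis by (simp only: nu_def nat_int sum.lessThan_Suc distrib_left)
    qed
    ultimately show ?thesis using minus_one_power_gchoose[OF assms, of k] by simp
  qed
  moreover have "of_nat (nat \<lfloor>nu (int k - 1) s\<rfloor>) = nu (int k - 1) s" "of_nat (nat \<lfloor>nu (int k) s\<rfloor>) = nu (int k) s"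
    using of_nat_nu[OF assms] by simp_all
  ultimately have "(of_nat (nat \<lfloor>nu (int k - 1) s\<rfloor> + nat \<lfloor>nu (int k) s\<rfloor>) :: rat) = of_nat ((s + k - 1) choose k)"
    by simp
  thus ?thesis unfolding of_nat_eq_iff .
qed

text \<open>From the value at 0 each equation determines the next order after cancelling a power of
  p, once going up and once going down. The second family is indexed by degree -k-1, whose weight is
  k.\<close>

lemma orders_from_recursion:
  fixes F :: "int \<Rightarrow> nat"
  assumes s: "s \<ge> 1" and p: "p > 1" and F0: "F 0 = 1"
    and pos: "\<And>k. F (int k) * F (int k + 1) = p ^ ((s + k - 1) choose k)"
    and neg: "\<And>k. F (- int k - 1) * F (- int k) = p ^ ((s + k - 1) choose k)"
  shows "F n = p ^ nat \<lfloor>nu (\<bar>n\<bar> - 1) s\<rfloor>"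
proof -
  let ?\<nu> = "\<lambda>k. nat \<lfloor>nu (int k - 1) s\<rfloor>"
  have \<nu>: "?\<nu> k + ?\<nu> (Suc k) = (s + k - 1) choose k" for k
    using nu_recursion[OF s, of k] by simp
  have step: "x = p ^ ?\<nu> (Suc k)" if "p ^ ?\<nu> k * x = p ^ ((s + k - 1) choose k)" for x k
    using that p unfolding \<nu>[symmetric] power_add by simp
  have \<nu>0: "?\<nu> 0 = 0" by (simp add: nu_def)
  have P: "F (int k) = p ^ ?\<nu> k" for k
  proof (induction k)
    case 0
    thus ?case using \<nu>0 F0 by simp
  next
    case (Suc k)
    thus ?case using step[of k "F (int k + 1)"] pos[of k] by (simp add: add.commute)
  qed
  have N: "F (- int k) = p ^ ?\<nu> k" for k
  proof (induction k)
    case 0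
    thus ?case using \<nu>0 F0 by simp
  next
    case (Suc k)
    have "- int (Suc k) = - int k - 1" by simp
    thus ?case using Suc step[of k "F (- int k - 1)"] neg[of k] by (simp only: mult.commute)
  qed
  show ?thesis
    using P[of "nat n"] N[of "nat (- n)"] by (cases "n \<ge> 0") simp_all
qed

section \<open>The dual module\<close>

definition qz :: "rat \<Rightarrow> rat set" where "qz r = \<int> #>\<^bsub>rat_group\<^esub> r"

lemma subgroup_Ints: "subgroup \<int> rat_group"
  using comm_group_rat_group by (intro group.subgroupI) (auto simp: comm_group_def)

lemma comm_group_rat_mod_int: "comm_group rat_mod_int"
  unfolding rat_mod_int_def by (rule comm_group.abelian_FactGroup[OF comm_group_rat_group subgroup_Ints])

lemma qz_hom: "qz \<in> hom rat_group rat_mod_int"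
  unfolding qz_def[abs_def] rat_mod_int_def
  by (rule normal.r_coset_hom_Mod[OF comm_group.subgroup_imp_normal[OF comm_group_rat_group subgroup_Ints]])

lemma qz_closed: "qz r \<in> carrier rat_mod_int"
  using qz_hom by (simp add: hom_def Pi_iff)

lemma qz_add: "qz (r + t) = qz r \<otimes>\<^bsub>rat_mod_int\<^esub> qz t"
  using hom_mult[OF qz_hom, of r t] by simp

lemma carrier_rat_mod_int: "carrier rat_mod_int = range qz"
  by (simp add: rat_mod_int_def carrier_FactGroup qz_def)

lemma qz_eq_iff: "qz r = qz t \<longleftrightarrow> r - t \<in> \<int>"
  unfolding qz_def using comm_group.coset_eq_iff[OF comm_group_rat_group subgroup_Ints, of r t] by simp

lemma qz_pow: "qz r [^]\<^bsub>rat_mod_int\<^esub> (k :: int) = qz (of_int k * r)"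
  using hom_int_pow[OF qz_hom, of r k] comm_group_rat_group comm_group_rat_mod_int
  by (simp add: comm_group_def)

lemma one_rat_mod_int: "\<one>\<^bsub>rat_mod_int\<^esub> = qz 0"
  using group_hom.hom_one[OF group_homI[OF _ _ qz_hom]] comm_group_rat_group comm_group_rat_mod_int
  by (simp add: comm_group_def)

context G_module
begin

lemma dual_iff: "f \<in> carrier (dual_module A) \<longleftrightarrow> f \<in> hom A rat_mod_int \<and> f \<in> extensional (carrier A)"
  by (simp add: dual_module_def)

lemma dual_mult: "f \<otimes>\<^bsub>dual_module A\<^esub> f' = (\<lambda>u\<in>carrier A. f u \<otimes>\<^bsub>rat_mod_int\<^esub> f' u)"
  by (simp add: dual_module_def)

lemma dual_one: "\<one>\<^bsub>dual_module A\<^esub> = (\<lambda>u\<in>carrier A. \<one>\<^bsub>rat_mod_int\<^esub>)"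
  by (simp add: dual_module_def)

lemma dual_closed: "f \<in> carrier (dual_module A) \<Longrightarrow> u \<in> carrier A \<Longrightarrow> f u \<in> carrier rat_mod_int"
  by (auto simp: dual_iff hom_def)

lemma dual_hom: "f \<in> carrier (dual_module A) \<Longrightarrow> u \<in> carrier A \<Longrightarrow> v \<in> carrier A \<Longrightarrow>
    f (u \<otimes>\<^bsub>A\<^esub> v) = f u \<otimes>\<^bsub>rat_mod_int\<^esub> f v"
  by (auto simp: dual_iff hom_def)

lemma dual_eqI:
  "f \<in> carrier (dual_module A) \<Longrightarrow> f' \<in> carrier (dual_module A) \<Longrightarrow> (\<And>u. u \<in> carrier A \<Longrightarrow> f u = f' u) \<Longrightarrow> f = f'"
  by (rule extensionalityI[of _ "carrier A"]) (auto simp: dual_iff)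

lemma dual_restrictI:
  assumes "\<And>u. u \<in> carrier A \<Longrightarrow> f u \<in> carrier rat_mod_int"
    and "\<And>u v. u \<in> carrier A \<Longrightarrow> v \<in> carrier A \<Longrightarrow> f (u \<otimes>\<^bsub>A\<^esub> v) = f u \<otimes>\<^bsub>rat_mod_int\<^esub> f v"
  shows "(\<lambda>u\<in>carrier A. f u) \<in> carrier (dual_module A)"
  using assms by (auto simp: dual_iff intro!: homI)

lemma comm_group_dual: "comm_group (dual_module A)"
proof -
  interpret Q: comm_group rat_mod_int by (rule comm_group_rat_mod_int)
  show ?thesis
  proof (rule comm_groupI)
    fix f f' assume f: "f \<in> carrier (dual_module A)" and f': "f' \<in> carrier (dual_module A)"
    show "f \<otimes>\<^bsub>dual_module A\<^esub> f' \<in> carrier (dual_module A)"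
      unfolding dual_mult
      using f f' dual_closed by (intro dual_restrictI) (auto simp: dual_hom Q.m_ac)
    show "f \<otimes>\<^bsub>dual_module A\<^esub> f' = f' \<otimes>\<^bsub>dual_module A\<^esub> f"
      unfolding dual_mult using f f' dual_closed by (intro restrict_ext) (simp add: Q.m_comm)
  next
    show "\<one>\<^bsub>dual_module A\<^esub> \<in> carrier (dual_module A)"
      unfolding dual_one by (intro dual_restrictI) auto
  next
    fix f g h assume "f \<in> carrier (dual_module A)" "g \<in> carrier (dual_module A)" "h \<in> carrier (dual_module A)"
    thus "f \<otimes>\<^bsub>dual_module A\<^esub> g \<otimes>\<^bsub>dual_module A\<^esub> h = f \<otimes>\<^bsub>dual_module A\<^esub> (g \<otimes>\<^bsub>dual_module A\<^esub> h)"
      unfolding dual_mult using dual_closed by (intro restrict_ext) (simp add: Q.m_assoc)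
  next
    fix f assume f: "f \<in> carrier (dual_module A)"
    have "(\<lambda>u\<in>carrier A. inv\<^bsub>rat_mod_int\<^esub> f u) \<in> carrier (dual_module A)"
      using f dual_closed by (intro dual_restrictI) (auto simp: dual_hom Q.inv_mult)
    moreover have "(\<lambda>u\<in>carrier A. inv\<^bsub>rat_mod_int\<^esub> f u) \<otimes>\<^bsub>dual_module A\<^esub> f = \<one>\<^bsub>dual_module A\<^esub>"
      unfolding dual_mult dual_one using f dual_closed by (intro restrict_ext) (simp add: Q.l_inv)
    ultimately show "\<exists>y\<in>carrier (dual_module A). y \<otimes>\<^bsub>dual_module A\<^esub> f = \<one>\<^bsub>dual_module A\<^esub>" by blast
    have "\<one>\<^bsub>dual_module A\<^esub> \<in> carrier (dual_module A)"
      unfolding dual_one by (intro dual_restrictI) auto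
    thus "\<one>\<^bsub>dual_module A\<^esub> \<otimes>\<^bsub>dual_module A\<^esub> f = f"
      using f dual_closed unfolding dual_mult dual_one
      by (auto simp: fun_eq_iff dual_iff extensional_def)
  qed
qed

lemma dual_inv:
  assumes f: "f \<in> carrier (dual_module A)" and u: "u \<in> carrier A"
  shows "(inv\<^bsub>dual_module A\<^esub> f) u = inv\<^bsub>rat_mod_int\<^esub> f u"
proof -
  interpret Q: comm_group rat_mod_int by (rule comm_group_rat_mod_int)
  interpret D: comm_group "dual_module A" by (rule comm_group_dual)
  have "(inv\<^bsub>dual_module A\<^esub> f \<otimes>\<^bsub>dual_module A\<^esub> f) u = \<one>\<^bsub>dual_module A\<^esub> u"
    using f by (simp add: D.l_inv)
  hence "(inv\<^bsub>dual_module A\<^esub> f) u \<otimes>\<^bsub>rat_mod_int\<^esub> f u = \<one>\<^bsub>rat_mod_int\<^esub>"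
    using u by (simp add: dual_mult dual_one)
  thus ?thesis using dual_closed[OF f u] dual_closed[OF D.inv_closed[OF f] u] by (rule Q.inv_equality[symmetric])
qed

lemma act_inv_closed: "g \<in> carrier G \<Longrightarrow> u \<in> carrier A \<Longrightarrow> act (inv\<^bsub>G\<^esub> g) u \<in> carrier A"
  using act_hom[of "inv\<^bsub>G\<^esub> g"] by (auto simp: hom_def)

lemma dual_act_closed:
  assumes "g \<in> carrier G" "f \<in> carrier (dual_module A)"
  shows "dual_act G A act g f \<in> carrier (dual_module A)"
  unfolding dual_act_def
  using assms act_inv_closed dual_closed hom_mult[OF act_hom[of "inv\<^bsub>G\<^esub> g"]]
  by (intro dual_restrictI) (auto simp: dual_hom)

lemma G_module_dual: "G_module G (dual_module A) (dual_act G A act)"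
proof (intro G_module.intro G_module_axioms.intro G.is_group comm_group_dual)
  fix g assume g: "g \<in> carrier G"
  show "dual_act G A act g \<in> hom (dual_module A) (dual_module A)"
    using dual_act_closed[OF g] act_inv_closed[OF g]
    by (intro homI) (auto simp: dual_act_def dual_mult intro!: restrict_ext)
next
  fix f assume "f \<in> carrier (dual_module A)"
  thus "dual_act G A act \<one>\<^bsub>G\<^esub> f = f"
    using act_one by (auto simp: dual_act_def fun_eq_iff dual_iff extensional_def)
next
  fix g h f assume g: "g \<in> carrier G" "h \<in> carrier G" and f: "f \<in> carrier (dual_module A)"
  show "dual_act G A act (g \<otimes>\<^bsub>G\<^esub> h) f = dual_act G A act g (dual_act G A act h f)"
    using g act_inv_closed by (auto simp: dual_act_def fun_eq_iff G.inv_mult_group act_mult)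
qed

end

text \<open>Since Q/Z is divisible and the lattice is free, the values on a basis can be divided by
  \<open>n\<close> and extended.\<close>

lemma (in G_lattice) dual_divisible:
  assumes f: "f \<in> carrier (dual_module M)" and n: "n > 0"
  obtains f' where "f' \<in> carrier (dual_module M)" "\<And>u. u \<in> carrier M \<Longrightarrow> f' u [^]\<^bsub>rat_mod_int\<^esub> (n :: int) = f u"
proof -
  interpret Q: comm_group rat_mod_int by (rule comm_group_rat_mod_int)
  obtain \<phi> and S :: "nat set" where \<phi>: "\<phi> \<in> hom M (free_Abelian_group S)" "inj_on \<phi> (carrier M)"
    "\<phi> ` carrier M = carrier (free_Abelian_group S)"
    using basis_iso by metis
  interpret h: group_hom M "free_Abelian_group S" \<phi>
    using \<phi>(1) by (intro group_homI A.is_group) auto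
  have iso: "\<phi> \<in> iso M (free_Abelian_group S)" using \<phi> by (simp add: iso_def bij_betw_def)
  define k where "k = inv_into (carrier M) \<phi>"
  have k: "k \<in> hom (free_Abelian_group S) M"
    using A.iso_set_sym[OF iso] by (simp add: k_def iso_def)
  have k\<phi>: "k (\<phi> u) = u" if "u \<in> carrier M" for u
    using that \<phi>(2) by (simp add: k_def inv_into_f_f)
  have div: "\<exists>y\<in>carrier rat_mod_int. y [^]\<^bsub>rat_mod_int\<^esub> n = x" if x: "x \<in> carrier rat_mod_int" for x
  proof -
    obtain t where "x = qz t" using x by (auto simp: carrier_rat_mod_int)
    hence "qz (t / of_int n) [^]\<^bsub>rat_mod_int\<^esub> n = x" using n by (simp add: qz_pow)
    thus ?thesis using qz_closed by blast
  qed
  have fk: "(\<lambda>c. f (k c)) \<in> hom (free_Abelian_group S) rat_mod_int"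
    using hom_compose[OF k, of f rat_mod_int] f by (simp add: dual_iff o_def)
  have "\<exists>y. y \<in> carrier rat_mod_int \<and> y [^]\<^bsub>rat_mod_int\<^esub> n = f (k (frag_of b))" if "b \<in> S" for b
    using div hom_in_carrier[OF fk, of "frag_of b"] that by auto
  then obtain y where y: "\<And>b. b \<in> S \<Longrightarrow> y b \<in> carrier rat_mod_int" "\<And>b. b \<in> S \<Longrightarrow> y b [^]\<^bsub>rat_mod_int\<^esub> n = f (k (frag_of b))"
    by metis
  have keys: "Poly_Mapping.keys (\<phi> u) \<subseteq> S" if "u \<in> carrier M" for u
    using h.hom_closed[OF that] by simp
  have y': "y \<in> S \<rightarrow> carrier rat_mod_int" using y by blast
  let ?f = "\<lambda>u\<in>carrier M. ev rat_mod_int y (\<phi> u)"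
  have "?f \<in> carrier (dual_module M)"
    using keys Q.ev_closed[OF y'] by (intro dual_restrictI) (auto simp: Q.ev_add[OF y'])
  moreover have "?f u [^]\<^bsub>rat_mod_int\<^esub> n = f u" if u: "u \<in> carrier M" for u
  proof -
    have "ev rat_mod_int y (\<phi> u) [^]\<^bsub>rat_mod_int\<^esub> n = ev rat_mod_int (\<lambda>b. y b [^]\<^bsub>rat_mod_int\<^esub> n) (\<phi> u)"
    proof (rule Q.ev_hom_comp[symmetric, OF Q.comm_group_axioms])
      show "(\<lambda>x. x [^]\<^bsub>rat_mod_int\<^esub> n) \<in> hom rat_mod_int rat_mod_int"
        by (rule homI) (auto simp: Q.int_pow_distrib)
    qed (use keys[OF u] y in auto)
    also have "\<dots> = ev rat_mod_int (\<lambda>b. f (k (frag_of b))) (\<phi> u)"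
      using keys[OF u] y(2) hom_in_carrier[OF fk] by (intro Q.ev_cong) auto
    also have "\<dots> = f (k (\<phi> u))"
      using Q.free_Abelian_hom_eq_ev[OF fk keys[OF u]] by simp
    finally show ?thesis using u k\<phi>[OF u] by simp
  qed
  ultimately show ?thesis using that by blast
qed

section \<open>Products of cyclic groups\<close>

lemma finite_cyclic_powers:
  assumes "group H" "cyclic_group H" "order H = q" "q > 0"
  obtains x where "x \<in> carrier H" "x [^]\<^bsub>H\<^esub> q = \<one>\<^bsub>H\<^esub>" "bij_betw (\<lambda>j. x [^]\<^bsub>H\<^esub> j) {..<q} (carrier H)"
proof -
  interpret group H by fact
  obtain x where x: "x \<in> carrier H" "carrier H = range (\<lambda>n :: int. x [^]\<^bsub>H\<^esub> n)"
    using assms(2) unfolding cyclic_group by blast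
  have "finite (carrier H)" using assms(3,4) unfolding order_def by (intro card_ge_0_finite) simp
  hence 1: "x [^]\<^bsub>H\<^esub> q = \<one>\<^bsub>H\<^esub>"
    using comm_group.power_order_eq_one[OF cyclic_imp_abelian_group[OF assms(2)] _ x(1)] assms(3)
    by (simp add: order_def)
  have "(\<lambda>j. x [^]\<^bsub>H\<^esub> j) ` {..<q} = carrier H"
  proof
    show "carrier H \<subseteq> (\<lambda>j. x [^]\<^bsub>H\<^esub> j) ` {..<q}"
    proof
      fix h assume "h \<in> carrier H"
      then obtain n :: int where n: "h = x [^]\<^bsub>H\<^esub> n" using x(2) by blast
      have "x [^]\<^bsub>H\<^esub> n = x [^]\<^bsub>H\<^esub> (int q * (n div int q) + n mod int q)" by simp
      also have "\<dots> = (x [^]\<^bsub>H\<^esub> q) [^]\<^bsub>H\<^esub> (n div int q) \<otimes>\<^bsub>H\<^esub> x [^]\<^bsub>H\<^esub> (n mod int q)"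
        using x(1) by (simp only: int_pow_mult int_pow_pow[symmetric] int_pow_int)
      also have "\<dots> = x [^]\<^bsub>H\<^esub> int (nat (n mod int q))"
        using x(1) 1 assms(4) by simp
      finally have "h = x [^]\<^bsub>H\<^esub> nat (n mod int q)" unfolding n int_pow_int .
      moreover have "nat (n mod int q) \<in> {..<q}" using assms(4) by (simp add: nat_less_iff)
      ultimately show "h \<in> (\<lambda>j. x [^]\<^bsub>H\<^esub> j) ` {..<q}" by blast
    qed
  qed (use x(1) in auto)
  moreover from this have "inj_on (\<lambda>j. x [^]\<^bsub>H\<^esub> j) {..<q}"
    using assms(3) by (intro eq_card_imp_inj_on) (simp_all add: order_def)
  ultimately show ?thesis using that x(1) 1 by (simp add: bij_betw_def)
qed

lemma pow_product_group:
  "x [^]\<^bsub>product_group I F\<^esub> (n :: nat) = (\<lambda>i\<in>I. x i [^]\<^bsub>F i\<^esub> n)"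
  by (induction n) (auto simp: nat_pow_def fun_eq_iff)

lemma product_group_coords:
  fixes Gs :: "nat \<Rightarrow> 'a monoid"
  assumes p: "prime p" and s: "s \<ge> 1" and grp: "\<And>k. k \<in> {1..s} \<Longrightarrow> group (Gs k)"
    and cyc: "\<And>k. k \<in> {1..s} \<Longrightarrow> cyclic_group (Gs k)"
    and m: "\<And>k. k \<in> {1..s} \<Longrightarrow> m k \<ge> 1" and ord: "\<And>k. k \<in> {1..s} \<Longrightarrow> order (Gs k) = p ^ m k"
  obtains \<gamma> lg where "coords (product_group {1..s} Gs) {1..s} \<gamma> (\<lambda>k. p ^ m k) lg p"
proof -
  let ?K = "{1..s}"
  let ?P = "product_group ?K Gs"
  have p0: "p > 0" using p prime_gt_0_nat by blast
  have "\<exists>x. x \<in> carrier (Gs k) \<and> x [^]\<^bsub>Gs k\<^esub> (p ^ m k) = \<one>\<^bsub>Gs k\<^esub> \<and>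
      bij_betw (\<lambda>j. x [^]\<^bsub>Gs k\<^esub> j) {..<p ^ m k} (carrier (Gs k))" if k: "k \<in> ?K" for k
    using finite_cyclic_powers[OF grp[OF k] cyc[OF k] ord[OF k]] p0 by (metis zero_less_power)
  then obtain x where x: "\<And>k. k \<in> ?K \<Longrightarrow> x k \<in> carrier (Gs k)"
      "\<And>k. k \<in> ?K \<Longrightarrow> x k [^]\<^bsub>Gs k\<^esub> (p ^ m k) = \<one>\<^bsub>Gs k\<^esub>"
      "\<And>k. k \<in> ?K \<Longrightarrow> bij_betw (\<lambda>j. x k [^]\<^bsub>Gs k\<^esub> j) {..<p ^ m k} (carrier (Gs k))"
    by metis
  define l where "l k = inv_into {..<p ^ m k} (\<lambda>j. x k [^]\<^bsub>Gs k\<^esub> j)" for k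
  have l_less: "l k a < p ^ m k" and x_l: "x k [^]\<^bsub>Gs k\<^esub> l k a = a" if "k \<in> ?K" "a \<in> carrier (Gs k)" for k a
  proof -
    have a: "a \<in> (\<lambda>j. x k [^]\<^bsub>Gs k\<^esub> j) ` {..<p ^ m k}"
      using x(3)[OF that(1)] that(2) by (simp add: bij_betw_def)
    show "l k a < p ^ m k" using inv_into_into[OF a] by (simp add: l_def)
    show "x k [^]\<^bsub>Gs k\<^esub> l k a = a" using f_inv_into_f[OF a] by (simp add: l_def)
  qed
  have l_x: "l k (x k [^]\<^bsub>Gs k\<^esub> j) = j" if "k \<in> ?K" "j < p ^ m k" for k j
    using x(3)[OF that(1)] that(2) by (simp add: bij_betw_def l_def inv_into_f_f)
  have mult_x: "a \<otimes>\<^bsub>Gs k\<^esub> x k = x k [^]\<^bsub>Gs k\<^esub> (Suc (l k a) mod p ^ m k)"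
    if k: "k \<in> ?K" and a: "a \<in> carrier (Gs k)" for k a
  proof -
    interpret group "Gs k" using grp[OF k] .
    have "a \<otimes>\<^bsub>Gs k\<^esub> x k = x k [^]\<^bsub>Gs k\<^esub> Suc (l k a)" using x_l[OF k a] by simp
    also have "\<dots> = x k [^]\<^bsub>Gs k\<^esub> (Suc (l k a) mod p ^ m k)"
    proof (cases "Suc (l k a) = p ^ m k")
      case True
      thus ?thesis using x(2)[OF k] by simp
    next
      case False
      thus ?thesis using l_less[OF k a] by simp
    qed
    finally show ?thesis .
  qed
  have comm: "a \<otimes>\<^bsub>Gs k\<^esub> b = b \<otimes>\<^bsub>Gs k\<^esub> a"
    if k: "k \<in> ?K" and a: "a \<in> carrier (Gs k)" and b: "b \<in> carrier (Gs k)" for k a b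
  proof -
    interpret group "Gs k" using grp[OF k] .
    have "x k [^]\<^bsub>Gs k\<^esub> l k a \<otimes>\<^bsub>Gs k\<^esub> x k [^]\<^bsub>Gs k\<^esub> l k b = x k [^]\<^bsub>Gs k\<^esub> l k b \<otimes>\<^bsub>Gs k\<^esub> x k [^]\<^bsub>Gs k\<^esub> l k a"
      using x(1)[OF k] by (simp add: nat_pow_mult add.commute)
    thus ?thesis unfolding x_l[OF k a] x_l[OF k b] .
  qed
  define \<gamma> where "\<gamma> k = (\<lambda>i\<in>?K. if i = k then x k else \<one>\<^bsub>Gs i\<^esub>)" for k
  have grpP: "group ?P" by (rule product_group) (rule grp)
  have "coords ?P ?K \<gamma> (\<lambda>k. p ^ m k) (\<lambda>k h. l k (h k)) p"
  proof (intro coords.intro coords_axioms.intro group.group_comm_groupI grpP p finite_atLeastAtMost)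
    fix a b assume "a \<in> carrier ?P" "b \<in> carrier ?P"
    thus "a \<otimes>\<^bsub>?P\<^esub> b = b \<otimes>\<^bsub>?P\<^esub> a" by (auto simp: PiE_iff intro!: restrict_ext comm)
  next
    have "finite (carrier (Gs k))" if "k \<in> ?K" for k
      using ord[OF that] p0 unfolding order_def by (intro card_ge_0_finite) simp
    thus "finite (carrier ?P)" unfolding carrier_product_group by (intro finite_PiE finite_atLeastAtMost)
    show "p dvd order ?P"
    proof -
      have "order ?P = (\<Prod>k\<in>?K. p ^ m k)" using ord by (simp add: order_def card_PiE)
      also have "\<dots> = p ^ (\<Sum>k\<in>?K. m k)" by (simp add: power_sum)
      also have "p dvd \<dots>" using m[of 1] s by (intro dvd_power) (auto simp: sum_pos2[of _ 1])
      finally show ?thesis .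
    qed
    fix k assume k: "k \<in> ?K"
    show "p dvd p ^ m k" using m[OF k] by (intro dvd_power) simp
    show \<gamma>c: "\<gamma> k \<in> carrier ?P"
      using x(1)[OF k] grp by (auto simp: \<gamma>_def PiE_iff group.is_monoid intro: monoid.one_closed)
    show "\<gamma> k [^]\<^bsub>?P\<^esub> (p ^ m k) = \<one>\<^bsub>?P\<^esub>"
      unfolding pow_product_group one_product_group
      using x(2)[OF k] grp by (intro restrict_ext) (auto simp: \<gamma>_def group.is_monoid monoid.nat_pow_one)
    fix h assume h: "h \<in> carrier ?P"
    show "l k (h k) < p ^ m k" using h k l_less by (auto simp: PiE_iff)
    show "l k ((h \<otimes>\<^bsub>?P\<^esub> \<gamma> k) k) = Suc (l k (h k)) mod p ^ m k"
      using h k mult_x[OF k, of "h k"] l_x[OF k] p0 by (simp add: \<gamma>_def PiE_iff)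
    fix j assume j: "j \<in> ?K" "j \<noteq> k"
    have "h j \<in> carrier (Gs j)" using h j by (auto simp: PiE_iff)
    thus "l j ((h \<otimes>\<^bsub>?P\<^esub> \<gamma> k) j) = l j (h j)"
      using j grp[OF j(1)] by (simp add: \<gamma>_def group.is_monoid monoid.r_one)
  next
    fix h h' assume h: "h \<in> carrier ?P" "h' \<in> carrier ?P" and eq: "\<And>k. k \<in> ?K \<Longrightarrow> l k (h k) = l k (h' k)"
    show "h = h'"
    proof (rule PiE_ext)
      show "h \<in> Pi\<^sub>E ?K (\<lambda>k. carrier (Gs k))" "h' \<in> Pi\<^sub>E ?K (\<lambda>k. carrier (Gs k))" using h by simp_all
      fix k assume k: "k \<in> ?K"
      hence "h k \<in> carrier (Gs k)" "h' k \<in> carrier (Gs k)" using h by (auto simp: PiE_iff)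
      thus "h k = h' k" using eq[OF k] x_l[OF k] by metis
    qed
  qed
  thus ?thesis using that by blast
qed

lemma exponent_embed:
  assumes "comm_group H" "comm_group K" "\<exists>\<phi>\<in>hom H K. inj_on \<phi> (carrier H)"
    and "\<And>y. y \<in> carrier K \<Longrightarrow> y [^]\<^bsub>K\<^esub> (k :: nat) = \<one>\<^bsub>K\<^esub>" and x: "x \<in> carrier H"
  shows "x [^]\<^bsub>H\<^esub> k = \<one>\<^bsub>H\<^esub>"
proof -
  obtain \<phi> where \<phi>: "\<phi> \<in> hom H K" "inj_on \<phi> (carrier H)" using assms(3) by blast
  interpret h: group_hom H K \<phi>
    using assms(1,2) \<phi>(1) by (intro group_homI) (auto simp: comm_group_def)
  have "\<phi> (x [^]\<^bsub>H\<^esub> k) = \<phi> \<one>\<^bsub>H\<^esub>" using assms(4) x by (simp add: h.hom_nat_pow)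
  thus ?thesis using inj_onD[OF \<phi>(2)] x by simp
qed

lemma qz_div_eq_iff:
  assumes "p > 0"
  shows "qz (of_int a / of_nat p) = qz (of_int b / of_nat p) \<longleftrightarrow> a mod int p = b mod int p"
proof -
  have "(of_int a / of_nat p - of_int b / of_nat p :: rat) = of_int (a - b) / of_int (int p)"
    by (simp add: diff_divide_distrib)
  thus ?thesis
    unfolding qz_eq_iff using assms by (simp only: of_int_div_of_int_in_Ints_iff) (simp add: mod_eq_dvd_iff)
qed

section \<open>Cohomology of the lattice and of its dual\<close>

locale uniformized_p_lattice = coords G K \<gamma> q lg p + generated_p_lattice G M act p e g r
  for G :: "('a, 'b) monoid_scheme" (structure) and K \<gamma> q lg p
    and M :: "('c, 'd) monoid_scheme" and act e g r +
  fixes v \<psi>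
  assumes v: "v \<in> carrier M" and \<psi>: "\<psi> \<in> hom M M"
    and \<psi>_\<theta>: "u \<in> carrier M \<Longrightarrow> \<psi> (\<theta> u) = u [^]\<^bsub>M\<^esub> int p"
    and v_decomp: "w \<in> carrier M \<Longrightarrow> \<exists>c :: int. \<exists>n\<in>carrier M. w = v [^]\<^bsub>M\<^esub> c \<otimes>\<^bsub>M\<^esub> \<theta> n"
    and v_pow: "v [^]\<^bsub>M\<^esub> (c :: int) \<in> \<theta> ` carrier M \<longleftrightarrow> int p dvd c"
begin

text \<open>The coordinate of \<open>u\<close> in \<open>M / \<theta> M\<close>, cyclic of order \<open>p\<close> on \<open>v\<close>; only its residue modulo \<open>p\<close>
  is determined.\<close>

definition \<kappa> :: "'c \<Rightarrow> int"
  where "\<kappa> u = (SOME c. \<exists>n\<in>carrier M. u = v [^]\<^bsub>M\<^esub> c \<otimes>\<^bsub>M\<^esub> \<theta> n)"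

lemma \<kappa>_decomp:
  assumes "u \<in> carrier M"
  obtains n where "n \<in> carrier M" "u = v [^]\<^bsub>M\<^esub> \<kappa> u \<otimes>\<^bsub>M\<^esub> \<theta> n"
  using someI_ex[OF v_decomp[OF assms]] unfolding \<kappa>_def by blast

text \<open>Two decompositions of the same element differ by a power of \<open>v\<close> lying in
  the image of \<open>\<theta>\<close>, so their exponents agree modulo p. This settles the
  arbitrary choice in \<open>\<kappa>\<close>.\<close>

lemma \<kappa>_eq:
  assumes n: "n \<in> carrier M"
  shows "\<kappa> (v [^]\<^bsub>M\<^esub> c \<otimes>\<^bsub>M\<^esub> \<theta> n) mod int p = c mod int p"
proof -
  let ?u = "v [^]\<^bsub>M\<^esub> c \<otimes>\<^bsub>M\<^esub> \<theta> n"
  have "?u \<in> carrier M" using v n by simp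
  then obtain k n' where n': "n' \<in> carrier M" "?u = v [^]\<^bsub>M\<^esub> k \<otimes>\<^bsub>M\<^esub> \<theta> n'" "k = \<kappa> ?u"
    using \<kappa>_decomp by metis
  have "v [^]\<^bsub>M\<^esub> (k - c) = inv\<^bsub>M\<^esub> (v [^]\<^bsub>M\<^esub> c) \<otimes>\<^bsub>M\<^esub> (v [^]\<^bsub>M\<^esub> k \<otimes>\<^bsub>M\<^esub> \<theta> n') \<otimes>\<^bsub>M\<^esub> inv\<^bsub>M\<^esub> \<theta> n'"
    using v n'(1) A.m_comm[of "v [^]\<^bsub>M\<^esub> k" "inv\<^bsub>M\<^esub> (v [^]\<^bsub>M\<^esub> c)"] by (simp add: A.int_pow_diff A.m_assoc A.r_inv)
  also have "\<dots> = inv\<^bsub>M\<^esub> (v [^]\<^bsub>M\<^esub> c) \<otimes>\<^bsub>M\<^esub> (v [^]\<^bsub>M\<^esub> c \<otimes>\<^bsub>M\<^esub> \<theta> n) \<otimes>\<^bsub>M\<^esub> inv\<^bsub>M\<^esub> \<theta> n'"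
    by (simp only: n'(2))
  also have "\<dots> = \<theta> n \<otimes>\<^bsub>M\<^esub> inv\<^bsub>M\<^esub> \<theta> n'"
    using v n n'(1) by (simp flip: A.m_assoc)
  also have "\<dots> = \<theta> (n \<otimes>\<^bsub>M\<^esub> inv\<^bsub>M\<^esub> n')"
    using n n'(1) group_hom.hom_inv[OF group_homI[OF A.is_group A.is_group \<theta>_hom]] by (simp add: \<theta>_mult)
  finally have "v [^]\<^bsub>M\<^esub> (k - c) \<in> \<theta> ` carrier M"
    by (rule image_eqI) (use n n'(1) in simp)
  thus ?thesis unfolding v_pow n'(3) by (simp add: mod_eq_dvd_iff)
qed

lemma \<kappa>_\<theta>: "n \<in> carrier M \<Longrightarrow> \<kappa> (\<theta> n) mod int p = 0"
  using \<kappa>_eq[of n 0] by simp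

lemma \<kappa>_v: "\<kappa> v mod int p = 1"
  using \<kappa>_eq[of "\<one>\<^bsub>M\<^esub>" 1] v group_hom.hom_one[OF group_homI[OF A.is_group A.is_group \<theta>_hom]]
    prime_gt_1_nat[OF p] by simp

lemma \<kappa>_mult:
  assumes u: "u \<in> carrier M" and w: "w \<in> carrier M"
  shows "\<kappa> (u \<otimes>\<^bsub>M\<^esub> w) mod int p = (\<kappa> u + \<kappa> w) mod int p"
proof -
  obtain n where n: "n \<in> carrier M" "u = v [^]\<^bsub>M\<^esub> \<kappa> u \<otimes>\<^bsub>M\<^esub> \<theta> n" using u by (rule \<kappa>_decomp)
  obtain n' where n': "n' \<in> carrier M" "w = v [^]\<^bsub>M\<^esub> \<kappa> w \<otimes>\<^bsub>M\<^esub> \<theta> n'" using w by (rule \<kappa>_decomp)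
  have "u \<otimes>\<^bsub>M\<^esub> w = (v [^]\<^bsub>M\<^esub> \<kappa> u \<otimes>\<^bsub>M\<^esub> \<theta> n) \<otimes>\<^bsub>M\<^esub> (v [^]\<^bsub>M\<^esub> \<kappa> w \<otimes>\<^bsub>M\<^esub> \<theta> n')"
    using n(2) n'(2) by simp
  also have "\<dots> = v [^]\<^bsub>M\<^esub> (\<kappa> u + \<kappa> w) \<otimes>\<^bsub>M\<^esub> \<theta> (n \<otimes>\<^bsub>M\<^esub> n')"
    using v n(1) n'(1) by (simp add: A.int_pow_mult \<theta>_mult A.m_ac)
  finally show ?thesis using \<kappa>_eq[of "n \<otimes>\<^bsub>M\<^esub> n'"] n(1) n'(1) by simp
qed

lemma \<kappa>_zero_iff:
  assumes u: "u \<in> carrier M"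
  shows "int p dvd \<kappa> u \<longleftrightarrow> u \<in> \<theta> ` carrier M"
proof
  obtain n where n: "n \<in> carrier M" "u = v [^]\<^bsub>M\<^esub> \<kappa> u \<otimes>\<^bsub>M\<^esub> \<theta> n" using u by (rule \<kappa>_decomp)
  assume "int p dvd \<kappa> u"
  then obtain n' where n': "n' \<in> carrier M" "v [^]\<^bsub>M\<^esub> \<kappa> u = \<theta> n'" using v_pow by blast
  have "u = \<theta> (n' \<otimes>\<^bsub>M\<^esub> n)" using n n' by (simp add: \<theta>_mult)
  thus "u \<in> \<theta> ` carrier M" by (rule image_eqI) (use n(1) n'(1) in simp)
qed (use \<kappa>_\<theta> in \<open>auto simp: dvd_eq_mod_eq_0\<close>)

lemma \<kappa>_act:
  assumes h: "h \<in> carrier G" and u: "u \<in> carrier M"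
  shows "\<kappa> (act h u) mod int p = \<kappa> u mod int p"
proof -
  obtain n where n: "n \<in> carrier M" "act h u \<otimes>\<^bsub>M\<^esub> inv\<^bsub>M\<^esub> u = \<theta> n" using act_cong_\<theta>[OF h u] by blast
  have "act h u = u \<otimes>\<^bsub>M\<^esub> \<theta> n" unfolding n(2)[symmetric] using h u A.m_lcomm[of u "act h u" "inv\<^bsub>M\<^esub> u"] by (simp add: A.r_inv)
  hence "\<kappa> (act h u) mod int p = (\<kappa> u + \<kappa> (\<theta> n)) mod int p" using \<kappa>_mult[OF u] n(1) by simp
  also have "\<dots> = (\<kappa> u + \<kappa> (\<theta> n) mod int p) mod int p" by (simp add: mod_simps)
  finally show ?thesis using \<kappa>_\<theta>[OF n(1)] by simp
qed

lemma finite_module_M: "finite_module G M act"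
  by (intro finite_module.intro finite_module_axioms.intro G_module_axioms fin_G)

text \<open>The norm of an element is fixed by \<open>g\<close>, and \<open>g\<close> has no
  nontrivial fixed points.\<close>

lemma norm_M:
  assumes u: "u \<in> carrier M"
  shows "(\<Otimes>\<^bsub>M\<^esub>h\<in>carrier G. act h u) = \<one>\<^bsub>M\<^esub>"
proof (rule fixed_trivial[OF g g_not_triv])
  interpret F: finite_module G M act by (rule finite_module_M)
  show "(\<Otimes>\<^bsub>M\<^esub>h\<in>carrier G. act h u) \<in> carrier M" using u by (intro A.finprod_closed) auto
  have "act g (\<Otimes>\<^bsub>M\<^esub>h\<in>carrier G. act h u) = (\<Otimes>\<^bsub>M\<^esub>h\<in>carrier G. act g (act h u))"
    using u g by (intro A.finprod_hom A.comm_group_axioms act_hom) auto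
  also have "\<dots> = (\<Otimes>\<^bsub>M\<^esub>h\<in>carrier G. act (g \<otimes> h) u)"
    using u g by (intro A.finprod_cong') (auto simp: act_mult)
  also have "\<dots> = (\<Otimes>\<^bsub>M\<^esub>h\<in>carrier G. act h u)"
    using u g by (intro F.finprod_translate) auto
  finally show "act g (\<Otimes>\<^bsub>M\<^esub>h\<in>carrier G. act h u) = (\<Otimes>\<^bsub>M\<^esub>h\<in>carrier G. act h u)" .
qed

lemma exponent_Zm:
  assumes "y \<in> carrier (tate_cohomology G (Zm 0) actP n)"
  shows "y [^]\<^bsub>tate_cohomology G (Zm 0) actP n\<^esub> p = \<one>\<^bsub>tate_cohomology G (Zm 0) actP n\<^esub>"
proof -
  interpret Z: finite_module G "Zm 0" actP by (rule finite_module_Zm)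
  have "u [^]\<^bsub>Zm 0\<^esub> p = \<one>\<^bsub>Zm 0\<^esub>" if u: "u \<in> carrier (Zm 0)" for u
  proof -
    have "u [^]\<^bsub>Zm 0\<^esub> k = u [^]\<^bsub>Pm 0\<^esub> k" for k :: nat by (simp add: nat_pow_def)
    moreover have "u [^]\<^bsub>Pm 0\<^esub> p = \<one>\<^bsub>Pm 0\<^esub>"
      using u by (intro ext) (simp add: pow_Pm Zm_iff one_Pm)
    ultimately show ?thesis by simp
  qed
  thus ?thesis using Z.exponent_H assms unfolding Z.tate_cohomology_eq by blast
qed

lemma \<theta>_equivariant: "module_hom G M act M act \<theta>"
  by (intro module_hom.intro module_hom_axioms.intro finite_module_M \<theta>_hom) (simp add: act_\<theta>)

text \<open>Reduction modulo \<open>\<theta>\<close>, with Z/p in its realisation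
  \<open>Zm 0\<close>; equivariance holds because \<open>G\<close> acts trivially on the
  cokernel.\<close>

lemma residue_exact: "module_exact G M act M act (Zm 0) actP \<theta> (\<lambda>u. cst (\<kappa> u))"
proof (intro module_exact.intro module_exact_axioms.intro \<theta>_equivariant module_hom.intro
    module_hom_axioms.intro finite_module_M finite_module_Zm)
  show "(\<lambda>u. cst (\<kappa> u)) \<in> hom M (Zm 0)"
    using \<kappa>_mult cst_closed by (intro homI) (simp_all only: cst_mult cst_eq_iff)
  show "inj_on \<theta> (carrier M)" using \<theta>_cancel by (rule inj_onI)
  show "(\<lambda>u. cst (\<kappa> u)) ` carrier M = carrier (Zm 0)"
  proof
    show "carrier (Zm 0) \<subseteq> (\<lambda>u. cst (\<kappa> u)) ` carrier M"
    proof
      fix x assume "x \<in> carrier (Zm 0)"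
      then obtain c where c: "x = cst c" unfolding carrier_Zm_0 by blast
      have "cst (\<kappa> (v [^]\<^bsub>M\<^esub> c \<otimes>\<^bsub>M\<^esub> \<theta> \<one>\<^bsub>M\<^esub>)) = cst c" using \<kappa>_eq unfolding cst_eq_iff by simp
      thus "x \<in> (\<lambda>u. cst (\<kappa> u)) ` carrier M" unfolding c
        by (rule image_eqI[OF sym]) (use v in simp)
    qed
  qed (use cst_closed in blast)
next
  fix h u assume "h \<in> carrier G" "u \<in> carrier M"
  thus "cst (\<kappa> (act h u)) = actP h (cst (\<kappa> u))" by (simp add: actP_cst cst_eq_iff \<kappa>_act)
next
  fix u assume "u \<in> carrier M"
  thus "cst (\<kappa> u) = \<one>\<^bsub>Zm 0\<^esub> \<longleftrightarrow> u \<in> \<theta> ` carrier M" by (simp only: cst_one \<kappa>_zero_iff)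
qed

text \<open>The common end of both computations: a family indexed so that degree 0 is the vanishing
  one. For the dual module the index is shifted by one.\<close>

lemma iso_from_orders:
  fixes H :: "int \<Rightarrow> 'e monoid"
  assumes s: "card K = s" "s \<ge> 1"
    and comm: "\<And>k. comm_group (H k)"
    and exp: "\<And>k x. x \<in> carrier (H k) \<Longrightarrow> x [^]\<^bsub>H k\<^esub> p = \<one>\<^bsub>H k\<^esub>"
    and H0: "card (carrier (H 0)) = 1"
    and step: "\<And>k. card (carrier (H k)) * card (carrier (H (k + 1))) = p ^ ((s + wt k - 1) choose wt k)"
  shows "H n \<cong> product_group {..<nat \<lfloor>nu (\<bar>n\<bar> - 1) s\<rfloor>} (\<lambda>_. integer_mod_group p)"
proof (rule elementary_abelian_iso[OF comm _ p exp])
  show "card (carrier (H n)) = p ^ nat \<lfloor>nu (\<bar>n\<bar> - 1) s\<rfloor>"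
  proof (rule orders_from_recursion[where F = "\<lambda>k. card (carrier (H k))", OF s(2) prime_gt_1_nat[OF p] H0])
    fix k
    show "card (carrier (H (int k))) * card (carrier (H (int k + 1))) = p ^ ((s + k - 1) choose k)"
      using step[of "int k"] by (simp add: wt_def)
    show "card (carrier (H (- int k - 1))) * card (carrier (H (- int k))) = p ^ ((s + k - 1) choose k)"
      using step[of "- int k - 1"] by (simp add: wt_def)
  qed
  have "card (carrier (H n)) * card (carrier (H (n + 1))) > 0" unfolding step using p_pos by simp
  hence "card (carrier (H n)) > 0" by simp
  thus "finite (carrier (H n))" by (rule card_ge_0_finite)
qed

lemma finite_cohomology_Zm_0:
  assumes "card K = s" "s \<ge> 1"
  shows "finite (carrier (tate_cohomology G (Zm 0) actP n))"
  using card_cohomology_Zm_0[OF assms, of n] p_pos by (intro card_ge_0_finite) simp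

theorem cohomology_M:
  assumes s: "card K = s" "s \<ge> 1"
  shows "tate_cohomology G M act n \<cong> product_group {..<nat \<lfloor>nu (\<bar>n\<bar> - 1) s\<rfloor>} (\<lambda>_. integer_mod_group p)"
proof (rule iso_from_orders[where H = "tate_cohomology G M act", OF s])
  interpret F: finite_module G M act by (rule finite_module_M)
  interpret E: module_exact G M act M act "Zm 0" actP \<theta> "\<lambda>u. cst (\<kappa> u)" by (rule residue_exact)
  have null: "push G \<theta> k ` F.Z k \<subseteq> F.B k" for k
    using F.act_minus_one_null[OF g G_comm[OF g]] unfolding \<theta>_def[abs_def] by blast
  fix k
  show "comm_group (tate_cohomology G M act k)" unfolding F.tate_cohomology_eq by (rule F.comm_group_H)
  show "x [^]\<^bsub>tate_cohomology G M act k\<^esub> p = \<one>\<^bsub>tate_cohomology G M act k\<^esub>"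
    if "x \<in> carrier (tate_cohomology G M act k)" for x
    using that E.null_inclusion(1)[OF null null, of k] exponent_Zm[of _ k]
    unfolding F.tate_cohomology_eq E.\<pi>.B.tate_cohomology_eq
    by (intro exponent_embed[OF F.comm_group_H E.\<pi>.B.comm_group_H])
  show "card (carrier (tate_cohomology G M act k)) * card (carrier (tate_cohomology G M act (k + 1)))
      = p ^ ((s + wt k - 1) choose wt k)"
    using E.null_inclusion(2)[OF null null, of k] card_cohomology_Zm_0[OF s, of k] finite_cohomology_Zm_0[OF s, of k]
    unfolding F.tate_cohomology_eq E.\<pi>.B.tate_cohomology_eq by simp
  \<comment> \<open>The invariants are trivial, and as norms vanish too, so is cohomology in degree
    0.\<close>
  have "{u \<in> carrier M. \<forall>h\<in>carrier G. act h u = u} = {\<one>\<^bsub>M\<^esub>}"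
    using fixed_trivial[OF g g_not_triv] g by (auto simp: act_one_M)
  thus "card (carrier (tate_cohomology G M act 0)) = 1"
    unfolding F.tate_cohomology_eq using F.card_H_0[OF norm_M] by simp
qed

end

section \<open>The dual exact sequence and the cohomology of the dual\<close>

context uniformized_p_lattice
begin

abbreviation "DM \<equiv> dual_module M"
abbreviation "dact \<equiv> dual_act G M act"

text \<open>The inverse of \<open>g\<close> appears because the dual action itself inverts: with
  this choice \<open>\<theta>D\<close> is composition with \<open>\<theta>\<close>, as
  \<open>\<theta>D_apply\<close> shows, and is still a central element minus one.\<close>

definition \<theta>D :: "('c \<Rightarrow> rat set) \<Rightarrow> 'c \<Rightarrow> rat set"
  where "\<theta>D f = dact (inv g) f \<otimes>\<^bsub>DM\<^esub> inv\<^bsub>DM\<^esub> f"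

text \<open>An element of \<open>Zm 0\<close> is read off as a constant c from its value in position
  zero at the identity; it becomes the functional c \<open>\<kappa>\<close> / p modulo integers,
  which factors through the cokernel of \<open>\<theta>\<close>.\<close>

definition \<iota> :: "((nat \<Rightarrow> nat) \<Rightarrow> 'a \<Rightarrow> int) \<Rightarrow> 'c \<Rightarrow> rat set"
  where "\<iota> x = (\<lambda>u\<in>carrier M. qz (of_int (x (\<lambda>_. 0) \<one> * \<kappa> u) / of_nat p))"

lemma finite_module_DM: "finite_module G DM dact"
  by (intro finite_module.intro finite_module_axioms.intro G_module_dual fin_G)

lemma \<theta>D_closed: "f \<in> carrier DM \<Longrightarrow> \<theta>D f \<in> carrier DM"
proof -
  interpret F: finite_module G DM dact by (rule finite_module_DM)
  show "f \<in> carrier DM \<Longrightarrow> \<theta>D f \<in> carrier DM" using g by (simp add: \<theta>D_def)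
qed

lemma \<theta>D_apply:
  assumes f: "f \<in> carrier DM" and u: "u \<in> carrier M"
  shows "\<theta>D f u = f (\<theta> u)"
proof -
  interpret Q: comm_group rat_mod_int by (rule comm_group_rat_mod_int)
  interpret f: group_hom M rat_mod_int f
    using f by (intro group_homI A.is_group Q.is_group) (simp add: dual_iff)
  show ?thesis
    using f u g by (simp add: \<theta>D_def \<theta>_def dual_mult dual_inv dual_act_def)
qed

lemmas qz_mod_p = qz_div_eq_iff[OF prime_gt_0_nat[OF p]]

lemma \<iota>_cst:
  assumes u: "u \<in> carrier M"
  shows "\<iota> (cst c) u = qz (of_int (c * \<kappa> u) / of_nat p)"
  using u qz_mod_p[of "c mod int p * \<kappa> u" "c * \<kappa> u"]
  by (simp add: \<iota>_def cst_def mod_simps)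

lemma \<iota>_closed: "\<iota> x \<in> carrier DM"
  unfolding \<iota>_def
proof (rule dual_restrictI)
  fix u w assume uw: "u \<in> carrier M" "w \<in> carrier M"
  let ?c = "x (\<lambda>_. 0) \<one>"
  have "(?c * \<kappa> (u \<otimes>\<^bsub>M\<^esub> w)) mod int p = (?c * (\<kappa> u + \<kappa> w)) mod int p"
    using \<kappa>_mult[OF uw] by (metis mod_mult_right_eq)
  hence "qz (of_int (?c * \<kappa> (u \<otimes>\<^bsub>M\<^esub> w)) / of_nat p) = qz (of_int (?c * (\<kappa> u + \<kappa> w)) / of_nat p)"
    unfolding qz_mod_p .
  thus "qz (of_int (?c * \<kappa> (u \<otimes>\<^bsub>M\<^esub> w)) / of_nat p)
      = qz (of_int (?c * \<kappa> u) / of_nat p) \<otimes>\<^bsub>rat_mod_int\<^esub> qz (of_int (?c * \<kappa> w) / of_nat p)"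
    by (simp add: distrib_left add_divide_distrib flip: qz_add)
qed (rule qz_closed)

lemma \<theta>D_equivariant: "module_hom G DM dact DM dact \<theta>D"
proof (intro module_hom.intro module_hom_axioms.intro finite_module_DM)
  interpret F: finite_module G DM dact by (rule finite_module_DM)
  show "\<theta>D \<in> hom DM DM"
  proof (rule homI)
    fix f f' assume f: "f \<in> carrier DM" "f' \<in> carrier DM"
    show "\<theta>D (f \<otimes>\<^bsub>DM\<^esub> f') = \<theta>D f \<otimes>\<^bsub>DM\<^esub> \<theta>D f'"
    proof (rule dual_eqI)
      fix u assume u: "u \<in> carrier M"
      show "\<theta>D (f \<otimes>\<^bsub>DM\<^esub> f') u = (\<theta>D f \<otimes>\<^bsub>DM\<^esub> \<theta>D f') u"
        using f u \<theta>D_apply[OF F.A.m_closed[OF f] u] by (simp add: \<theta>D_apply dual_mult)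
    qed (use f \<theta>D_closed F.A.m_closed in auto)
  qed (rule \<theta>D_closed)
  fix h f assume h: "h \<in> carrier G" and f: "f \<in> carrier DM"
  show "\<theta>D (dact h f) = dact h (\<theta>D f)"
  proof (rule dual_eqI)
    fix u assume u: "u \<in> carrier M"
    show "\<theta>D (dact h f) u = dact h (\<theta>D f) u"
      using h f u \<theta>D_apply[OF F.act_closed[OF h f] u] by (simp add: \<theta>D_apply dual_act_def act_\<theta>)
  qed (use h f \<theta>D_closed F.act_closed in auto)
qed

text \<open>Divide \<open>f\<close> by p in the dual and compose with \<open>\<psi>\<close>: since
  \<open>\<psi>\<close> after \<open>\<theta>\<close> is multiplication by p, composing with
  \<open>\<theta>\<close> gives back \<open>f\<close>.\<close>

lemma \<theta>D_surj: "\<theta>D ` carrier DM = carrier DM"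
proof
  show "carrier DM \<subseteq> \<theta>D ` carrier DM"
  proof
    fix f assume f: "f \<in> carrier DM"
    obtain f' where f': "f' \<in> carrier DM" "\<And>u. u \<in> carrier M \<Longrightarrow> f' u [^]\<^bsub>rat_mod_int\<^esub> int p = f u"
      using dual_divisible[OF f, of "int p"] p_pos by auto
    have \<psi>c: "\<psi> u \<in> carrier M" if "u \<in> carrier M" for u using \<psi> that by (rule hom_in_carrier)
    define F where "F = (\<lambda>u\<in>carrier M. f' (\<psi> u))"
    have F: "F \<in> carrier DM"
      unfolding F_def
      using \<psi>c hom_mult[OF \<psi>] dual_closed[OF f'(1)] dual_hom[OF f'(1)] by (intro dual_restrictI) simp_all
    have "group rat_mod_int" using comm_group_rat_mod_int by (simp add: comm_group_def)
    hence f'_pow: "f' (u [^]\<^bsub>M\<^esub> int p) = f' u [^]\<^bsub>rat_mod_int\<^esub> int p" if "u \<in> carrier M" for u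
      using that f'(1) by (intro hom_int_pow A.is_group) (simp_all add: dual_iff)
    have "\<theta>D F = f"
    proof (rule dual_eqI[OF \<theta>D_closed[OF F] f])
      fix u assume u: "u \<in> carrier M"
      have "\<theta>D F u = F (\<theta> u)" by (rule \<theta>D_apply[OF F u])
      thus "\<theta>D F u = f u" using u by (simp add: F_def \<psi>_\<theta> f'_pow f'(2))
    qed
    thus "f \<in> \<theta>D ` carrier DM" using F by blast
  qed
qed (use \<theta>D_closed in blast)

text \<open>A functional killing the image of \<open>\<theta>\<close> is determined by its value at
  \<open>v\<close>, and that value is killed by p because p times \<open>v\<close> lies in the
  image; so it is c / p modulo integers.\<close>

lemma \<theta>D_kernel:
  assumes f: "f \<in> carrier DM"
  shows "\<theta>D f = \<one>\<^bsub>DM\<^esub> \<longleftrightarrow> f \<in> \<iota> ` carrier (Zm 0)"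
proof
  interpret Q: comm_group rat_mod_int by (rule comm_group_rat_mod_int)
  interpret f: group_hom M rat_mod_int f
    using f by (intro group_homI A.is_group Q.is_group) (simp add: dual_iff)
  assume "\<theta>D f = \<one>\<^bsub>DM\<^esub>"
  hence f\<theta>: "f (\<theta> u) = \<one>\<^bsub>rat_mod_int\<^esub>" if "u \<in> carrier M" for u
    using \<theta>D_apply[OF f that] that by (simp add: dual_one)
  have fv: "f (v [^]\<^bsub>M\<^esub> c) = f v [^]\<^bsub>rat_mod_int\<^esub> c" for c :: int
    using v by (simp add: f.hom_int_pow)
  obtain t where t: "f v = qz t" using dual_closed[OF f v] by (auto simp: carrier_rat_mod_int)
  obtain n where "n \<in> carrier M" "v [^]\<^bsub>M\<^esub> int p = \<theta> n" using v_pow[of "int p"] by auto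
  hence "qz (of_int (int p) * t) = qz 0" using f\<theta> fv[of "int p"] by (simp add: t qz_pow one_rat_mod_int)
  then obtain c where "of_nat p * t = of_int c" unfolding qz_eq_iff by (auto elim: Ints_cases)
  hence c: "t = of_int c / of_nat p" using p_pos by (simp add: field_simps)
  have "f = \<iota> (cst c)"
  proof (rule dual_eqI[OF f \<iota>_closed])
    fix u assume u: "u \<in> carrier M"
    obtain n where n: "n \<in> carrier M" "u = v [^]\<^bsub>M\<^esub> \<kappa> u \<otimes>\<^bsub>M\<^esub> \<theta> n" using u by (rule \<kappa>_decomp)
    have "f u = f (v [^]\<^bsub>M\<^esub> \<kappa> u \<otimes>\<^bsub>M\<^esub> \<theta> n)" using n(2) by (rule arg_cong)
    also have "\<dots> = qz (of_int (\<kappa> u) * t)" using n(1) v by (simp add: f\<theta> fv t qz_pow qz_closed)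
    finally show "f u = \<iota> (cst c) u" unfolding \<iota>_cst[OF u] by (simp add: c mult.commute)
  qed
  thus "f \<in> \<iota> ` carrier (Zm 0)" using cst_closed by blast
next
  interpret F: finite_module G DM dact by (rule finite_module_DM)
  assume "f \<in> \<iota> ` carrier (Zm 0)"
  then obtain c where c: "f = \<iota> (cst c)" unfolding carrier_Zm_0 by blast
  show "\<theta>D f = \<one>\<^bsub>DM\<^esub>"
  proof (rule dual_eqI[OF \<theta>D_closed[OF f] F.A.one_closed])
    fix u assume u: "u \<in> carrier M"
    have "(c * \<kappa> (\<theta> u)) mod int p = 0 mod int p" using \<kappa>_\<theta>[OF u] by auto
    hence "qz (of_int (c * \<kappa> (\<theta> u)) / of_nat p) = qz (of_int 0 / of_nat p)"
      unfolding qz_mod_p .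
    thus "\<theta>D f u = \<one>\<^bsub>DM\<^esub> u"
      using u \<theta>D_apply[OF f u] by (simp add: c \<iota>_cst dual_one one_rat_mod_int)
  qed
qed

lemma dual_residue_exact: "module_exact G (Zm 0) actP DM dact DM dact \<iota> \<theta>D"
proof (intro module_exact.intro module_exact_axioms.intro \<theta>D_equivariant \<theta>D_kernel \<theta>D_surj module_hom.intro
    module_hom_axioms.intro finite_module_DM finite_module_Zm)
  have cstE: "\<exists>c. x = cst c" if "x \<in> carrier (Zm 0)" for x
    using that unfolding carrier_Zm_0 by blast
  show "\<iota> \<in> hom (Zm 0) DM"
  proof (rule homI[OF \<iota>_closed])
    fix x y assume "x \<in> carrier (Zm 0)" "y \<in> carrier (Zm 0)"
    then obtain c d where cd: "x = cst c" "y = cst d" using cstE by blast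
    have "\<iota> (cst (c + d)) u = \<iota> (cst c) u \<otimes>\<^bsub>rat_mod_int\<^esub> \<iota> (cst d) u" if "u \<in> carrier M" for u
      using that by (simp add: \<iota>_cst distrib_right add_divide_distrib flip: qz_add)
    hence "\<iota> (cst (c + d)) = \<iota> (cst c) \<otimes>\<^bsub>DM\<^esub> \<iota> (cst d)"
      by (intro dual_eqI[OF \<iota>_closed comm_groupE(1)[OF comm_group_dual \<iota>_closed \<iota>_closed]]) (simp add: dual_mult)
    thus "\<iota> (x \<otimes>\<^bsub>Zm 0\<^esub> y) = \<iota> x \<otimes>\<^bsub>DM\<^esub> \<iota> y" unfolding cd cst_mult .
  qed
  show "inj_on \<iota> (carrier (Zm 0))"
  proof (rule inj_onI)
    fix x y assume xy: "x \<in> carrier (Zm 0)" "y \<in> carrier (Zm 0)" "\<iota> x = \<iota> y"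
    then obtain c d where cd: "x = cst c" "y = cst d" using cstE by blast
    have "(c * \<kappa> v) mod int p = (d * \<kappa> v) mod int p"
      using arg_cong[OF xy(3), of "\<lambda>f. f v"] unfolding cd \<iota>_cst[OF v] qz_mod_p .
    hence "c mod int p = d mod int p" using \<kappa>_v by (metis mod_mult_right_eq mult.right_neutral)
    thus "x = y" unfolding cd cst_eq_iff .
  qed
  fix h x assume h: "h \<in> carrier G" and "x \<in> carrier (Zm 0)"
  then obtain c where c: "x = cst c" using cstE by blast
  show "\<iota> (actP h x) = dact h (\<iota> x)"
  proof (rule dual_eqI[OF \<iota>_closed dual_act_closed[OF h \<iota>_closed]])
    fix u assume u: "u \<in> carrier M"
    have "(c * \<kappa> u) mod int p = (c * \<kappa> (act (inv h) u)) mod int p"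
      using \<kappa>_act[OF inv_closed[OF h] u] by (metis mod_mult_right_eq)
    hence "qz (of_int (c * \<kappa> u) / of_nat p) = qz (of_int (c * \<kappa> (act (inv h) u)) / of_nat p)"
      unfolding qz_mod_p .
    thus "\<iota> (actP h x) u = dact h (\<iota> x) u"
      using u h act_inv_closed[OF h u] by (simp only: c actP_cst \<iota>_cst dual_act_def restrict_apply if_True)
  qed
qed

text \<open>Evaluated at \<open>u\<close>, the norm of \<open>f\<close> becomes \<open>f\<close> of
  the norm of \<open>u\<close>, after reindexing by inverses, and the latter is trivial.\<close>

lemma norm_DM:
  assumes f: "f \<in> carrier DM"
  shows "(\<Otimes>\<^bsub>DM\<^esub>h\<in>carrier G. dact h f) = \<one>\<^bsub>DM\<^esub>"
proof -
  interpret F: finite_module G DM dact by (rule finite_module_DM)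
  interpret Q: comm_group rat_mod_int by (rule comm_group_rat_mod_int)
  interpret f: group_hom M rat_mod_int f
    using f by (intro group_homI A.is_group Q.is_group) (simp add: dual_iff)
  have c: "(\<lambda>h. dact h f) \<in> carrier G \<rightarrow> carrier DM" using f by simp
  show ?thesis
  proof (rule dual_eqI[OF F.A.finprod_closed[OF c] F.A.one_closed])
    fix u assume u: "u \<in> carrier M"
    have "(\<lambda>f. f u) \<in> hom DM rat_mod_int"
      using u dual_closed by (intro homI) (auto simp: dual_mult)
    hence "(\<Otimes>\<^bsub>DM\<^esub>h\<in>carrier G. dact h f) u = (\<Otimes>\<^bsub>rat_mod_int\<^esub>h\<in>carrier G. dact h f u)"
      using F.A.finprod_hom[OF Q.comm_group_axioms _ c] by blast
    also have "\<dots> = (\<Otimes>\<^bsub>rat_mod_int\<^esub>h\<in>carrier G. f (act (inv h) u))"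
      using u by (simp add: dual_act_def)
    also have "\<dots> = f (\<Otimes>\<^bsub>M\<^esub>h\<in>carrier G. act (inv h) u)"
      using u f.homh by (intro A.finprod_hom[symmetric] Q.comm_group_axioms) auto
    also have "(\<Otimes>\<^bsub>M\<^esub>h\<in>carrier G. act (inv h) u) = (\<Otimes>\<^bsub>M\<^esub>h\<in>m_inv G ` carrier G. act h u)"
      using u by (intro A.finprod_reindex[symmetric] inj_on_inverseI[of _ "m_inv G"]) auto
    also have "m_inv G ` carrier G = carrier G"
    proof (intro equalityI subsetI)
      fix h assume h: "h \<in> carrier G"
      show "h \<in> m_inv G ` carrier G" by (rule image_eqI[of _ _ "inv h"]) (use h in simp_all)
    qed auto
    finally show "(\<Otimes>\<^bsub>DM\<^esub>h\<in>carrier G. dact h f) u = \<one>\<^bsub>DM\<^esub> u"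
      using u norm_M[OF u] by (simp add: dual_one)
  qed
qed

theorem cohomology_DM:
  assumes s: "card K = s" "s \<ge> 1"
  shows "tate_cohomology G DM dact (n - 1) \<cong> product_group {..<nat \<lfloor>nu (\<bar>n\<bar> - 1) s\<rfloor>} (\<lambda>_. integer_mod_group p)"
proof (rule iso_from_orders[where H = "\<lambda>k. tate_cohomology G DM dact (k - 1)", OF s])
  interpret F: finite_module G DM dact by (rule finite_module_DM)
  interpret Z: finite_module G "Zm 0" actP by (rule finite_module_Zm)
  interpret E: module_exact G "Zm 0" actP DM dact DM dact \<iota> \<theta>D by (rule dual_residue_exact)
  have null: "push G \<theta>D k ` F.Z k \<subseteq> F.B k" for k
    using F.act_minus_one_null[OF inv_closed[OF g] m_comm[OF inv_closed[OF g]]] unfolding \<theta>D_def[abs_def] by blast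
  fix k
  show "comm_group (tate_cohomology G DM dact (k - 1))" unfolding F.tate_cohomology_eq by (rule F.comm_group_H)
  show "x [^]\<^bsub>tate_cohomology G DM dact (k - 1)\<^esub> p = \<one>\<^bsub>tate_cohomology G DM dact (k - 1)\<^esub>"
    if "x \<in> carrier (tate_cohomology G DM dact (k - 1))" for x
    using that E.null_projection(1)[OF null null, of "k - 1"] exponent_Zm[of _ "k - 1 + 1"]
    unfolding F.tate_cohomology_eq Z.tate_cohomology_eq
    by (intro exponent_embed[OF F.comm_group_H Z.comm_group_H])
  show "card (carrier (tate_cohomology G DM dact (k - 1))) * card (carrier (tate_cohomology G DM dact (k + 1 - 1)))
      = p ^ ((s + wt k - 1) choose wt k)"
    using E.null_projection(2)[OF null null, of "k - 1"] card_cohomology_Zm_0[OF s, of k] finite_cohomology_Zm_0[OF s, of k]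
    unfolding F.tate_cohomology_eq Z.tate_cohomology_eq by simp
  \<comment> \<open>A cocycle of degree -1 is \<open>\<theta>D\<close> applied to some cochain,
    since \<open>\<theta>D\<close> is onto. That cochain is again a cocycle, its coboundary being a
    norm, and \<open>\<theta>D\<close> sends cocycles to coboundaries.\<close>
  have "F.Z (- 1) \<subseteq> F.B (- 1)"
  proof
    fix x assume "x \<in> F.Z (- 1)"
    hence "x \<in> push G \<theta>D (- 1) ` carrier (F.Ch (- 1))"
      unfolding E.\<pi>.push_surj[OF \<theta>D_surj] F.Z_iff by simp
    then obtain y where y: "y \<in> carrier (F.Ch (- 1))" "x = push G \<theta>D (- 1) y" by blast
    have "y \<in> F.Z (- 1)" using y(1) F.norm_coboundary[OF norm_DM y(1)] by (simp add: F.Z_iff)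
    thus "x \<in> F.B (- 1)" using null y(2) by blast
  qed
  hence "F.cls (- 1) ` F.Z (- 1) = {\<one>\<^bsub>F.H (- 1)\<^esub>}"
    using F.cls_eq_one_iff[of _ "- 1"] F.comm_group_H[of "- 1"] F.carrier_H[of "- 1"]
      monoid.one_closed[of "F.H (- 1)"] by (auto simp: comm_group_def group.is_monoid)
  thus "card (carrier (tate_cohomology G DM dact (0 - 1))) = 1"
    by (simp add: F.tate_cohomology_eq F.carrier_H)
qed

end

theorem corollary4p2:
  fixes p s :: nat and m :: "nat \<Rightarrow> nat"
    and Gs :: "nat \<Rightarrow> 'a monoid" and G :: "(nat \<Rightarrow> 'a) monoid"
    and M :: "('c, 'd) monoid_scheme" and act :: "(nat \<Rightarrow> 'a) \<Rightarrow> 'c \<Rightarrow> 'c"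
    and n :: int
  assumes "prime p" and "s \<ge> 1"
    and "\<And>k. k \<in> {1..s} \<Longrightarrow> group (Gs k)"
    and "\<And>k. k \<in> {1..s} \<Longrightarrow> cyclic_group (Gs k)"
    and "\<And>k. k \<in> {1..s} \<Longrightarrow> m k \<ge> 1"
    and "\<And>k. k \<in> {1..s} \<Longrightarrow> order (Gs k) = p ^ m k"
    and "G = product_group {1..s} Gs"
    and "G_lattice G M act"
    and "irreducible_lattice G M act"
    and "\<not> acts_trivially G M act"
  shows "tate_cohomology G M act n
           \<cong> tate_cohomology G (dual_module M) (dual_act G M act) (n - 1) \<and>
         tate_cohomology G (dual_module M) (dual_act G M act) (n - 1)
           \<cong> product_group {..<nat \<lfloor>nu (\<bar>n\<bar> - 1) s\<rfloor>} (\<lambda>_. integer_mod_group p)"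
proof -
  obtain \<gamma> lg where "coords (product_group {1..s} Gs) {1..s} \<gamma> (\<lambda>k. p ^ m k) lg p"
    by (rule product_group_coords[of p s Gs m]) (use assms(1-6) in \<open>blast+\<close>)
  then interpret C: coords G "{1..s}" \<gamma> "\<lambda>k. p ^ m k" lg p unfolding assms(7) .
  \<comment> \<open>The order serves as a p-power exponent of \<open>G\<close>; any such bound would
    do for finding the maximal exponent of the image.\<close>
  have "order G = p ^ (\<Sum>k\<in>{1..s}. m k)"
    using assms(6) by (simp add: assms(7) order_def card_PiE power_sum)
  hence exponent: "h [^]\<^bsub>G\<^esub> (p ^ (\<Sum>k\<in>{1..s}. m k)) = \<one>\<^bsub>G\<^esub>" if "h \<in> carrier G" for h
    using C.power_order_eq_one[OF C.fin_G that] by (simp add: order_def)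
  interpret I: irreducible_p_lattice G M act p "\<Sum>k\<in>{1..s}. m k"
    by (intro irreducible_p_lattice.intro irreducible_p_lattice_axioms.intro assms(1,8-10) exponent C.m_comm)
  obtain g r where "generated_p_lattice G M act p (\<Sum>k\<in>{1..s}. m k) g r"
    using I.cyclic_image I.irreducible_p_lattice_axioms generated_p_lattice.intro[unfolded generated_p_lattice_axioms_def]
    by (metis (no_types))
  then interpret L: generated_p_lattice G M act p "\<Sum>k\<in>{1..s}. m k" g r .
  obtain v \<psi> where "uniformized_p_lattice G {1..s} \<gamma> (\<lambda>k. p ^ m k) lg p M act (\<Sum>k\<in>{1..s}. m k) g r v \<psi>"
  proof (rule L.uniformizer)
    fix v \<psi>
    assume "v \<in> carrier M" "\<psi> \<in> hom M M" "\<And>u. u \<in> carrier M \<Longrightarrow> \<psi> (L.\<theta> u) = u [^]\<^bsub>M\<^esub> int p"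
      "\<And>w. w \<in> carrier M \<Longrightarrow> \<exists>c :: int. \<exists>n\<in>carrier M. w = v [^]\<^bsub>M\<^esub> c \<otimes>\<^bsub>M\<^esub> L.\<theta> n"
      "\<And>c :: int. v [^]\<^bsub>M\<^esub> c \<in> L.\<theta> ` carrier M \<longleftrightarrow> int p dvd c"
    thus thesis
      by (intro that[of v \<psi>] uniformized_p_lattice.intro uniformized_p_lattice_axioms.intro
          C.coords_axioms L.generated_p_lattice_axioms)
  qed
  then interpret U: uniformized_p_lattice G "{1..s}" \<gamma> "\<lambda>k. p ^ m k" lg p M act "\<Sum>k\<in>{1..s}. m k" g r v \<psi> .
  interpret F: finite_module G "dual_module M" "dual_act G M act" by (rule U.finite_module_DM)
  have "group (tate_cohomology G (dual_module M) (dual_act G M act) (n - 1))"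
    using F.comm_group_H unfolding F.tate_cohomology_eq by (simp add: comm_group_def)
  moreover have c: "card {1..s} = s" by simp
  \<comment> \<open>The first isomorphism is obtained by comparing both sides with the same power of
    Z/p.\<close>
  ultimately show ?thesis
    using U.cohomology_M[OF c assms(2), of n] U.cohomology_DM[OF c assms(2), of n]
    by (meson group.iso_sym iso_trans)
qed

end
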